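(* There is a polynomial $P$ such that for every sentence $F$ of the language $\mathcal{L}_{\mathsf{PrA}}$ that is true in the standard model $(\mathbb{N};0,1,+)$, there is a proof of $F$ in $\mathsf{PrA}_{\mathit{alt}}$ that uses at most $2^{2^{2^{P(|F|)}}}$ characters, where $|F|$ is the length of $F$.
   Context: $\mathcal{L}_{\mathsf{PrA}}$ is the first-order language with equality, constants $0,1$ and the binary function symbol $+$. $\mathsf{PrA}^-$ is the theory with axioms: (1) the axioms of a cancellative Abelian semigroup with neutral element $0$ for $+$; (2) $\forall x\; x+1\neq 0$; (3) $\forall x\,(x\neq 0\rightarrow \exists y\; x=y+1)$; (4) $\forall x,y\,(x\le y\vee y\le x)$, where $x\le y$ abbreviates $\exists z\; x+z=y$. $\mathsf{PrA}_{\mathit{alt}}$ is $\mathsf{PrA}^-$ together with, for each prime $p$, the axiom $\forall x\,(x\equiv_p 0\vee\dots\vee x\equiv_p p-1)$, where $x\equiv_n s$ abbreviates $\exists z\,(\underbrace{z+\dots+z}_{n}+s=x\;\vee\;\underbrace{z+\dots+z}_{n}+x=s)$ and natural numbers are written as sums of $1$'s. Proofs are taken in any fixed standard proof system for first-order logic such as a Hilbert-style system, natural deduction, or sequent calculus with cut (these are polynomially equivalent). Length of formulas and proofs is the number of characters. *)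

theory Defs
  imports "HOL-Computational_Algebra.Computational_Algebra"
begin

datatype trm =
    Var nat
  | Zero
  | One
  | Add trm trm

datatype fm =
    Equ trm trm
  | Neg fm
  | Conj fm fm
  | Disj fm fm
  | Imp fm fm
  | Forall nat fm
  | Exists nat fm

fun vars :: "trm \<Rightarrow> nat set" where
  "vars (Var i) = {i}"
| "vars Zero = {}"
| "vars One = {}"
| "vars (Add s t) = vars s \<union> vars t"

fun fv :: "fm \<Rightarrow> nat set" where
  "fv (Equ s t) = vars s \<union> vars t"
| "fv (Neg \<phi>) = fv \<phi>"
| "fv (Conj \<phi> \<psi>) = fv \<phi> \<union> fv \<psi>"
| "fv (Disj \<phi> \<psi>) = fv \<phi> \<union> fv \<psi>"
| "fv (Imp \<phi> \<psi>) = fv \<phi> \<union> fv \<psi>"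
| "fv (Forall x \<phi>) = fv \<phi> - {x}"
| "fv (Exists x \<phi>) = fv \<phi> - {x}"

definition sentence :: "fm \<Rightarrow> bool" where
  "sentence \<phi> \<longleftrightarrow> fv \<phi> = {}"

fun eval :: "(nat \<Rightarrow> nat) \<Rightarrow> trm \<Rightarrow> nat" where
  "eval e (Var i) = e i"
| "eval e Zero = 0"
| "eval e One = 1"
| "eval e (Add s t) = eval e s + eval e t"

fun sat :: "(nat \<Rightarrow> nat) \<Rightarrow> fm \<Rightarrow> bool" where
  "sat e (Equ s t) \<longleftrightarrow> eval e s = eval e t"
| "sat e (Neg \<phi>) \<longleftrightarrow> \<not> sat e \<phi>"
| "sat e (Conj \<phi> \<psi>) \<longleftrightarrow> sat e \<phi> \<and> sat e \<psi>"
| "sat e (Disj \<phi> \<psi>) \<longleftrightarrow> sat e \<phi> \<or> sat e \<psi>"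
| "sat e (Imp \<phi> \<psi>) \<longleftrightarrow> (sat e \<phi> \<longrightarrow> sat e \<psi>)"
| "sat e (Forall x \<phi>) \<longleftrightarrow> (\<forall>n. sat (e(x := n)) \<phi>)"
| "sat e (Exists x \<phi>) \<longleftrightarrow> (\<exists>n. sat (e(x := n)) \<phi>)"

definition true_in_N :: "fm \<Rightarrow> bool" where
  "true_in_N \<phi> \<longleftrightarrow> (\<forall>e. sat e \<phi>)"

fun tsubst :: "nat \<Rightarrow> trm \<Rightarrow> trm \<Rightarrow> trm" where
  "tsubst x u (Var i) = (if i = x then u else Var i)"
| "tsubst x u Zero = Zero"
| "tsubst x u One = One"
| "tsubst x u (Add s t) = Add (tsubst x u s) (tsubst x u t)"

text \<open>\<open>subst\<close> replaces the free occurrences of a variable and never renames bound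
  variables; every rule using it therefore requires the substituted term to be \<open>free_for\<close>
  the variable.\<close>

fun subst :: "nat \<Rightarrow> trm \<Rightarrow> fm \<Rightarrow> fm" where
  "subst x u (Equ s t) = Equ (tsubst x u s) (tsubst x u t)"
| "subst x u (Neg \<phi>) = Neg (subst x u \<phi>)"
| "subst x u (Conj \<phi> \<psi>) = Conj (subst x u \<phi>) (subst x u \<psi>)"
| "subst x u (Disj \<phi> \<psi>) = Disj (subst x u \<phi>) (subst x u \<psi>)"
| "subst x u (Imp \<phi> \<psi>) = Imp (subst x u \<phi>) (subst x u \<psi>)"
| "subst x u (Forall y \<phi>) = (if y = x then Forall y \<phi> else Forall y (subst x u \<phi>))"
| "subst x u (Exists y \<phi>) = (if y = x then Exists y \<phi> else Exists y (subst x u \<phi>))"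

fun free_for :: "trm \<Rightarrow> nat \<Rightarrow> fm \<Rightarrow> bool" where
  "free_for u x (Equ s t) \<longleftrightarrow> True"
| "free_for u x (Neg \<phi>) \<longleftrightarrow> free_for u x \<phi>"
| "free_for u x (Conj \<phi> \<psi>) \<longleftrightarrow> free_for u x \<phi> \<and> free_for u x \<psi>"
| "free_for u x (Disj \<phi> \<psi>) \<longleftrightarrow> free_for u x \<phi> \<and> free_for u x \<psi>"
| "free_for u x (Imp \<phi> \<psi>) \<longleftrightarrow> free_for u x \<phi> \<and> free_for u x \<psi>"
| "free_for u x (Forall y \<phi>) \<longleftrightarrow> x \<notin> fv (Forall y \<phi>) \<or> (y \<notin> vars u \<and> free_for u x \<phi>)"
| "free_for u x (Exists y \<phi>) \<longleftrightarrow> x \<notin> fv (Exists y \<phi>) \<or> (y \<notin> vars u \<and> free_for u x \<phi>)"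

text \<open>A line \<open>(\<Gamma>, \<phi>)\<close> of a derivation states that \<open>\<phi>\<close> follows from the open
  assumptions \<open>\<Gamma>\<close>. \<open>infer T S l\<close> says that the line \<open>l\<close> follows by one rule from lines
  in \<open>S\<close>, where the members of \<open>T\<close> are the nonlogical axioms.\<close>

type_synonym line = "fm list \<times> fm"

definition fvs :: "fm list \<Rightarrow> nat set" where
  "fvs \<Gamma> = (\<Union>\<phi>\<in>set \<Gamma>. fv \<phi>)"

inductive infer :: "fm set \<Rightarrow> line set \<Rightarrow> line \<Rightarrow> bool" for T S where
  Axiom: "\<phi> \<in> T \<Longrightarrow> infer T S (\<Gamma>, \<phi>)"
| Assume: "\<phi> \<in> set \<Gamma> \<Longrightarrow> infer T S (\<Gamma>, \<phi>)"
| Weaken: "(\<Gamma>, \<phi>) \<in> S \<Longrightarrow> set \<Gamma> \<subseteq> set \<Delta> \<Longrightarrow> infer T S (\<Delta>, \<phi>)"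
| NegI: "(\<phi> # \<Gamma>, \<psi>) \<in> S \<Longrightarrow> (\<phi> # \<Gamma>, Neg \<psi>) \<in> S \<Longrightarrow> infer T S (\<Gamma>, Neg \<phi>)"
| Contra: "(Neg \<phi> # \<Gamma>, \<psi>) \<in> S \<Longrightarrow> (Neg \<phi> # \<Gamma>, Neg \<psi>) \<in> S \<Longrightarrow> infer T S (\<Gamma>, \<phi>)"
| ConjI: "(\<Gamma>, \<phi>) \<in> S \<Longrightarrow> (\<Gamma>, \<psi>) \<in> S \<Longrightarrow> infer T S (\<Gamma>, Conj \<phi> \<psi>)"
| ConjE1: "(\<Gamma>, Conj \<phi> \<psi>) \<in> S \<Longrightarrow> infer T S (\<Gamma>, \<phi>)"
| ConjE2: "(\<Gamma>, Conj \<phi> \<psi>) \<in> S \<Longrightarrow> infer T S (\<Gamma>, \<psi>)"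
| DisjI1: "(\<Gamma>, \<phi>) \<in> S \<Longrightarrow> infer T S (\<Gamma>, Disj \<phi> \<psi>)"
| DisjI2: "(\<Gamma>, \<psi>) \<in> S \<Longrightarrow> infer T S (\<Gamma>, Disj \<phi> \<psi>)"
| DisjE: "(\<Gamma>, Disj \<phi> \<psi>) \<in> S \<Longrightarrow> (\<phi> # \<Gamma>, \<chi>) \<in> S \<Longrightarrow> (\<psi> # \<Gamma>, \<chi>) \<in> S \<Longrightarrow> infer T S (\<Gamma>, \<chi>)"
| ImpI: "(\<phi> # \<Gamma>, \<psi>) \<in> S \<Longrightarrow> infer T S (\<Gamma>, Imp \<phi> \<psi>)"
| ImpE: "(\<Gamma>, Imp \<phi> \<psi>) \<in> S \<Longrightarrow> (\<Gamma>, \<phi>) \<in> S \<Longrightarrow> infer T S (\<Gamma>, \<psi>)"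
| ForallI: "(\<Gamma>, subst x (Var y) \<phi>) \<in> S \<Longrightarrow> free_for (Var y) x \<phi> \<Longrightarrow>
    y \<notin> fvs \<Gamma> \<union> fv (Forall x \<phi>) \<Longrightarrow> infer T S (\<Gamma>, Forall x \<phi>)"
| ForallE: "(\<Gamma>, Forall x \<phi>) \<in> S \<Longrightarrow> free_for t x \<phi> \<Longrightarrow> infer T S (\<Gamma>, subst x t \<phi>)"
| ExistsI: "(\<Gamma>, subst x t \<phi>) \<in> S \<Longrightarrow> free_for t x \<phi> \<Longrightarrow> infer T S (\<Gamma>, Exists x \<phi>)"
| ExistsE: "(\<Gamma>, Exists x \<phi>) \<in> S \<Longrightarrow> (subst x (Var y) \<phi> # \<Gamma>, \<psi>) \<in> S \<Longrightarrow>
    free_for (Var y) x \<phi> \<Longrightarrow> y \<notin> fvs \<Gamma> \<union> fv (Exists x \<phi>) \<union> fv \<psi> \<Longrightarrow> infer T S (\<Gamma>, \<psi>)"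
| EquI: "infer T S (\<Gamma>, Equ t t)"
| EquE: "(\<Gamma>, Equ s t) \<in> S \<Longrightarrow> (\<Gamma>, subst x s \<phi>) \<in> S \<Longrightarrow>
    free_for s x \<phi> \<Longrightarrow> free_for t x \<phi> \<Longrightarrow> infer T S (\<Gamma>, subst x t \<phi>)"

definition is_proof :: "fm set \<Rightarrow> line list \<Rightarrow> fm \<Rightarrow> bool" where
  "is_proof T ls \<phi> \<longleftrightarrow>
     (\<forall>i<length ls. infer T (set (take i ls)) (ls ! i)) \<and> ls \<noteq> [] \<and> last ls = ([], \<phi>)"

text \<open>Formulas and proofs are written over a fixed finite alphabet; the variable with
  index \<open>i\<close> is written as the letter x followed by \<open>i\<close> in binary.\<close>

fun bin_string :: "nat \<Rightarrow> string" where
  "bin_string n = (if n < 2 then [] else bin_string (n div 2)) @ (if even n then ''0'' else ''1'')"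

declare bin_string.simps [simp del]

definition var_string :: "nat \<Rightarrow> string" where
  "var_string i = ''x'' @ bin_string i"

fun trm_string :: "trm \<Rightarrow> string" where
  "trm_string (Var i) = var_string i"
| "trm_string Zero = ''0''"
| "trm_string One = ''1''"
| "trm_string (Add s t) = ''('' @ trm_string s @ ''+'' @ trm_string t @ '')''"

fun fm_string :: "fm \<Rightarrow> string" where
  "fm_string (Equ s t) = ''('' @ trm_string s @ ''='' @ trm_string t @ '')''"
| "fm_string (Neg \<phi>) = ''~'' @ fm_string \<phi>"
| "fm_string (Conj \<phi> \<psi>) = ''('' @ fm_string \<phi> @ ''&'' @ fm_string \<psi> @ '')''"
| "fm_string (Disj \<phi> \<psi>) = ''('' @ fm_string \<phi> @ ''|'' @ fm_string \<psi> @ '')''"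
| "fm_string (Imp \<phi> \<psi>) = ''('' @ fm_string \<phi> @ ''>'' @ fm_string \<psi> @ '')''"
| "fm_string (Forall x \<phi>) = ''A'' @ var_string x @ fm_string \<phi>"
| "fm_string (Exists x \<phi>) = ''E'' @ var_string x @ fm_string \<phi>"

definition line_string :: "line \<Rightarrow> string" where
  "line_string l = concat (map (\<lambda>\<phi>. fm_string \<phi> @ '','') (fst l)) @ '':'' @ fm_string (snd l)"

definition proof_string :: "line list \<Rightarrow> string" where
  "proof_string ls = concat (map (\<lambda>l. line_string l @ '';'') ls)"

text \<open>\<open>nmul n t\<close> is the sum of \<open>n\<close> copies of \<open>t\<close>, bracketed to the left;
  \<open>Zero\<close> for \<open>n = 0\<close>.\<close>

fun nmul :: "nat \<Rightarrow> trm \<Rightarrow> trm" where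
  "nmul 0 t = Zero"
| "nmul (Suc 0) t = t"
| "nmul (Suc (Suc n)) t = Add (nmul (Suc n) t) t"

definition numeral_trm :: "nat \<Rightarrow> trm" where
  "numeral_trm s = nmul s One"

text \<open>\<open>disj_upto f n\<close> is the disjunction of \<open>f 0, \<dots>, f n\<close>.\<close>

fun disj_upto :: "(nat \<Rightarrow> fm) \<Rightarrow> nat \<Rightarrow> fm" where
  "disj_upto f 0 = f 0"
| "disj_upto f (Suc n) = Disj (disj_upto f n) (f (Suc n))"

text \<open>The abbreviations \<open>le_fm\<close> and \<open>congr_fm\<close> bind variable 2, so their arguments must
  not contain it.\<close>

definition le_fm :: "trm \<Rightarrow> trm \<Rightarrow> fm" where
  "le_fm s t = Exists 2 (Equ (Add s (Var 2)) t)"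

definition congr_fm :: "nat \<Rightarrow> trm \<Rightarrow> trm \<Rightarrow> fm" where
  "congr_fm n t s = Exists 2 (Disj
     (Equ (Add (nmul n (Var 2)) s) t)
     (Equ (Add (nmul n (Var 2)) t) s))"

definition PrA_minus :: "fm set" where
  "PrA_minus = {
     Forall 0 (Forall 1 (Forall 2
       (Equ (Add (Add (Var 0) (Var 1)) (Var 2)) (Add (Var 0) (Add (Var 1) (Var 2)))))),
     Forall 0 (Forall 1 (Equ (Add (Var 0) (Var 1)) (Add (Var 1) (Var 0)))),
     Forall 0 (Equ (Add (Var 0) Zero) (Var 0)),
     Forall 0 (Forall 1 (Forall 2
       (Imp (Equ (Add (Var 0) (Var 2)) (Add (Var 1) (Var 2))) (Equ (Var 0) (Var 1))))),
     Forall 0 (Neg (Equ (Add (Var 0) One) Zero)),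
     Forall 0 (Imp (Neg (Equ (Var 0) Zero)) (Exists 1 (Equ (Var 0) (Add (Var 1) One)))),
     Forall 0 (Forall 1 (Disj (le_fm (Var 0) (Var 1)) (le_fm (Var 1) (Var 0))))}"

definition residue_axiom :: "nat \<Rightarrow> fm" where
  "residue_axiom p =
     Forall 0 (disj_upto (\<lambda>s. congr_fm p (Var 0) (numeral_trm s)) (p - 1))"

definition PrA_alt :: "fm set" where
  "PrA_alt = PrA_minus \<union> {residue_axiom p | p. prime p}"

end

theory Submission
  imports Defs
begin

text \<open>The proof follows Ferrante and Rackoff: instead of eliminating quantifiers, it describes a tuple
  of numbers up to elementary equivalence for formulas of bounded quantifier depth. The description
  consists of the signs of all linear forms with small coefficients and of the residues of these forms
  modulo a highly divisible number. Passing to one quantifier less squares the coefficients and multiplies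
  the modulus by a factorial, so that for a sentence of length \<open>n\<close> the coefficients stay doubly
  exponential and the constants and moduli triply exponential in \<open>n\<close>.

  A context that fixes the description of a tuple proves or refutes every formula of the corresponding
  depth. For a true existential formula, the least witness of its type is the root of a form up to a small
  constant, and the theory proves that this linear equation is solvable. For a false one, the
  theory splits on the residue of the quantified variable and, for each homogeneous form, on
  whether it is large, small or equal to one of the values in between. A form with known value
  determines the variable; if all forms are far from 0, the gap between the lower and the upper bounds contains
  a standard number of the same type, unless the bounds contradict each other.\<close>

section \<open>Derivations with bounded width\<close>

text \<open>What limits the construction is the number of branches. The forms with their constants
  are triply exponentially many, and a split on the sign of each would produce a fourfold
  exponential number of branches. Splits are therefore made on homogeneous forms only. Of these
  there are at most \<open>P\<close>, a doubly exponential number, and each costs a factor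
  \<open>20 * (C + 1)\<close>; a triply exponential number raised to a doubly exponential power is
  still triply exponential. This is why coefficients and constants have separate bounds.

  A description does not state residues by congruences. A fresh variable names the quotient of the
  new variable, and to know a form modulo \<open>M\<close> means to prove it equal to a form whose
  nonconstant coefficients are divisible by \<open>M\<close>. Reasoning about types is then
  reasoning about linear inequalities, and divisibility acts only through rounding.

  The axioms provide prime moduli only; the quotient is divided again to obtain composite
  ones.\<close>

definition tsz :: "trm \<Rightarrow> nat" where "tsz t = length (trm_string t)"
definition fsz :: "fm \<Rightarrow> nat" where "fsz \<phi> = length (fm_string \<phi>)"
definition vsz :: "nat \<Rightarrow> nat" where "vsz i = length (var_string i)"
definition csz :: "fm list \<Rightarrow> nat" where "csz \<Gamma> = (\<Sum>\<phi>\<leftarrow>\<Gamma>. fsz \<phi> + 1)"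

lemma tsz_simps [simp]:
  "tsz (Var i) = vsz i" "tsz Zero = 1" "tsz One = 1" "tsz (Add s t) = tsz s + tsz t + 3"
  by (simp_all add: tsz_def vsz_def)

lemma fsz_simps [simp]:
  "fsz (Equ s t) = tsz s + tsz t + 3"
  "fsz (Neg \<phi>) = fsz \<phi> + 1"
  "fsz (Conj \<phi> \<psi>) = fsz \<phi> + fsz \<psi> + 3"
  "fsz (Disj \<phi> \<psi>) = fsz \<phi> + fsz \<psi> + 3"
  "fsz (Imp \<phi> \<psi>) = fsz \<phi> + fsz \<psi> + 3"
  "fsz (Forall x \<phi>) = vsz x + fsz \<phi> + 1"
  "fsz (Exists x \<phi>) = vsz x + fsz \<phi> + 1"
  by (simp_all add: fsz_def tsz_def vsz_def)

lemma csz_simps [simp]: "csz [] = 0" "csz (\<phi> # \<Gamma>) = fsz \<phi> + 1 + csz \<Gamma>"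
  by (simp_all add: csz_def)

text \<open>A linear bound in place of the logarithm is enough: variable indices stay below
  \<open>R\<close>, which is singly exponential.\<close>

lemma length_bin_string: "length (bin_string n) \<le> n + 1"
proof (induction n rule: less_induct)
  case (less n)
  show ?case
  proof (cases "n < 2")
    case True then show ?thesis by (subst bin_string.simps) simp
  next
    case False
    then show ?thesis using less[of "n div 2"] by (subst bin_string.simps) simp
  qed
qed

lemma vsz_le: "vsz i \<le> i + 2"
  using length_bin_string[of i] by (simp add: vsz_def var_string_def)

text \<open>Conversely an index is at most exponential in the length of its name. This bounds the
  variables of the given sentence, and fresh ones are taken beyond that bound.\<close>

lemma less_power_length_bin_string: "n < 2 ^ length (bin_string n)"
proof (induction n rule: less_induct)
  case (less n)
  show ?case
  proof (cases "n < 2")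
    case True then show ?thesis by (subst bin_string.simps) auto
  next
    case False
    then have "n div 2 < 2 ^ length (bin_string (n div 2))" using less[of "n div 2"] by simp
    then show ?thesis using False by (subst bin_string.simps) simp
  qed
qed

lemma vsz_ge1 [simp]: "Suc 0 \<le> vsz i" by (simp add: vsz_def var_string_def)
lemma tsz_ge1 [simp]: "Suc 0 \<le> tsz t" by (induction t) auto
lemma fsz_ge1 [simp]: "Suc 0 \<le> fsz \<phi>" by (induction \<phi>) auto

text \<open>The 2 counts the colon inside the line and the semicolon that
  \<open>proof_string\<close> puts after it.\<close>

definition lsz :: "line \<Rightarrow> nat" where "lsz l = csz (fst l) + fsz (snd l) + 2"

lemma length_line_string: "length (line_string l) + 1 = lsz l"
proof -
  have "length (concat (map (\<lambda>\<phi>. fm_string \<phi> @ '','') xs)) = csz xs" for xs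
    by (induction xs) (auto simp: fsz_def)
  then show ?thesis by (simp add: line_string_def lsz_def fsz_def)
qed

lemma length_proof_string: "length (proof_string ls) = (\<Sum>l\<leftarrow>ls. lsz l)"
proof (induction ls)
  case (Cons l ls)
  then show ?case using length_line_string[of l] by (simp add: proof_string_def)
qed (simp add: proof_string_def)

definition valid :: "line list \<Rightarrow> bool" where
  "valid ls \<longleftrightarrow> (\<forall>i<length ls. infer PrA_alt (set (take i ls)) (ls ! i))"

lemma infer_mono: "infer T S l \<Longrightarrow> S \<subseteq> S' \<Longrightarrow> infer T S' l"
  by (induction rule: infer.induct) (blast intro: infer.intros)+

lemma valid_append: "valid xs \<Longrightarrow> valid ys \<Longrightarrow> valid (xs @ ys)"
  unfolding valid_def
proof (intro allI impI)
  fix i assume a: "\<forall>i<length xs. infer PrA_alt (set (take i xs)) (xs ! i)"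
    "\<forall>i<length ys. infer PrA_alt (set (take i ys)) (ys ! i)" "i < length (xs @ ys)"
  show "infer PrA_alt (set (take i (xs @ ys))) ((xs @ ys) ! i)"
  proof (cases "i < length xs")
    case True then show ?thesis using a(1) by (simp add: nth_append)
  next
    case False
    then have "infer PrA_alt (set (take (i - length xs) ys)) (ys ! (i - length xs))" using a by simp
    then show ?thesis using False by (auto simp: nth_append elim: infer_mono)
  qed
qed

lemma valid_snoc: "valid xs \<Longrightarrow> infer PrA_alt (set xs) l \<Longrightarrow> valid (xs @ [l])"
  by (auto simp: valid_def nth_append less_Suc_eq)

text \<open>Only the number of lines has to be added up along a derivation; their width stays below a
  bound \<open>L\<close> that is chosen once and for all.\<close>

definition der :: "nat \<Rightarrow> nat \<Rightarrow> fm list \<Rightarrow> fm \<Rightarrow> bool" where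
  "der L N \<Gamma> \<phi> \<longleftrightarrow> (\<exists>ls. length ls \<le> N \<and> (\<forall>l\<in>set ls. lsz l \<le> L) \<and> valid ls \<and> (\<Gamma>, \<phi>) \<in> set ls)"

lemma der_mono: "der L N \<Gamma> \<phi> \<Longrightarrow> L \<le> L' \<Longrightarrow> N \<le> N' \<Longrightarrow> der L' N' \<Gamma> \<phi>"
  unfolding der_def by (meson order_trans)

lemma der_lines_mono: "der L N \<Gamma> \<phi> \<Longrightarrow> N \<le> N' \<Longrightarrow> der L N' \<Gamma> \<phi>"
  by (rule der_mono) auto

lemma der_width: "der L N \<Gamma> \<phi> \<Longrightarrow> csz \<Gamma> + fsz \<phi> + 2 \<le> L"
  unfolding der_def lsz_def by fastforce

lemma der_ge1: "der L N \<Gamma> \<phi> \<Longrightarrow> 1 \<le> N"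
  unfolding der_def by (metis One_nat_def Suc_leI empty_iff le_trans length_pos_if_in_set)

lemma der_infer0: "infer PrA_alt {} (\<Gamma>, \<phi>) \<Longrightarrow> csz \<Gamma> + fsz \<phi> + 2 \<le> L \<Longrightarrow> der L 1 \<Gamma> \<phi>"
  unfolding der_def by (rule exI[of _ "[(\<Gamma>, \<phi>)]"]) (auto simp: valid_def lsz_def)

lemma der_infer1:
  assumes "der L N \<Delta> \<psi>" "infer PrA_alt {(\<Delta>, \<psi>)} (\<Gamma>, \<phi>)" "csz \<Gamma> + fsz \<phi> + 2 \<le> L"
  shows "der L (Suc N) \<Gamma> \<phi>"
proof -
  obtain ls where "length ls \<le> N" "\<forall>l\<in>set ls. lsz l \<le> L" "valid ls" "(\<Delta>, \<psi>) \<in> set ls"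
    using assms(1) der_def by auto
  then show ?thesis unfolding der_def using assms(2,3)
    by (intro exI[of _ "ls @ [(\<Gamma>, \<phi>)]"])
      (auto simp: lsz_def intro!: valid_snoc intro: infer_mono)
qed

lemma der_infer2:
  assumes "der L N1 \<Delta>1 \<psi>1" "der L N2 \<Delta>2 \<psi>2"
    "infer PrA_alt {(\<Delta>1, \<psi>1), (\<Delta>2, \<psi>2)} (\<Gamma>, \<phi>)" "csz \<Gamma> + fsz \<phi> + 2 \<le> L"
  shows "der L (Suc (N1 + N2)) \<Gamma> \<phi>"
proof -
  obtain ls where ls: "length ls \<le> N1" "\<forall>l\<in>set ls. lsz l \<le> L" "valid ls" "(\<Delta>1, \<psi>1) \<in> set ls"
    using assms(1) der_def by auto
  obtain ls' where ls': "length ls' \<le> N2" "\<forall>l\<in>set ls'. lsz l \<le> L" "valid ls'" "(\<Delta>2, \<psi>2) \<in> set ls'"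
    using assms(2) der_def by auto
  show ?thesis unfolding der_def
  proof (intro exI[of _ "(ls @ ls') @ [(\<Gamma>, \<phi>)]"] conjI)
    show "valid ((ls @ ls') @ [(\<Gamma>, \<phi>)])"
      by (rule valid_snoc, rule valid_append, fact, fact, rule infer_mono, fact)
        (use ls ls' in auto)
  qed (use ls ls' assms(4) in \<open>auto simp: lsz_def\<close>)
qed

lemma der_infer3:
  assumes "der L N1 \<Delta>1 \<psi>1" "der L N2 \<Delta>2 \<psi>2" "der L N3 \<Delta>3 \<psi>3"
    "infer PrA_alt {(\<Delta>1, \<psi>1), (\<Delta>2, \<psi>2), (\<Delta>3, \<psi>3)} (\<Gamma>, \<phi>)" "csz \<Gamma> + fsz \<phi> + 2 \<le> L"
  shows "der L (Suc (N1 + N2 + N3)) \<Gamma> \<phi>"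
proof -
  obtain ls where ls: "length ls \<le> N1" "\<forall>l\<in>set ls. lsz l \<le> L" "valid ls" "(\<Delta>1, \<psi>1) \<in> set ls"
    using assms(1) der_def by auto
  obtain ls' where ls': "length ls' \<le> N2" "\<forall>l\<in>set ls'. lsz l \<le> L" "valid ls'" "(\<Delta>2, \<psi>2) \<in> set ls'"
    using assms(2) der_def by auto
  obtain ls'' where ls'': "length ls'' \<le> N3" "\<forall>l\<in>set ls''. lsz l \<le> L" "valid ls''" "(\<Delta>3, \<psi>3) \<in> set ls''"
    using assms(3) der_def by auto
  show ?thesis unfolding der_def
  proof (intro exI[of _ "(ls @ ls' @ ls'') @ [(\<Gamma>, \<phi>)]"] conjI)
    show "valid ((ls @ ls' @ ls'') @ [(\<Gamma>, \<phi>)])"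
      by (rule valid_snoc, rule valid_append, fact, rule valid_append, fact, fact, rule infer_mono, fact)
        (use ls ls' ls'' in auto)
  qed (use ls ls' ls'' assms(5) in \<open>auto simp: lsz_def\<close>)
qed

text \<open>\<open>der\<close> only asks its line to occur somewhere, which makes derivations easy
  to concatenate, whereas a proof has to end with it. The list is therefore cut off after an
  occurrence.\<close>

lemma der_imp_proof:
  assumes "der L N [] F"
  obtains \<pi> where "is_proof PrA_alt \<pi> F" "length (proof_string \<pi>) \<le> N * L"
proof -
  obtain ls where ls: "length ls \<le> N" "\<forall>l\<in>set ls. lsz l \<le> L" "valid ls" "([], F) \<in> set ls"
    using assms der_def by auto
  then obtain i where i: "i < length ls" "ls ! i = ([], F)" by (metis in_set_conv_nth)
  let ?\<pi> = "take (Suc i) ls"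
  have "is_proof PrA_alt ?\<pi> F"
    using ls i unfolding is_proof_def valid_def
    by (auto simp: min_def take_Suc_conv_app_nth nth_append less_Suc_eq)
  moreover have "(\<Sum>l\<leftarrow>?\<pi>. lsz l) \<le> length ?\<pi> * L"
  proof -
    have "(\<Sum>l\<leftarrow>xs. lsz l) \<le> length xs * L" if "\<forall>l\<in>set xs. lsz l \<le> L" for xs
      using that by (induction xs) auto
    then show ?thesis using ls(2) in_set_takeD by fast
  qed
  moreover have "length ?\<pi> * L \<le> N * L" by (rule mult_right_mono) (use ls i in auto)
  ultimately show ?thesis using that length_proof_string by (metis le_trans)
qed

section \<open>Derived rules with counted lines\<close>

lemma der_assume: "\<phi> \<in> set \<Gamma> \<Longrightarrow> csz \<Gamma> + fsz \<phi> + 2 \<le> L \<Longrightarrow> der L 1 \<Gamma> \<phi>"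
  by (rule der_infer0) (auto intro: infer.intros)

lemma der_axiom: "\<phi> \<in> PrA_alt \<Longrightarrow> csz \<Gamma> + fsz \<phi> + 2 \<le> L \<Longrightarrow> der L 1 \<Gamma> \<phi>"
  by (rule der_infer0) (auto intro: infer.intros)

lemma der_weaken:
  "der L N \<Gamma> \<phi> \<Longrightarrow> set \<Gamma> \<subseteq> set \<Delta> \<Longrightarrow> csz \<Delta> + fsz \<phi> + 2 \<le> L \<Longrightarrow> der L (Suc N) \<Delta> \<phi>"
  by (erule der_infer1) (auto intro: infer.intros)

lemma der_impE: "der L N \<Gamma> (Imp \<phi> \<psi>) \<Longrightarrow> der L M \<Gamma> \<phi> \<Longrightarrow> der L (Suc (N + M)) \<Gamma> \<psi>"
  by (frule der_width, erule (1) der_infer2) (auto intro: infer.ImpE)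

lemma der_impI: "der L N (\<phi> # \<Gamma>) \<psi> \<Longrightarrow> csz \<Gamma> + fsz \<phi> + fsz \<psi> + 5 \<le> L \<Longrightarrow> der L (Suc N) \<Gamma> (Imp \<phi> \<psi>)"
  by (erule der_infer1) (auto intro: infer.ImpI)

lemma der_negI:
  "der L N (\<phi> # \<Gamma>) \<psi> \<Longrightarrow> der L M (\<phi> # \<Gamma>) (Neg \<psi>) \<Longrightarrow> der L (Suc (N + M)) \<Gamma> (Neg \<phi>)"
  by (frule der_width[of L M], erule (1) der_infer2) (auto intro: infer.NegI)

lemma der_contra:
  "der L N (Neg \<phi> # \<Gamma>) \<psi> \<Longrightarrow> der L M (Neg \<phi> # \<Gamma>) (Neg \<psi>) \<Longrightarrow> der L (Suc (N + M)) \<Gamma> \<phi>"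
  by (frule der_width[of L M], erule (1) der_infer2) (auto intro: infer.Contra)

lemma der_explode:
  assumes "der L N \<Gamma> \<psi>" "der L M \<Gamma> (Neg \<psi>)" "csz \<Gamma> + fsz \<phi> + fsz \<psi> + 5 \<le> L"
  shows "der L (N + M + 3) \<Gamma> \<phi>"
proof -
  have "der L (Suc N) (Neg \<phi> # \<Gamma>) \<psi>" by (rule der_weaken[OF assms(1)]) (use assms(3) in auto)
  moreover have "der L (Suc M) (Neg \<phi> # \<Gamma>) (Neg \<psi>)"
    by (rule der_weaken[OF assms(2)]) (use assms(3) in auto)
  ultimately have "der L (Suc (Suc N + Suc M)) \<Gamma> \<phi>" by (rule der_contra)
  then show ?thesis by (rule der_lines_mono) simp
qed

lemma der_conjI: "der L N \<Gamma> \<phi> \<Longrightarrow> der L M \<Gamma> \<psi> \<Longrightarrow> csz \<Gamma> + fsz \<phi> + fsz \<psi> + 5 \<le> L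
   \<Longrightarrow> der L (Suc (N + M)) \<Gamma> (Conj \<phi> \<psi>)"
  by (elim der_infer2) (auto intro: infer.ConjI)

lemma der_conjE1: "der L N \<Gamma> (Conj \<phi> \<psi>) \<Longrightarrow> der L (Suc N) \<Gamma> \<phi>"
  by (frule der_width, erule der_infer1) (auto intro: infer.ConjE1)

lemma der_conjE2: "der L N \<Gamma> (Conj \<phi> \<psi>) \<Longrightarrow> der L (Suc N) \<Gamma> \<psi>"
  by (frule der_width, erule der_infer1) (auto intro: infer.ConjE2)

lemma der_disjI1: "der L N \<Gamma> \<phi> \<Longrightarrow> csz \<Gamma> + fsz \<phi> + fsz \<psi> + 5 \<le> L \<Longrightarrow> der L (Suc N) \<Gamma> (Disj \<phi> \<psi>)"
  by (elim der_infer1) (auto intro: infer.DisjI1)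

lemma der_disjI2: "der L N \<Gamma> \<psi> \<Longrightarrow> csz \<Gamma> + fsz \<phi> + fsz \<psi> + 5 \<le> L \<Longrightarrow> der L (Suc N) \<Gamma> (Disj \<phi> \<psi>)"
  by (elim der_infer1) (auto intro: infer.DisjI2)

lemma der_disjE:
  "der L N \<Gamma> (Disj \<phi> \<psi>) \<Longrightarrow> der L M (\<phi> # \<Gamma>) \<chi> \<Longrightarrow> der L K (\<psi> # \<Gamma>) \<chi> \<Longrightarrow> der L (Suc (N + M + K)) \<Gamma> \<chi>"
  by (frule der_width[of L M], erule (2) der_infer3) (auto intro: infer.DisjE)

lemma der_forallI:
  "der L N \<Gamma> (subst x (Var y) \<phi>) \<Longrightarrow> free_for (Var y) x \<phi> \<Longrightarrow> y \<notin> fvs \<Gamma> \<union> fv (Forall x \<phi>) \<Longrightarrow>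
    csz \<Gamma> + fsz (Forall x \<phi>) + 2 \<le> L \<Longrightarrow> der L (Suc N) \<Gamma> (Forall x \<phi>)"
  by (erule der_infer1, rule infer.ForallI[where y = y]) auto

lemma der_forallE:
  "der L N \<Gamma> (Forall x \<phi>) \<Longrightarrow> free_for t x \<phi> \<Longrightarrow> csz \<Gamma> + fsz (subst x t \<phi>) + 2 \<le> L
    \<Longrightarrow> der L (Suc N) \<Gamma> (subst x t \<phi>)"
  by (erule der_infer1) (auto intro: infer.ForallE)

lemma der_existsI:
  "der L N \<Gamma> (subst x t \<phi>) \<Longrightarrow> free_for t x \<phi> \<Longrightarrow> csz \<Gamma> + fsz (Exists x \<phi>) + 2 \<le> L
    \<Longrightarrow> der L (Suc N) \<Gamma> (Exists x \<phi>)"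
  by (erule der_infer1, rule infer.ExistsI) auto

lemma der_existsE:
  "der L N \<Gamma> (Exists x \<phi>) \<Longrightarrow> der L M (subst x (Var y) \<phi> # \<Gamma>) \<psi> \<Longrightarrow> free_for (Var y) x \<phi> \<Longrightarrow>
    y \<notin> fvs \<Gamma> \<union> fv (Exists x \<phi>) \<union> fv \<psi> \<Longrightarrow> der L (Suc (N + M)) \<Gamma> \<psi>"
  by (frule der_width[of L M], erule (1) der_infer2) (auto intro: infer.ExistsE)

lemma der_refl: "csz \<Gamma> + 2 * tsz t + 5 \<le> L \<Longrightarrow> der L 1 \<Gamma> (Equ t t)"
  by (rule der_infer0) (auto intro: infer.intros)

text \<open>Derivability without bounds, for the finitely many arithmetical sentences whose proofs only
  contribute a constant.\<close>

inductive Prv :: "fm list \<Rightarrow> fm \<Rightarrow> bool" where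
  Prv: "\<forall>l\<in>S. Prv (fst l) (snd l) \<Longrightarrow> finite S \<Longrightarrow> infer PrA_alt S (\<Gamma>, \<phi>) \<Longrightarrow> Prv \<Gamma> \<phi>"

lemma Prv_der: "Prv \<Gamma> \<phi> \<Longrightarrow> \<exists>c. der c c \<Gamma> \<phi>"
proof (induction rule: Prv.induct)
  case (Prv S \<Gamma> \<phi>)
  have "\<exists>ls. valid ls \<and> S \<subseteq> set ls" using Prv(2,1)
  proof (induction S rule: finite_induct)
    case empty then show ?case by (auto simp: valid_def intro: exI[of _ "[]"])
  next
    case (insert l S)
    then obtain ls where "valid ls" "S \<subseteq> set ls" by auto
    moreover obtain ls' where "valid ls'" "l \<in> set ls'" using insert by (auto simp: der_def)
    ultimately show ?case by (intro exI[of _ "ls @ ls'"]) (auto intro: valid_append)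
  qed
  then obtain ls where "valid ls" "S \<subseteq> set ls" by auto
  then have v: "valid (ls @ [(\<Gamma>, \<phi>)])" by (intro valid_snoc infer_mono[OF Prv(3)])
  let ?ls = "ls @ [(\<Gamma>, \<phi>)]"
  show ?case unfolding der_def
  proof (intro exI[of _ "length ?ls + (\<Sum>l\<leftarrow>?ls. lsz l)"] exI[of _ ?ls] conjI ballI)
    fix l assume "l \<in> set ?ls"
    then have "lsz l \<le> (\<Sum>l\<leftarrow>?ls. lsz l)" by (intro member_le_sum_list) auto
    then show "lsz l \<le> length ?ls + (\<Sum>l\<leftarrow>?ls. lsz l)" by simp
  qed (use v in auto)
qed

text \<open>A rule reads only finitely many lines of the infinite set of derivable ones, and the
  case distinction names them. Finiteness is what lets \<open>Prv_der\<close> concatenate one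
  derivation for each premise.\<close>

lemma Prv_infer: "infer PrA_alt {(\<Gamma>', \<phi>'). Prv \<Gamma>' \<phi>'} (\<Gamma>, \<phi>) \<Longrightarrow> Prv \<Gamma> \<phi>"
proof -
  assume "infer PrA_alt {(\<Gamma>', \<phi>'). Prv \<Gamma>' \<phi>'} (\<Gamma>, \<phi>)"
  moreover have "infer T {(\<Gamma>', \<phi>'). Prv \<Gamma>' \<phi>'} l \<Longrightarrow> \<exists>S. finite S \<and> (\<forall>l\<in>S. Prv (fst l) (snd l)) \<and> infer T S l" for T l
  proof (induction rule: infer.induct)
    case (NegI \<phi> \<Gamma> \<psi>)
    then show ?case by (intro exI[of _ "{(\<phi> # \<Gamma>, \<psi>), (\<phi> # \<Gamma>, Neg \<psi>)}"]) (auto intro: infer.NegI)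
  next
    case (Contra \<phi> \<Gamma> \<psi>)
    then show ?case by (intro exI[of _ "{(Neg \<phi> # \<Gamma>, \<psi>), (Neg \<phi> # \<Gamma>, Neg \<psi>)}"]) (auto intro: infer.Contra)
  next
    case (Weaken \<Gamma> \<phi> \<Delta>)
    then show ?case by (intro exI[of _ "{(\<Gamma>, \<phi>)}"]) (auto intro: infer.Weaken)
  next
    case (ConjI \<Gamma> \<phi> \<psi>)
    then show ?case by (intro exI[of _ "{(\<Gamma>, \<phi>), (\<Gamma>, \<psi>)}"]) (auto intro: infer.ConjI)
  next
    case (ConjE1 \<Gamma> \<phi> \<psi>)
    then show ?case by (intro exI[of _ "{(\<Gamma>, Conj \<phi> \<psi>)}"]) (auto intro: infer.ConjE1)
  next
    case (ConjE2 \<Gamma> \<phi> \<psi>)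
    then show ?case by (intro exI[of _ "{(\<Gamma>, Conj \<phi> \<psi>)}"]) (auto intro: infer.ConjE2)
  next
    case (DisjI1 \<Gamma> \<phi> \<psi>)
    then show ?case by (intro exI[of _ "{(\<Gamma>, \<phi>)}"]) (auto intro: infer.DisjI1)
  next
    case (DisjI2 \<Gamma> \<psi> \<phi>)
    then show ?case by (intro exI[of _ "{(\<Gamma>, \<psi>)}"]) (auto intro: infer.DisjI2)
  next
    case (DisjE \<Gamma> \<phi> \<psi> \<chi>)
    then show ?case by (intro exI[of _ "{(\<Gamma>, Disj \<phi> \<psi>), (\<phi> # \<Gamma>, \<chi>), (\<psi> # \<Gamma>, \<chi>)}"]) (auto intro: infer.DisjE)
  next
    case (ImpI \<phi> \<Gamma> \<psi>)
    then show ?case by (intro exI[of _ "{(\<phi> # \<Gamma>, \<psi>)}"]) (auto intro: infer.ImpI)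
  next
    case (ImpE \<Gamma> \<phi> \<psi>)
    then show ?case by (intro exI[of _ "{(\<Gamma>, Imp \<phi> \<psi>), (\<Gamma>, \<phi>)}"]) (auto intro: infer.ImpE)
  next
    case (ForallI \<Gamma> x y \<phi>)
    then show ?case
      by (intro exI[of _ "{(\<Gamma>, subst x (Var y) \<phi>)}"]) (auto intro: infer.ForallI[where y = y])
  next
    case (ForallE \<Gamma> x \<phi> t)
    then show ?case by (intro exI[of _ "{(\<Gamma>, Forall x \<phi>)}"]) (auto intro: infer.ForallE)
  next
    case (ExistsI \<Gamma> x t \<phi>)
    then show ?case
      by (intro exI[of _ "{(\<Gamma>, subst x t \<phi>)}"]) (auto intro: infer.ExistsI[where t = t])
  next
    case (ExistsE \<Gamma> x \<phi> y \<psi>)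
    then show ?case
      by (intro exI[of _ "{(\<Gamma>, Exists x \<phi>), (subst x (Var y) \<phi> # \<Gamma>, \<psi>)}"])
        (auto intro: infer.ExistsE[where y = y])
  next
    case (EquE \<Gamma> s t x \<phi>)
    then show ?case
      by (intro exI[of _ "{(\<Gamma>, Equ s t), (\<Gamma>, subst x s \<phi>)}"])
        (auto intro: infer.EquE)
  qed (auto intro: infer.intros exI[of _ "{}"])
  ultimately show ?thesis by (meson Prv.Prv)
qed

section \<open>Arithmetical schemes and their instances\<close>

lemma finite_vars [simp]: "finite (vars t)" by (induction t) auto
lemma finite_fv [simp]: "finite (fv \<phi>)" by (induction \<phi>) auto
lemma finite_fvs [simp]: "finite (fvs \<Gamma>)" by (simp add: fvs_def)
lemma fvs_simps [simp]: "fvs [] = {}" "fvs (\<phi> # \<Gamma>) = fv \<phi> \<union> fvs \<Gamma>" by (simp_all add: fvs_def)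

lemma tsubst_idle [simp]: "x \<notin> vars t \<Longrightarrow> tsubst x u t = t" by (induction t) auto
lemma tsubst_self [simp]: "tsubst x (Var x) t = t" by (induction t) auto
lemma subst_self [simp]: "subst x (Var x) \<phi> = \<phi>" by (induction \<phi>) auto
lemma free_for_self [simp]: "free_for (Var x) x \<phi>" by (induction \<phi>) auto

fun bound_vars :: "fm \<Rightarrow> nat set" where
  "bound_vars (Equ s t) = {}"
| "bound_vars (Neg \<phi>) = bound_vars \<phi>"
| "bound_vars (Conj \<phi> \<psi>) = bound_vars \<phi> \<union> bound_vars \<psi>"
| "bound_vars (Disj \<phi> \<psi>) = bound_vars \<phi> \<union> bound_vars \<psi>"
| "bound_vars (Imp \<phi> \<psi>) = bound_vars \<phi> \<union> bound_vars \<psi>"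
| "bound_vars (Forall x \<phi>) = insert x (bound_vars \<phi>)"
| "bound_vars (Exists x \<phi>) = insert x (bound_vars \<phi>)"

lemma free_for_bvs: "vars t \<inter> bound_vars \<phi> = {} \<Longrightarrow> free_for t x \<phi>" by (induction \<phi>) auto
lemma bound_vars_subst [simp]: "bound_vars (subst x t \<phi>) = bound_vars \<phi>" by (induction \<phi>) auto

lemma Prv_assume: "\<phi> \<in> set \<Gamma> \<Longrightarrow> Prv \<Gamma> \<phi>"
  by (rule Prv_infer) (auto intro: infer.intros)

lemma Prv_axiom: "\<phi> \<in> PrA_alt \<Longrightarrow> Prv \<Gamma> \<phi>"
  by (rule Prv_infer) (auto intro: infer.intros)

lemma Prv_weaken: "Prv \<Gamma> \<phi> \<Longrightarrow> set \<Gamma> \<subseteq> set \<Delta> \<Longrightarrow> Prv \<Delta> \<phi>"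
  by (rule Prv_infer, rule infer.Weaken) auto

lemma Prv_impI: "Prv (\<phi> # \<Gamma>) \<psi> \<Longrightarrow> Prv \<Gamma> (Imp \<phi> \<psi>)"
  by (rule Prv_infer) (auto intro: infer.intros)

lemma Prv_impE: "Prv \<Gamma> (Imp \<phi> \<psi>) \<Longrightarrow> Prv \<Gamma> \<phi> \<Longrightarrow> Prv \<Gamma> \<psi>"
  by (rule Prv_infer, rule infer.ImpE[of _ \<phi>]) auto

lemma Prv_negI: "Prv (\<phi> # \<Gamma>) \<psi> \<Longrightarrow> Prv (\<phi> # \<Gamma>) (Neg \<psi>) \<Longrightarrow> Prv \<Gamma> (Neg \<phi>)"
  by (rule Prv_infer, rule infer.NegI) auto

lemma Prv_contra: "Prv (Neg \<phi> # \<Gamma>) \<psi> \<Longrightarrow> Prv (Neg \<phi> # \<Gamma>) (Neg \<psi>) \<Longrightarrow> Prv \<Gamma> \<phi>"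
  by (rule Prv_infer, rule infer.Contra) auto

lemma Prv_disjI1: "Prv \<Gamma> \<phi> \<Longrightarrow> Prv \<Gamma> (Disj \<phi> \<psi>)"
  by (rule Prv_infer) (auto intro: infer.intros)

lemma Prv_disjI2: "Prv \<Gamma> \<psi> \<Longrightarrow> Prv \<Gamma> (Disj \<phi> \<psi>)"
  by (rule Prv_infer) (auto intro: infer.intros)

lemma Prv_disjE: "Prv \<Gamma> (Disj \<phi> \<psi>) \<Longrightarrow> Prv (\<phi> # \<Gamma>) \<chi> \<Longrightarrow> Prv (\<psi> # \<Gamma>) \<chi> \<Longrightarrow> Prv \<Gamma> \<chi>"
  by (rule Prv_infer, rule infer.DisjE[of _ \<phi> \<psi>]) auto

lemma Prv_forallE: "Prv \<Gamma> (Forall x \<phi>) \<Longrightarrow> free_for t x \<phi> \<Longrightarrow> Prv \<Gamma> (subst x t \<phi>)"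
  by (rule Prv_infer, rule infer.ForallE) auto

lemma Prv_generalize: "Prv [] \<phi> \<Longrightarrow> Prv [] (Forall x \<phi>)"
  by (rule Prv_infer, rule infer.ForallI[where y = x]) auto

lemma Prv_existsI: "Prv \<Gamma> (subst x t \<phi>) \<Longrightarrow> free_for t x \<phi> \<Longrightarrow> Prv \<Gamma> (Exists x \<phi>)"
  by (rule Prv_infer, rule infer.ExistsI) auto

text \<open>The eigenvariable is chosen from 3 on, so that it is not captured when it is put into
  the axioms, which bind 0, 1 and 2.\<close>

lemma Prv_existsE:
  assumes "Prv \<Gamma> (Exists x \<phi>)" "\<And>y. free_for (Var y) x \<phi>"
    "\<And>y. 3 \<le> y \<Longrightarrow> Prv (subst x (Var y) \<phi> # \<Gamma>) \<psi>"
  shows "Prv \<Gamma> \<psi>"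
proof -
  obtain y where "y \<notin> {..<3} \<union> (fvs \<Gamma> \<union> fv (Exists x \<phi>) \<union> fv \<psi>)"
    using ex_new_if_finite[of "{..<3::nat} \<union> (fvs \<Gamma> \<union> fv (Exists x \<phi>) \<union> fv \<psi>)"] by auto
  then have "3 \<le> y" "y \<notin> fvs \<Gamma> \<union> fv (Exists x \<phi>) \<union> fv \<psi>" by auto
  then show ?thesis using assms
    by (intro Prv_infer[OF infer.ExistsE[of \<Gamma> x \<phi> _ y \<psi>]]) auto
qed

lemma Prv_refl: "Prv \<Gamma> (Equ t t)"
  by (rule Prv_infer) (auto intro: infer.intros)

text \<open>\<open>EquE\<close> rewrites the places marked by \<open>x\<close> in a template. A
  marker that is fresh leaves the other side of the equation alone; the next two lemmas use the same
  device.\<close>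

lemma Prv_sym: "Prv \<Gamma> (Equ s t) \<Longrightarrow> Prv \<Gamma> (Equ t s)"
proof -
  assume a: "Prv \<Gamma> (Equ s t)"
  obtain x where "x \<notin> vars s" using ex_new_if_finite[of "vars s"] by auto
  then have e: "subst x s (Equ (Var x) s) = Equ s s" "subst x t (Equ (Var x) s) = Equ t s" by auto
  show ?thesis unfolding e(2)[symmetric]
    by (rule Prv_infer, rule infer.EquE[of _ s]) (use a Prv_refl e in auto)
qed

lemma Prv_trans [trans]: "Prv \<Gamma> (Equ s t) \<Longrightarrow> Prv \<Gamma> (Equ t u) \<Longrightarrow> Prv \<Gamma> (Equ s u)"
proof -
  assume a: "Prv \<Gamma> (Equ s t)" "Prv \<Gamma> (Equ t u)"
  obtain x where "x \<notin> vars s" using ex_new_if_finite[of "vars s"] by auto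
  then have e: "subst x t (Equ s (Var x)) = Equ s t" "subst x u (Equ s (Var x)) = Equ s u" by auto
  show ?thesis unfolding e(2)[symmetric]
    by (rule Prv_infer, rule infer.EquE[of _ t]) (use a e in auto)
qed

lemma Prv_add: "Prv \<Gamma> (Equ s s') \<Longrightarrow> Prv \<Gamma> (Equ t t') \<Longrightarrow> Prv \<Gamma> (Equ (Add s t) (Add s' t'))"
proof -
  assume a: "Prv \<Gamma> (Equ s s')" "Prv \<Gamma> (Equ t t')"
  obtain x where x: "x \<notin> vars s \<union> vars t \<union> vars s'"
    using ex_new_if_finite[of "vars s \<union> vars t \<union> vars s'"] by auto
  have e: "subst x s (Equ (Add s t) (Add (Var x) t)) = Equ (Add s t) (Add s t)"
     "subst x s' (Equ (Add s t) (Add (Var x) t)) = Equ (Add s t) (Add s' t)"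
     "subst x t (Equ (Add s t) (Add s' (Var x))) = Equ (Add s t) (Add s' t)"
     "subst x t' (Equ (Add s t) (Add s' (Var x))) = Equ (Add s t) (Add s' t')" using x by auto
  have "Prv \<Gamma> (Equ (Add s t) (Add s' t))" unfolding e(2)[symmetric]
    by (rule Prv_infer, rule infer.EquE[of _ s]) (use a(1) Prv_refl e(1) in auto)
  then show ?thesis unfolding e(4)[symmetric]
    by (intro Prv_infer[OF infer.EquE[of _ t]]) (use a(2) e(3) in auto)
qed

text \<open>The axioms bind variables below 3, so terms without these can be substituted into them.\<close>

definition okt :: "trm \<Rightarrow> bool" where "okt t \<longleftrightarrow> (\<forall>i\<in>vars t. 3 \<le> i)"

lemma okt_simps [simp]: "okt (Var i) \<longleftrightarrow> 3 \<le> i" "okt Zero" "okt One" "okt (Add s t) \<longleftrightarrow> okt s \<and> okt t"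
  by (auto simp: okt_def)

lemma okt_notin: "okt t \<Longrightarrow> i < 3 \<Longrightarrow> i \<notin> vars t" by (auto simp: okt_def)
lemma okt_tsubst [simp]: "okt t \<Longrightarrow> tsubst 0 u t = t" "okt t \<Longrightarrow> tsubst (Suc 0) u t = t" "okt t \<Longrightarrow> tsubst 1 u t = t"
    "okt t \<Longrightarrow> tsubst 2 u t = t"
  by (auto simp: okt_notin)

lemma PrA_minus_subset: "\<phi> \<in> PrA_minus \<Longrightarrow> \<phi> \<in> PrA_alt" by (simp add: PrA_alt_def)

section \<open>Semigroup laws, order and discreteness from the axioms of
  \<open>PrA_minus\<close>\<close>

lemma Prv_assoc:
  assumes [simp]: "okt a" "okt b" "okt c"
  shows "Prv \<Gamma> (Equ (Add (Add a b) c) (Add a (Add b c)))"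
proof -
  have "Prv \<Gamma> (Forall 0 (Forall 1 (Forall 2
       (Equ (Add (Add (Var 0) (Var 1)) (Var 2)) (Add (Var 0) (Add (Var 1) (Var 2)))))))"
    by (rule Prv_axiom, rule PrA_minus_subset) (simp add: PrA_minus_def)
  from Prv_forallE[OF this, of a] have "Prv \<Gamma> (Forall 1 (Forall 2
       (Equ (Add (Add a (Var 1)) (Var 2)) (Add a (Add (Var 1) (Var 2))))))"
    by (simp add: okt_notin)
  from Prv_forallE[OF this, of b] have "Prv \<Gamma> (Forall 2
       (Equ (Add (Add a b) (Var 2)) (Add a (Add b (Var 2)))))" by (simp add: okt_notin)
  from Prv_forallE[OF this, of c] show ?thesis by (simp add: okt_notin)
qed

lemma Prv_comm:
  assumes [simp]: "okt a" "okt b"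
  shows "Prv \<Gamma> (Equ (Add a b) (Add b a))"
proof -
  have "Prv \<Gamma> (Forall 0 (Forall 1 (Equ (Add (Var 0) (Var 1)) (Add (Var 1) (Var 0)))))"
    by (rule Prv_axiom, rule PrA_minus_subset) (simp add: PrA_minus_def)
  from Prv_forallE[OF this, of a] have "Prv \<Gamma> (Forall 1 (Equ (Add a (Var 1)) (Add (Var 1) a)))"
    by (simp add: okt_notin)
  from Prv_forallE[OF this, of b] show ?thesis by (simp add: okt_notin)
qed

lemma Prv_zero: "Prv \<Gamma> (Equ (Add a Zero) a)"
proof -
  have "Prv \<Gamma> (Forall 0 (Equ (Add (Var 0) Zero) (Var 0)))"
    by (rule Prv_axiom, rule PrA_minus_subset) (simp add: PrA_minus_def)
  from Prv_forallE[OF this, of a] show ?thesis by simp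
qed

lemma Prv_cancel:
  assumes s: "Prv \<Gamma> (Equ (Add a c) (Add b c))"
  assumes [simp]: "okt a" "okt b" "okt c"
  shows "Prv \<Gamma> (Equ a b)"
proof -
  have "Prv \<Gamma> (Forall 0 (Forall 1 (Forall 2
       (Imp (Equ (Add (Var 0) (Var 2)) (Add (Var 1) (Var 2))) (Equ (Var 0) (Var 1))))))"
    by (rule Prv_axiom, rule PrA_minus_subset) (simp add: PrA_minus_def)
  from Prv_forallE[OF this, of a] have "Prv \<Gamma> (Forall 1 (Forall 2
       (Imp (Equ (Add a (Var 2)) (Add (Var 1) (Var 2))) (Equ a (Var 1)))))"
    by (simp add: okt_notin)
  from Prv_forallE[OF this, of b] have "Prv \<Gamma> (Forall 2
       (Imp (Equ (Add a (Var 2)) (Add b (Var 2))) (Equ a b)))" by (simp add: okt_notin)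
  from Prv_forallE[OF this, of c] show ?thesis using s by (auto simp: okt_notin intro: Prv_impE)
qed

lemma Prv_suc_ne: "Prv \<Gamma> (Neg (Equ (Add a One) Zero))"
proof -
  have "Prv \<Gamma> (Forall 0 (Neg (Equ (Add (Var 0) One) Zero)))"
    by (rule Prv_axiom, rule PrA_minus_subset) (simp add: PrA_minus_def)
  from Prv_forallE[OF this, of a] show ?thesis by simp
qed

text \<open>The axiom on predecessors as a case distinction. It is an implication from a negation,
  so the case split is made classically: from \<open>Neg \<chi>\<close> the case of zero is refuted,
  whence a predecessor exists and \<chi> follows.\<close>

lemma Prv_pred:
  assumes [simp]: "okt a"
  assumes "Prv (Equ a Zero # \<Gamma>) \<chi>" "\<And>y. 3 \<le> y \<Longrightarrow> Prv (Equ a (Add (Var y) One) # \<Gamma>) \<chi>"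
  shows "Prv \<Gamma> \<chi>"
proof -
  let ?E = "Exists 1 (Equ a (Add (Var 1) One))"
  have "Prv \<Gamma> (Forall 0 (Imp (Neg (Equ (Var 0) Zero)) (Exists 1 (Equ (Var 0) (Add (Var 1) One)))))"
    by (rule Prv_axiom, rule PrA_minus_subset) (simp add: PrA_minus_def)
  from Prv_forallE[OF this, of a]
  have imp: "Prv \<Gamma> (Imp (Neg (Equ a Zero)) ?E)" by (simp add: okt_notin)
  have e: "Prv (?E # \<Gamma>) \<chi>"
  proof (rule Prv_existsE)
    show "Prv (?E # \<Gamma>) ?E" by (simp add: Prv_assume)
    fix y :: nat assume "3 \<le> y"
    from assms(3)[OF this] show "Prv (subst 1 (Var y) (Equ a (Add (Var 1) One)) # ?E # \<Gamma>) \<chi>"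
      by (rule Prv_weaken) auto
  qed auto
  let ?D = "Neg \<chi> # \<Gamma>"
  have z: "Prv ?D (Neg (Equ a Zero))"
    by (rule Prv_negI[of _ _ \<chi>]) (auto intro: Prv_assume Prv_weaken[OF assms(2)])
  have "Prv ?D ?E" by (rule Prv_impE[OF Prv_weaken[OF imp] z]) auto
  moreover have "Prv ?D (Imp ?E \<chi>)" by (rule Prv_impI, rule Prv_weaken[OF e]) auto
  ultimately have "Prv ?D \<chi>" by (blast intro: Prv_impE)
  then show ?thesis by (rule Prv_contra) (auto intro: Prv_assume)
qed

lemma Prv_zero_left: "okt a \<Longrightarrow> Prv \<Gamma> (Equ (Add Zero a) a)"
  by (rule Prv_trans[OF Prv_comm Prv_zero]) auto

lemma Prv_swap:
  assumes [simp]: "okt a" "okt b" "okt c"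
  shows "Prv \<Gamma> (Equ (Add a (Add b c)) (Add b (Add a c)))"
proof -
  have "Prv \<Gamma> (Equ (Add a (Add b c)) (Add (Add a b) c))" by (rule Prv_sym, rule Prv_assoc) auto
  also have "Prv \<Gamma> (Equ (Add (Add a b) c) (Add (Add b a) c))"
    by (intro Prv_add Prv_comm Prv_refl) auto
  also have "Prv \<Gamma> (Equ (Add (Add b a) c) (Add b (Add a c)))" by (rule Prv_assoc) auto
  finally show ?thesis .
qed

lemma Prv_interchange:
  assumes [simp]: "okt a" "okt b" "okt c" "okt d"
  shows "Prv \<Gamma> (Equ (Add (Add a b) (Add c d)) (Add (Add a c) (Add b d)))"
proof -
  have "Prv \<Gamma> (Equ (Add (Add a b) (Add c d)) (Add a (Add b (Add c d))))" by (rule Prv_assoc) auto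
  also have "Prv \<Gamma> (Equ (Add a (Add b (Add c d))) (Add a (Add c (Add b d))))"
    by (intro Prv_add Prv_swap Prv_refl) auto
  also have "Prv \<Gamma> (Equ (Add a (Add c (Add b d))) (Add (Add a c) (Add b d)))"
    by (rule Prv_sym, rule Prv_assoc) auto
  finally show ?thesis .
qed

text \<open>If a = y + 1, then a + b = (y + b) + 1 is a successor and cannot be 0.\<close>

lemma Prv_sum_zero:
  assumes s: "Prv \<Gamma> (Equ (Add a b) Zero)" and [simp]: "okt a" "okt b"
  shows "Prv \<Gamma> (Equ a Zero)"
proof (rule Prv_pred)
  fix y :: nat assume y: "3 \<le> y"
  let ?D = "Equ a (Add (Var y) One) # \<Gamma>"
  have "Prv ?D (Equ (Add (Add (Var y) b) One) (Add (Var y) (Add b One)))" by (rule Prv_assoc) (use y in auto)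
  also have "Prv ?D (Equ (Add (Var y) (Add b One)) (Add (Var y) (Add One b)))"
    by (intro Prv_add Prv_refl Prv_comm) auto
  also have "Prv ?D (Equ (Add (Var y) (Add One b)) (Add (Add (Var y) One) b))"
    by (rule Prv_sym, rule Prv_assoc) (use y in auto)
  also have "Prv ?D (Equ (Add (Add (Var y) One) b) (Add a b))"
    by (intro Prv_add Prv_refl, rule Prv_sym) (auto intro: Prv_assume)
  also have "Prv ?D (Equ (Add a b) Zero)" by (rule Prv_weaken[OF s]) auto
  finally have c: "Prv ?D (Equ (Add (Add (Var y) b) One) Zero)" .
  show "Prv ?D (Equ a Zero)"
    by (rule Prv_contra[of _ _ "Equ (Add (Add (Var y) b) One) Zero"])
      (auto intro: Prv_weaken[OF c] Prv_suc_ne)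
qed (auto intro: Prv_assume)

lemma Prv_leI: "Prv \<Gamma> (Equ (Add s w) t) \<Longrightarrow> okt s \<Longrightarrow> okt t \<Longrightarrow> Prv \<Gamma> (le_fm s t)"
  unfolding le_fm_def by (rule Prv_existsI[where t = w]) auto

lemma Prv_leE:
  assumes "Prv \<Gamma> (le_fm s t)" "okt s" "okt t"
    "\<And>y. 3 \<le> y \<Longrightarrow> Prv (Equ (Add s (Var y)) t # \<Gamma>) \<chi>"
  shows "Prv \<Gamma> \<chi>"
  by (rule Prv_existsE[OF assms(1)[unfolded le_fm_def]]) (use assms in auto)

lemma Prv_le_add:
  assumes [simp]: "okt s" "okt t" "okt s'" "okt t'"
  assumes 1: "Prv \<Gamma> (le_fm s t)" and 2: "Prv \<Gamma> (le_fm s' t')"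
  shows "Prv \<Gamma> (le_fm (Add s s') (Add t t'))"
proof (rule Prv_leE[OF 1])
  fix y :: nat assume y: "3 \<le> y"
  let ?D = "Equ (Add s (Var y)) t # \<Gamma>"
  show "Prv ?D (le_fm (Add s s') (Add t t'))"
  proof (rule Prv_leE[of _ s' t'])
    show "Prv ?D (le_fm s' t')" by (rule Prv_weaken[OF 2]) auto
    fix z :: nat assume z: "3 \<le> z"
    let ?E = "Equ (Add s' (Var z)) t' # ?D"
    show "Prv ?E (le_fm (Add s s') (Add t t'))"
    proof (rule Prv_leI)
      show "Prv ?E (Equ (Add (Add s s') (Add (Var y) (Var z))) (Add t t'))"
        by (rule Prv_trans[OF Prv_interchange Prv_add]) (use y z in \<open>auto intro: Prv_assume\<close>)
    qed auto
  qed auto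
qed auto

text \<open>An inequality depends only on the difference of its sides. If a + w = b, then c + w + a
  = c + b = d + a, and cancelling a leaves c + w = d.\<close>

lemma Prv_le_transfer:
  assumes [simp]: "okt a" "okt b" "okt c" "okt d"
  assumes 1: "Prv \<Gamma> (le_fm a b)" and 2: "Prv \<Gamma> (Equ (Add a d) (Add c b))"
  shows "Prv \<Gamma> (le_fm c d)"
proof (rule Prv_leE[OF 1])
  fix w :: nat assume w: "3 \<le> w"
  let ?D = "Equ (Add a (Var w)) b # \<Gamma>"
  have "Prv ?D (Equ (Add (Add c (Var w)) a) (Add c (Add (Var w) a)))" by (rule Prv_assoc) (use w in auto)
  also have "Prv ?D (Equ (Add c (Add (Var w) a)) (Add c (Add a (Var w))))"
    by (intro Prv_add Prv_refl Prv_comm) (use w in auto)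
  also have "Prv ?D (Equ (Add c (Add a (Var w))) (Add c b))"
    by (intro Prv_add Prv_refl Prv_assume) auto
  also have "Prv ?D (Equ (Add c b) (Add a d))" by (rule Prv_sym, rule Prv_weaken[OF 2]) auto
  also have "Prv ?D (Equ (Add a d) (Add d a))" by (rule Prv_comm) auto
  finally have "Prv ?D (Equ (Add c (Var w)) d)" by (rule Prv_cancel) (use w in auto)
  then show "Prv ?D (le_fm c d)" by (rule Prv_leI) auto
qed auto

text \<open>Discreteness of the order, from which every split on the sign of a form comes. If b + w
  = a, then w = 0 gives the first alternative and w = y + 1 the second.\<close>

lemma Prv_le_discrete:
  assumes [simp]: "okt a" "okt b"
  shows "Prv \<Gamma> (Disj (le_fm a b) (le_fm (Add b One) a))"
proof -
  have "Prv \<Gamma> (Forall 0 (Forall 1 (Disj (le_fm (Var 0) (Var 1)) (le_fm (Var 1) (Var 0)))))"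
    by (rule Prv_axiom, rule PrA_minus_subset) (simp add: PrA_minus_def)
  from Prv_forallE[OF this, of a]
  have "Prv \<Gamma> (Forall 1 (Disj (le_fm a (Var 1)) (le_fm (Var 1) a)))"
    by (simp add: okt_notin le_fm_def)
  from Prv_forallE[OF this, of b]
  have "Prv \<Gamma> (Disj (le_fm a b) (le_fm b a))" by (simp add: okt_notin le_fm_def)
  then show ?thesis
  proof (rule Prv_disjE)
    show "Prv (le_fm a b # \<Gamma>) (Disj (le_fm a b) (le_fm (Add b One) a))"
      by (rule Prv_disjI1, rule Prv_assume) auto
    show "Prv (le_fm b a # \<Gamma>) (Disj (le_fm a b) (le_fm (Add b One) a))"
    proof (rule Prv_leE[of _ b a])
      fix w :: nat assume w: "3 \<le> w"
      let ?D = "Equ (Add b (Var w)) a # le_fm b a # \<Gamma>"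
      show "Prv ?D (Disj (le_fm a b) (le_fm (Add b One) a))"
      proof (rule Prv_pred[of "Var w"])
        let ?E = "Equ (Var w) Zero # ?D"
        have "Prv ?E (Equ a (Add b (Var w)))" by (rule Prv_sym) (simp add: Prv_assume)
        also have "Prv ?E (Equ (Add b (Var w)) (Add b Zero))"
          by (intro Prv_add Prv_refl Prv_assume) auto
        also have "Prv ?E (Equ (Add b Zero) b)" by (rule Prv_zero)
        finally have "Prv ?E (Equ (Add a Zero) b)" by (rule Prv_trans[OF Prv_zero])
        then show "Prv ?E (Disj (le_fm a b) (le_fm (Add b One) a))"
          by (intro Prv_disjI1 Prv_leI[of _ _ Zero]) auto
      next
        fix y :: nat assume y: "3 \<le> y"
        let ?E = "Equ (Var w) (Add (Var y) One) # ?D"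
        have "Prv ?E (Equ (Add (Add b One) (Var y)) (Add b (Add One (Var y))))" by (rule Prv_assoc) (use y in auto)
        also have "Prv ?E (Equ (Add b (Add One (Var y))) (Add b (Add (Var y) One)))"
          by (intro Prv_add Prv_refl Prv_comm) (use y in auto)
        also have "Prv ?E (Equ (Add b (Add (Var y) One)) (Add b (Var w)))"
          by (intro Prv_add Prv_refl, rule Prv_sym) (auto intro: Prv_assume)
        also have "Prv ?E (Equ (Add b (Var w)) a)" by (rule Prv_assume) auto
        finally show "Prv ?E (Disj (le_fm a b) (le_fm (Add b One) a))"
          by (intro Prv_disjI2 Prv_leI[of _ _ "Var y"]) (use y in auto)
      qed (use w in auto)
    qed (auto intro: Prv_assume)
  qed
qed

lemma Prv_le_zero: "okt a \<Longrightarrow> Prv \<Gamma> (le_fm Zero a)"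
  by (rule Prv_leI[OF Prv_zero_left]) auto

lemma Prv_le_antisym:
  assumes [simp]: "okt s" "okt t"
  assumes 1: "Prv \<Gamma> (le_fm s t)" and 2: "Prv \<Gamma> (le_fm t s)"
  shows "Prv \<Gamma> (Equ s t)"
proof (rule Prv_leE[OF 1])
  fix y :: nat assume y: "3 \<le> y"
  let ?D = "Equ (Add s (Var y)) t # \<Gamma>"
  show "Prv ?D (Equ s t)"
  proof (rule Prv_leE[of _ t s])
    show "Prv ?D (le_fm t s)" by (rule Prv_weaken[OF 2]) auto
    fix z :: nat assume z: "3 \<le> z"
    let ?E = "Equ (Add t (Var z)) s # ?D"
    have "Prv ?E (Equ (Add (Add (Var y) (Var z)) s) (Add s (Add (Var y) (Var z))))"
      by (rule Prv_comm) (use y z in auto)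
    also have "Prv ?E (Equ (Add s (Add (Var y) (Var z))) (Add (Add s (Var y)) (Var z)))"
      by (rule Prv_sym, rule Prv_assoc) (use y z in auto)
    also have "Prv ?E (Equ (Add (Add s (Var y)) (Var z)) (Add t (Var z)))"
      by (intro Prv_add Prv_refl Prv_assume) auto
    also have "Prv ?E (Equ (Add t (Var z)) s)" by (rule Prv_assume) auto
    also have "Prv ?E (Equ s (Add Zero s))" by (rule Prv_sym, rule Prv_zero_left) auto
    finally have "Prv ?E (Equ (Add (Var y) (Var z)) Zero)"
      by (rule Prv_cancel) (use y z in auto)
    then have y0: "Prv ?E (Equ (Var y) Zero)" by (rule Prv_sum_zero) (use y z in auto)
    have "Prv ?E (Equ s (Add s Zero))" by (rule Prv_sym, rule Prv_zero)
    also have "Prv ?E (Equ (Add s Zero) (Add s (Var y)))"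
      by (intro Prv_add Prv_refl Prv_sym[OF y0])
    also have "Prv ?E (Equ (Add s (Var y)) t)" by (rule Prv_assume) auto
    finally show "Prv ?E (Equ s t)" .
  qed auto
qed auto

lemma Prv_eq_le: "Prv \<Gamma> (Equ s t) \<Longrightarrow> okt s \<Longrightarrow> okt t \<Longrightarrow> Prv \<Gamma> (le_fm s t)"
  by (rule Prv_leI[of _ _ Zero]) (auto intro: Prv_trans[OF Prv_zero])

text \<open>Written with \<open>Add One Zero\<close>, because this is the term that
  \<open>pos_part\<close> produces for the constant form 1.\<close>

lemma Prv_not_le_zero: "Prv \<Gamma> (Neg (le_fm (Add One Zero) Zero))"
proof (rule Prv_negI)
  let ?D = "le_fm (Add One Zero) Zero # \<Gamma>"
  have "Prv ?D (Equ (Add One Zero) Zero)"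
  proof (rule Prv_leE)
    show "Prv ?D (le_fm (Add One Zero) Zero)" by (rule Prv_assume) auto
    fix y :: nat assume y: "3 \<le> y"
    show "Prv (Equ (Add (Add One Zero) (Var y)) Zero # ?D) (Equ (Add One Zero) Zero)"
      by (rule Prv_sum_zero[of _ _ "Var y"]) (use y in \<open>auto intro: Prv_assume\<close>)
  qed auto
  then show "Prv ?D (Equ (Add Zero One) Zero)" by (rule Prv_trans[OF Prv_comm, rotated 2]) auto
qed (rule Prv_suc_ne)

text \<open>Schematic arithmetical facts, to be instantiated at the variables 3, \<dots>, 6.\<close>

definition schemes :: "fm list" where
  "schemes = (let a = Var 3; b = Var 4; c = Var 5; d = Var 6 in
    [Imp (Equ a b) (Equ b a),
     Imp (Equ a b) (Imp (Equ b c) (Equ a c)),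
     Imp (Equ a b) (Imp (Equ c d) (Equ (Add a c) (Add b d))),
     Equ (Add (Add a b) c) (Add a (Add b c)),
     Equ (Add Zero a) a,
     Equ (Add a Zero) a,
     Equ (Add a (Add b c)) (Add b (Add a c)),
     Imp (le_fm a b) (Imp (le_fm c d) (le_fm (Add a c) (Add b d))),
     Imp (le_fm a b) (Imp (Equ (Add a d) (Add c b)) (le_fm c d)),
     Disj (le_fm a b) (le_fm (Add b One) a),
     le_fm Zero a,
     Imp (le_fm a b) (Imp (le_fm b a) (Equ a b)),
     Imp (Equ a b) (le_fm a b),
     Neg (le_fm (Add One Zero) Zero)])"

lemma Prv_schemes: "\<psi> \<in> set schemes \<Longrightarrow> Prv [] \<psi>"
proof -
  let ?a = "Var 3" and ?b = "Var 4" and ?c = "Var 5" and ?d = "Var 6"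
  have 1: "Prv [] (Imp (Equ ?a ?b) (Equ ?b ?a))"
    by (rule Prv_impI, rule Prv_sym, rule Prv_assume) simp
  have 2: "Prv [] (Imp (Equ ?a ?b) (Imp (Equ ?b ?c) (Equ ?a ?c)))"
    by (rule Prv_impI, rule Prv_impI, rule Prv_trans[of _ _ ?b]; rule Prv_assume; simp)
  have 3: "Prv [] (Imp (Equ ?a ?b) (Imp (Equ ?c ?d) (Equ (Add ?a ?c) (Add ?b ?d))))"
    by (rule Prv_impI, rule Prv_impI, rule Prv_add; rule Prv_assume; simp)
  have 7: "Prv [] (Imp (le_fm ?a ?b) (Imp (le_fm ?c ?d) (le_fm (Add ?a ?c) (Add ?b ?d))))"
    by (rule Prv_impI, rule Prv_impI, rule Prv_le_add) (simp_all add: Prv_assume)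
  have 8: "Prv [] (Imp (le_fm ?a ?b) (Imp (Equ (Add ?a ?d) (Add ?c ?b)) (le_fm ?c ?d)))"
    by (rule Prv_impI, rule Prv_impI, rule Prv_le_transfer[of ?a ?b]) (simp_all add: Prv_assume)
  have 11: "Prv [] (Imp (le_fm ?a ?b) (Imp (le_fm ?b ?a) (Equ ?a ?b)))"
    by (rule Prv_impI, rule Prv_impI, rule Prv_le_antisym) (simp_all add: Prv_assume)
  have 12: "Prv [] (Imp (Equ ?a ?b) (le_fm ?a ?b))"
    by (rule Prv_impI, rule Prv_eq_le) (simp_all add: Prv_assume)
  have "\<forall>\<psi>\<in>set schemes. Prv [] \<psi>"
    unfolding schemes_def Let_def
    by (simp add: 1 2 3 7 8 11 12 Prv_assoc Prv_zero_left Prv_zero Prv_swap Prv_le_discrete Prv_le_zero Prv_not_le_zero)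
  then show "\<psi> \<in> set schemes \<Longrightarrow> Prv [] \<psi>" by blast
qed

definition close4 :: "fm \<Rightarrow> fm" where "close4 \<psi> = Forall 3 (Forall 4 (Forall 5 (Forall 6 \<psi>)))"

text \<open>The substitutions are made one after the other. For \<open>big\<close> terms this
  amounts to simultaneous substitution, since no inserted term contains one of the variables 3 to
  6.\<close>

definition inst :: "trm \<Rightarrow> trm \<Rightarrow> trm \<Rightarrow> trm \<Rightarrow> fm \<Rightarrow> fm" where
  "inst a b c d \<psi> = subst 6 d (subst 5 c (subst 4 b (subst 3 a \<psi>)))"

lemma ex_scheme_bound: "\<exists>c. \<forall>\<psi>\<in>set schemes. der c c [] (close4 \<psi>)"
proof -
  have "\<exists>c. \<forall>\<psi>\<in>set xs. der c c [] (close4 \<psi>)" if "\<forall>\<psi>\<in>set xs. Prv [] \<psi>" for xs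
    using that
  proof (induction xs)
    case (Cons \<psi> xs)
    then obtain c where c: "\<forall>\<psi>\<in>set xs. der c c [] (close4 \<psi>)" by auto
    have "Prv [] (close4 \<psi>)" unfolding close4_def using Cons by (intro Prv_generalize) auto
    then obtain k where "der k k [] (close4 \<psi>)" using Prv_der by blast
    then have "der (c + k) (c + k) [] (close4 \<psi>)" by (rule der_mono) auto
    moreover have "der (c + k) (c + k) [] (close4 \<psi>')" if "\<psi>' \<in> set xs" for \<psi>'
      by (rule der_mono[of c c]) (use c that in auto)
    ultimately show ?case by auto
  qed auto
  then show ?thesis using Prv_schemes by blast
qed

text \<open>The schemes do not depend on the sentence to be proved, so the existence of a common
  bound is enough. It enters the final polynomial as part of the constant term.\<close>

definition scheme_bound :: nat where "scheme_bound = (SOME c. \<forall>\<psi>\<in>set schemes. der c c [] (close4 \<psi>))"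

lemma der_scheme: "\<psi> \<in> set schemes \<Longrightarrow> der scheme_bound scheme_bound [] (close4 \<psi>)"
  unfolding scheme_bound_def using someI_ex[OF ex_scheme_bound] by blast

lemma tsz_tsubst: "tsz (tsubst x u t) \<le> tsz t * tsz u"
proof (induction t)
  case (Add s t)
  then show ?case using tsz_ge1[of u]
    unfolding tsz_simps tsubst.simps add_mult_distrib by linarith
qed (use tsz_ge1[of u] in \<open>auto simp: mult_le_mono\<close>)

lemma fsz_subst: "fsz (subst x u \<phi>) \<le> fsz \<phi> * tsz u"
proof (induction \<phi>)
  case (Equ s t)
  show ?case using tsz_tsubst[of x u s] tsz_tsubst[of x u t] tsz_ge1[of u]
    unfolding fsz_simps subst.simps add_mult_distrib by linarith
next
  case (Forall y \<phi>)
  have "(vsz y + 1) * 1 \<le> (vsz y + 1) * tsz u" "fsz \<phi> * 1 \<le> fsz \<phi> * tsz u"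
    using tsz_ge1[of u] by (intro mult_le_mono2, simp)+
  then have "vsz y + fsz \<phi> + 1 \<le> (vsz y + fsz \<phi> + 1) * tsz u"
      "vsz y + fsz (subst x u \<phi>) + 1 \<le> (vsz y + fsz \<phi> + 1) * tsz u"
    using Forall unfolding add_mult_distrib by linarith+
  then show ?case by (cases "y = x") auto
next
  case (Exists y \<phi>)
  have "(vsz y + 1) * 1 \<le> (vsz y + 1) * tsz u" "fsz \<phi> * 1 \<le> fsz \<phi> * tsz u"
    using tsz_ge1[of u] by (intro mult_le_mono2, simp)+
  then have "vsz y + fsz \<phi> + 1 \<le> (vsz y + fsz \<phi> + 1) * tsz u"
      "vsz y + fsz (subst x u \<phi>) + 1 \<le> (vsz y + fsz \<phi> + 1) * tsz u"
    using Exists unfolding add_mult_distrib by linarith+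
  then show ?case by (cases "y = x") auto
qed (use tsz_ge1[of u] in \<open>unfold fsz_simps subst.simps add_mult_distrib, linarith+\<close>)

lemma bvs_schemes: "\<psi> \<in> set schemes \<Longrightarrow> bound_vars \<psi> \<subseteq> {2}"
  unfolding schemes_def Let_def by (auto simp: le_fm_def)

text \<open>Indices below 10 are left to the variables bound in the axioms, in the closed schemes
  and in \<open>Res\<close>, so that a \<open>big\<close> term can be substituted there without
  capture.\<close>

definition big :: "trm \<Rightarrow> bool" where "big t \<longleftrightarrow> (\<forall>i\<in>vars t. 10 \<le> i)"

lemma big_simps [simp]: "big (Var i) \<longleftrightarrow> 10 \<le> i" "big Zero" "big One" "big (Add s t) \<longleftrightarrow> big s \<and> big t"
  by (auto simp: big_def)

lemma big_notin: "big t \<Longrightarrow> i < 10 \<Longrightarrow> i \<notin> vars t" by (auto simp: big_def)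

text \<open>Each of the four instantiations multiplies the size of the formula by at most
  \<open>S\<close>, hence the fourth power. The 5 additional lines are these instantiations and one
  weakening.\<close>

lemma der_inst:
  assumes psi: "\<psi> \<in> set schemes" and b: "big a" "big b" "big c" "big d"
    and sz: "tsz a \<le> S" "tsz b \<le> S" "tsz c \<le> S" "tsz d \<le> S"
    and L: "csz \<Gamma> + scheme_bound * S ^ 4 + 2 \<le> L"
  shows "der L (scheme_bound + 5) \<Gamma> (inst a b c d \<psi>)"
proof -
  have S1: "1 \<le> S" using sz(1) tsz_ge1[of a] by linarith
  have pw: "scheme_bound * S ^ 1 \<le> scheme_bound * S ^ 4" "scheme_bound * S ^ 2 \<le> scheme_bound * S ^ 4" "scheme_bound * S ^ 3 \<le> scheme_bound * S ^ 4"
    using S1 by (auto intro!: power_increasing mult_left_mono self_le_power)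
  have step: "fsz (subst x u \<phi>) \<le> scheme_bound * S ^ Suc n" if "fsz \<phi> \<le> scheme_bound * S ^ n" "tsz u \<le> S" for x u \<phi> n
  proof -
    have "fsz \<phi> * tsz u \<le> scheme_bound * S ^ n * S" using that by (intro mult_le_mono) auto
    then show ?thesis using fsz_subst[of x u \<phi>] by (simp add: mult.assoc mult.commute[of S])
  qed
  have 0: "der scheme_bound scheme_bound [] (close4 \<psi>)" by (rule der_scheme[OF psi])
  have f0: "fsz (Forall 4 (Forall 5 (Forall 6 \<psi>))) \<le> scheme_bound * S ^ 0"
    using der_width[OF 0] by (simp add: close4_def)
  have kcL: "scheme_bound \<le> L" using L S1 by (metis add_leE le_trans mult.right_neutral mult_le_mono2 one_le_power)
  have 0: "der L scheme_bound [] (close4 \<psi>)" by (rule der_mono[OF 0 kcL]) simp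
  have ff: "vars t \<inter> bound_vars \<phi> = {}" if "bound_vars \<phi> \<subseteq> {2,4,5,6}" "big t" for t \<phi>
    using that by (fastforce simp: big_def)
  note bp = bvs_schemes[OF psi]
  have e1: "subst 3 a (Forall 4 (Forall 5 (Forall 6 \<psi>))) = Forall 4 (Forall 5 (Forall 6 (subst 3 a \<psi>)))"
    by simp
  have e2: "subst 4 b (Forall 5 (Forall 6 (subst 3 a \<psi>))) = Forall 5 (Forall 6 (subst 4 b (subst 3 a \<psi>)))"
    by simp
  have e3: "subst 5 c (Forall 6 (subst 4 b (subst 3 a \<psi>))) = Forall 6 (subst 5 c (subst 4 b (subst 3 a \<psi>)))"
    by simp
  have f1: "fsz (Forall 4 (Forall 5 (Forall 6 (subst 3 a \<psi>)))) \<le> scheme_bound * S ^ 1"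
    using step[OF f0 sz(1), of 3] by (simp only: e1 One_nat_def)
  have f2: "fsz (Forall 5 (Forall 6 (subst 4 b (subst 3 a \<psi>)))) \<le> scheme_bound * S ^ 2"
    using step[of "Forall 5 (Forall 6 (subst 3 a \<psi>))" 1 b 4] f1 sz(2)
    by (simp only: e2 One_nat_def numeral_2_eq_2) simp
  have f3: "fsz (Forall 6 (subst 5 c (subst 4 b (subst 3 a \<psi>)))) \<le> scheme_bound * S ^ 3"
    using step[of "Forall 6 (subst 4 b (subst 3 a \<psi>))" 2 c 5] f2 sz(3)
    by (simp only: e3 numeral_3_eq_3 numeral_2_eq_2) simp
  have f4: "fsz (inst a b c d \<psi>) \<le> scheme_bound * S ^ 4"
    using step[of "subst 5 c (subst 4 b (subst 3 a \<psi>))" 3 d 6] f3 sz(4)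
    by (simp add: inst_def eval_nat_numeral)
  have bs: "bound_vars \<psi> \<subseteq> {2,4,5,6}" using bp by auto
  have 1: "der L (Suc scheme_bound) [] (Forall 4 (Forall 5 (Forall 6 (subst 3 a \<psi>))))"
    unfolding e1[symmetric]
    by (rule der_forallE[OF 0[unfolded close4_def]], rule free_for_bvs, rule ff)
      (use bs b le_trans[OF f1 pw(1)] L in \<open>auto simp del: fsz_simps\<close>)
  have 2: "der L (Suc (Suc scheme_bound)) [] (Forall 5 (Forall 6 (subst 4 b (subst 3 a \<psi>))))"
    unfolding e2[symmetric]
    by (rule der_forallE[OF 1], rule free_for_bvs, rule ff)
      (use bs b le_trans[OF f2 pw(2)] L in \<open>auto simp del: fsz_simps\<close>)
  have 3: "der L (Suc (Suc (Suc scheme_bound))) [] (Forall 6 (subst 5 c (subst 4 b (subst 3 a \<psi>))))"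
    unfolding e3[symmetric]
    by (rule der_forallE[OF 2], rule free_for_bvs, rule ff)
      (use bs b le_trans[OF f3 pw(3)] L in \<open>auto simp del: fsz_simps\<close>)
  have 4: "der L (Suc (Suc (Suc (Suc scheme_bound)))) [] (inst a b c d \<psi>)"
    unfolding inst_def
    by (rule der_forallE[OF 3], rule free_for_bvs, rule ff)
      (use bs b f4[unfolded inst_def] L in auto)
  have "der L (Suc (Suc (Suc (Suc (Suc scheme_bound))))) \<Gamma> (inst a b c d \<psi>)"
    by (rule der_weaken[OF 4]) (use f4 L in auto)
  then show ?thesis by (simp add: eval_nat_numeral)
qed

section \<open>Provable equality of equal linear terms\<close>

lemma scheme_bound_ge: "10 \<le> scheme_bound"
proof -
  have "Imp (Equ (Var 3) (Var 4)) (Equ (Var 4) (Var 3)) \<in> set schemes" by (simp add: schemes_def Let_def)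
  from der_width[OF der_scheme[OF this]] show ?thesis by (simp add: close4_def)
qed

fun flat :: "trm \<Rightarrow> trm list" where
  "flat (Var i) = [Var i]"
| "flat Zero = []"
| "flat One = [One]"
| "flat (Add s t) = flat s @ flat t"

fun lsum :: "trm list \<Rightarrow> trm" where
  "lsum [] = Zero"
| "lsum (x # xs) = Add x (lsum xs)"

lemma big_lsum [simp]: "big (lsum xs) \<longleftrightarrow> (\<forall>x\<in>set xs. big x)" by (induction xs) auto
lemma vars_lsum: "vars (lsum xs) = (\<Union>x\<in>set xs. vars x)" by (induction xs) auto
lemma big_flat: "big t \<Longrightarrow> x \<in> set (flat t) \<Longrightarrow> big x" by (induction t) auto
lemma tsz_lsum: "tsz (lsum xs) = 1 + (\<Sum>x\<leftarrow>xs. tsz x + 3)" by (induction xs) auto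
lemma tsz_lsum_flat: "tsz (lsum (flat t)) \<le> 5 * tsz t"
proof (induction t)
  case (Var i) show ?case using vsz_ge1[of i] by (simp del: vsz_ge1)
qed (auto simp: tsz_lsum)
lemma length_flat: "length (flat t) \<le> tsz t"
  by (induction t) (use vsz_ge1 in auto)
lemma eval_lsum: "eval e (lsum xs) = (\<Sum>x\<leftarrow>xs. eval e x)" by (induction xs) auto

text \<open>The values determine the atoms: at the zero assignment a term evaluates to the number of
  its ones, and at the indicator of i the number of occurrences of \<open>Var i\<close> is
  added.\<close>

lemma mset_flat:
  assumes "\<And>e. eval e s = eval e t" shows "mset (flat s) = mset (flat t)"
proof (rule multiset_eqI)
  have v: "eval (\<lambda>j. if j = i then 1 else 0) t = count (mset (flat t)) (Var i) + count (mset (flat t)) One" for i t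
    by (induction t) auto
  have o: "eval (\<lambda>j. 0) t = count (mset (flat t)) One" for t by (induction t) auto
  have z: "count (mset (flat t)) Zero = 0" "count (mset (flat t)) (Add a b) = 0" for t a b by (induction t) auto
  fix x show "count (mset (flat s)) x = count (mset (flat t)) x"
  proof (cases x)
    case (Var i) then show ?thesis using v[of i s] v[of i t] o[of s] o[of t] assms by simp
  next
    case One then show ?thesis using o[of s] o[of t] assms by simp
  qed (simp_all add: z)
qed

definition k0 :: nat where "k0 = scheme_bound + 10"

text \<open>Within \<open>room\<close> all instances of the schemes at terms of size at most \<open>S\<close> fit into the width.\<close>

definition room :: "nat \<Rightarrow> nat \<Rightarrow> fm list \<Rightarrow> bool" where
  "room L S \<Gamma> \<longleftrightarrow> csz \<Gamma> + scheme_bound * S ^ 4 + 2 \<le> L"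

lemmas schemes_simps = schemes_def Let_def
lemmas inst_simps = inst_def le_fm_def big_notin

lemma room_sym:
  assumes "room L S \<Gamma>" "der L N \<Gamma> (Equ s t)" "big s" "big t" "tsz s \<le> S" "tsz t \<le> S"
  shows "der L (N + k0) \<Gamma> (Equ t s)"
proof -
  have "1 \<le> S" using assms tsz_ge1[of s] by linarith
  then have "der L (scheme_bound + 5) \<Gamma> (inst s t Zero Zero (Imp (Equ (Var 3) (Var 4)) (Equ (Var 4) (Var 3))))"
    using assms by (intro der_inst[where S = S]) (auto simp: schemes_simps room_def)
  then have "der L (scheme_bound + 5) \<Gamma> (Imp (Equ s t) (Equ t s))" using assms by (simp add: inst_simps)
  from der_impE[OF this assms(2)] show ?thesis by (rule der_lines_mono) (simp add: k0_def)
qed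

lemma room_trans:
  assumes "room L S \<Gamma>" "der L N \<Gamma> (Equ s t)" "der L M \<Gamma> (Equ t u)"
    "big s" "big t" "big u" "tsz s \<le> S" "tsz t \<le> S" "tsz u \<le> S"
  shows "der L (N + M + k0) \<Gamma> (Equ s u)"
proof -
  have "1 \<le> S" using assms tsz_ge1[of s] by linarith
  then have "der L (scheme_bound + 5) \<Gamma> (inst s t u Zero
     (Imp (Equ (Var 3) (Var 4)) (Imp (Equ (Var 4) (Var 5)) (Equ (Var 3) (Var 5)))))"
    using assms by (intro der_inst[where S = S]) (auto simp: schemes_simps room_def)
  then have "der L (scheme_bound + 5) \<Gamma> (Imp (Equ s t) (Imp (Equ t u) (Equ s u)))" using assms by (simp add: inst_simps)
  from der_impE[OF der_impE[OF this assms(2)] assms(3)] show ?thesis by (rule der_lines_mono) (simp add: k0_def)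
qed

lemma room_add:
  assumes "room L S \<Gamma>" "der L N \<Gamma> (Equ s s')" "der L M \<Gamma> (Equ t t')"
    "big s" "big t" "big s'" "big t'" "tsz s \<le> S" "tsz t \<le> S" "tsz s' \<le> S" "tsz t' \<le> S"
  shows "der L (N + M + k0) \<Gamma> (Equ (Add s t) (Add s' t'))"
proof -
  have "der L (scheme_bound + 5) \<Gamma> (inst s s' t t'
     (Imp (Equ (Var 3) (Var 4)) (Imp (Equ (Var 5) (Var 6)) (Equ (Add (Var 3) (Var 5)) (Add (Var 4) (Var 6))))))"
    using assms by (intro der_inst[where S = S]) (auto simp: schemes_simps room_def)
  then have "der L (scheme_bound + 5) \<Gamma> (Imp (Equ s s') (Imp (Equ t t') (Equ (Add s t) (Add s' t'))))"
    using assms by (simp add: inst_simps)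
  from der_impE[OF der_impE[OF this assms(2)] assms(3)] show ?thesis by (rule der_lines_mono) (simp add: k0_def)
qed

lemma room_assoc:
  assumes "room L S \<Gamma>" "big a" "big b" "big c" "tsz a \<le> S" "tsz b \<le> S" "tsz c \<le> S"
  shows "der L k0 \<Gamma> (Equ (Add (Add a b) c) (Add a (Add b c)))"
proof -
  have "1 \<le> S" using assms tsz_ge1[of a] by linarith
  then have "der L (scheme_bound + 5) \<Gamma> (inst a b c Zero
     (Equ (Add (Add (Var 3) (Var 4)) (Var 5)) (Add (Var 3) (Add (Var 4) (Var 5)))))"
    using assms by (intro der_inst[where S = S]) (auto simp: schemes_simps room_def)
  then have "der L (scheme_bound + 5) \<Gamma> (Equ (Add (Add a b) c) (Add a (Add b c)))"
    using assms by (simp add: inst_simps)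
  then show ?thesis by (rule der_lines_mono) (simp add: k0_def)
qed

lemma room_swap:
  assumes "room L S \<Gamma>" "big a" "big b" "big c" "tsz a \<le> S" "tsz b \<le> S" "tsz c \<le> S"
  shows "der L k0 \<Gamma> (Equ (Add a (Add b c)) (Add b (Add a c)))"
proof -
  have "1 \<le> S" using assms tsz_ge1[of a] by linarith
  then have "der L (scheme_bound + 5) \<Gamma> (inst a b c Zero
     (Equ (Add (Var 3) (Add (Var 4) (Var 5))) (Add (Var 4) (Add (Var 3) (Var 5)))))"
    using assms by (intro der_inst[where S = S]) (auto simp: schemes_simps room_def)
  then have "der L (scheme_bound + 5) \<Gamma> (Equ (Add a (Add b c)) (Add b (Add a c)))"
    using assms by (simp add: inst_simps)
  then show ?thesis by (rule der_lines_mono) (simp add: k0_def)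
qed

lemma room_zero_left:
  assumes "room L S \<Gamma>" "big a" "tsz a \<le> S"
  shows "der L k0 \<Gamma> (Equ (Add Zero a) a)"
proof -
  have "1 \<le> S" using assms tsz_ge1[of a] by linarith
  then have "der L (scheme_bound + 5) \<Gamma> (inst a Zero Zero Zero (Equ (Add Zero (Var 3)) (Var 3)))"
    using assms by (intro der_inst[where S = S]) (auto simp: schemes_simps room_def)
  then have "der L (scheme_bound + 5) \<Gamma> (Equ (Add Zero a) a)" using assms by (simp add: inst_simps)
  then show ?thesis by (rule der_lines_mono) (simp add: k0_def)
qed

lemma room_zero:
  assumes "room L S \<Gamma>" "big a" "tsz a \<le> S"
  shows "der L k0 \<Gamma> (Equ (Add a Zero) a)"
proof -
  have "1 \<le> S" using assms tsz_ge1[of a] by linarith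
  then have "der L (scheme_bound + 5) \<Gamma> (inst a Zero Zero Zero (Equ (Add (Var 3) Zero) (Var 3)))"
    using assms by (intro der_inst[where S = S]) (auto simp: schemes_simps room_def)
  then have "der L (scheme_bound + 5) \<Gamma> (Equ (Add a Zero) a)" using assms by (simp add: inst_simps)
  then show ?thesis by (rule der_lines_mono) (simp add: k0_def)
qed

lemma room_refl:
  assumes "room L S \<Gamma>" "tsz a \<le> S"
  shows "der L 1 \<Gamma> (Equ a a)"
proof (rule der_refl)
  have S: "1 \<le> S" using assms tsz_ge1[of a] by linarith
  then have "S * 1 \<le> S ^ 4" using self_le_power[of S 4] by simp
  then have "10 * S \<le> scheme_bound * S ^ 4" using scheme_bound_ge by (intro mult_le_mono) auto
  then show "csz \<Gamma> + 2 * tsz a + 5 \<le> L" using assms S unfolding room_def by linarith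
qed

lemma room_lsum_append:
  assumes "room L S \<Gamma>" "\<forall>x\<in>set xs. big x" "\<forall>x\<in>set ys. big x" "tsz (lsum xs) + tsz (lsum ys) + 3 \<le> S"
  shows "der L (k0 * (4 * length xs + 1)) \<Gamma> (Equ (Add (lsum xs) (lsum ys)) (lsum (xs @ ys)))"
  using assms
proof (induction xs)
  case Nil
  then show ?case using room_zero_left[of L S \<Gamma> "lsum ys"] by simp
next
  case (Cons x xs)
  have t: "tsz (lsum (xs @ ys)) \<le> tsz (lsum xs) + tsz (lsum ys)" by (simp add: tsz_lsum)
  have 1: "der L k0 \<Gamma> (Equ (Add (Add x (lsum xs)) (lsum ys)) (Add x (Add (lsum xs) (lsum ys))))"
    by (rule room_assoc[of L S]) (use Cons.prems in auto)
  have 2: "der L (1 + k0 * (4 * length xs + 1) + k0) \<Gamma> (Equ (Add x (Add (lsum xs) (lsum ys))) (Add x (lsum (xs @ ys))))"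
    by (rule room_add[of L S, OF _ room_refl[of L S] Cons.IH]) (use Cons.prems t in auto)
  have "der L (k0 + (1 + k0 * (4 * length xs + 1) + k0) + k0) \<Gamma> (Equ (Add (Add x (lsum xs)) (lsum ys)) (Add x (lsum (xs @ ys))))"
    by (rule room_trans[of L S, OF _ 1 2]) (use Cons.prems t in auto)
  then have "der L (k0 * (4 * length (x # xs) + 1)) \<Gamma> (Equ (Add (Add x (lsum xs)) (lsum ys)) (Add x (lsum (xs @ ys))))"
    by (rule der_lines_mono) (simp add: k0_def algebra_simps)
  then show ?case by simp
qed

text \<open>At each \<open>Add\<close> the normal forms of the summands are appended at a cost
  linear in the first of them; over the whole term this is quadratic.\<close>

lemma room_flat:
  assumes "room L S \<Gamma>" "big t" "20 * tsz t \<le> S"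
  shows "der L (8 * k0 * tsz t ^ 2) \<Gamma> (Equ t (lsum (flat t)))"
  using assms
proof (induction t)
  case (Var i)
  have "der L (k0 + k0) \<Gamma> (Equ (Var i) (Add (Var i) Zero))"
    by (rule room_sym[of L S, OF _ room_zero[of L S]]) (use Var vsz_ge1[of i] in \<open>auto simp del: vsz_ge1\<close>)
  moreover have "1 \<le> vsz i ^ 2" by (rule one_le_power) simp
  then have "8 * k0 * 1 \<le> 8 * k0 * vsz i ^ 2" by (rule mult_le_mono2)
  then have "k0 + k0 \<le> 8 * k0 * vsz i ^ 2" by linarith
  ultimately show ?case by (auto elim!: der_lines_mono)
next
  case Zero
  have "der L 1 \<Gamma> (Equ Zero Zero)" by (rule room_refl[of L S]) (use Zero in auto)
  then show ?case by (auto elim!: der_lines_mono simp: k0_def)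
next
  case One
  have "der L (k0 + k0) \<Gamma> (Equ One (Add One Zero))"
    by (rule room_sym[of L S, OF _ room_zero[of L S]]) (use One in auto)
  then show ?case by (auto elim!: der_lines_mono)
next
  case (Add s t)
  have t: "tsz (lsum (flat s)) \<le> 5 * tsz s" "tsz (lsum (flat t)) \<le> 5 * tsz t"
     "tsz (lsum (flat s @ flat t)) \<le> 5 * (tsz s + tsz t + 3)"
    using tsz_lsum_flat[of s] tsz_lsum_flat[of t] tsz_lsum_flat[of "Add s t"] by auto
  have b: "\<forall>x\<in>set (flat s). big x" "\<forall>x\<in>set (flat t). big x" using Add.prems big_flat by auto
  have 1: "der L (8 * k0 * tsz s ^ 2 + 8 * k0 * tsz t ^ 2 + k0) \<Gamma> (Equ (Add s t) (Add (lsum (flat s)) (lsum (flat t))))"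
    by (rule room_add[of L S, OF _ Add.IH]) (use Add.prems t b in auto)
  have 2: "der L (k0 * (4 * length (flat s) + 1)) \<Gamma> (Equ (Add (lsum (flat s)) (lsum (flat t))) (lsum (flat s @ flat t)))"
    by (rule room_lsum_append[of L S]) (use Add.prems t b in auto)
  have 3: "der L ((8 * k0 * tsz s ^ 2 + 8 * k0 * tsz t ^ 2 + k0) + k0 * (4 * length (flat s) + 1) + k0) \<Gamma>
      (Equ (Add s t) (lsum (flat s @ flat t)))"
    by (rule room_trans[of L S, OF _ 1 2]) (use Add.prems t b in auto)
  have "(8 * k0 * tsz s ^ 2 + 8 * k0 * tsz t ^ 2 + k0) + k0 * (4 * length (flat s) + 1) + k0
     \<le> k0 * (8 * tsz s ^ 2 + 8 * tsz t ^ 2 + 4 * tsz s + 3)"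
    using length_flat[of s] by (simp add: algebra_simps)
  also have "8 * tsz s ^ 2 + 8 * tsz t ^ 2 + 4 * tsz s + 3 \<le> 8 * (tsz s + tsz t + 3) ^ 2"
    by (simp add: power2_eq_square algebra_simps)
  finally have "(8 * k0 * tsz s ^ 2 + 8 * k0 * tsz t ^ 2 + k0) + k0 * (4 * length (flat s) + 1) + k0
     \<le> 8 * k0 * (tsz s + tsz t + 3) ^ 2" by simp
  then show ?case using der_lines_mono[OF 3] by simp
qed

lemma room_lsum_pull:
  assumes "room L S \<Gamma>" "\<forall>x\<in>set (as @ x # bs). big x" "tsz (lsum (as @ x # bs)) \<le> S"
  shows "der L (4 * k0 * length as + 1) \<Gamma> (Equ (lsum (as @ x # bs)) (lsum (x # as @ bs)))"
  using assms
proof (induction as)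
  case Nil
  then show ?case using room_refl[of L S \<Gamma>] by auto
next
  case (Cons a as)
  have t: "tsz (lsum (as @ x # bs)) = tsz (lsum (as @ bs)) + tsz x + 3" by (simp add: tsz_lsum)
  have 1: "der L (1 + (4 * k0 * length as + 1) + k0) \<Gamma>
     (Equ (Add a (lsum (as @ x # bs))) (Add a (lsum (x # as @ bs))))"
    by (rule room_add[of L S, OF _ room_refl[of L S] Cons.IH]) (use Cons.prems t in auto)
  have 2: "der L k0 \<Gamma> (Equ (Add a (lsum (x # as @ bs))) (Add x (Add a (lsum (as @ bs)))))"
    unfolding lsum.simps by (rule room_swap[of L S]) (use Cons.prems t in auto)
  have "der L ((1 + (4 * k0 * length as + 1) + k0) + k0 + k0) \<Gamma> (Equ (Add a (lsum (as @ x # bs))) (Add x (Add a (lsum (as @ bs)))))"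
    by (rule room_trans[of L S, OF _ 1 2]) (use Cons.prems t in auto)
  then show ?case by simp (erule der_lines_mono, simp add: k0_def algebra_simps)
qed

text \<open>The head of \<open>xs\<close> is pulled to the front of \<open>ys\<close> and the rest
  is permuted by induction, so the cost is again quadratic.\<close>

lemma room_perm:
  assumes "room L S \<Gamma>" "\<forall>x\<in>set xs. big x" "tsz (lsum xs) \<le> S" "mset xs = mset ys"
  shows "der L (k0 * (8 * length xs ^ 2 + 1)) \<Gamma> (Equ (lsum xs) (lsum ys))"
  using assms
proof (induction xs arbitrary: ys)
  case Nil
  then have "der L 1 \<Gamma> (Equ Zero Zero)" using room_refl[of L S \<Gamma> Zero] by auto
  then show ?case using Nil by (auto elim!: der_lines_mono simp: k0_def)
next
  case (Cons x xs)
  have "x \<in> set ys" using Cons.prems(4) by (metis list.set_intros(1) set_mset_mset)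
  then obtain as bs where ys: "ys = as @ x # bs" by (meson split_list)
  have m: "mset xs = mset (as @ bs)" using Cons.prems(4) ys by simp
  have len: "length as \<le> length xs" using mset_eq_length[OF m] by simp
  have t: "tsz (lsum (as @ bs)) = tsz (lsum xs)"
    using arg_cong[OF m, of "\<lambda>m. sum_mset (image_mset (\<lambda>x. tsz x + 3) m)"]
    by (simp only: tsz_lsum mset_map[symmetric] sum_mset_sum_list)
  have t': "tsz (lsum (as @ x # bs)) = tsz (lsum (x # xs))" using t by (simp add: tsz_lsum)
  have b: "\<forall>x\<in>set (as @ bs). big x" using Cons.prems m by (metis list.set_intros(2) set_mset_mset)
  have 1: "der L (1 + k0 * (8 * length xs ^ 2 + 1) + k0) \<Gamma> (Equ (Add x (lsum xs)) (Add x (lsum (as @ bs))))"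
    by (rule room_add[of L S, OF _ room_refl[of L S] Cons.IH]) (use Cons.prems t b m in auto)
  have 2: "der L ((4 * k0 * length as + 1) + k0) \<Gamma> (Equ (lsum (x # as @ bs)) (lsum (as @ x # bs)))"
    by (rule room_sym[of L S, OF _ room_lsum_pull[of L S]]) (use Cons.prems t' b t in \<open>auto simp: tsz_lsum\<close>)
  have 3: "der L ((1 + k0 * (8 * length xs ^ 2 + 1) + k0) + ((4 * k0 * length as + 1) + k0) + k0) \<Gamma>
      (Equ (Add x (lsum xs)) (lsum ys))"
    unfolding ys
    by (rule room_trans[of L S, OF _ 1 2[unfolded lsum.simps]]) (use Cons.prems t' b t in \<open>auto simp: tsz_lsum\<close>)
  have "k0 * length as \<le> k0 * length xs" using len by simp
  then have "((1 + k0 * (8 * length xs ^ 2 + 1) + k0) + ((4 * k0 * length as + 1) + k0) + k0)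
      \<le> k0 * (8 * length (x # xs) ^ 2 + 1)"
    by (simp add: power2_eq_square k0_def algebra_simps)
  then show ?case using der_lines_mono[OF 3] by simp
qed

text \<open>Both terms are brought to sums of atoms, and these are permutations of each other by
  \<open>mset_flat\<close>. From here on a rearrangement of linear terms only needs an identity of
  values.\<close>

lemma room_norm:
  assumes "room L S \<Gamma>" "big s" "big t" "20 * tsz s \<le> S" "20 * tsz t \<le> S" "tsz s \<le> \<sigma>" "tsz t \<le> \<sigma>"
    "\<And>e. eval e s = eval e t"
  shows "der L (30 * k0 * \<sigma> ^ 2) \<Gamma> (Equ s t)"
proof -
  note m = mset_flat[OF assms(8)]
  have s: "tsz (lsum (flat s)) \<le> 5 * tsz s" "tsz (lsum (flat t)) \<le> 5 * tsz t" by (rule tsz_lsum_flat)+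
  have b: "\<forall>x\<in>set (flat s). big x" "\<forall>x\<in>set (flat t). big x" using assms big_flat by auto
  have 1: "der L (8 * k0 * tsz s ^ 2) \<Gamma> (Equ s (lsum (flat s)))" by (rule room_flat[of L S]) (use assms in auto)
  have 2: "der L (k0 * (8 * length (flat s) ^ 2 + 1)) \<Gamma> (Equ (lsum (flat s)) (lsum (flat t)))"
    by (rule room_perm[of L S]) (use assms s b m in auto)
  have 3: "der L (8 * k0 * tsz t ^ 2 + k0) \<Gamma> (Equ (lsum (flat t)) t)"
    by (rule room_sym[of L S, OF _ room_flat[of L S]]) (use assms s b in auto)
  have 4: "der L (8 * k0 * tsz s ^ 2 + k0 * (8 * length (flat s) ^ 2 + 1) + k0) \<Gamma> (Equ s (lsum (flat t)))"
    by (rule room_trans[of L S, OF _ 1 2]) (use assms s b in auto)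
  have 5: "der L ((8 * k0 * tsz s ^ 2 + k0 * (8 * length (flat s) ^ 2 + 1) + k0) + (8 * k0 * tsz t ^ 2 + k0) + k0) \<Gamma> (Equ s t)"
    by (rule room_trans[of L S, OF _ 4 3]) (use assms s b in auto)
  have l: "length (flat s) \<le> \<sigma>" using length_flat[of s] assms(6) by linarith
  have sq: "tsz s ^ 2 \<le> \<sigma> ^ 2" "tsz t ^ 2 \<le> \<sigma> ^ 2" "length (flat s) ^ 2 \<le> \<sigma> ^ 2"
    by (rule power_mono; use assms l in simp)+
  have "1 \<le> \<sigma>" using assms(6) tsz_ge1[of s] by linarith
  then have "1 \<le> \<sigma> ^ 2" by simp
  then have "8 * tsz s ^ 2 + (8 * length (flat s) ^ 2 + 1) + 1 + 8 * tsz t ^ 2 + 2 \<le> 30 * \<sigma> ^ 2"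
    using sq by linarith
  then have "k0 * (8 * tsz s ^ 2 + (8 * length (flat s) ^ 2 + 1) + 1 + 8 * tsz t ^ 2 + 2) \<le> k0 * (30 * \<sigma> ^ 2)"
    by (rule mult_le_mono2)
  then show ?thesis by (intro der_lines_mono[OF 5]) (simp add: algebra_simps)
qed

section \<open>Linear forms over the integers\<close>

lemma fsz_le_fm: "fsz (le_fm s t) \<le> tsz s + tsz t + 15"
  using vsz_le[of 2] by (simp add: le_fm_def)

lemma der_cut:
  assumes "der L N \<Gamma> \<phi>" "der L M (\<phi> # \<Delta>) \<chi>" "set \<Delta> \<subseteq> set \<Gamma>" "csz \<Gamma> + fsz \<phi> + fsz \<chi> + 5 \<le> L"
    "csz \<Delta> \<le> csz \<Gamma>"
  shows "der L (N + M + 3) \<Gamma> \<chi>"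
proof -
  have "der L (Suc M) \<Delta> (Imp \<phi> \<chi>)" by (rule der_impI[OF assms(2)]) (use assms in auto)
  then have "der L (Suc (Suc M)) \<Gamma> (Imp \<phi> \<chi>)" by (rule der_weaken) (use assms in auto)
  from der_impE[OF this assms(1)] show ?thesis by (rule der_lines_mono) simp
qed

text \<open>A form is a vector of integer coefficients, with the constant term at index 0. It is
  represented by the difference of the terms for its positive and its negative part.\<close>

definition atom :: "nat \<Rightarrow> trm" where "atom i = (if i = 0 then One else Var i)"

definition neg :: "(nat \<Rightarrow> int) \<Rightarrow> nat \<Rightarrow> int" where "neg f = (\<lambda>i. - f i)"

lemma neg_apply [simp]: "neg f i = - f i" by (simp add: neg_def)
lemma neg_neg [simp]: "neg (neg f) = f" by (simp add: neg_def)

definition ev0 :: "(nat \<Rightarrow> nat) \<Rightarrow> nat \<Rightarrow> nat" where "ev0 e i = (if i = 0 then 1 else e i)"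

text \<open>\<open>R\<close> bounds the variables, \<open>H\<close> the coefficients of forms,
  \<open>G\<close> the size of contexts and \<open>L\<close> the width of lines. Fixing them
  together reduces the side conditions on widths to comparisons with multiples of \<tau>.\<close>

locale calc =
  fixes R H G L :: nat
  assumes R20: "20 \<le> R" and H1: "1 \<le> H"
    and L_ge: "G + scheme_bound * (400 * ((R + 10) ^ 2 * (H + 1))) ^ 4 + 2 \<le> L"
begin

text \<open>A form has at most \<open>R\<close> nonzero coefficients of absolute value at most
  \<open>H\<close>, and an atom takes fewer than \<open>R + 10\<close> characters; so \<tau> bounds
  the terms that represent a form.\<close>

definition \<tau> :: nat where "\<tau> = (R + 10) ^ 2 * (H + 1)"

lemma tau_ge: "100 \<le> \<tau>"
proof -
  have "10 ^ 2 \<le> (R + 10) ^ 2" by (rule power_mono) auto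
  then have "10 ^ 2 * 1 \<le> (R + 10) ^ 2 * (H + 1)" by (rule mult_le_mono) auto
  then show ?thesis by (simp add: \<tau>_def)
qed

lemma L_room: "csz \<Gamma> \<le> G \<Longrightarrow> room L (400 * \<tau>) \<Gamma>"
  using L_ge by (simp add: room_def \<tau>_def)

lemma L_slack: "G + 4000 * \<tau> + 2 \<le> L"
proof -
  have "400 * \<tau> \<le> (400 * \<tau>) ^ 4" using self_le_power[of "400 * \<tau>" 4] tau_ge by auto
  then have "10 * (400 * \<tau>) \<le> scheme_bound * (400 * \<tau>) ^ 4" using scheme_bound_ge by (intro mult_le_mono) auto
  then show ?thesis using L_ge by (simp add: \<tau>_def)
qed

definition pos_part :: "(nat \<Rightarrow> int) \<Rightarrow> trm" where
  "pos_part f = lsum (concat (map (\<lambda>i. replicate (nat (f i)) (atom i)) [0..<R]))"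

text \<open>Nonnegativity of a form, expressed without subtraction. It is an existential formula,
  and its witness is the value of the form.\<close>

definition GE :: "(nat \<Rightarrow> int) \<Rightarrow> fm" where "GE f = le_fm (pos_part (neg f)) (pos_part f)"

definition val :: "(nat \<Rightarrow> int) \<Rightarrow> (nat \<Rightarrow> nat) \<Rightarrow> int" where
  "val f e = (\<Sum>i<R. f i * int (ev0 e i))"

definition form_bound :: "nat \<Rightarrow> (nat \<Rightarrow> int) \<Rightarrow> bool" where
  "form_bound x f \<longleftrightarrow> (\<forall>i. \<bar>f i\<bar> \<le> int x) \<and> (\<forall>i. f i \<noteq> 0 \<longrightarrow> i = 0 \<or> 10 \<le> i \<and> i < R)"

lemma form_bound_mono: "form_bound x f \<Longrightarrow> x \<le> y \<Longrightarrow> form_bound y f"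
  unfolding form_bound_def by (meson of_nat_mono order_trans)

lemma form_bound_neg [simp]: "form_bound x (neg f) \<longleftrightarrow> form_bound x f" by (simp add: form_bound_def)

lemma val_neg [simp]: "val (neg f) e = - val f e" by (simp add: val_def sum_negf)

lemma int_eval_pos_part: "int (eval e (pos_part f)) = (\<Sum>i<R. int (nat (f i)) * int (ev0 e i))"
proof -
  have "(\<Sum>x\<leftarrow>concat (map (\<lambda>i. replicate (nat (f i)) (atom i)) xs). eval e x)
      = (\<Sum>i\<leftarrow>xs. nat (f i) * ev0 e i)" for xs
    by (induction xs) (auto simp: sum_list_replicate atom_def ev0_def)
  then have "eval e (pos_part f) = (\<Sum>i<R. nat (f i) * ev0 e i)"
    by (simp add: pos_part_def eval_lsum interv_sum_list_conv_sum_set_nat atLeast0LessThan)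
  then show ?thesis by simp
qed

lemma eval_pos_part_diff: "int (eval e (pos_part f)) - int (eval e (pos_part (neg f))) = val f e"
proof -
  have "int (nat (f i)) - int (nat (- f i)) = f i" for i by auto
  then show ?thesis unfolding int_eval_pos_part val_def
    by (simp add: sum_subtractf[symmetric] left_diff_distrib[symmetric] del: int_nat_eq)
qed

lemma pos_part_nonpos: "\<forall>i. f i \<le> 0 \<Longrightarrow> pos_part f = Zero"
proof -
  assume "\<forall>i. f i \<le> 0"
  then have "(\<lambda>i. replicate (nat (f i)) (atom i)) = (\<lambda>i. [])" by auto
  then show ?thesis unfolding pos_part_def by (simp add: map_replicate_const)
qed

lemma big_pos_part: "form_bound x f \<Longrightarrow> big (pos_part f)"
  unfolding pos_part_def big_lsum
proof
  fix t assume "form_bound x f" "t \<in> set (concat (map (\<lambda>i. replicate (nat (f i)) (atom i)) [0..<R]))"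
  then obtain i where i: "t = atom i" "f i \<noteq> 0" by auto
  then have "i = 0 \<or> 10 \<le> i" using \<open>form_bound x f\<close> unfolding form_bound_def by blast
  then show "big t" using i by (auto simp: atom_def)
qed

lemma tsz_pos_part: "form_bound H f \<Longrightarrow> tsz (pos_part f) \<le> \<tau>"
proof -
  assume f: "form_bound H f"
  have n: "nat (f i) \<le> H" for i using f unfolding form_bound_def by (metis abs_le_D1 nat_le_iff)
  have a: "tsz (atom i) + 3 \<le> R + 5" if "i < R" for i using vsz_le[of i] that R20 by (auto simp: atom_def)
  have "(\<Sum>x\<leftarrow>concat (map (\<lambda>i. replicate (nat (f i)) (atom i)) xs). tsz x + 3) \<le> length xs * (H * (R + 5))"
    if "\<forall>i\<in>set xs. i < R" for xs
    using that
  proof (induction xs)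
    case (Cons i xs)
    then show ?case using mult_le_mono[OF n[of i] a[of i]] by (simp add: sum_list_replicate)
  qed simp
  from this[of "[0..<R]"] have "tsz (pos_part f) \<le> 1 + R * (H * (R + 5))" by (simp add: pos_part_def tsz_lsum)
  also have "\<dots> \<le> \<tau>" unfolding \<tau>_def power2_eq_square by (simp add: algebra_simps)
  finally show ?thesis .
qed

lemma fsz_GE: "form_bound H f \<Longrightarrow> fsz (GE f) \<le> 3 * \<tau>"
  using tsz_pos_part[of f] tsz_pos_part[of "neg f"] fsz_le_fm[of "pos_part (neg f)" "pos_part f"] tau_ge by (simp add: GE_def)

section \<open>Inference with linear inequalities\<close>

definition k1 :: nat where "k1 = 30 * k0 * (20 * \<tau>) ^ 2 + 2 * k0"

lemma k1_ge: "k0 \<le> k1" "20 \<le> k1" "scheme_bound + 15 \<le> k1" using scheme_bound_ge by (auto simp: k1_def k0_def)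

lemma norm:
  assumes "csz \<Gamma> \<le> G" "big s" "big t" "tsz s \<le> 20 * \<tau>" "tsz t \<le> 20 * \<tau>" "\<And>e. eval e s = eval e t"
  shows "der L (30 * k0 * (20 * \<tau>) ^ 2) \<Gamma> (Equ s t)"
  by (rule room_norm[OF L_room]) (use assms in auto)

text \<open>The common route for rearranging inequalities: the new one must have the same difference
  of values as the given one, and the equation that \<open>Prv_le_transfer\<close> asks for is then
  found by \<open>norm\<close>.\<close>

lemma le_transfer:
  assumes "csz \<Gamma> \<le> G" "der L N \<Gamma> (le_fm s t)"
    and b: "big s" "big t" "big s'" "big t'" 
    and t: "tsz s \<le> 5 * \<tau>" "tsz t \<le> 5 * \<tau>" "tsz s' \<le> 5 * \<tau>" "tsz t' \<le> 5 * \<tau>"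
    and e: "\<And>e. eval e s + eval e t' = eval e s' + eval e t"
  shows "der L (N + k1) \<Gamma> (le_fm s' t')"
proof -
  have "der L (scheme_bound + 5) \<Gamma> (inst s t s' t'
      (Imp (le_fm (Var 3) (Var 4)) (Imp (Equ (Add (Var 3) (Var 6)) (Add (Var 5) (Var 4))) (le_fm (Var 5) (Var 6)))))"
    using b t L_room[OF assms(1)] by (intro der_inst[where S = "400 * \<tau>"]) (auto simp: schemes_simps room_def)
  then have 1: "der L (scheme_bound + 5) \<Gamma> (Imp (le_fm s t) (Imp (Equ (Add s t') (Add s' t)) (le_fm s' t')))"
    using b by (simp add: inst_simps)
  have "der L (30 * k0 * (20 * \<tau>) ^ 2) \<Gamma> (Equ (Add s t') (Add s' t))"
    by (rule norm) (use assms tau_ge in auto)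
  from der_impE[OF der_impE[OF 1 assms(2)] this] show ?thesis
    by (rule der_lines_mono) (simp add: k1_def k0_def)
qed

lemma ge_add:
  assumes "csz \<Gamma> \<le> G" "form_bound H f" "form_bound H g" "form_bound H h" "\<And>i. h i = f i + g i"
    and f: "der L N \<Gamma> (GE f)" and g: "der L M \<Gamma> (GE g)"
  shows "der L (N + M + 2 * k1) \<Gamma> (GE h)"
proof -
  have bt: "big (pos_part f)" "big (pos_part (neg f))" "big (pos_part g)" "big (pos_part (neg g))" "big (pos_part h)" "big (pos_part (neg h))"
    "tsz (pos_part f) \<le> \<tau>" "tsz (pos_part (neg f)) \<le> \<tau>" "tsz (pos_part g) \<le> \<tau>" "tsz (pos_part (neg g)) \<le> \<tau>"
    "tsz (pos_part h) \<le> \<tau>" "tsz (pos_part (neg h)) \<le> \<tau>"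
    using assms by (auto intro!: tsz_pos_part) (meson form_bound_neg big_pos_part)+
  have "der L (scheme_bound + 5) \<Gamma> (inst (pos_part (neg f)) (pos_part f) (pos_part (neg g)) (pos_part g)
      (Imp (le_fm (Var 3) (Var 4)) (Imp (le_fm (Var 5) (Var 6)) (le_fm (Add (Var 3) (Var 5)) (Add (Var 4) (Var 6))))))"
    using bt L_room[OF assms(1)] by (intro der_inst[where S = "400 * \<tau>"]) (auto simp: schemes_simps room_def)
  then have 1: "der L (scheme_bound + 5) \<Gamma> (Imp (GE f) (Imp (GE g) (le_fm (Add (pos_part (neg f)) (pos_part (neg g))) (Add (pos_part f) (pos_part g)))))"
    using bt by (simp add: inst_simps GE_def)
  note 2 = der_impE[OF der_impE[OF 1 f] g]
  have v: "val h e = val f e + val g e" for e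
    by (simp add: val_def assms(5) distrib_right sum.distrib)
  have "der L (Suc (Suc (scheme_bound + 5 + N) + M) + k1) \<Gamma> (GE h)" unfolding GE_def
  proof (rule le_transfer[OF assms(1) 2])
    fix e
    show "eval e (Add (pos_part (neg f)) (pos_part (neg g))) + eval e (pos_part h) = eval e (pos_part (neg h)) + eval e (Add (pos_part f) (pos_part g))"
      using v[of e] eval_pos_part_diff[of e h] eval_pos_part_diff[of e f] eval_pos_part_diff[of e g] by simp
  qed (use bt tau_ge in auto)
  then show ?thesis by (rule der_lines_mono) (use k1_ge in auto)
qed

lemma ge_nonneg:
  assumes "csz \<Gamma> \<le> G" "form_bound H f" "\<And>i. 0 \<le> f i"
  shows "der L k1 \<Gamma> (GE f)"
proof -
  have b: "big (pos_part f)" "tsz (pos_part f) \<le> \<tau>" using assms by (auto intro: tsz_pos_part big_pos_part)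
  have "der L (scheme_bound + 5) \<Gamma> (inst (pos_part f) Zero Zero Zero (le_fm Zero (Var 3)))"
    using b tau_ge L_room[OF assms(1)] by (intro der_inst[where S = "400 * \<tau>"]) (auto simp: schemes_simps room_def)
  then have "der L (scheme_bound + 5) \<Gamma> (GE f)" using b assms by (simp add: inst_simps GE_def pos_part_nonpos)
  then show ?thesis by (rule der_lines_mono) (use k1_ge in auto)
qed

text \<open>Over the integers the complement of f \<ge> 0 is - f - 1 \<ge> 0. Thus a case split adds
  an inequality to the context on either side and never a negation.\<close>

lemma ge_split:
  assumes "csz \<Gamma> + 10 * \<tau> \<le> G" "form_bound H f" "form_bound H g" "\<And>i. g i = - f i - (if i = 0 then 1 else 0)"
    "fsz \<chi> \<le> 100 * \<tau>"
    and f: "der L N (GE f # \<Gamma>) \<chi>" and g: "der L M (GE g # \<Gamma>) \<chi>"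
  shows "der L (N + M + 3 * k1) \<Gamma> \<chi>"
proof -
  have bt: "big (pos_part f)" "big (pos_part (neg f))" "big (pos_part g)" "big (pos_part (neg g))"
    "tsz (pos_part f) \<le> \<tau>" "tsz (pos_part (neg f)) \<le> \<tau>" "tsz (pos_part g) \<le> \<tau>" "tsz (pos_part (neg g)) \<le> \<tau>"
    using assms by (auto intro!: tsz_pos_part) (meson form_bound_neg big_pos_part)+
  let ?l = "le_fm (Add (pos_part f) One) (pos_part (neg f))"
  have sl: "fsz ?l \<le> 3 * \<tau>" using fsz_le_fm[of "Add (pos_part f) One" "pos_part (neg f)"] bt tau_ge by simp
  have "der L (scheme_bound + 5) \<Gamma> (inst (pos_part (neg f)) (pos_part f) Zero Zero
      (Disj (le_fm (Var 3) (Var 4)) (le_fm (Add (Var 4) One) (Var 3))))"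
    using bt tau_ge L_room[of \<Gamma>] assms(1) by (intro der_inst[where S = "400 * \<tau>"]) (auto simp: schemes_simps room_def)
  then have 1: "der L (scheme_bound + 5) \<Gamma> (Disj (GE f) ?l)"
    using bt by (simp add: inst_simps GE_def)
  have v: "val g e = - val f e - 1" for e
  proof -
    have "val g e = (\<Sum>i<R. - (f i * int (ev0 e i)) - (if i = 0 then 1 else 0))"
      unfolding val_def by (rule sum.cong) (auto simp: assms(4) ev0_def algebra_simps)
    also have "\<dots> = - val f e - (\<Sum>i<R. if i = 0 then 1 else 0)"
      by (simp add: val_def sum_subtractf sum_negf)
    finally show ?thesis using R20 by simp
  qed
  have cl: "csz (?l # \<Gamma>) \<le> G" using sl assms tau_ge by simp
  have "der L 1 (?l # \<Gamma>) ?l" by (rule der_assume) (use cl sl L_slack tau_ge in auto)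
  then have "der L (1 + k1) (?l # \<Gamma>) (GE g)" unfolding GE_def
  proof (rule le_transfer[OF cl])
    fix e
    show "eval e (Add (pos_part f) One) + eval e (pos_part g) = eval e (pos_part (neg g)) + eval e (pos_part (neg f))"
      using v[of e] eval_pos_part_diff[of e f] eval_pos_part_diff[of e g] by simp
  qed (use bt tau_ge in auto)
  then have "der L ((1 + k1) + M + 3) (?l # \<Gamma>) \<chi>"
    by (rule der_cut[OF _ g]) (use cl assms fsz_GE[of g] L_slack tau_ge in auto)
  from der_disjE[OF 1 f this] show ?thesis by (rule der_lines_mono) (use k1_ge in auto)
qed

lemma ge_minus_one:
  assumes "csz \<Gamma> \<le> G" "der L N \<Gamma> (GE (\<lambda>i. if i = 0 then - 1 else 0))" "fsz \<chi> \<le> 100 * \<tau>"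
  shows "der L (N + k1) \<Gamma> \<chi>"
proof -
  let ?m = "\<lambda>i::nat. if i = 0 then - 1 else 0 :: int"
  have p: "pos_part ?m = Zero" by (rule pos_part_nonpos) simp
  have "map (\<lambda>i. replicate (nat (neg ?m i)) (atom i)) [0..<R] = [One] # map (\<lambda>i. []) [1..<R]"
    using R20 by (subst upt_conv_Cons) (auto simp: atom_def)
  then have "concat (map (\<lambda>i. replicate (nat (neg ?m i)) (atom i)) [0..<R]) = [One]"
    by (simp add: map_replicate_const)
  then have q: "pos_part (neg ?m) = Add One Zero" by (simp add: pos_part_def)
  have "der L (scheme_bound + 5) \<Gamma> (inst Zero Zero Zero Zero (Neg (le_fm (Add One Zero) Zero)))"
    using tau_ge L_room[OF assms(1)] by (intro der_inst[where S = "400 * \<tau>"]) (auto simp: schemes_simps room_def)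
  then have 1: "der L (scheme_bound + 5) \<Gamma> (Neg (GE ?m))" by (simp add: inst_simps GE_def p q)
  have "der L (N + (scheme_bound + 5) + 3) \<Gamma> \<chi>"
    by (rule der_explode[OF assms(2) 1])
      (use assms L_slack fsz_le_fm[of "Add One Zero" Zero] tau_ge in \<open>auto simp: GE_def p q\<close>)
  then show ?thesis by (rule der_lines_mono) (use k1_ge in auto)
qed

lemma form_bound_scale:
  assumes "form_bound x f" "n * x \<le> y" shows "form_bound y (\<lambda>i. int n * f i)"
  unfolding form_bound_def
proof (intro conjI allI impI)
  fix i
  have "int n * \<bar>f i\<bar> \<le> int n * int x" using assms(1) by (intro mult_left_mono) (auto simp: form_bound_def)
  also have "\<dots> \<le> int y" using assms(2) by (metis of_nat_le_iff of_nat_mult)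
  finally show "\<bar>int n * f i\<bar> \<le> int y" by (simp add: abs_mult)
qed (use assms in \<open>auto simp: form_bound_def\<close>)

lemma form_bound_add: "form_bound x f \<Longrightarrow> form_bound y g \<Longrightarrow> x + y \<le> z \<Longrightarrow> form_bound z (\<lambda>i. f i + g i)"
  unfolding form_bound_def
proof (intro conjI allI impI; elim conjE)
  fix i assume "\<forall>i. \<bar>f i\<bar> \<le> int x" "\<forall>i. \<bar>g i\<bar> \<le> int y" "x + y \<le> z"
  then have "\<bar>f i\<bar> \<le> int x" "\<bar>g i\<bar> \<le> int y" "int x + int y \<le> int z" by auto
  then show "\<bar>f i + g i\<bar> \<le> int z" by linarith
next
  fix i
  assume a: "\<forall>i. f i \<noteq> 0 \<longrightarrow> i = 0 \<or> 10 \<le> i \<and> i < R" "\<forall>i. g i \<noteq> 0 \<longrightarrow> i = 0 \<or> 10 \<le> i \<and> i < R"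
    "f i + g i \<noteq> 0"
  then have "f i \<noteq> 0 \<or> g i \<noteq> 0" by auto
  then show "i = 0 \<or> 10 \<le> i \<and> i < R" using a by blast
qed

lemma ge_scale:
  assumes "csz \<Gamma> \<le> G" "form_bound x f" "n * x \<le> H" "x \<le> H" "der L N \<Gamma> (GE f)"
  shows "der L (n * (N + 2 * k1) + k1) \<Gamma> (GE (\<lambda>i. int n * f i))"
  using assms(3)
proof (induction n)
  case 0
  then show ?case using assms by (auto intro!: ge_nonneg simp: form_bound_def)
next
  case (Suc n)
  have "der L ((n * (N + 2 * k1) + k1) + N + 2 * k1) \<Gamma> (GE (\<lambda>i. int (Suc n) * f i))"
  proof (rule ge_add[OF assms(1) _ _ _ _ Suc.IH assms(5)])
    show "form_bound H (\<lambda>i. int n * f i)" by (rule form_bound_scale[OF assms(2)]) (use Suc.prems in simp)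
    show "form_bound H f" by (rule form_bound_mono[OF assms(2,4)])
    show "form_bound H (\<lambda>i. int (Suc n) * f i)" by (rule form_bound_scale[OF assms(2) Suc.prems])
    show "n * x \<le> H" using Suc.prems by simp
  qed (simp add: algebra_simps)
  then show ?case by (rule der_lines_mono) simp
qed

text \<open>Scaling the two summands of a linear combination takes at most \<open>2 * H\<close>
  additions of \<open>2 * k1\<close> lines each, besides the repeated premises. One combination
  therefore multiplies numbers of lines by at most \<kappa>, and later costs are counted in powers
  of \<kappa>.\<close>

definition \<kappa> :: nat where "\<kappa> = 20 * (H + 1) * (k1 + 1)"

lemma kappa_ge: "100 \<le> \<kappa>" "20 * k1 \<le> \<kappa>" "20 * H \<le> \<kappa>"
proof -
  have "20 * 1 * (k1 + 1) \<le> \<kappa>" "20 * (H + 1) * 1 \<le> \<kappa>" unfolding \<kappa>_def by (intro mult_le_mono; simp)+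
  then show "100 \<le> \<kappa>" "20 * k1 \<le> \<kappa>" "20 * H \<le> \<kappa>" using k1_ge by auto
qed

text \<open>The target may exceed the combination coefficientwise: the remainder has nonnegative
  coefficients and is nonnegative because all variables are.\<close>

lemma ge_lincomb:
  assumes "csz \<Gamma> \<le> G" "form_bound x f" "form_bound y g" "form_bound z t" "x \<le> H" "y \<le> H" "a \<le> H" "b \<le> H" "a * x + b * y + z \<le> H"
    and f: "der L N \<Gamma> (GE f)" and g: "der L M \<Gamma> (GE g)"
    and t: "\<And>i. int a * f i + int b * g i \<le> t i"
  shows "der L (\<kappa> * (N + M)) \<Gamma> (GE t)"
proof -
  let ?f = "\<lambda>i. int a * f i" and ?g = "\<lambda>i. int b * g i"
  let ?r = "\<lambda>i. t i + - 1 * (?f i + ?g i)"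
  have bf: "form_bound (a * x) ?f" "form_bound (b * y) ?g" using form_bound_scale assms by auto
  have bfg: "form_bound (a * x + b * y) (\<lambda>i. ?f i + ?g i)" using form_bound_add[OF bf] by simp
  have "form_bound (a * x + b * y) (neg (\<lambda>i. ?f i + ?g i))" using bfg by (simp del: neg_apply)
  then have br: "form_bound H ?r" using form_bound_add[OF assms(4), of _ "neg (\<lambda>i. ?f i + ?g i)" H] assms(9)
    by (simp add: algebra_simps)
  have 1: "der L ((a * (N + 2 * k1) + k1) + (b * (M + 2 * k1) + k1) + 2 * k1) \<Gamma> (GE (\<lambda>i. ?f i + ?g i))"
    by (rule ge_add[OF assms(1) _ _ _ _ ge_scale[OF assms(1) assms(2) _ _ f] ge_scale[OF assms(1) assms(3) _ _ g]])
      (use assms bf bfg in \<open>auto elim: form_bound_mono\<close>)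
  have 2: "der L k1 \<Gamma> (GE ?r)" by (rule ge_nonneg[OF assms(1) br]) (use t in \<open>simp add: algebra_simps\<close>)
  have 3: "der L (((a * (N + 2 * k1) + k1) + (b * (M + 2 * k1) + k1) + 2 * k1) + k1 + 2 * k1) \<Gamma> (GE t)"
    by (rule ge_add[OF assms(1) _ br _ _ 1 2]) (use bfg assms in \<open>auto elim: form_bound_mono\<close>)
  have NM: "1 \<le> N" "1 \<le> M" using f g der_ge1 by auto
  have k: "2 * k1 \<le> 2 * k1 * N" "2 * k1 \<le> 2 * k1 * M" "7 * k1 \<le> 7 * k1 * N" using NM by auto
  have "a * (N + 2 * k1) \<le> H * (N + 2 * k1 * N)" "b * (M + 2 * k1) \<le> H * (M + 2 * k1 * M)"
    using assms k by (auto intro!: mult_le_mono)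
  then have "((a * (N + 2 * k1) + k1) + (b * (M + 2 * k1) + k1) + 2 * k1) + k1 + 2 * k1
     \<le> H * (N + 2 * k1 * N) + H * (M + 2 * k1 * M) + 7 * k1 * N" using k by linarith
  also have "\<dots> \<le> (H * (1 + 2 * k1) + 7 * k1) * (N + M)" by (simp add: algebra_simps)
  also have "\<dots> \<le> \<kappa> * (N + M)" by (rule mult_le_mono1) (simp add: \<kappa>_def algebra_simps)
  finally show ?thesis using 3 der_lines_mono by blast
qed

lemma ge_falsum:
  assumes "csz \<Gamma> \<le> G" "form_bound x f" "form_bound y g" "x \<le> H" "y \<le> H" "a \<le> H" "b \<le> H" "a * x + b * y + 1 \<le> H"
    and f: "der L N \<Gamma> (GE f)" and g: "der L M \<Gamma> (GE g)"
    and t: "\<And>i. i \<noteq> 0 \<Longrightarrow> int a * f i + int b * g i \<le> 0" "int a * f 0 + int b * g 0 < 0"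
    and c: "fsz \<chi> \<le> 100 * \<tau>"
  shows "der L (2 * \<kappa> * (N + M)) \<Gamma> \<chi>"
proof -
  have "der L (\<kappa> * (N + M)) \<Gamma> (GE (\<lambda>i. if i = 0 then - 1 else 0))"
    by (rule ge_lincomb[OF assms(1-3) _ assms(4-8) f g]) (use t in \<open>auto simp: form_bound_def\<close>)
  from ge_minus_one[OF assms(1) this c] show ?thesis
  proof (rule der_lines_mono)
    have "\<kappa> * 1 \<le> \<kappa> * (N + M)" using der_ge1[OF f] by (intro mult_le_mono2) simp
    then show "\<kappa> * (N + M) + k1 \<le> 2 * \<kappa> * (N + M)" using kappa_ge by linarith
  qed
qed

text \<open>If f were negative, then f \<le> - 1, so n * f + n - 1 \<le> - 1, against g \<ge> 0.
  This divides an inequality by n and rounds the constant; the slack n - 1 is the largest that a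
  remainder can have.\<close>

lemma ge_round:
  assumes "csz \<Gamma> + 20 * \<tau> \<le> G" "form_bound y g" "form_bound x f" "n \<le> H" "1 \<le> n" "n * (x + 1) + y + 1 \<le> H"
    and g: "der L N \<Gamma> (GE g)"
    and r: "\<And>i. i \<noteq> 0 \<Longrightarrow> g i \<le> int n * f i" "g 0 \<le> int n * f 0 + int n - 1"
  shows "der L (\<kappa> ^ 2 * N) \<Gamma> (GE f)"
proof -
  let ?h = "\<lambda>i. neg f i + (if i = 0 then - 1 else 0)"
  have x: "x + 1 \<le> n * (x + 1)" using assms(5) by (cases n) auto
  have bh: "form_bound (x + 1) ?h" by (rule form_bound_add[of x _ 1]) (use assms(3) in \<open>simp, auto simp: form_bound_def\<close>)
  have bf: "form_bound H f" using assms(3) x assms(6) by (auto elim: form_bound_mono)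
  have bhH: "form_bound H ?h" using bh x assms(6) by (auto elim: form_bound_mono)
  have ch: "csz (GE ?h # \<Gamma>) \<le> G" using fsz_GE[OF bhH] assms(1) tau_ge by simp
  have 1: "der L 1 (GE f # \<Gamma>) (GE f)"
    by (rule der_assume) (use fsz_GE[OF bf] L_slack assms(1) tau_ge in auto)
  have 2: "der L 1 (GE ?h # \<Gamma>) (GE ?h)"
    by (rule der_assume) (use fsz_GE[OF bhH] L_slack assms(1) tau_ge in auto)
  have bg: "form_bound H g" using assms(2,6) by (auto elim: form_bound_mono)
  have 3: "der L (Suc N) (GE ?h # \<Gamma>) (GE g)"
    by (rule der_weaken[OF g]) (use fsz_GE[OF bhH] fsz_GE[OF bg] L_slack assms(1) tau_ge in auto)
  have 4: "der L (2 * \<kappa> * (1 + Suc N)) (GE ?h # \<Gamma>) (GE f)"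
  proof (rule ge_falsum[OF ch bh assms(2) _ _ assms(4) H1 _ 2 3])
    fix i :: nat assume "i \<noteq> 0" then show "int n * ?h i + int 1 * g i \<le> 0" using r(1)[of i] by simp
  next
    show "int n * ?h 0 + int 1 * g 0 < 0" using r(2) by (simp add: algebra_simps)
  next
    show "fsz (GE f) \<le> 100 * \<tau>" using fsz_GE[OF bf] by simp
  qed (use assms x in auto)
  have 5: "der L (1 + 2 * \<kappa> * (1 + Suc N) + 3 * k1) \<Gamma> (GE f)"
    by (rule ge_split[OF _ bf bhH _ _ 1 4]) (use assms(1) fsz_GE[OF bf] in auto)
  have N: "1 \<le> N" using g der_ge1 by auto
  have "1 + 2 * \<kappa> * (1 + Suc N) + 3 * k1 \<le> \<kappa> * (2 * (2 + N) + 2)"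
    using kappa_ge by (simp add: algebra_simps)
  also have "\<dots> \<le> \<kappa> * (\<kappa> * N)"
  proof (rule mult_le_mono2)
    have "10 * N \<le> \<kappa> * N" using kappa_ge by (intro mult_le_mono1) linarith
    then show "2 * (2 + N) + 2 \<le> \<kappa> * N" by (rule order_trans[rotated]) (use N in auto)
  qed
  finally show ?thesis using der_lines_mono[OF 5] by (simp add: power2_eq_square algebra_simps)
qed

section \<open>Equations between forms, as pairs of inequalities\<close>

definition EQ :: "nat \<Rightarrow> fm list \<Rightarrow> (nat \<Rightarrow> int) \<Rightarrow> bool" where
  "EQ N \<Gamma> f \<longleftrightarrow> der L N \<Gamma> (GE f) \<and> der L N \<Gamma> (GE (neg f))"

lemma EQ_neg: "EQ N \<Gamma> f \<Longrightarrow> EQ N \<Gamma> (neg f)" by (simp add: EQ_def)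
lemma EQ_mono: "EQ N \<Gamma> f \<Longrightarrow> N \<le> M \<Longrightarrow> EQ M \<Gamma> f" by (auto simp: EQ_def intro: der_lines_mono)

lemma ge_eq_lincomb:
  assumes "csz \<Gamma> \<le> G" "form_bound x f" "form_bound y g" "form_bound z t" "x \<le> H" "y \<le> H" "a \<le> H" "nat \<bar>b\<bar> \<le> H"
    "a * x + nat \<bar>b\<bar> * y + z \<le> H"
    and f: "der L N \<Gamma> (GE f)" and g: "EQ M \<Gamma> g"
    and t: "\<And>i. int a * f i + b * g i \<le> t i"
  shows "der L (\<kappa> * (N + M)) \<Gamma> (GE t)"
proof (cases "b \<ge> 0")
  case True
  then show ?thesis
    by (intro ge_lincomb[OF assms(1-9) f, of M]) (use t g in \<open>auto simp: EQ_def\<close>)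
next
  case False
  then show ?thesis
    by (intro ge_lincomb[OF assms(1-2) _ assms(4-9) f, of "neg g" M]) (use t g assms(3) in \<open>auto simp: EQ_def\<close>)
qed

lemma EQ_lincomb:
  assumes "csz \<Gamma> \<le> G" "form_bound x f" "form_bound y g" "form_bound z t" "x \<le> H" "y \<le> H" "nat \<bar>a\<bar> \<le> H" "nat \<bar>b\<bar> \<le> H"
    "nat \<bar>a\<bar> * x + nat \<bar>b\<bar> * y + z \<le> H"
    and f: "EQ N \<Gamma> f" and g: "EQ M \<Gamma> g"
    and t: "\<And>i. t i = a * f i + b * g i"
  shows "EQ (\<kappa> * (N + M)) \<Gamma> t"
proof -
  have gen: "der L (\<kappa> * (N + M)) \<Gamma> (GE t)"
    if "form_bound z t" "nat \<bar>a\<bar> \<le> H" "nat \<bar>b\<bar> \<le> H" "nat \<bar>a\<bar> * x + nat \<bar>b\<bar> * y + z \<le> H" "\<And>i. t i = a * f i + b * g i"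
    for a b t
  proof (cases "a \<ge> 0")
    case True
    then show ?thesis using f that(5)
      by (intro ge_eq_lincomb[OF assms(1-3) that(1) assms(5,6) that(2,3,4) _ g]) (auto simp: EQ_def)
  next
    case False
    then show ?thesis using f that(5) assms(2)
      by (intro ge_eq_lincomb[OF assms(1) _ assms(3) that(1) assms(5,6) that(2,3,4) _ g, of "neg f"])
        (auto simp: EQ_def)
  qed
  have "der L (\<kappa> * (N + M)) \<Gamma> (GE t)" by (rule gen) (use assms t in auto)
  moreover have "der L (\<kappa> * (N + M)) \<Gamma> (GE (neg t))"
    by (rule gen[of _ "- a" "- b"]) (use assms t in auto)
  ultimately show ?thesis by (simp add: EQ_def)
qed

text \<open>The contradiction comes from rounding both inequalities that make up the equation.\<close>

lemma EQ_div_falsum: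
  assumes "csz \<Gamma> + 20 * \<tau> \<le> G" "form_bound y g" "1 \<le> n" "n \<le> H" "n * (y + 3) + 3 * y + 5 \<le> H"
    and g: "EQ N \<Gamma> g" and d: "\<And>i. i \<noteq> 0 \<Longrightarrow> int n dvd g i" "\<not> int n dvd g 0" and c: "fsz \<chi> \<le> 100 * \<tau>"
  shows "der L (\<kappa> ^ 4 * N) \<Gamma> \<chi>"
proof -
  \<comment> \<open>The quotients are exact except at the constant, where the floors of g 0 / n and
    of - g 0 / n add up to - 1. Hence f + f' is the constant - 1, although rounding makes both forms
    nonnegative.\<close>
  define f where "f = (\<lambda>i. g i div int n)"
  define f' where "f' = (\<lambda>i. neg g i div int n)"
  have ab: "\<bar>a div int n\<bar> \<le> \<bar>a\<bar> + 1" for a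
  proof -
    define q where "q = a div int n"
    have n: "1 \<le> int n" using assms(3) by simp
    have "q * int n + a mod int n = a" by (simp add: q_def)
    moreover have "0 \<le> a mod int n" "a mod int n < int n" using n by auto
    ultimately have *: "q * int n \<le> a" "a < (q + 1) * int n" by (auto simp: algebra_simps)
    have "q \<le> \<bar>a\<bar>"
    proof (cases "q \<ge> 0")
      case True
      then have "q * 1 \<le> q * int n" using n by (intro mult_left_mono) auto
      then show ?thesis using * by linarith
    qed linarith
    moreover have "- \<bar>a\<bar> - 1 \<le> q"
    proof (cases "q + 1 \<le> 0")
      case True
      then have "(q + 1) * int n \<le> (q + 1) * 1" using n by (intro mult_left_mono_neg) auto
      then have "a < q + 1" using *(2) by (simp only: mult_1_right)
      then show ?thesis by linarith
    qed linarith
    ultimately show ?thesis by (simp add: q_def)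
  qed
  have form_bound: "form_bound (y + 1) (\<lambda>i. h i div int n)" if h: "form_bound y h" for h
    unfolding form_bound_def
  proof (intro conjI allI impI)
    fix i
    have "\<bar>h i\<bar> \<le> int y" using h by (auto simp: form_bound_def)
    then show "\<bar>h i div int n\<bar> \<le> int (y + 1)" using ab[of "h i"] by linarith
  next
    fix i assume "h i div int n \<noteq> 0"
    then have "h i \<noteq> 0" by auto
    then show "i = 0 \<or> 10 \<le> i \<and> i < R" using h by (auto simp: form_bound_def)
  qed
  have b: "form_bound (y + 1) f" "form_bound (y + 1) f'" using form_bound[of g] form_bound[of "neg g"] assms(2) by (auto simp: f_def f'_def)
  have up: "a \<le> int n * (a div int n) + int n - 1" for a
    using pos_mod_bound[of "int n" a] assms(3) mult_div_mod_eq[of "int n" a] by linarith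
  have r: "n * (y + 1 + 1) + y + 1 \<le> H" using assms(5) by (simp add: algebra_simps)
  have 1: "der L (\<kappa> ^ 2 * N) \<Gamma> (GE f)"
    by (rule ge_round[OF assms(1,2) b(1) assms(4,3) r])
      (use g d up[of "g 0"] in \<open>auto simp: EQ_def f_def\<close>)
  have 2: "der L (\<kappa> ^ 2 * N) \<Gamma> (GE f')"
    by (rule ge_round[where g = "neg g", OF assms(1) _ b(2) assms(4,3) r])
      (use assms(2) g d up[of "- g 0"] in \<open>auto simp: EQ_def f'_def\<close>)
  have "der L (2 * \<kappa> * (\<kappa> ^ 2 * N + \<kappa> ^ 2 * N)) \<Gamma> \<chi>"
  proof (rule ge_falsum[OF _ b _ _ H1 H1 _ 1 2 _ _ c])
    fix i :: nat assume "i \<noteq> 0"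
    then show "int 1 * f i + int 1 * f' i \<le> 0" using d(1)[of i] by (auto simp: f_def f'_def dvd_neg_div)
  next
    have "(- g 0) div int n = - (g 0 div int n) - 1"
      using d(2) assms(3) by (subst zdiv_zminus1_eq_if) (auto simp: dvd_eq_mod_eq_0)
    then show "int 1 * f 0 + int 1 * f' 0 < 0" by (simp add: f_def f'_def)
  qed (use assms in auto)
  moreover have "4 * (\<kappa> * (\<kappa> ^ 2 * N)) \<le> \<kappa> * (\<kappa> * (\<kappa> ^ 2 * N))"
    using kappa_ge by (intro mult_le_mono1) linarith
  then have "2 * \<kappa> * (\<kappa> ^ 2 * N + \<kappa> ^ 2 * N) \<le> \<kappa> ^ 4 * N" by (simp add: eval_nat_numeral algebra_simps)
  ultimately show ?thesis by (rule der_lines_mono)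
qed

lemma EQ_of_Equ:
  assumes "csz \<Gamma> \<le> G" "der L N \<Gamma> (Equ s t)" "big s" "big t" "tsz s \<le> 5 * \<tau>" "tsz t \<le> 5 * \<tau>" "form_bound H f"
    "\<And>e. val f e = int (eval e t) - int (eval e s)"
  shows "EQ (N + 2 * k1) \<Gamma> f"
proof -
  have bt: "big (pos_part f)" "big (pos_part (neg f))" "tsz (pos_part f) \<le> \<tau>" "tsz (pos_part (neg f)) \<le> \<tau>"
    using assms by (auto intro!: tsz_pos_part) (meson form_bound_neg big_pos_part)+
  have le: "der L (scheme_bound + 6 + K) \<Gamma> (le_fm s t)"
    if "der L K \<Gamma> (Equ s t)" "big s" "big t" "tsz s \<le> 5 * \<tau>" "tsz t \<le> 5 * \<tau>" for s t K
  proof -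
    have "der L (scheme_bound + 5) \<Gamma> (inst s t Zero Zero (Imp (Equ (Var 3) (Var 4)) (le_fm (Var 3) (Var 4))))"
      using that tau_ge L_room[OF assms(1)] by (intro der_inst[where S = "400 * \<tau>"]) (auto simp: schemes_simps room_def)
    then have "der L (scheme_bound + 5) \<Gamma> (Imp (Equ s t) (le_fm s t))" using that by (simp add: inst_simps)
    from der_impE[OF this that(1)] show ?thesis by (rule der_lines_mono) simp
  qed
  have "der L (scheme_bound + 6 + N + k1) \<Gamma> (GE f)" unfolding GE_def
  proof (rule le_transfer[OF assms(1) le[OF assms(2-6)]])
    fix e show "eval e s + eval e (pos_part f) = eval e (pos_part (neg f)) + eval e t"
      using eval_pos_part_diff[of e f] assms(8)[of e] by simp
  qed (use bt assms in auto)
  moreover have "der L (N + k0) \<Gamma> (Equ t s)"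
    by (rule room_sym[OF L_room[OF assms(1)]]) (use assms in auto)
  then have "der L (scheme_bound + 6 + (N + k0) + k1) \<Gamma> (GE (neg f))" unfolding GE_def neg_neg
  proof (rule le_transfer[OF assms(1) le])
    fix e show "eval e t + eval e (pos_part (neg f)) = eval e (pos_part f) + eval e s"
      using eval_pos_part_diff[of e f] assms(8)[of e] by simp
  qed (use bt assms in auto)
  ultimately show ?thesis unfolding EQ_def using k1_ge
    by (auto elim!: der_lines_mono simp: k1_def k0_def)
qed

lemma Equ_of_EQ:
  assumes "csz \<Gamma> \<le> G" "EQ N \<Gamma> f" "big s" "big t" "tsz s \<le> 5 * \<tau>" "tsz t \<le> 5 * \<tau>" "form_bound H f"
    "\<And>e. val f e = int (eval e t) - int (eval e s)"
  shows "der L (2 * N + 3 * k1) \<Gamma> (Equ s t)"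
proof -
  have bt: "big (pos_part f)" "big (pos_part (neg f))" "tsz (pos_part f) \<le> \<tau>" "tsz (pos_part (neg f)) \<le> \<tau>"
    using assms by (auto intro!: tsz_pos_part) (meson form_bound_neg big_pos_part)+
  have 1: "der L (N + k1) \<Gamma> (le_fm s t)"
  proof (rule le_transfer[OF assms(1)])
    show "der L N \<Gamma> (le_fm (pos_part (neg f)) (pos_part f))" using assms(2) by (simp add: EQ_def GE_def)
    fix e show "eval e (pos_part (neg f)) + eval e t = eval e s + eval e (pos_part f)"
      using eval_pos_part_diff[of e f] assms(8)[of e] by simp
  qed (use bt assms in auto)
  have 2: "der L (N + k1) \<Gamma> (le_fm t s)"
  proof (rule le_transfer[OF assms(1)])
    show "der L N \<Gamma> (le_fm (pos_part f) (pos_part (neg f)))" using assms(2) by (simp add: EQ_def GE_def)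
    fix e show "eval e (pos_part f) + eval e s = eval e t + eval e (pos_part (neg f))"
      using eval_pos_part_diff[of e f] assms(8)[of e] by simp
  qed (use bt assms in auto)
  have "der L (scheme_bound + 5) \<Gamma> (inst s t Zero Zero (Imp (le_fm (Var 3) (Var 4)) (Imp (le_fm (Var 4) (Var 3)) (Equ (Var 3) (Var 4)))))"
    using assms tau_ge L_room[OF assms(1)] by (intro der_inst[where S = "400 * \<tau>"]) (auto simp: schemes_simps room_def)
  then have "der L (scheme_bound + 5) \<Gamma> (Imp (le_fm s t) (Imp (le_fm t s) (Equ s t)))" using assms by (simp add: inst_simps)
  from der_impE[OF der_impE[OF this 1] 2] show ?thesis by (rule der_lines_mono) (use k1_ge in auto)
qed

lemma vars_pos_part: "vars (pos_part f) \<subseteq> {i. 0 < f i \<and> i \<noteq> 0}"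
  by (auto simp: pos_part_def vars_lsum atom_def split: if_splits)

text \<open>Since \<open>GE f\<close> asserts the existence of a difference, a provably nonnegative
  form can be given a name: the fresh variable v stands for its value. This is how witnesses are
  introduced.\<close>

lemma ge_witness:
  assumes c: "csz \<Gamma> \<le> G" and f: "form_bound H f" "der L N \<Gamma> (GE f)" and v: "10 \<le> v" "v < R" "f v = 0" "v \<notin> fvs \<Gamma>" "v \<notin> fv \<chi>"
    and x: "der L M (Equ (Add (pos_part (neg f)) (Var v)) (pos_part f) # \<Gamma>) \<chi>"
  shows "der L (Suc (N + M)) \<Gamma> \<chi>"
proof -
  have nv: "v \<notin> vars (pos_part f)" "v \<notin> vars (pos_part (neg f))" using vars_pos_part[of f] vars_pos_part[of "neg f"] v by auto
  have n2: "2 \<notin> vars (pos_part f)" "2 \<notin> vars (pos_part (neg f))"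
    using big_pos_part[of H f] big_pos_part[of H "neg f"] f(1) by (auto simp: big_def)
  have s: "subst 2 (Var v) (Equ (Add (pos_part (neg f)) (Var 2)) (pos_part f)) = Equ (Add (pos_part (neg f)) (Var v)) (pos_part f)"
    using n2 by simp
  show ?thesis
    by (rule der_existsE[OF f(2)[unfolded GE_def le_fm_def], of M v])
      (use x s v nv in auto)
qed

lemma form_bound_witness:
  assumes "form_bound x f" "10 \<le> v" "v < R" "f v = 0"
  shows "form_bound (x + 1) (f(v := - 1))"
  using assms unfolding form_bound_def by (auto intro: order_trans)

lemma EQ_witness:
  assumes c: "csz \<Gamma> \<le> G" and f: "form_bound H f" "form_bound H (f(v := -1))" and v: "10 \<le> v" "v < R" "f v = 0"
    and m: "Equ (Add (pos_part (neg f)) (Var v)) (pos_part f) \<in> set \<Gamma>"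
  shows "EQ (3 * k1) \<Gamma> (f(v := - 1))"
proof -
  have bt: "big (pos_part f)" "big (pos_part (neg f))" "tsz (pos_part f) \<le> \<tau>" "tsz (pos_part (neg f)) \<le> \<tau>"
    using assms by (auto intro!: tsz_pos_part) (meson form_bound_neg big_pos_part)+
  have "tsz (Var v) \<le> \<tau>"
  proof -
    have "R + 10 \<le> (R + 10) ^ 2" using self_le_power[of "R + 10" 2] by simp
    also have "\<dots> \<le> \<tau>" by (simp add: \<tau>_def)
    finally show ?thesis using vsz_le[of v] v by simp
  qed
  then have t: "tsz (Add (pos_part (neg f)) (Var v)) \<le> 3 * \<tau>" using bt tau_ge by simp
  have "der L 1 \<Gamma> (Equ (Add (pos_part (neg f)) (Var v)) (pos_part f))"
    by (rule der_assume[OF m]) (use c L_slack t bt tau_ge in auto)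
  then have "EQ (1 + 2 * k1) \<Gamma> (f(v := - 1))"
  proof (rule EQ_of_Equ[OF c])
    fix e
    have "val (f(v := - 1)) e = (\<Sum>i<R. f i * int (ev0 e i) - (if i = v then int (ev0 e i) else 0))"
      unfolding val_def by (rule sum.cong) (use v in auto)
    also have "\<dots> = val f e - int (e v)" using v by (simp add: val_def sum_subtractf ev0_def)
    finally show "val (f(v := - 1)) e = int (eval e (pos_part f)) - int (eval e (Add (pos_part (neg f)) (Var v)))"
      using eval_pos_part_diff[of e f] by simp
  qed (use bt t v f in auto)
  then show ?thesis by (rule EQ_mono) (use k1_ge in auto)
qed

end

section \<open>Residues modulo composite numbers\<close>

lemma fsz_disj_upto: "(\<And>i. i \<le> n \<Longrightarrow> fsz (f i) \<le> B) \<Longrightarrow> fsz (disj_upto f n) \<le> (n + 1) * (B + 3)"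
proof (induction n)
  case (Suc n)
  then have "fsz (disj_upto f n) \<le> (n + 1) * (B + 3)" "fsz (f (Suc n)) \<le> B" by auto
  then show ?case by simp
qed (auto intro: le_trans)

lemma subst_disj_upto [simp]: "subst x t (disj_upto f n) = disj_upto (\<lambda>i. subst x t (f i)) n"
  by (induction n) auto

lemma bvs_disj_upto: "bound_vars (disj_upto f n) = (\<Union>i\<le>n. bound_vars (f i))"
  by (induction n) (auto simp: atMost_Suc)

lemma fv_disj_upto: "fv (disj_upto f n) = (\<Union>i\<le>n. fv (f i))"
  by (induction n) (auto simp: atMost_Suc)

lemma der_disj_upto_intro:
  "der L N \<Gamma> (f k) \<Longrightarrow> k \<le> n \<Longrightarrow> csz \<Gamma> + fsz (disj_upto f n) + 2 \<le> L \<Longrightarrow> der L (N + n + 1) \<Gamma> (disj_upto f n)"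
proof (induction n)
  case 0
  then show ?case by (auto elim: der_lines_mono)
next
  case (Suc n)
  show ?case
  proof (cases "k = Suc n")
    case True
    then have "der L (Suc N) \<Gamma> (disj_upto f (Suc n))" using Suc.prems by (auto intro!: der_disjI2)
    then show ?thesis by (rule der_lines_mono) simp
  next
    case False
    then have "der L (N + n + 1) \<Gamma> (disj_upto f n)" using Suc by auto
    then have "der L (Suc (N + n + 1)) \<Gamma> (disj_upto f (Suc n))" using Suc.prems by (auto intro!: der_disjI1)
    then show ?thesis by (rule der_lines_mono) simp
  qed
qed

text \<open>The conclusion is an implication over the unchanged context. A direct case split would
  accumulate the nested disjunctions in the context.\<close>

lemma der_disj_upto_imp:
  assumes "\<And>r. r \<le> n \<Longrightarrow> der L K (f r # \<Gamma>) \<chi>" "csz \<Gamma> + 3 * fsz (disj_upto f n) + 2 * fsz \<chi> + 20 \<le> L"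
  shows "der L ((n + 1) * (K + 20)) \<Gamma> (Imp (disj_upto f n) \<chi>)"
  using assms
proof (induction n)
  case 0
  have "der L (Suc K) \<Gamma> (Imp (f 0) \<chi>)" by (rule der_impI) (use 0 in auto)
  then show ?case by (auto elim!: der_lines_mono)
next
  case (Suc n)
  let ?A = "disj_upto f n" and ?B = "f (Suc n)" and ?D = "disj_upto f (Suc n)"
  have D: "?D = Disj ?A ?B" by simp
  have 1: "der L ((n + 1) * (K + 20)) \<Gamma> (Imp ?A \<chi>)" by (rule Suc.IH) (use Suc.prems in auto)
  have 2: "der L K (?B # \<Gamma>) \<chi>" using Suc.prems by auto
  have 3: "der L (Suc ((n + 1) * (K + 20))) (?A # ?D # \<Gamma>) (Imp ?A \<chi>)"
    by (rule der_weaken[OF 1]) (use Suc.prems in auto)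
  have 4: "der L 1 (?A # ?D # \<Gamma>) ?A" by (rule der_assume) (use Suc.prems in auto)
  have 5: "der L (Suc K) (?B # ?D # \<Gamma>) \<chi>" by (rule der_weaken[OF 2]) (use Suc.prems in auto)
  have 6: "der L 1 (?D # \<Gamma>) (Disj ?A ?B)" by (rule der_assume) (use Suc.prems in auto)
  have 7: "der L (Suc (1 + Suc (Suc ((n + 1) * (K + 20)) + 1) + Suc K)) (?D # \<Gamma>) \<chi>"
    by (rule der_disjE[OF 6 der_impE[OF 3 4] 5])
  have "der L (Suc (Suc (1 + Suc (Suc ((n + 1) * (K + 20)) + 1) + Suc K))) \<Gamma> (Imp ?D \<chi>)"
    by (rule der_impI[OF 7]) (use Suc.prems in auto)
  then show ?case by (rule der_lines_mono) simp
qed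

definition residue_trm :: "nat \<Rightarrow> nat \<Rightarrow> nat \<Rightarrow> trm" where
  "residue_trm M r w = lsum (replicate r One @ replicate M (Var w))"

lemma eval_residue_trm: "eval e (residue_trm M r w) = r + M * e w"
  by (simp add: residue_trm_def eval_lsum sum_list_replicate)

lemma tsz_residue_trm: "tsz (residue_trm M r w) = 1 + r * 4 + M * (vsz w + 3)"
  by (simp add: residue_trm_def tsz_lsum sum_list_replicate)

lemma vars_residue_trm: "vars (residue_trm M r w) \<subseteq> {w}"
  by (auto simp: residue_trm_def vars_lsum)

lemma big_residue_trm: "10 \<le> w \<Longrightarrow> big (residue_trm M r w)" by (auto simp: residue_trm_def)

lemma tsubst_lsum: "tsubst x u (lsum xs) = lsum (map (tsubst x u) xs)" by (induction xs) auto

lemma tsubst_residue_trm: "tsubst x (Var v) (residue_trm M r w) = (if w = x then residue_trm M r v else residue_trm M r w)"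
  by (simp add: residue_trm_def tsubst_lsum)

text \<open>Division with remainder, so that a name for the quotient turns the residue into one
  linear equation. The congruences of the axioms allow an excess on either side and do not have this
  form.\<close>

definition res_fm :: "nat \<Rightarrow> nat \<Rightarrow> nat \<Rightarrow> fm" where
  "res_fm M z r = Exists 4 (Equ (Var z) (residue_trm M r 4))"

definition Res :: "nat \<Rightarrow> fm" where "Res M = Forall 3 (disj_upto (res_fm M 3) (M - 1))"

lemma nmul_size: "tsz (nmul n t) \<le> 1 + n * (tsz t + 3)" by (induction n t rule: nmul.induct) auto
lemma nmul_eval: "eval e (nmul n t) = n * eval e t" by (induction n t rule: nmul.induct) auto
lemma nmul_vars: "vars (nmul n t) \<subseteq> vars t" by (induction n t rule: nmul.induct) auto
lemma nmul_tsubst: "tsubst x u (nmul n t) = nmul n (tsubst x u t)" by (induction n t rule: nmul.induct) auto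
lemma nmul_big: "big t \<Longrightarrow> big (nmul n t)" by (induction n t rule: nmul.induct) auto

definition residue_form :: "nat \<Rightarrow> nat \<Rightarrow> nat \<Rightarrow> nat \<Rightarrow> nat \<Rightarrow> int" where
  "residue_form z M w r = (\<lambda>i. if i = 0 then - int r else if i = z then 1 else if i = w then - int M else 0)"

context calc begin

lemma L_slack2: "G + 100000 * (\<tau> * \<tau>) + 2 \<le> L"
proof -
  have "(400 * \<tau>) ^ 2 \<le> (400 * \<tau>) ^ 4" by (rule power_increasing) (use tau_ge in auto)
  then have "10 * (400 * \<tau>) ^ 2 \<le> scheme_bound * (400 * \<tau>) ^ 4" using scheme_bound_ge by (intro mult_le_mono) auto
  moreover have "10 * (400 * \<tau>) ^ 2 = 1600000 * (\<tau> * \<tau>)" by (simp add: power2_eq_square)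
  moreover have "G + scheme_bound * (400 * \<tau>) ^ 4 + 2 \<le> L" using L_ge by (simp add: \<tau>_def)
  ultimately show ?thesis by linarith
qed

lemma tau_sq: "10000 \<le> \<tau> * \<tau>" "100 * \<tau> \<le> \<tau> * \<tau>"
proof -
  show "100 * \<tau> \<le> \<tau> * \<tau>" using tau_ge by (rule mult_le_mono1)
  then show "10000 \<le> \<tau> * \<tau>" using tau_ge by linarith
qed

lemma H_tau: "100 * (H + 1) \<le> \<tau>"
proof -
  have "10 ^ 2 \<le> (R + 10) ^ 2" by (rule power_mono) auto
  then have "10 ^ 2 * (H + 1) \<le> (R + 10) ^ 2 * (H + 1)" by (rule mult_le_mono1)
  then show ?thesis by (simp add: \<tau>_def)
qed

lemma R_tau: "R + 10 \<le> \<tau>"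
proof -
  have "(R + 10) * 1 \<le> (R + 10) ^ 2 * (H + 1)" by (rule mult_le_mono) (auto simp: power2_eq_square)
  then show ?thesis by (simp add: \<tau>_def)
qed

lemma RH_tau: "(R + 10) * (H + 1) * 30 \<le> \<tau>"
proof -
  have "(R + 10) * (H + 1) * 30 \<le> (R + 10) * (H + 1) * (R + 10)" by (rule mult_le_mono2) (use R20 in simp)
  then show ?thesis by (simp add: \<tau>_def power2_eq_square algebra_simps)
qed

lemma tsz_residue_trm_le: "M \<le> H \<Longrightarrow> r \<le> H \<Longrightarrow> w < R \<Longrightarrow> tsz (residue_trm M r w) \<le> \<tau>"
proof -
  assume a: "M \<le> H" "r \<le> H" "w < R"
  have "M * (vsz w + 3) \<le> H * (R + 10)" by (rule mult_le_mono) (use a vsz_le[of w] in auto)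
  moreover have "r * 4 \<le> H * (R + 10)" by (rule mult_le_mono) (use a in auto)
  moreover have "1 \<le> R + 10" by simp
  ultimately have "tsz (residue_trm M r w) \<le> 2 * (H * (R + 10)) + (R + 10)" unfolding tsz_residue_trm by linarith
  then show ?thesis using RH_tau by (simp add: algebra_simps)
qed

lemma tsz_nmul_le: "n \<le> H \<Longrightarrow> tsz t \<le> R + 5 \<Longrightarrow> tsz (nmul n t) \<le> \<tau>"
proof -
  assume a: "n \<le> H" "tsz t \<le> R + 5"
  have "n * (tsz t + 3) \<le> H * (R + 10)" by (rule mult_le_mono) (use a in auto)
  moreover have "1 \<le> R + 10" by simp
  ultimately have "tsz (nmul n t) \<le> H * (R + 10) + (R + 10)" using nmul_size[of n t] by linarith
  then show ?thesis using RH_tau by (simp add: algebra_simps)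
qed

lemma vsz_tau: "z < R \<Longrightarrow> vsz z \<le> \<tau>" using vsz_le[of z] R_tau by simp

lemma fsz_res_fm: "M \<le> H \<Longrightarrow> r \<le> H \<Longrightarrow> z < R \<Longrightarrow> fsz (res_fm M z r) \<le> 3 * \<tau>"
  using tsz_residue_trm_le[of M r 4] vsz_tau[of z] vsz_le[of 4] R20 tau_ge by (simp add: res_fm_def)

lemma fsz_res_disj: "1 \<le> M \<Longrightarrow> M \<le> H \<Longrightarrow> z < R \<Longrightarrow> fsz (disj_upto (res_fm M z) (M - 1)) \<le> \<tau> * \<tau>"
proof -
  assume a: "1 \<le> M" "M \<le> H" "z < R"
  have "fsz (disj_upto (res_fm M z) (M - 1)) \<le> (M - 1 + 1) * (3 * \<tau> + 3)"
    by (rule fsz_disj_upto, rule fsz_res_fm) (use a in auto)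
  also have "\<dots> \<le> H * (4 * \<tau>)" using a tau_ge by (intro mult_le_mono) auto
  also have "\<dots> = (4 * H) * \<tau>" by simp
  also have "\<dots> \<le> \<tau> * \<tau>" by (rule mult_le_mono1) (use H_tau in simp)
  finally show ?thesis .
qed

lemma form_bound_residue_form:
  assumes "10 \<le> z" "z < R" "10 \<le> w" "w < R" "r \<le> x" "M \<le> x" "1 \<le> x"
  shows "form_bound x (residue_form z M w r)"
  using assms by (auto simp: form_bound_def residue_form_def)

lemma val_residue_form:
  assumes "10 \<le> z" "z < R" "10 \<le> w" "w < R" "z \<noteq> w"
  shows "val (residue_form z M w r) e = int (e z) - int M * int (e w) - int r"
proof -
  have "val (residue_form z M w r) e = (\<Sum>i<R. (if i = 0 then - int r else 0) + (if i = z then int (e i) else 0)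
      + (if i = w then - int M * int (e i) else 0))"
    unfolding val_def residue_form_def by (rule sum.cong) (use assms in \<open>auto simp: ev0_def\<close>)
  also have "\<dots> = int (e z) - int M * int (e w) - int r"
    using assms R20 by (simp add: sum.distrib)
  finally show ?thesis .
qed

lemma EQ_of_residue:
  assumes "csz \<Gamma> \<le> G" "Equ (Var z) (residue_trm M r w) \<in> set \<Gamma>" "10 \<le> z" "z < R" "10 \<le> w" "w < R" "z \<noteq> w"
    "r \<le> H" "M \<le> H"
  shows "EQ (3 * k1) \<Gamma> (residue_form z M w r)"
proof -
  have 1: "der L 1 \<Gamma> (Equ (Var z) (residue_trm M r w))"
    by (rule der_assume) (use assms L_slack tsz_residue_trm_le[of M r w] vsz_tau[of z] tau_ge in auto)
  have "EQ (1 + 2 * k1) \<Gamma> (neg (residue_form z M w r))"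
    by (rule EQ_of_Equ[OF assms(1) 1])
      (use assms H1 tsz_residue_trm_le[of M r w] vsz_tau[of z] tau_ge in \<open>auto simp: big_residue_trm form_bound_residue_form val_residue_form eval_residue_trm\<close>)
  from EQ_mono[OF EQ_neg[OF this]] show ?thesis using k1_ge by auto
qed

lemma res_cases:
  assumes "csz \<Gamma> \<le> G" "1 \<le> M" "M \<le> H" "der L N [] (Res M)" "10 \<le> z" "z < R" "10 \<le> w" "w < R" "w \<noteq> z"
    "w \<notin> fvs \<Gamma>" "w \<notin> fv \<chi>" and sx: "fsz \<chi> \<le> 100 * (\<tau> * \<tau>)"
    and step: "\<And>r. r < M \<Longrightarrow> der L K (Equ (Var z) (residue_trm M r w) # \<Gamma>) \<chi>"
  shows "der L (N + M * (K + 30)) \<Gamma> \<chi>"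
proof -
  note sz = fsz_res_disj[OF assms(2,3,6)]
  have sub: "subst 3 (Var z) (disj_upto (res_fm M 3) (M - 1)) = disj_upto (res_fm M z) (M - 1)"
    using assms by (simp add: res_fm_def[abs_def] tsubst_residue_trm)
  note t2 = tau_sq
  have w1: "csz \<Gamma> + fsz (Res M) + 2 \<le> L"
    using assms(1) fsz_res_disj[OF assms(2,3), of 3] L_slack2 vsz_le[of 3] R20 t2
    unfolding Res_def fsz_simps by linarith
  have 1: "der L (Suc N) \<Gamma> (Res M)" by (rule der_weaken[OF assms(4) _ w1]) simp
  have 2: "der L (Suc (Suc N)) \<Gamma> (disj_upto (res_fm M z) (M - 1))"
    unfolding sub[symmetric]
  proof (rule der_forallE[OF 1[unfolded Res_def]])
    show "free_for (Var z) 3 (disj_upto (res_fm M 3) (M - 1))"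
      by (rule free_for_bvs) (use assms in \<open>auto simp: bvs_disj_upto res_fm_def\<close>)
  qed (use assms sz L_slack2 sub in auto)
  have "der L ((M - 1 + 1) * ((3 + K) + 20)) \<Gamma> (Imp (disj_upto (res_fm M z) (M - 1)) \<chi>)"
  proof (rule der_disj_upto_imp)
    fix r assume "r \<le> M - 1"
    then have r: "r < M" using assms by auto
    let ?E = "Equ (Var z) (residue_trm M r w)"
    have fz: "fsz (res_fm M z r) \<le> 3 * \<tau>" using fsz_res_fm r assms by auto
    have a: "der L 1 (res_fm M z r # \<Gamma>) (Exists 4 (Equ (Var z) (residue_trm M r 4)))"
      by (rule der_assume) (use fz assms L_slack tau_ge in \<open>auto simp: res_fm_def\<close>)
    have "fsz ?E \<le> 3 * \<tau>" using tsz_residue_trm_le[of M r w] vsz_tau[of z] r assms tau_ge by auto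
    then have "csz (?E # res_fm M z r # \<Gamma>) + fsz \<chi> + 2 \<le> L"
      using fz assms(1) sx L_slack2 t2 unfolding csz_simps by linarith
    then have "der L (Suc K) (?E # res_fm M z r # \<Gamma>) \<chi>"
      by (intro der_weaken[OF step[OF r]]) auto
    then have "der L (Suc (1 + Suc K)) (res_fm M z r # \<Gamma>) \<chi>"
      by (intro der_existsE[OF a, of _ w]) (use assms vars_residue_trm[of M r 4] in \<open>auto simp: res_fm_def tsubst_residue_trm\<close>)
    then show "der L (3 + K) (res_fm M z r # \<Gamma>) \<chi>" by (rule der_lines_mono) simp
  qed (use assms(1) sx sz L_slack2 t2 in linarith)
  from der_impE[OF this 2] show ?thesis by (rule der_lines_mono) (use assms in \<open>auto simp: algebra_simps\<close>)
qed


section \<open>From prime moduli to composite ones\<close>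

lemma fsz_congr: "p \<le> H \<Longrightarrow> r \<le> H \<Longrightarrow> z < R \<Longrightarrow> fsz (congr_fm p (Var z) (numeral_trm r)) \<le> 10 * \<tau>"
  using tsz_nmul_le[of p "Var 2"] tsz_nmul_le[of r One] vsz_tau[of z] vsz_le[of 2] tau_ge
  by (simp add: congr_fm_def numeral_trm_def)

text \<open>Dividing by p and then the quotient by q: if x = p * y + s and y = q * u + r, then x = p
  * q * u + (p * r + s), and p * r + s ranges below p * q.\<close>

lemma Res_mult:
  assumes p: "prime p" and q: "1 \<le> q" and Rq: "der L N [] (Res q)" and G: "100 * \<tau> \<le> G"
    and H: "20 * (p * q) * (p * q) + 100 \<le> H"
  shows "der L (3 * p * (N + q * \<kappa> ^ 6) + \<kappa>) [] (Res (p * q))"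
proof -
  let ?m = "p * q"
  let ?D = "disj_upto (res_fm ?m 10) (?m - 1)"
  have p2: "2 \<le> p" using p by (rule prime_ge_2_nat)
  have m1: "1 \<le> ?m" using p2 q by simp
  have pm: "p \<le> ?m" "q \<le> ?m" using p2 q by auto
  have "20 * ?m * 1 \<le> 20 * ?m * ?m" using m1 by (rule mult_le_mono2)
  then have mH: "20 * ?m \<le> H" using H by linarith
  have mH': "?m \<le> H" "p \<le> H" "q \<le> H" using mH pm by linarith+
  note sD = fsz_res_disj[OF m1 mH'(1), of 10]
  have R: "10 < R" "11 < R" "12 < R" using R20 by auto
  have sD: "fsz ?D \<le> \<tau> * \<tau>" using sD R by simp
  have fvD: "fv ?D \<subseteq> {10}" using vars_residue_trm by (fastforce simp: fv_disj_upto res_fm_def)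
  \<comment> \<open>Variable 10 is the dividend, 11 its quotient by p, and 12 the quotient of that
    by q.\<close>
  have core: "der L (N + q * \<kappa> ^ 5) \<Delta> ?D"
    if D: "csz \<Delta> + 40 * \<tau> \<le> G" "EQ K \<Delta> (residue_form 10 p 11 s)" "s < p" "12 \<notin> fvs \<Delta>" "K \<le> \<kappa> ^ 3" for \<Delta> s K
  proof -
    let ?K = "\<kappa> * (Suc (\<kappa> ^ 3) + 3 * k1)"
    have "der L (N + q * ((2 * ?K + 3 * k1) + 1 + ?m + 1 + 30)) \<Delta> ?D"
    proof (rule res_cases[OF _ q mH'(3) Rq, of \<Delta> 11 12])
      fix r assume r: "r < q"
      let ?E = "Equ (Var 11) (residue_trm q r 12)"
      have sE: "fsz ?E \<le> 3 * \<tau>"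
        using tsz_residue_trm_le[of q r 12] vsz_tau[of 11] r mH' R tau_ge by auto
      have cE: "csz (?E # \<Delta>) \<le> G" using sE D(1) tau_ge by simp
      have "p * r + s < p * r + p" using D(3) by simp
      also have "\<dots> = p * (r + 1)" by simp
      also have "\<dots> \<le> ?m" using r by (intro mult_le_mono2) auto
      finally have rs: "p * r + s < ?m" .
      have bH: "form_bound H (residue_form 10 p 11 s)" by (rule form_bound_residue_form) (use R D(3) mH' H1 in auto)
      have e1: "EQ (Suc (\<kappa> ^ 3)) (?E # \<Delta>) (residue_form 10 p 11 s)"
        using D(2,5) cE sE fsz_GE[OF bH] fsz_GE[of "neg (residue_form 10 p 11 s)"] bH L_slack
        unfolding EQ_def
        by (auto intro!: der_weaken[of L "\<kappa> ^ 3" \<Delta>] elim!: der_lines_mono)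
      have e2: "EQ (3 * k1) (?E # \<Delta>) (residue_form 11 q 12 r)"
        by (rule EQ_of_residue[OF cE]) (use R r mH' in auto)
      have e3: "EQ ?K (?E # \<Delta>) (residue_form 10 ?m 12 (p * r + s))"
      proof (rule EQ_lincomb[OF cE _ _ _ _ _ _ _ _ e1 e2])
        have sm: "s \<le> ?m" using D(3) pm by linarith
        show "form_bound ?m (residue_form 10 p 11 s)" by (rule form_bound_residue_form) (use sm R pm m1 in auto)
        have rm: "r \<le> ?m" using r pm by linarith
        show "form_bound ?m (residue_form 11 q 12 r)" by (rule form_bound_residue_form) (use rm R pm m1 in auto)
        show "form_bound ?m (residue_form 10 ?m 12 (p * r + s))" by (rule form_bound_residue_form) (use R rs m1 in auto)
        have "p * ?m \<le> ?m * ?m" using pm(1) by (rule mult_le_mono1)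
        then have "1 * ?m + p * ?m + ?m \<le> H" using H mH by linarith
        then show "nat \<bar>1\<bar> * ?m + nat \<bar>int p\<bar> * ?m + ?m \<le> H" by simp
      next
        fix i show "residue_form 10 ?m 12 (p * r + s) i = 1 * residue_form 10 p 11 s i + int p * residue_form 11 q 12 r i"
          by (simp add: residue_form_def)
      qed (use mH' H1 in auto)
      have t: "tsz (residue_trm ?m (p * r + s) 12) \<le> \<tau>" by (rule tsz_residue_trm_le) (use rs mH' R in auto)
      have e4: "der L (2 * ?K + 3 * k1) (?E # \<Delta>) (Equ (Var 10) (residue_trm ?m (p * r + s) 12))"
        by (rule Equ_of_EQ[OF cE EQ_neg[OF e3]])
          (use t R rs mH' H1 tau_ge vsz_tau[of 10] in \<open>auto simp: big_residue_trm form_bound_residue_form val_residue_form eval_residue_trm\<close>)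
      have s5: "fsz (res_fm ?m 10 (p * r + s)) \<le> 3 * \<tau>" by (rule fsz_res_fm) (use rs mH' R in auto)
      have e5: "der L (Suc (2 * ?K + 3 * k1)) (?E # \<Delta>) (res_fm ?m 10 (p * r + s))"
        unfolding res_fm_def
        by (rule der_existsI[of _ _ _ _ "Var 12"])
          (use e4 s5 cE L_slack in \<open>auto simp: tsubst_residue_trm res_fm_def\<close>)
      have "csz (?E # \<Delta>) + fsz ?D + 2 \<le> L" using cE sD L_slack2 tau_sq by linarith
      from der_disj_upto_intro[OF e5 _ this] rs
      have "der L (Suc (2 * ?K + 3 * k1) + (?m - 1) + 1) (?E # \<Delta>) ?D" by linarith
      then show "der L ((2 * ?K + 3 * k1) + 1 + ?m + 1) (?E # \<Delta>) ?D"
        by (rule der_lines_mono) simp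
    qed (use D R fvD sD tau_sq in auto)
    then show ?thesis
    proof (rule der_lines_mono)
      have "2 * ?K + 3 * k1 + 1 + ?m + 1 + 30 \<le> \<kappa> ^ 5"
      proof -
        have "\<kappa> * 1 \<le> \<kappa> * \<kappa> ^ 2" "\<kappa> ^ 3 = \<kappa> * \<kappa> ^ 2" using kappa_ge by (auto simp: eval_nat_numeral)
        then have k3: "\<kappa> \<le> \<kappa> ^ 3" by linarith
        have "?K \<le> \<kappa> * (3 * \<kappa> ^ 3)" using kappa_ge k3 by (intro mult_le_mono2) linarith
        then have "2 * ?K + 3 * k1 + 1 + ?m + 1 + 30 \<le> 6 * (\<kappa> * \<kappa> ^ 3) + 2 * \<kappa>"
          using kappa_ge mH by linarith
        also have "\<dots> \<le> 8 * (\<kappa> * \<kappa> ^ 3)" using k3 kappa_ge by auto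
        also have "\<dots> \<le> \<kappa> * (\<kappa> * \<kappa> ^ 3)" using kappa_ge by (intro mult_le_mono1) linarith
        finally show ?thesis by (simp add: eval_nat_numeral)
      qed
      then show "N + q * (2 * ?K + 3 * k1 + 1 + ?m + 1 + 30) \<le> N + q * \<kappa> ^ 5" by simp
    qed
  qed
  let ?C = "\<lambda>s. congr_fm p (Var 10) (numeral_trm s)"
  have each: "der L (2 * (N + q * \<kappa> ^ 5) + 5) [?C s] ?D" if s: "s < p" for s
  proof -
    let ?A = "Equ (Add (nmul p (Var 11)) (numeral_trm s)) (Var 10)"
    let ?B = "Equ (Add (nmul p (Var 11)) (Var 10)) (numeral_trm s)"
    have bt: "big (nmul p (Var 11))" "big (numeral_trm s)" "tsz (nmul p (Var 11)) \<le> \<tau>" "tsz (numeral_trm s) \<le> \<tau>"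
      "tsz (Var 10) \<le> \<tau>"
      using tsz_nmul_le[of p "Var 11"] tsz_nmul_le[of s One] mH' s R vsz_tau[of 10] vsz_le[of 11]
      by (auto simp: numeral_trm_def nmul_big)
    have vn: "vars (numeral_trm s) = {}" "vars (nmul p (Var 11)) \<subseteq> {11}"
      using nmul_vars[of s One] nmul_vars[of p "Var 11"] by (auto simp: numeral_trm_def)
    have sz: "fsz ?A \<le> 4 * \<tau>" "fsz ?B \<le> 4 * \<tau>" "fsz (?C s) \<le> 10 * \<tau>"
      using bt tau_ge fsz_congr[of p s 10] mH' s R by auto
    let ?\<Delta> = "[Disj ?A ?B, ?C s]"
    have cA: "csz (?A # ?\<Delta>) + 60 * \<tau> \<le> G" "csz (?B # ?\<Delta>) + 60 * \<tau> \<le> G" using sz G tau_ge by auto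
    have fC: "fv (?C s) \<subseteq> {10}" using vn nmul_vars[of p "Var 2"] by (auto simp: congr_fm_def)
    have fA: "12 \<notin> fvs (?A # ?\<Delta>)" "12 \<notin> fvs (?B # ?\<Delta>)" using vn fC by auto
    have k3: "20 * \<kappa> * \<kappa> \<le> \<kappa> ^ 3" "100 * \<kappa> \<le> \<kappa> * \<kappa>" "20 * k1 \<le> \<kappa>"
    proof -
      show "100 * \<kappa> \<le> \<kappa> * \<kappa>" using kappa_ge(1) by (rule mult_le_mono1)
      then have "20 * \<kappa> \<le> \<kappa> * \<kappa>" by linarith
      then have "20 * \<kappa> * \<kappa> \<le> \<kappa> * \<kappa> * \<kappa>" by (rule mult_le_mono1)
      then show "20 * \<kappa> * \<kappa> \<le> \<kappa> ^ 3" by (simp add: power3_eq_cube)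
    qed (rule kappa_ge)
    have a1: "EQ (1 + 2 * k1) (?A # ?\<Delta>) (residue_form 10 p 11 s)"
      by (rule EQ_of_Equ[where s = "Add (nmul p (Var 11)) (numeral_trm s)" and t = "Var 10"], use cA in simp,
          rule der_assume)
        (use bt cA L_slack sz R tau_ge mH' s H1 in \<open>auto simp: form_bound_residue_form val_residue_form nmul_eval numeral_trm_def\<close>)
    have 1: "der L (N + q * \<kappa> ^ 5) (?A # ?\<Delta>) ?D"
      by (rule core[OF _ a1 s fA(1)]) (use cA k3 kappa_ge in linarith)+
    define g :: "nat \<Rightarrow> int" where "g = (\<lambda>i. if i = 0 then int s else if i = 10 then - 1 else if i = 11 then - int p else 0)"
    have vg: "val g e = int s - int (e 10) - int p * int (e 11)" for e
    proof -
      have "val g e = (\<Sum>i<R. (if i = 0 then int s else 0) + (if i = 10 then - int (e i) else 0)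
          + (if i = 11 then - int p * int (e i) else 0))"
        unfolding val_def g_def by (rule sum.cong) (auto simp: ev0_def)
      then show ?thesis using R by (simp add: sum.distrib)
    qed
    have bg: "form_bound p g" using R s p2 by (auto simp: form_bound_def g_def)
    have b1: "EQ (1 + 2 * k1) (?B # ?\<Delta>) g"
      by (rule EQ_of_Equ[where s = "Add (nmul p (Var 11)) (Var 10)" and t = "numeral_trm s"], use cA in simp,
          rule der_assume)
        (use bt cA L_slack sz R tau_ge mH' s H1 form_bound_mono[OF bg] in \<open>auto simp: vg nmul_eval numeral_trm_def\<close>)
    \<comment> \<open>Let x and y be the variables 10 and 11. As s < p, the equation p * y + x = s
      forces y = 0: h says y \<ge> 1, which is refuted, and h' says - y \<ge> 0. Adding
      \<open>2 * p\<close> times h' to x + p * y - s gives x - p * y - s \<ge> 0, so also in this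
      case s is the remainder and y the quotient.\<close>
    define h :: "nat \<Rightarrow> int" where "h = (\<lambda>i. if i = 0 then - 1 else if i = 11 then 1 else 0)"
    define h' :: "nat \<Rightarrow> int" where "h' = (\<lambda>i. if i = 11 then - 1 else 0)"
    have bh: "form_bound 1 h" "form_bound 1 h'" "form_bound H h" "form_bound H h'" using R H1 by (auto simp: form_bound_def h_def h'_def)
    have bf: "form_bound p (residue_form 10 p 11 s)" "form_bound H (residue_form 10 p 11 s)" by (rule form_bound_residue_form; use R s mH' p2 H1 in simp)+
    have sh: "fsz (GE h) \<le> 3 * \<tau>" "fsz (GE h') \<le> 3 * \<tau>" using bh fsz_GE by auto
    have ch: "csz (GE h # ?B # ?\<Delta>) \<le> G" "csz (GE h' # ?B # ?\<Delta>) \<le> G" using sh cA tau_ge by auto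
    have bgH: "form_bound H g" "form_bound H (neg g)" using form_bound_mono[OF bg] mH' by auto
    note sg = fsz_GE[OF bgH(1)] fsz_GE[OF bgH(2)]
    have g1: "der L (Suc (1 + 2 * k1)) (GE h # ?B # ?\<Delta>) (GE g)" "der L (Suc (1 + 2 * k1)) (GE h' # ?B # ?\<Delta>) (GE (neg g))"
      using b1 unfolding EQ_def by (auto intro!: der_weaken[of L "Suc (2 * k1)" "?B # ?\<Delta>"] simp del: csz_simps)
        (use ch sg L_slack in linarith)+
    have h1: "der L 1 (GE h # ?B # ?\<Delta>) (GE h)" "der L 1 (GE h' # ?B # ?\<Delta>) (GE h')"
      by (rule der_assume, simp, use ch sh L_slack in linarith)+
    have pH: "5 * p + 5 \<le> H" using mH pm m1 H by linarith
    have g2: "der L (2 * \<kappa> * (1 + Suc (1 + 2 * k1))) (GE h # ?B # ?\<Delta>) (GE (residue_form 10 p 11 s))"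
      by (rule ge_falsum[OF ch(1) bh(1) bg _ _ mH'(2) H1 _ h1(1) g1(1)])
        (use pH s fsz_GE[OF bf(2)] in \<open>auto simp: h_def g_def\<close>)
    have "5 * p * p + 5 \<le> H"
    proof -
      have "p * p \<le> ?m * ?m" using pm(1) by (intro mult_le_mono)
      then show ?thesis using H by linarith
    qed
    then have g3: "der L (\<kappa> * (Suc (1 + 2 * k1) + 1)) (GE h' # ?B # ?\<Delta>) (GE (residue_form 10 p 11 s))"
      by (intro ge_lincomb[OF ch(2) _ bh(2) bf(1) _ _ H1 _ _ g1(2) h1(2), where b = "2 * p" and x = p])
        (use pH H1 s bg in \<open>auto simp: h'_def g_def residue_form_def\<close>)
    have b2: "der L (2 * \<kappa> * (1 + Suc (1 + 2 * k1)) + \<kappa> * (Suc (1 + 2 * k1) + 1) + 3 * k1) (?B # ?\<Delta>) (GE (residue_form 10 p 11 s))"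
      by (rule ge_split[OF _ bh(3,4) _ _ g2 g3]) (use cA fsz_GE[OF bf(2)] in \<open>auto simp: h_def h'_def\<close>)
    have b3: "der L (\<kappa> * (1 + 2 * k1 + (1 + 2 * k1))) (?B # ?\<Delta>) (GE (neg (residue_form 10 p 11 s)))"
      using b1 unfolding EQ_def
      by (intro ge_lincomb[where f = g and g = g and a = 1 and b = 0 and x = p and y = p and z = p])
        (use cA pH bf bg H1 s in \<open>auto simp: g_def residue_form_def\<close>)
    have b4: "EQ (\<kappa> * (12 + 12 * k1)) (?B # ?\<Delta>) (residue_form 10 p 11 s)"
      unfolding EQ_def using b2 b3 kappa_ge by (auto elim!: der_lines_mono simp: algebra_simps)
    have "\<kappa> * (12 + 12 * k1) \<le> \<kappa> * \<kappa>" using kappa_ge k1_ge by (intro mult_le_mono2) linarith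
    then have 2: "der L (N + q * \<kappa> ^ 5) (?B # ?\<Delta>) ?D"
      by (intro core[OF _ b4 s fA(2)]) (use cA k3 kappa_ge in linarith)+
    have wD: "csz ?\<Delta> + fsz (?C s) + 2 \<le> L" "csz [?C s] + fsz (?C s) + 2 \<le> L"
      using cA sz L_slack tau_ge by auto
    have 3: "der L 1 ?\<Delta> (Disj ?A ?B)" by (rule der_assume) (use cA sz L_slack tau_ge in auto)
    note 4 = der_disjE[OF 3 1 2]
    have cf: "?C s = Exists 2 (Disj (Equ (Add (nmul p (Var 2)) (numeral_trm s)) (Var 10))
        (Equ (Add (nmul p (Var 2)) (Var 10)) (numeral_trm s)))" by (simp add: congr_fm_def)
    have "der L 1 [?C s] (?C s)" by (rule der_assume) (use wD in auto)
    then have 5: "der L 1 [?C s] (Exists 2 (Disj (Equ (Add (nmul p (Var 2)) (numeral_trm s)) (Var 10))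
        (Equ (Add (nmul p (Var 2)) (Var 10)) (numeral_trm s))))" by (simp only: cf)
    have "der L (Suc (1 + Suc (1 + (N + q * \<kappa> ^ 5) + (N + q * \<kappa> ^ 5)))) [?C s] ?D"
      by (rule der_existsE[OF 5, of _ 11])
        (use 4 fC fvD nmul_vars[of p "Var 2"] vn in \<open>auto simp: nmul_tsubst numeral_trm_def congr_fm_def\<close>)
    then show ?thesis by (rule der_lines_mono) simp
  qed
  have sC: "fsz (disj_upto ?C (p - 1)) \<le> \<tau> * \<tau>" "fsz (residue_axiom p) \<le> \<tau> * \<tau>"
  proof -
    have *: "fsz (disj_upto (\<lambda>s. congr_fm p (Var z) (numeral_trm s)) (p - 1)) + 10 \<le> \<tau> * \<tau>" if "z < R" for z
    proof -
      have "fsz (disj_upto (\<lambda>s. congr_fm p (Var z) (numeral_trm s)) (p - 1)) \<le> (p - 1 + 1) * (10 * \<tau> + 3)"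
        by (rule fsz_disj_upto, rule fsz_congr) (use that mH' p2 in auto)
      also have "\<dots> \<le> H * (11 * \<tau>)" using mH' p2 tau_ge by (intro mult_le_mono) auto
      finally have "fsz (disj_upto (\<lambda>s. congr_fm p (Var z) (numeral_trm s)) (p - 1)) \<le> H * (11 * \<tau>)" .
      moreover have "(11 * (H + 1)) * \<tau> = H * (11 * \<tau>) + 11 * \<tau>" by (simp add: algebra_simps)
      ultimately have "fsz (disj_upto (\<lambda>s. congr_fm p (Var z) (numeral_trm s)) (p - 1)) + 10 \<le> (11 * (H + 1)) * \<tau>"
        using tau_ge by linarith
      also have "\<dots> \<le> \<tau> * \<tau>" by (rule mult_le_mono1) (use H_tau in simp)
      finally show ?thesis .
    qed
    show "fsz (disj_upto ?C (p - 1)) \<le> \<tau> * \<tau>" using *[of 10] R by simp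
    show "fsz (residue_axiom p) \<le> \<tau> * \<tau>" using *[of 0] R vsz_le[of 0] by (simp add: residue_axiom_def)
  qed
  have 1: "der L 1 [] (residue_axiom p)"
    by (rule der_axiom) (use sC L_slack2 p in \<open>auto simp: PrA_alt_def\<close>)
  have sub: "subst 0 (Var 10) (disj_upto (\<lambda>s. congr_fm p (Var 0) (numeral_trm s)) (p - 1)) = disj_upto ?C (p - 1)"
    by (simp add: congr_fm_def nmul_tsubst numeral_trm_def)
  have "der L (Suc 1) [] (disj_upto ?C (p - 1))"
    unfolding sub[symmetric]
  proof (rule der_forallE[OF 1[unfolded residue_axiom_def]])
    show "free_for (Var 10) 0 (disj_upto (\<lambda>s. congr_fm p (Var 0) (numeral_trm s)) (p - 1))"
      by (rule free_for_bvs) (auto simp: bvs_disj_upto congr_fm_def)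
    show "csz [] + fsz (subst 0 (Var 10) (disj_upto (\<lambda>s. congr_fm p (Var 0) (numeral_trm s)) (p - 1))) + 2 \<le> L"
      unfolding sub csz_simps using sC L_slack2 by linarith
  qed
  then have 2: "der L 2 [] (disj_upto ?C (p - 1))" by (rule der_lines_mono) simp
  have 3: "der L ((p - 1 + 1) * ((2 * (N + q * \<kappa> ^ 5) + 5) + 20)) [] (Imp (disj_upto ?C (p - 1)) ?D)"
  proof (rule der_disj_upto_imp)
    fix s assume "s \<le> p - 1"
    then show "der L (2 * (N + q * \<kappa> ^ 5) + 5) [?C s] ?D" using p2 by (intro each) auto
  next
    show "csz [] + 3 * fsz (disj_upto ?C (p - 1)) + 2 * fsz ?D + 20 \<le> L"
      using sC sD L_slack2 tau_sq unfolding csz_simps by linarith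
  qed
  note 4 = der_impE[OF 3 2]
  have 5: "der L (Suc (Suc ((p - 1 + 1) * ((2 * (N + q * \<kappa> ^ 5) + 5) + 20) + 2))) [] (Res ?m)"
    unfolding Res_def
  proof (rule der_forallI)
    show "der L (Suc ((p - 1 + 1) * ((2 * (N + q * \<kappa> ^ 5) + 5) + 20) + 2)) []
        (subst 3 (Var 10) (disj_upto (res_fm ?m 3) (?m - 1)))"
      using 4 by (simp add: res_fm_def[abs_def] tsubst_residue_trm)
    show "free_for (Var 10) 3 (disj_upto (res_fm ?m 3) (?m - 1))"
      by (rule free_for_bvs) (auto simp: bvs_disj_upto res_fm_def)
    show "10 \<notin> fvs [] \<union> fv (Forall 3 (disj_upto (res_fm ?m 3) (?m - 1)))"
      using vars_residue_trm by (fastforce simp: fv_disj_upto res_fm_def)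
    show "csz [] + fsz (Forall 3 (disj_upto (res_fm ?m 3) (?m - 1))) + 2 \<le> L"
      using fsz_res_disj[OF m1 mH'(1), of 3] R L_slack2 tau_sq vsz_le[of 3] unfolding csz_simps fsz_simps by linarith
  qed
  have "q * \<kappa> ^ 5 * 3 + 25 \<le> 3 * (q * \<kappa> ^ 6)"
  proof -
    have "1 * 1 \<le> q * \<kappa> ^ 5" using q kappa_ge by (intro mult_le_mono) auto
    then have "q * \<kappa> ^ 5 * 3 + 25 \<le> 100 * (q * \<kappa> ^ 5)" by linarith
    also have "\<dots> \<le> \<kappa> * (q * \<kappa> ^ 5)" using kappa_ge by (intro mult_le_mono1)
    finally show ?thesis by (simp add: eval_nat_numeral algebra_simps)
  qed
  then have "p * ((2 * (N + q * \<kappa> ^ 5) + 5) + 20) \<le> p * (3 * (N + q * \<kappa> ^ 6))"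
    by (intro mult_le_mono2) (simp add: algebra_simps)
  moreover have "p - 1 + 1 = p" "p * (3 * (N + q * \<kappa> ^ 6)) = 3 * p * (N + q * \<kappa> ^ 6)" using p2 by simp_all
  ultimately have "Suc (Suc ((p - 1 + 1) * ((2 * (N + q * \<kappa> ^ 5) + 5) + 20) + 2)) \<le> 3 * p * (N + q * \<kappa> ^ 6) + \<kappa>"
    using kappa_ge by (simp only:)
  with 5 show ?thesis by (rule der_lines_mono)
qed


text \<open>The prime factors of \<open>M\<close> are split off one by one. A factor p multiplies
  the number of lines by at most \<open>4 * p\<close>, and \<open>4 * p \<le> p ^ 4\<close> since p
  is at least 2; with the exponent 4 no constant accumulates over the factors. For M = 1 the number
  is its own quotient.\<close>

lemma der_Res:
  assumes "1 \<le> M" "100 * \<tau> \<le> G" "20 * M * M + 100 \<le> H"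
  shows "der L (\<kappa> ^ 7 * M ^ 4) [] (Res M)"
  using assms(1,3)
proof (induction M rule: less_induct)
  case (less M)
  show ?case
  proof (cases "M = 1")
    case True
    have R: "10 < R" using R20 by auto
    have e: "der L (30 * k0 * (20 * \<tau>) ^ 2) [] (Equ (Var 10) (residue_trm 1 0 10))"
      by (rule norm) (use tau_ge vsz_tau[of 10] R in \<open>auto simp: residue_trm_def\<close>)
    have s: "fsz (res_fm 1 z 0) \<le> 3 * \<tau>" if "z < R" for z by (rule fsz_res_fm) (use that H1 in auto)
    have e: "der L (Suc (30 * k0 * (20 * \<tau>) ^ 2)) [] (res_fm 1 10 0)"
      unfolding res_fm_def
      by (rule der_existsI[of _ _ _ _ "Var 10"])
        (use e s[of 10] R L_slack in \<open>auto simp: tsubst_residue_trm res_fm_def\<close>)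
    have "der L (Suc (Suc (30 * k0 * (20 * \<tau>) ^ 2))) [] (Res 1)"
      unfolding Res_def
    proof (rule der_forallI)
      show "der L (Suc (30 * k0 * (20 * \<tau>) ^ 2)) [] (subst 3 (Var 10) (disj_upto (res_fm 1 3) (1 - 1)))"
        using e by (simp add: res_fm_def tsubst_residue_trm)
      show "free_for (Var 10) 3 (disj_upto (res_fm 1 3) (1 - 1))"
        by (rule free_for_bvs) (auto simp: bvs_disj_upto res_fm_def)
      show "10 \<notin> fvs [] \<union> fv (Forall 3 (disj_upto (res_fm 1 3) (1 - 1)))"
        using vars_residue_trm[of 1 0 4] by (auto simp: res_fm_def)
      show "csz [] + fsz (Forall 3 (disj_upto (res_fm 1 3) (1 - 1))) + 2 \<le> L"
        using s[of 3] R L_slack vsz_le[of 3] tau_ge by simp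
    qed
    moreover have "Suc (Suc (30 * k0 * (20 * \<tau>) ^ 2)) \<le> \<kappa> ^ 7 * M ^ 4"
    proof -
      have "\<kappa> \<le> \<kappa> ^ 7" using self_le_power[of \<kappa> 7] kappa_ge by auto
      moreover
      have "Suc (Suc (30 * k0 * (20 * \<tau>) ^ 2)) \<le> k1" using scheme_bound_ge by (simp add: k1_def k0_def)
      then have "Suc (Suc (30 * k0 * (20 * \<tau>) ^ 2)) \<le> \<kappa>" using kappa_ge by linarith
      ultimately show ?thesis using True by simp
    qed
    ultimately show ?thesis using True der_lines_mono by blast
  next
    case False
    then obtain p where p: "prime p" "p dvd M" using prime_factor_nat by blast
    then obtain q where q: "M = p * q" by auto
    have p2: "2 \<le> p" using p(1) by (rule prime_ge_2_nat)
    have q1: "1 \<le> q" using q less.prems by (cases q) auto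
    have qM: "q < M" using q p2 q1 by simp
    have "20 * q * q \<le> 20 * M * M" using qM by (intro mult_le_mono) auto
    then have IH: "der L (\<kappa> ^ 7 * q ^ 4) [] (Res q)" using less.IH[OF qM q1] less.prems by simp
    have "der L (3 * p * (\<kappa> ^ 7 * q ^ 4 + q * \<kappa> ^ 6) + \<kappa>) [] (Res (p * q))"
      by (rule Res_mult[OF p(1) q1 IH assms(2)]) (use less.prems q in simp)
    moreover have "3 * p * (\<kappa> ^ 7 * q ^ 4 + q * \<kappa> ^ 6) + \<kappa> \<le> \<kappa> ^ 7 * M ^ 4"
    proof -
      let ?a = "\<kappa> ^ 7 * q ^ 4"
      have "q \<le> q ^ 4" using self_le_power[of q 4] q1 by auto
      then have "q * \<kappa> ^ 6 \<le> q ^ 4 * \<kappa> ^ 6" by simp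
      then have "100 * (q * \<kappa> ^ 6) \<le> \<kappa> * (q ^ 4 * \<kappa> ^ 6)" using kappa_ge by (intro mult_le_mono) auto
      then have b: "100 * (q * \<kappa> ^ 6) \<le> ?a" by (simp add: eval_nat_numeral algebra_simps)
      have "1 * \<kappa> \<le> q * \<kappa> ^ 6" using q1 self_le_power[of \<kappa> 6] kappa_ge by (intro mult_le_mono) auto
      then have k: "100 * \<kappa> \<le> ?a" using b by linarith
      have "p * (100 * (q * \<kappa> ^ 6)) \<le> p * ?a" using b by (rule mult_le_mono2)
      moreover have "1 * ?a \<le> p * ?a" using p2 by (intro mult_le_mono1) auto
      ultimately have "3 * p * (?a + q * \<kappa> ^ 6) + \<kappa> \<le> 4 * (p * ?a)"
      proof -
        have *: "p * (100 * b) \<le> p * a \<Longrightarrow> a \<le> p * a \<Longrightarrow> 100 * c \<le> a \<Longrightarrow> 3 * p * (a + b) + c \<le> 4 * (p * a)" for a b c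
        proof -
          assume "p * (100 * b) \<le> p * a" "a \<le> p * a" "100 * c \<le> a"
          moreover have "p * (100 * b) = 100 * (p * b)" "3 * p * (a + b) = 3 * (p * a) + 3 * (p * b)"
            by (simp_all add: algebra_simps)
          ultimately show ?thesis by linarith
        qed
        show ?thesis using * k \<open>p * (100 * (q * \<kappa> ^ 6)) \<le> p * ?a\<close> \<open>1 * ?a \<le> p * ?a\<close> by simp
      qed
      also have "\<dots> \<le> p ^ 4 * ?a"
      proof -
        have "2 ^ 3 \<le> p ^ 3" using p2 by (rule power_mono) simp
        then have "4 * p \<le> p ^ 3 * p" by (intro mult_le_mono1) simp
        then have "4 * p * ?a \<le> p ^ 4 * ?a" by (intro mult_le_mono1) (simp add: eval_nat_numeral algebra_simps)
        then show ?thesis by (simp add: mult.assoc)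
      qed
      finally show ?thesis using q by (simp add: power_mult_distrib algebra_simps)
    qed
    ultimately show ?thesis using q der_lines_mono by blast
  qed
qed

end

section \<open>Types of tuples of numbers\<close>

lemma abs_add_mult_le:
  fixes a b x y :: int
  assumes "\<bar>a\<bar> \<le> A" "\<bar>x\<bar> \<le> X" "\<bar>b\<bar> \<le> B" "\<bar>y\<bar> \<le> Y"
  shows "\<bar>a * x + b * y\<bar> \<le> A * X + B * Y"
proof -
  have "\<bar>a * x\<bar> \<le> A * X" "\<bar>b * y\<bar> \<le> B * Y" using assms by (auto simp: abs_mult intro!: mult_mono)
  then show ?thesis by linarith
qed

context calc begin

lemma val_lincomb: "val (\<lambda>i. a * f i + b * g i) e = a * val f e + b * val g e"
  by (simp add: val_def sum.distrib sum_distrib_left algebra_simps)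

lemma val_upd:
  assumes "10 \<le> z" "z < R"
  shows "val f (e(z := n)) = val (f(z := 0)) e + f z * int n"
proof -
  have "val f (e(z := n)) = (\<Sum>i<R. (f(z := 0)) i * int (ev0 e i) + (if i = z then f z * int n else 0))"
    unfolding val_def by (rule sum.cong) (use assms in \<open>auto simp: ev0_def\<close>)
  then show ?thesis using assms by (simp add: sum.distrib val_def)
qed

lemma val_const: "val (\<lambda>i. if i = 0 then c else 0) e = c"
proof -
  have "val (\<lambda>i. if i = 0 then c else 0) e = (\<Sum>i<R. if i = 0 then c else 0)"
    unfolding val_def by (rule sum.cong) (auto simp: ev0_def)
  then show ?thesis using R20 by simp
qed

lemma val_add_const: "val (\<lambda>i. f i + (if i = 0 then c else 0)) e = val f e + c"
  using val_lincomb[of 1 f 1 "\<lambda>i. if i = 0 then c else 0" e] by (simp add: val_const)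

text \<open>Coefficients and constants are bounded separately, because the former remain doubly
  exponential while the latter grow with the modulus and become triply exponential. Homogeneous
  forms are those with bound 0 for the constant.\<close>

definition over :: "nat set \<Rightarrow> nat \<Rightarrow> nat \<Rightarrow> (nat \<Rightarrow> int) \<Rightarrow> bool" where
  "over V A B f \<longleftrightarrow> (\<forall>i. i \<noteq> 0 \<longrightarrow> i \<notin> V \<longrightarrow> f i = 0) \<and> (\<forall>i. i \<noteq> 0 \<longrightarrow> \<bar>f i\<bar> \<le> int A) \<and> \<bar>f 0\<bar> \<le> int B"

lemma over_bd:
  assumes f: "over V A B f" and V: "V \<subseteq> {10..<R}" and AB: "A \<le> x" "B \<le> x"
  shows "form_bound x f"
  unfolding form_bound_def
proof (intro conjI allI impI)
  fix i
  have "\<bar>f i\<bar> \<le> int A \<or> \<bar>f i\<bar> \<le> int B" using f unfolding over_def by (cases "i = 0") auto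
  then show "\<bar>f i\<bar> \<le> int x" using AB by linarith
next
  fix i assume "f i \<noteq> 0"
  then have "i = 0 \<or> i \<in> V" using f unfolding over_def by blast
  then show "i = 0 \<or> 10 \<le> i \<and> i < R" using V by auto
qed

lemma over_mono:
  assumes f: "over V A B f" and le: "V \<subseteq> V'" "A \<le> A'" "B \<le> B'"
  shows "over V' A' B' f"
  unfolding over_def
proof (intro conjI allI impI)
  fix i assume "i \<noteq> 0" "i \<notin> V'"
  then show "f i = 0" using f le(1) unfolding over_def by blast
next
  fix i :: nat assume "i \<noteq> 0"
  then have "\<bar>f i\<bar> \<le> int A" using f unfolding over_def by blast
  then show "\<bar>f i\<bar> \<le> int A'" using le(2) by linarith
next
  have "\<bar>f 0\<bar> \<le> int B" using f unfolding over_def by blast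
  then show "\<bar>f 0\<bar> \<le> int B'" using le(3) by linarith
qed

lemma over_neg [simp]: "over V A B (neg f) \<longleftrightarrow> over V A B f" by (auto simp: over_def)

text \<open>\<open>\<Gamma>\<close> knows the signs at \<open>e\<close> of all forms over \<open>V\<close> with the given bounds, and it knows every
  homogeneous form over \<open>V\<close> modulo \<open>M\<close>. Variables from \<open>m\<close> on are unused.\<close>

definition decides :: "fm list \<Rightarrow> nat \<Rightarrow> nat \<Rightarrow> nat set \<Rightarrow> (nat \<Rightarrow> nat) \<Rightarrow> nat \<Rightarrow> nat \<Rightarrow> nat \<Rightarrow> nat \<Rightarrow> bool" where
  "decides \<Gamma> N m V e A B M W \<longleftrightarrow>
    (\<forall>f. over V A B f \<longrightarrow> 0 \<le> val f e \<longrightarrow> der L N \<Gamma> (GE f)) \<and>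
    (\<forall>f. over V A 0 f \<longrightarrow> (\<exists>U. form_bound W U \<and> (\<forall>i\<ge>m. U i = 0) \<and> EQ N \<Gamma> (\<lambda>i. f i - U i) \<and>
       (\<forall>i. i \<noteq> 0 \<longrightarrow> int M dvd U i) \<and> int M dvd U 0 - val f e))"

lemma EQ_weaken:
  assumes "EQ N \<Gamma> f" "set \<Gamma> \<subseteq> set \<Delta>" "csz \<Delta> \<le> G" "form_bound H f"
  shows "EQ (Suc N) \<Delta> f"
  using assms fsz_GE[of f] fsz_GE[of "neg f"] L_slack tau_ge
  unfolding EQ_def by (auto intro!: der_weaken)

lemma ge_weaken:
  assumes "der L N \<Gamma> (GE f)" "set \<Gamma> \<subseteq> set \<Delta>" "csz \<Delta> \<le> G" "form_bound H f"
  shows "der L (Suc N) \<Delta> (GE f)"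
  using assms fsz_GE[of f] L_slack tau_ge by (auto intro!: der_weaken)

end

text \<open>\<open>Q\<close> bounds the coefficients, constants and moduli that occur in
  descriptions. The fifth power in \<open>H\<close> leaves room for the auxiliary forms, which arise
  from these by a few multiplications.\<close>

locale lev = calc +
  fixes Q :: nat
  assumes Q1: "1 \<le> Q" and QH: "1000 * Q ^ 5 \<le> H"
begin

lemma Qpow: "Q \<le> Q ^ 2" "Q ^ 2 \<le> Q ^ 3" "Q ^ 3 \<le> Q ^ 4" "Q ^ 4 \<le> Q ^ 5" "Q \<le> H" "1 \<le> Q ^ 2"
proof -
  show "Q \<le> Q ^ 2" using self_le_power[of Q 2] Q1 by auto
  show "Q ^ 2 \<le> Q ^ 3" "Q ^ 3 \<le> Q ^ 4" "Q ^ 4 \<le> Q ^ 5" by (rule power_increasing; use Q1 in simp)+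
  then show "Q \<le> H" using \<open>Q \<le> Q ^ 2\<close> QH by linarith
  show "1 \<le> Q ^ 2" using Q1 by simp
qed

lemma Qmult1: "x \<le> Q \<Longrightarrow> y \<le> Q \<Longrightarrow> x * y \<le> Q ^ 2"
  by (simp add: power2_eq_square mult_le_mono)

end

text \<open>The primed bounds describe what \<open>\<Gamma>\<close> knows about \<open>V\<close>, the others what its extensions are to know
  about \<open>V\<close> and the new variable \<open>m\<close>, whose quotient by \<open>M\<close> is named by the next variable.\<close>

locale step = lev +
  fixes A B C M W A' B' M' m :: nat and V :: "nat set" and e :: "nat \<Rightarrow> nat" and \<Gamma> :: "fm list" and N :: nat
  assumes A1: "1 \<le> A" and M1: "1 \<le> M" and CB: "A * M + B \<le> C"
    and A': "2 * A * A \<le> A'" and B': "2 * A * (C + 1) \<le> B'" and M': "\<And>a. 1 \<le> a \<Longrightarrow> a \<le> A \<Longrightarrow> a * M dvd M'"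
    and M'1: "1 \<le> M'"
    and Qb: "A' \<le> Q" "B' \<le> Q" "M' \<le> Q" "W + A * M \<le> Q"
    and m: "10 \<le> m" "m + 1 < R" and V: "V \<subseteq> {10..<m}" and fG: "fvs \<Gamma> \<subseteq> {..<m}" and cG: "csz \<Gamma> + 200 * \<tau> \<le> G"
    and dec: "decides \<Gamma> N m V e A' B' M' W" and N1: "1 \<le> N"
begin

abbreviation "z \<equiv> m"
abbreviation "w \<equiv> Suc m"

text \<open>The primed bounds have these origins. \<open>A'\<close> and \<open>B'\<close> cover the
  forms that result when z is eliminated from two forms, so that coefficients get multiplied.
  \<open>C\<close> covers a form bounded by \<open>B\<close> after a shift of z by one period
  \<open>M\<close>. And \<open>M'\<close> is a multiple of a * M, because from a * z = s the residue
  of z modulo M can be read off only if s is known modulo a * M.\<close>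

lemma bounds: "A \<le> A'" "C + 1 \<le> B'" "B \<le> C" "A \<le> Q" "B \<le> Q" "C + 1 \<le> Q" "M \<le> Q" "W \<le> Q" "A * B + A * C \<le> B'" "M \<le> C"
  "A * M \<le> C" "B \<le> B'"
proof -
  have "A * 1 \<le> A * A" using A1 by (intro mult_le_mono2)
  then show "A \<le> A'" using A' by linarith
  have "1 * (C + 1) \<le> A * (C + 1)" using A1 by (intro mult_le_mono1)
  also have "A * (C + 1) \<le> 2 * A * (C + 1)" by simp
  also note B'
  finally show C: "C + 1 \<le> B'" by simp
  show B: "B \<le> C" using CB by simp
  have "1 * M \<le> A * M" using A1 by (intro mult_le_mono1)
  then show "M \<le> C" using CB by linarith
  show "A * M \<le> C" using CB by simp
  then show "A \<le> Q" "B \<le> Q" "C + 1 \<le> Q" "M \<le> Q" "W \<le> Q" "B \<le> B'" using \<open>A \<le> A'\<close> C B \<open>M \<le> C\<close> Qb by auto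
  have "A * B \<le> A * C" using B by (rule mult_le_mono2)
  moreover have "2 * A * (C + 1) = 2 * (A * C) + 2 * A" by simp
  ultimately show "A * B + A * C \<le> B'" using B' by linarith
qed

lemma VR: "V \<subseteq> {10..<R}" "insert z V \<subseteq> {10..<R}" using V m by auto

lemma zw: "10 \<le> z" "z < R" "10 \<le> w" "w < R" "z \<notin> V" "w \<notin> V" using m V by auto

lemma dec_ge: "over V A' B' f \<Longrightarrow> 0 \<le> val f e \<Longrightarrow> der L N \<Gamma> (GE f)"
  using dec by (simp add: decides_def)

lemma dec_res:
  assumes "over V A 0 f"
  obtains U where "form_bound W U" "\<And>i. m \<le> i \<Longrightarrow> U i = 0" "EQ N \<Gamma> (\<lambda>i. f i - U i)"
    "\<And>i. i \<noteq> 0 \<Longrightarrow> int M' dvd U i" "int M' dvd U 0 - val f e" "form_bound (2 * Q) (\<lambda>i. f i - U i)"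
proof -
  have "over V A' 0 f" by (rule over_mono[OF assms]) (use bounds in auto)
  then obtain U where U: "form_bound W U" "\<forall>i\<ge>m. U i = 0" "EQ N \<Gamma> (\<lambda>i. f i - U i)"
    "\<forall>i. i \<noteq> 0 \<longrightarrow> int M' dvd U i" "int M' dvd U 0 - val f e"
    using dec unfolding decides_def by blast
  have "form_bound Q f" by (rule over_bd[OF assms VR(1)]) (use bounds in auto)
  moreover have "form_bound Q (neg U)" using U(1) bounds by (auto elim: form_bound_mono)
  ultimately have "form_bound (2 * Q) (\<lambda>i. f i + neg U i)" by (rule form_bound_add) simp
  then show ?thesis using U that by auto
qed

lemma MM': "int M dvd int M'" using M'[of 1] A1 by (simp add: int_dvd_int_iff)

lemma res_ext:
  assumes D: "set \<Gamma> \<subseteq> set \<Delta>" "csz \<Delta> \<le> G" and q: "EQ K \<Delta> (residue_form z M w r)" "r < M" "n mod M = r"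
    and f: "over (insert z V) A 0 f"
  shows "\<exists>U. form_bound (W + A * M) U \<and> (\<forall>i\<ge>m + 2. U i = 0) \<and> EQ (\<kappa> * (Suc N + K)) \<Delta> (\<lambda>i. f i - U i) \<and>
       (\<forall>i. i \<noteq> 0 \<longrightarrow> int M dvd U i) \<and> int M dvd U 0 - val f (e(z := n))"
proof -
  let ?t = "f(z := 0)"
  have ot: "over V A 0 ?t" using f zw unfolding over_def by auto
  obtain U where U: "form_bound W U" "\<And>i. m \<le> i \<Longrightarrow> U i = 0" "EQ N \<Gamma> (\<lambda>i. ?t i - U i)"
    "\<And>i. i \<noteq> 0 \<Longrightarrow> int M' dvd U i" "int M' dvd U 0 - val ?t e" "form_bound (2 * Q) (\<lambda>i. ?t i - U i)"
    using dec_res[OF ot] by blast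
  define b where "b = f z"
  have b: "\<bar>b\<bar> \<le> int A" using f zw unfolding over_def b_def by auto
  define X where "X = (\<lambda>i. if i = 0 then b * int r else if i = w then b * int M else 0)"
  have bX: "form_bound (A * M) X"
  proof -
    have "\<bar>b * int r\<bar> \<le> int A * int M" "\<bar>b * int M\<bar> \<le> int A * int M"
      using b q(2) by (auto simp: abs_mult intro!: mult_mono)
    then show ?thesis using zw unfolding form_bound_def X_def by auto
  qed
  have bU: "form_bound (W + A * M) (\<lambda>i. U i + X i)" by (rule form_bound_add[OF U(1) bX]) simp
  have bfin: "form_bound (2 * Q) (\<lambda>i. f i - (U i + X i))"
  proof -
    have "form_bound Q f" by (rule over_bd[OF f VR(2)]) (use bounds in auto)
    moreover have "form_bound Q (neg (\<lambda>i. U i + X i))" using bU Qb by (simp del: neg_apply) (erule form_bound_mono)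
    ultimately have "form_bound (2 * Q) (\<lambda>i. f i + neg (\<lambda>i. U i + X i) i)" by (rule form_bound_add) simp
    moreover have "(\<lambda>i. f i + neg (\<lambda>i. U i + X i) i) = (\<lambda>i. f i - (U i + X i))" by auto
    ultimately show ?thesis by simp
  qed
  have "form_bound H (\<lambda>i. ?t i - U i)" by (rule form_bound_mono[OF U(6)]) (use QH Qpow in linarith)
  then have e1: "EQ (Suc N) \<Delta> (\<lambda>i. ?t i - U i)" by (rule EQ_weaken[OF U(3) D])
  have "EQ (\<kappa> * (Suc N + K)) \<Delta> (\<lambda>i. f i - (U i + X i))"
  proof (rule EQ_lincomb[OF D(2) U(6) _ bfin _ _ _ _ _ e1 q(1)])
    show "form_bound Q (residue_form z M w r)" by (rule form_bound_residue_form) (use zw q bounds Q1 in auto)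
    have "nat \<bar>b\<bar> * Q \<le> Q ^ 2" by (rule Qmult1) (use b bounds in auto)
    then show "nat \<bar>1\<bar> * (2 * Q) + nat \<bar>b\<bar> * Q + 2 * Q \<le> H" using QH Qpow by simp
    show "f i - (U i + X i) = 1 * (?t i - U i) + b * residue_form z M w r i" for i
      using U(2) zw by (auto simp: X_def residue_form_def b_def)
  qed (use b bounds Q1 QH Qpow H1 in auto)
  moreover have "int M dvd U i + X i" if "i \<noteq> 0" for i
    using dvd_trans[OF MM' U(4)[OF that]] that by (auto simp: X_def)
  moreover have "int M dvd U 0 + X 0 - val f (e(z := n))"
  proof -
    have 1: "int M dvd U 0 - val ?t e" by (rule dvd_trans[OF MM' U(5)])
    have 2: "int M dvd int r - int n" using q(3) by (metis mod_eq_dvd_iff mod_mod_trivial zmod_int)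
    have 3: "U 0 + X 0 - val f (e(z := n)) = (U 0 - val ?t e) + b * (int r - int n)"
      using val_upd[OF zw(1,2), of f e n] by (simp add: X_def b_def algebra_simps)
    show ?thesis unfolding 3 using 1 2 by (intro dvd_add dvd_mult)
  qed
  moreover have "\<forall>i\<ge>m + 2. U i + X i = 0" using U(2) by (auto simp: X_def)
  ultimately show ?thesis using bU by (intro exI[of _ "\<lambda>i. U i + X i"]) blast
qed

text \<open>An equation f = 0 with coefficient a > 0 at z determines all signs. To decide g with
  coefficient b at z, form a * g - b * f: it is free of z and thus known to the old context. Adding
  b * f = 0 gives a * g \<ge> 0, and division by a gives g \<ge> 0.\<close>

lemma near_dec:
  assumes D: "set \<Gamma> \<subseteq> set \<Delta>" "csz \<Delta> + 100 * \<tau> \<le> G"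
    and q: "EQ K \<Delta> (residue_form z M w r)" "r < M" "n mod M = r"
    and f: "over (insert z V) A C f" "0 < f z" "EQ K \<Delta> f" "val f (e(z := n)) = 0"
  shows "decides \<Delta> (\<kappa> ^ 4 * (N + K)) (m + 2) (insert z V) (e(z := n)) A B M (W + A * M)"
  unfolding decides_def
proof (intro conjI allI impI)
  have cD: "csz \<Delta> \<le> G" using D by simp
  have K1: "1 \<le> K" using q(1) der_ge1 unfolding EQ_def by blast
  fix g assume g: "over (insert z V) A 0 g"
  from res_ext[OF D(1) cD q g] obtain U where U: "form_bound (W + A * M) U" "\<forall>i\<ge>m + 2. U i = 0" "EQ (\<kappa> * (Suc N + K)) \<Delta> (\<lambda>i. g i - U i)"
       "\<forall>i. i \<noteq> 0 \<longrightarrow> int M dvd U i" "int M dvd U 0 - val g (e(z := n))" by blast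
  have "\<kappa> * (Suc N + K) \<le> \<kappa> ^ 4 * (N + K)"
  proof -
    have "Suc N + K \<le> 2 * (N + K)" using N1 by simp
    moreover have "2 \<le> \<kappa> ^ 3" using self_le_power[of \<kappa> 3] kappa_ge by linarith
    ultimately have "Suc N + K \<le> \<kappa> ^ 3 * (N + K)" by (meson le_trans mult_le_mono1)
    then have "\<kappa> * (Suc N + K) \<le> \<kappa> * (\<kappa> ^ 3 * (N + K))" by (rule mult_le_mono2)
    then show ?thesis by (simp add: eval_nat_numeral algebra_simps)
  qed
  then have "EQ (\<kappa> ^ 4 * (N + K)) \<Delta> (\<lambda>i. g i - U i)" using U(3) EQ_mono by blast
  then show "\<exists>U. form_bound (W + A * M) U \<and> (\<forall>i\<ge>m + 2. U i = 0) \<and> EQ (\<kappa> ^ 4 * (N + K)) \<Delta> (\<lambda>i. g i - U i) \<and>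
       (\<forall>i. i \<noteq> 0 \<longrightarrow> int M dvd U i) \<and> int M dvd U 0 - val g (e(z := n))" using U by blast
next
  have cD: "csz \<Delta> \<le> G" "csz \<Delta> + 20 * \<tau> \<le> G" using D by auto
  fix g assume g: "over (insert z V) A B g" "0 \<le> val g (e(z := n))"
  define a where "a = nat (f z)"
  have "\<bar>f z\<bar> \<le> int A" using f(1) zw unfolding over_def by auto
  then have a: "1 \<le> a" "int a = f z" "a \<le> A" using f(2) unfolding a_def by auto
  define b where "b = g z"
  have b: "\<bar>b\<bar> \<le> int A" using g zw unfolding over_def b_def by auto
  define h where "h = (\<lambda>i. int a * g i + (- b) * f i)"
  have hz: "h z = 0" using a by (simp add: h_def b_def)
  have oh: "over V A' B' h"
    unfolding over_def
  proof (intro conjI allI impI)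
    fix i assume "i \<noteq> 0" "i \<notin> V"
    then show "h i = 0" using f(1) g(1) hz unfolding h_def over_def by (cases "i = z") auto
  next
    fix i :: nat assume i: "i \<noteq> 0"
    have "\<bar>h i\<bar> \<le> int A * int A + int A * int A" unfolding h_def
      by (rule abs_add_mult_le) (use i f(1) g(1) a b in \<open>auto simp: over_def\<close>)
    also have "\<dots> \<le> int A'" using A' by (metis of_nat_add of_nat_le_iff of_nat_mult mult_2 mult.assoc)
    finally show "\<bar>h i\<bar> \<le> int A'" .
  next
    have "\<bar>h 0\<bar> \<le> int A * int B + int A * int C" unfolding h_def
      by (rule abs_add_mult_le) (use f(1) g(1) a b in \<open>auto simp: over_def\<close>)
    also have "\<dots> \<le> int B'" using bounds(9) by (metis of_nat_add of_nat_le_iff of_nat_mult)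
    finally show "\<bar>h 0\<bar> \<le> int B'" .
  qed
  have "val h e = val h (e(z := n))" using val_upd[OF zw(1,2), of h e n] hz by (simp add: fun_upd_idem)
  also have "\<dots> = int a * val g (e(z := n))" unfolding h_def val_lincomb using f(4) by simp
  finally have "0 \<le> val h e" using g(2) by simp
  then have "der L N \<Gamma> (GE h)" by (rule dec_ge[OF oh])
  moreover have bh: "form_bound Q h" by (rule over_bd[OF oh VR(1)]) (use Qb in auto)
  ultimately have 1: "der L (Suc N) \<Delta> (GE h)" by (intro ge_weaken[OF _ D(1) cD(1)]) (use Qpow in \<open>auto elim: form_bound_mono\<close>)
  have bf: "form_bound Q f" by (rule over_bd[OF f(1) VR(2)]) (use bounds in auto)
  have bg: "form_bound Q g" by (rule over_bd[OF g(1) VR(2)]) (use bounds in auto)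
  have aQ: "a * Q \<le> Q ^ 2" "nat \<bar>b\<bar> * Q \<le> Q ^ 2" by (rule Qmult1; use a b bounds in auto)+
  have bag: "form_bound (Q ^ 2) (\<lambda>i. int a * g i)" by (rule form_bound_scale[OF bg aQ(1)])
  have 2: "der L (\<kappa> * (Suc N + K)) \<Delta> (GE (\<lambda>i. int a * g i))"
  proof (rule ge_eq_lincomb[OF cD(1) bh bf bag _ _ _ _ _ 1 f(3), of 1 b])
    show "int 1 * h i + b * f i \<le> int a * g i" for i by (simp add: h_def)
    show "1 * Q + nat \<bar>b\<bar> * Q + Q ^ 2 \<le> H" using aQ QH Qpow by linarith
  qed (use b bounds Qpow H1 in auto)
  have "der L (\<kappa> ^ 2 * (\<kappa> * (Suc N + K))) \<Delta> (GE g)"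
  proof (rule ge_round[OF cD(2) bag bg _ a(1) _ 2])
    have "a * (Q + 1) \<le> Q ^ 2 + Q" using aQ a bounds by (simp add: algebra_simps)
    then show "a * (Q + 1) + Q ^ 2 + 1 \<le> H" using QH Qpow by linarith
  qed (use a bounds Qpow in auto)
  moreover have "\<kappa> ^ 2 * (\<kappa> * (Suc N + K)) \<le> \<kappa> ^ 4 * (N + K)"
  proof -
    have "Suc N + K \<le> 2 * (N + K)" using N1 by simp
    also have "\<dots> \<le> \<kappa> * (N + K)" using kappa_ge by (intro mult_le_mono1) linarith
    finally have "\<kappa> ^ 2 * (\<kappa> * (Suc N + K)) \<le> \<kappa> ^ 2 * (\<kappa> * (\<kappa> * (N + K)))" by (intro mult_le_mono2)
    then show ?thesis by (simp add: eval_nat_numeral algebra_simps)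
  qed
  ultimately show "der L (\<kappa> ^ 4 * (N + K)) \<Delta> (GE g)" by (rule der_lines_mono)
qed

text \<open>The contradiction in the first case comes from divisibility or from nonnegativity.\<close>

lemma near_cases:
  assumes D: "set \<Gamma> \<subseteq> set \<Delta>" "csz \<Delta> + 100 * \<tau> \<le> G"
    and q: "EQ K \<Delta> (residue_form z M w r)" "r < M"
    and f: "over (insert z V) A C f" "0 < f z" "EQ K \<Delta> f"
  shows "(\<forall>\<chi>. fsz \<chi> \<le> 100 * \<tau> \<longrightarrow> der L (\<kappa> ^ 8 * (N + K)) \<Delta> \<chi>) \<or>
    (\<exists>n. val f (e(z := n)) = 0 \<and> n mod M = r)"
proof -
  have cD: "csz \<Delta> \<le> G" "csz \<Delta> + 20 * \<tau> \<le> G" using D by auto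
  have K1: "1 \<le> K" using q(1) der_ge1 unfolding EQ_def by blast
  have NK: "Suc N \<le> 2 * (N + K)" "Suc N + K \<le> 2 * (N + K)" "K + K \<le> 2 * (N + K)" using N1 by auto
  define a where "a = nat (f z)"
  have "\<bar>f z\<bar> \<le> int A" using f(1) zw unfolding over_def by auto
  then have a: "1 \<le> a" "int a = f z" "a \<le> A" using f(2) unfolding a_def by auto
  \<comment> \<open>Thus f = a * z - s + f 0, and a root of f satisfies a * z = s - f 0.\<close>
  define s where "s = (\<lambda>i. if i = 0 \<or> i = z then 0 else - f i)"
  have os: "over V A 0 s" using f(1) zw unfolding over_def s_def by auto
  obtain U where U: "form_bound W U" "\<And>i. m \<le> i \<Longrightarrow> U i = 0" "EQ N \<Gamma> (\<lambda>i. s i - U i)"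
    "\<And>i. i \<noteq> 0 \<Longrightarrow> int M' dvd U i" "int M' dvd U 0 - val s e" "form_bound (2 * Q) (\<lambda>i. s i - U i)"
    using dec_res[OF os] by blast
  have aMM: "int (a * M) dvd int M'" using M'[OF a(1,3)] by (simp only: int_dvd_int_iff)
  have aM: "a * M \<le> Q ^ 2" "1 \<le> a * M" "a * Q \<le> Q ^ 2"
    using a bounds M1 by (auto intro!: Qmult1)
  \<comment> \<open>The result of putting z = M * w + r and s = U into f. Its nonconstant
    coefficients are divisible by a * M, so the equation g = 0 is refutable unless its constant is
    divisible as well.\<close>
  define g where "g = (\<lambda>i. (if i = 0 then f 0 + int a * int r else if i = w then int (a * M) else 0) - U i)"
  have valf: "val f (e(z := n)) = int a * int n - (val s e - f 0)" for n
  proof -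
    have "f(z := 0) = (\<lambda>i. neg s i + (if i = 0 then f 0 else 0))" using zw by (auto simp: s_def)
    then have "val (f(z := 0)) e = - val s e + f 0" using val_add_const[of "neg s" "f 0" e] by simp
    then show ?thesis using val_upd[OF zw(1,2), of f e n] a by simp
  qed
  have bf: "form_bound Q f" by (rule over_bd[OF f(1) VR(2)]) (use bounds in auto)
  have br: "form_bound Q (residue_form z M w r)" by (rule form_bound_residue_form) (use zw q bounds Q1 in auto)
  show ?thesis
  proof (cases "int (a * M) dvd g 0")
    case False
    define g1 where "g1 = (\<lambda>i. 1 * f i + (- int a) * residue_form z M w r i)"
    have b1: "form_bound (2 * Q ^ 2) g1"
    proof -
      have "form_bound (Q ^ 2) (\<lambda>i. int a * neg (residue_form z M w r) i)"
        by (rule form_bound_scale[of Q "neg (residue_form z M w r)"]) (use br aM in auto)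
      then have "form_bound (2 * Q ^ 2) (\<lambda>i. f i + int a * neg (residue_form z M w r) i)"
        by (rule form_bound_add[OF bf]) (use Qpow in linarith)
      then show ?thesis by (simp add: g1_def)
    qed
    have e1: "EQ (\<kappa> * (K + K)) \<Delta> g1"
    proof (rule EQ_lincomb[OF cD(1) bf br b1 _ _ _ _ _ f(3) q(1)])
      show "nat \<bar>1\<bar> * Q + nat \<bar>- int a\<bar> * Q + 2 * Q ^ 2 \<le> H" using aM QH Qpow by simp
    qed (use a bounds Qpow H1 in \<open>auto simp: g1_def\<close>)
    have "form_bound H (\<lambda>i. s i - U i)" by (rule form_bound_mono[OF U(6)]) (use QH Qpow in linarith)
    then have e2: "EQ (Suc N) \<Delta> (\<lambda>i. s i - U i)" by (rule EQ_weaken[OF U(3) D(1) cD(1)])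
    have gg: "g i = 1 * g1 i + 1 * (s i - U i)" for i
      using a f(1) U(2)[of z] U(2)[of w] zw m unfolding g_def g1_def s_def residue_form_def over_def by auto
    have bg: "form_bound (4 * Q ^ 2) g"
      unfolding gg[abs_def] mult_1 by (rule form_bound_add[OF b1 U(6)]) (use Qpow in linarith)
    have e3: "EQ (\<kappa> * (\<kappa> * (K + K) + Suc N)) \<Delta> g"
      by (rule EQ_lincomb[OF cD(1) b1 U(6) bg _ _ _ _ _ e1 e2 gg]) (use QH Qpow H1 in auto)
    have "der L (\<kappa> ^ 4 * (\<kappa> * (\<kappa> * (K + K) + Suc N))) \<Delta> \<chi>" if c: "fsz \<chi> \<le> 100 * \<tau>" for \<chi>
    proof (rule EQ_div_falsum[OF cD(2) bg aM(2) _ _ e3 _ False c])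
      have "a * M * (4 * Q ^ 2 + 3) \<le> Q ^ 2 * (4 * Q ^ 2 + 3)" using aM by (intro mult_le_mono1)
      also have "\<dots> = 4 * Q ^ 4 + 3 * Q ^ 2" by (simp add: eval_nat_numeral algebra_simps)
      finally show "a * M * (4 * Q ^ 2 + 3) + 3 * (4 * Q ^ 2) + 5 \<le> H" using QH Qpow Q1 by linarith
      show "a * M \<le> H" using aM QH Qpow by linarith
      fix i :: nat assume i: "i \<noteq> 0"
      have "int (a * M) dvd U i" by (rule dvd_trans[OF aMM U(4)[OF i]])
      then show "int (a * M) dvd g i" using i by (auto simp: g_def)
    qed
    moreover have "\<kappa> ^ 4 * (\<kappa> * (\<kappa> * (K + K) + Suc N)) \<le> \<kappa> ^ 8 * (N + K)"
    proof -
      have "\<kappa> * (K + K) + Suc N \<le> \<kappa> * (2 * (N + K)) + 2 * (N + K)"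
        using NK by (intro add_mono mult_le_mono2)
      also have "\<dots> = (\<kappa> * 2 + 2) * (N + K)" by (simp add: algebra_simps)
      also have "\<dots> \<le> (\<kappa> * \<kappa>) * (N + K)"
      proof (rule mult_le_mono1)
        have "100 * \<kappa> \<le> \<kappa> * \<kappa>" using kappa_ge(1) by (rule mult_le_mono1)
        then show "\<kappa> * 2 + 2 \<le> \<kappa> * \<kappa>" using kappa_ge(1) by linarith
      qed
      finally have "\<kappa> ^ 4 * (\<kappa> * (\<kappa> * (K + K) + Suc N)) \<le> \<kappa> ^ 4 * (\<kappa> * (\<kappa> * \<kappa> * (N + K)))"
        by (intro mult_le_mono2)
      also have "\<dots> = \<kappa> ^ 7 * (N + K)" by (simp add: eval_nat_numeral)
      also have "\<dots> \<le> \<kappa> ^ 8 * (N + K)" by (intro mult_le_mono1 power_increasing) (use kappa_ge in auto)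
      finally show ?thesis .
    qed
    ultimately show ?thesis using der_lines_mono by blast
  next
    case True
    \<comment> \<open>The residue of s that the context knows is the true one at e. Hence
      divisibility passes to the number s - f 0, and the root n is an integer congruent to
      r.\<close>
    have "int (a * M) dvd U 0 - val s e" by (rule dvd_trans[OF aMM U(5)])
    with True have "int (a * M) dvd g 0 + (U 0 - val s e)" by (rule dvd_add)
    then have dv: "int (a * M) dvd int a * int r - (val s e - f 0)" by (simp add: g_def algebra_simps)
    then have "int a dvd int a * int r - (val s e - f 0)" by (metis dvd_mult_left of_nat_mult)
    from dvd_diff[OF dvd_triv_left this, of "int r"] have "int a dvd val s e - f 0" by simp
    then obtain n where n: "val s e - f 0 = int a * n" by auto
    show ?thesis
    proof (cases "0 \<le> n")
      case pos: True
      have "int a * int M dvd int a * (int r - n)" using dv n by (simp add: algebra_simps)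
      then have "int M dvd int r - int (nat n)" using a pos by simp
      then have "int (nat n) mod int M = int r mod int M" by (metis mod_eq_dvd_iff)
      then have "nat n mod M = r" using q(2) by (metis mod_less of_nat_eq_iff zmod_int)
      moreover have "val f (e(z := nat n)) = 0" using valf[of "nat n"] n pos by simp
      ultimately show ?thesis by blast
    next
      case False
      have "val s e - f 0 < 0" using n a False by (simp add: mult_pos_neg)
      \<comment> \<open>If the root is negative, then t = f 0 - 1 - s is nonnegative at e and hence
        provably so. But t - f = - 1 - a * z has no positive coefficient and a negative
        constant.\<close>
      define t where "t = (\<lambda>i. neg s i + (if i = 0 then f 0 - 1 else 0))"
      have vt: "val t e = f 0 - 1 - val s e" unfolding t_def val_add_const val_neg by simp
      have ot: "over V A' B' t"
        unfolding over_def
      proof (intro conjI allI impI)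
        fix i assume "i \<noteq> 0" "i \<notin> V" then show "t i = 0" using os by (auto simp: t_def over_def)
      next
        fix i :: nat assume "i \<noteq> 0"
        then have "\<bar>t i\<bar> \<le> int A" using os by (auto simp: t_def over_def)
        then show "\<bar>t i\<bar> \<le> int A'" using bounds by linarith
      next
        have "\<bar>f 0\<bar> \<le> int C" "s 0 = 0" using f(1) by (auto simp: over_def s_def)
        then have "\<bar>t 0\<bar> \<le> int (C + 1)" by (simp add: t_def)
        then show "\<bar>t 0\<bar> \<le> int B'" using bounds by linarith
      qed
      have "der L N \<Gamma> (GE t)" by (rule dec_ge[OF ot]) (use vt \<open>val s e - f 0 < 0\<close> in linarith)
      moreover have bt: "form_bound Q t" by (rule over_bd[OF ot VR(1)]) (use Qb in auto)
      ultimately have 1: "der L (Suc N) \<Delta> (GE t)" by (intro ge_weaken[OF _ D(1) cD(1)]) (use Qpow in \<open>auto elim: form_bound_mono\<close>)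
      have 2: "der L K \<Delta> (GE (neg f))" using f(3) by (simp add: EQ_def)
      have "der L (2 * \<kappa> * (Suc N + K)) \<Delta> \<chi>" if c: "fsz \<chi> \<le> 100 * \<tau>" for \<chi>
      proof (rule ge_falsum[OF cD(1) bt _ _ _ H1 H1 _ 1 2 _ _ c])
        show "form_bound Q (neg f)" using bf by simp
        show "1 * Q + 1 * Q + 1 \<le> H" using QH Qpow Q1 by linarith
        fix i :: nat assume "i \<noteq> 0" then show "int 1 * t i + int 1 * neg f i \<le> 0"
          using a f(2) os zw by (auto simp: t_def s_def over_def)
      qed (use Qpow in \<open>auto simp: t_def s_def\<close>)
      moreover have "2 * \<kappa> * (Suc N + K) \<le> \<kappa> ^ 8 * (N + K)"
      proof -
        have "2 * \<kappa> * (Suc N + K) \<le> 2 * \<kappa> * (2 * (N + K))" using NK by (intro mult_le_mono2)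
        also have "\<dots> = 4 * (\<kappa> * (N + K))" by simp
        also have "\<dots> \<le> \<kappa> * (\<kappa> * (N + K))" by (intro mult_le_mono1) (use kappa_ge in linarith)
        also have "\<dots> = \<kappa> ^ 2 * (N + K)" by (simp add: power2_eq_square)
        also have "\<dots> \<le> \<kappa> ^ 8 * (N + K)" by (intro mult_le_mono1 power_increasing) (use kappa_ge in auto)
        finally show ?thesis .
      qed
      ultimately show ?thesis using der_lines_mono by blast
    qed
  qed
qed

end

section \<open>The case in which all homogeneous forms in the new variable are far from 0\<close>

context step begin

text \<open>Up to sign these are all homogeneous forms, within the bound, that involve z. Far above
  0 such a form gives a lower bound for z, far below 0 an upper bound.\<close>

definition pos_forms :: "(nat \<Rightarrow> int) set" where
  "pos_forms = {f. over (insert z V) A 0 f \<and> 0 < f z}"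

text \<open>For a homogeneous form \<open>f\<close> this is \<open>f - C - 1\<close>.\<close>

definition above :: "(nat \<Rightarrow> int) \<Rightarrow> nat \<Rightarrow> int" where
  "above f = f(0 := - int C - 1)"

text \<open>The combination that eliminates z from a lower and an upper bound; it explains the
  growth of the coefficients from A to 2 * A * A.\<close>

lemma over_comb:
  assumes "over U A 0 f" "over U A 0 g" "0 \<le> f z" "0 \<le> g z" "z \<noteq> 0"
  shows "over (U - {z}) (2 * A * A) 0 (\<lambda>i. g z * f i + (- f z) * g i)"
  unfolding over_def
proof (intro conjI allI impI)
  fix i assume "i \<noteq> 0" "i \<notin> U - {z}"
  then show "g z * f i + - f z * g i = 0" using assms by (cases "i = z") (auto simp: over_def)
next
  fix i :: nat assume i: "i \<noteq> 0"
  have "\<bar>f z\<bar> \<le> int A" "\<bar>g z\<bar> \<le> int A" using assms(1,2,5) unfolding over_def by blast+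
  then have "\<bar>g z * f i + - f z * g i\<bar> \<le> int A * int A + int A * int A"
    by (intro abs_add_mult_le) (use i assms in \<open>auto simp: over_def\<close>)
  then show "\<bar>g z * f i + - f z * g i\<bar> \<le> int (2 * A * A)" by simp
next
  show "\<bar>g z * f 0 + - f z * g 0\<bar> \<le> int 0" using assms by (auto simp: over_def)
qed

text \<open>All homogeneous forms involving \<open>z\<close> are far from 0. Either the lower and the upper bounds for \<open>z\<close>
  contradict each other, or the gap between them contains a number with the required residue.\<close>

lemma gap_cases:
  assumes D: "set \<Gamma> \<subseteq> set \<Delta>" "csz \<Delta> + 100 * \<tau> \<le> G"
    and q: "EQ K \<Delta> (residue_form z M w r)" "r < M"
    and gap: "\<And>f. f \<in> pos_forms \<Longrightarrow> der L K \<Delta> (GE (above f)) \<or> der L K \<Delta> (GE (above (neg f)))"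
  shows "(\<forall>\<chi>. fsz \<chi> \<le> 100 * \<tau> \<longrightarrow> der L (\<kappa> ^ 8 * (N + K)) \<Delta> \<chi>) \<or>
    (\<exists>n. decides \<Delta> (\<kappa> ^ 8 * (N + K)) (m + 2) (insert z V) (e(z := n)) A B M (W + A * M))"
proof (rule disjCI)
  assume "\<not> (\<exists>n. decides \<Delta> (\<kappa> ^ 8 * (N + K)) (m + 2) (insert z V) (e(z := n)) A B M (W + A * M))"
  then have nd: "\<And>n. \<not> decides \<Delta> (\<kappa> ^ 8 * (N + K)) (m + 2) (insert z V) (e(z := n)) A B M (W + A * M)" by blast
  have cD: "csz \<Delta> \<le> G" "csz \<Delta> + 20 * \<tau> \<le> G" using D by auto
  have K1: "1 \<le> K" using q(1) der_ge1 unfolding EQ_def by blast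
  have NK: "Suc N \<le> 2 * (N + K)" "Suc N + K \<le> 2 * (N + K)" "K + K \<le> 2 * (N + K)" using N1 by auto
  have kk: "8 * (\<kappa> * (\<kappa> * (N + K))) \<le> \<kappa> ^ 8 * (N + K)" "16 * (\<kappa> * (N + K)) \<le> \<kappa> ^ 8 * (N + K)"
  proof -
    have "8 * (\<kappa> * (\<kappa> * (N + K))) \<le> \<kappa> * (\<kappa> * (\<kappa> * (N + K)))" by (intro mult_le_mono1) (use kappa_ge in linarith)
    also have "\<dots> = \<kappa> ^ 3 * (N + K)" by (simp add: power3_eq_cube)
    also have "\<dots> \<le> \<kappa> ^ 8 * (N + K)" by (intro mult_le_mono1 power_increasing) (use kappa_ge in auto)
    finally show "8 * (\<kappa> * (\<kappa> * (N + K))) \<le> \<kappa> ^ 8 * (N + K)" .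
    have "16 * (\<kappa> * (N + K)) \<le> \<kappa> * (\<kappa> * (N + K))" by (intro mult_le_mono1) (use kappa_ge in linarith)
    also have "\<dots> = \<kappa> ^ 2 * (N + K)" by (simp add: power2_eq_square)
    also have "\<dots> \<le> \<kappa> ^ 8 * (N + K)" by (intro mult_le_mono1 power_increasing) (use kappa_ge in auto)
    finally show "16 * (\<kappa> * (N + K)) \<le> \<kappa> ^ 8 * (N + K)" .
  qed
  have oC: "over (insert z V) A (C + 1) (above f)" if "over (insert z V) A 0 f" for f
    using that by (auto simp: over_def above_def)
  have bdC: "form_bound Q (above f)" if "over (insert z V) A 0 f" for f
    by (rule over_bd[OF oC[OF that] VR(2)]) (use bounds in auto)
  define Lo where "Lo = {f \<in> pos_forms. der L K \<Delta> (GE (above f))}"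
  define Up where "Up = {f \<in> pos_forms. der L K \<Delta> (GE (above (neg f)))}"
  \<comment> \<open>The form z itself. It cannot be far below 0, so it always supplies a lower
    bound; it also serves as the nearby bound when the number found is less than M.\<close>
  define pz where "pz = (\<lambda>i. if i = z then 1 else 0 :: int)"
  have pz: "pz \<in> pos_forms" using A1 zw by (auto simp: pos_forms_def over_def pz_def)
  show "\<forall>\<chi>. fsz \<chi> \<le> 100 * \<tau> \<longrightarrow> der L (\<kappa> ^ 8 * (N + K)) \<Delta> \<chi>"
  proof (intro allI impI)
    fix \<chi> assume c: "fsz \<chi> \<le> 100 * \<tau>"
    show "der L (\<kappa> ^ 8 * (N + K)) \<Delta> \<chi>"
    proof (cases "pz \<in> Up")
      case True
      then have u: "der L K \<Delta> (GE (above (neg pz)))" by (simp add: Up_def)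
      have b: "form_bound Q (above (neg pz))" by (rule bdC) (use pz in \<open>simp add: pos_forms_def\<close>)
      have "der L (2 * \<kappa> * (K + K)) \<Delta> \<chi>"
        by (rule ge_falsum[OF cD(1) b b _ _ H1 _ _ u u, of 0])
          (use c QH Qpow Q1 in \<open>auto simp: above_def pz_def\<close>)
      moreover have "2 * \<kappa> * (K + K) \<le> 16 * (\<kappa> * (N + K))" by (simp add: algebra_simps)
      ultimately show ?thesis using kk(2) by (meson der_lines_mono le_trans)
    next
      case False
      then have pzL: "pz \<in> Lo" using gap[OF pz] pz by (auto simp: Lo_def Up_def)
      \<comment> \<open>If all lower and upper bounds leave the margin C + 1 on both sides, a number
        n of the required type exists, against \<open>nd\<close>. Hence some pair of bounds violates
        the margin at e.\<close>
      have "\<exists>f\<in>Lo. \<exists>g\<in>Up. g z * val (f(z := 0)) e - f z * val (g(z := 0)) e < (f z + g z) * (int C + 1)"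
      proof (rule ccontr)
        assume "\<not> ?thesis"
        then have sep: "\<And>f g. f \<in> Lo \<Longrightarrow> g \<in> Up \<Longrightarrow>
            (f z + g z) * (int C + 1) \<le> g z * val (f(z := 0)) e - f z * val (g(z := 0)) e" by force
        \<comment> \<open>The number wanted is the least n of residue r at which all forms in
          \<open>Lo\<close> exceed B. Being least, it is at most M beyond one of the bounds, so some
          form in \<open>Lo\<close> has value at most C there (\<open>low\<close>); then
          \<open>sep\<close> pushes all forms in \<open>Up\<close> below - B
          (\<open>up\<close>).\<close>
        define P where "P = (\<lambda>n. n mod M = r \<and> (\<forall>f\<in>Lo. int B < val f (e(z := n))))"
        define X where "X = (\<Sum>i<R. int A * int (ev0 e i))"
        have X: "- X \<le> val (f(z := 0)) e" if "f \<in> pos_forms" for f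
        proof -
          have "val (f(z := 0)) e \<ge> (\<Sum>i<R. - (int A * int (ev0 e i)))"
            unfolding val_def
          proof (rule sum_mono)
            fix i
            have "\<bar>(f(z := 0)) i\<bar> \<le> int A" using that unfolding pos_forms_def over_def by (cases "i = 0") auto
            then have "- int A * int (ev0 e i) \<le> (f(z := 0)) i * int (ev0 e i)" by (intro mult_right_mono) auto
            then show "- (int A * int (ev0 e i)) \<le> (f(z := 0)) i * int (ev0 e i)" by simp
          qed
          then show ?thesis by (simp add: X_def sum_negf)
        qed
        \<comment> \<open>X bounds the absolute contribution of the part without z, so n0 lies
          beyond all lower bounds.\<close>
        define n0 where "n0 = r + M * (nat X + B + 1)"
        have "1 * (nat X + B + 1) \<le> M * (nat X + B + 1)" using M1 by (rule mult_le_mono1)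
        then have "nat X + B + 1 \<le> n0" by (simp add: n0_def)
        then have n0: "X + int B + 1 \<le> int n0" by linarith
        have "P n0"
          unfolding P_def
        proof (intro conjI ballI)
          show "n0 mod M = r" unfolding n0_def by (simp only: mod_mult_self2) (use q(2) in simp)
          fix f assume f: "f \<in> Lo"
          have "1 * int n0 \<le> f z * int n0"
            using f by (intro mult_right_mono) (auto simp: Lo_def pos_forms_def)
          then show "int B < val f (e(z := n0))"
            using X[of f] f val_upd[OF zw(1,2), of f e n0] n0 by (simp add: Lo_def)
        qed
        then obtain n where n: "P n" and least: "\<And>k. k < n \<Longrightarrow> \<not> P k" using exists_least_iff[of P] by blast
        have low: "\<exists>f\<in>Lo. val f (e(z := n)) \<le> int B + f z * int M"
        proof (cases "M \<le> n")
          case True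
          then have "\<not> P (n - M)" using M1 by (intro least) auto
          moreover have "(n - M) mod M = r" using n True by (simp add: P_def le_mod_geq)
          ultimately obtain f where f: "f \<in> Lo" "val f (e(z := n - M)) \<le> int B" by (force simp: P_def)
          have "val f (e(z := n)) = val f (e(z := n - M)) + f z * int M"
            using val_upd[OF zw(1,2), of f e] True by (simp add: of_nat_diff algebra_simps)
          then show ?thesis using f by force
        next
          case False
          have "pz(z := 0) = (\<lambda>i. 0)" by (auto simp: pz_def)
          then have "val (pz(z := 0)) e = 0" by (simp add: val_def)
          then have "val pz (e(z := n)) = int n" using val_upd[OF zw(1,2), of pz e n] by (simp add: pz_def)
          then show ?thesis using pzL False by (intro bexI[of _ pz]) (auto simp: pz_def)
        qed
        have up: "val g (e(z := n)) < - int B" if g: "g \<in> Up" for g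
        proof -
          obtain f where f: "f \<in> Lo" "val f (e(z := n)) \<le> int B + f z * int M" using low by blast
          have fz: "0 < f z" "f z \<le> int A" "0 < g z"
            using f g by (auto simp: Lo_def Up_def pos_forms_def over_def zw dest!: spec[of _ z])
          have "f z * int M \<le> int A * int M" using fz by (intro mult_right_mono) auto
          also have "\<dots> + int B \<le> int C" using CB by (metis of_nat_add of_nat_le_iff of_nat_mult)
          finally have c: "int B + f z * int M \<le> int C" by simp
          have "(f z + g z) * (int C + 1) \<le> g z * val f (e(z := n)) - f z * val g (e(z := n))"
            using sep[OF f(1) g] val_upd[OF zw(1,2), of f e n] val_upd[OF zw(1,2), of g e n] by (simp add: algebra_simps)
          moreover have "g z * val f (e(z := n)) \<le> g z * int C" using f(2) c fz by (intro mult_left_mono) auto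
          moreover have "(f z + g z) * (int C + 1) = f z * int C + f z + g z * int C + g z"
            "f z * (val g (e(z := n)) + int C) = f z * val g (e(z := n)) + f z * int C" by (simp_all add: algebra_simps)
          ultimately have "f z * (val g (e(z := n)) + int C) < 0" using fz by linarith
          then have "val g (e(z := n)) + int C < 0" using fz by (simp add: mult_less_0_iff)
          then show ?thesis using bounds by linarith
        qed
        have "decides \<Delta> (\<kappa> ^ 8 * (N + K)) (m + 2) (insert z V) (e(z := n)) A B M (W + A * M)"
          unfolding decides_def
        proof (intro conjI allI impI)
          fix g assume g: "over (insert z V) A 0 g"
          have "n mod M = r" using n by (simp add: P_def)
          from res_ext[OF D(1) cD(1) q this g] obtain U where U: "form_bound (W + A * M) U" "\<forall>i\<ge>m + 2. U i = 0" "EQ (\<kappa> * (Suc N + K)) \<Delta> (\<lambda>i. g i - U i)"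
            "\<forall>i. i \<noteq> 0 \<longrightarrow> int M dvd U i" "int M dvd U 0 - val g (e(z := n))" by blast
          have "\<kappa> * (Suc N + K) \<le> \<kappa> * (2 * (N + K))" using NK by (intro mult_le_mono2)
          also have "\<dots> \<le> 16 * (\<kappa> * (N + K))" by simp
          finally have "\<kappa> * (Suc N + K) \<le> \<kappa> ^ 8 * (N + K)" using kk by linarith
          then have "EQ (\<kappa> ^ 8 * (N + K)) \<Delta> (\<lambda>i. g i - U i)" using U(3) EQ_mono by blast
          then show "\<exists>U. form_bound (W + A * M) U \<and> (\<forall>i\<ge>m + 2. U i = 0) \<and> EQ (\<kappa> ^ 8 * (N + K)) \<Delta> (\<lambda>i. g i - U i) \<and>
            (\<forall>i. i \<noteq> 0 \<longrightarrow> int M dvd U i) \<and> int M dvd U 0 - val g (e(z := n))" using U by blast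
        next
          fix g assume g: "over (insert z V) A B g" "0 \<le> val g (e(z := n))"
          have bg: "form_bound Q g" by (rule over_bd[OF g(1) VR(2)]) (use bounds in auto)
          show "der L (\<kappa> ^ 8 * (N + K)) \<Delta> (GE g)"
          proof (cases "g z = 0")
            case True
            have og: "over V A B g" using g(1) True unfolding over_def by auto
            have "over V A' B' g" by (rule over_mono[OF og]) (use bounds in auto)
            moreover have "val g e = val g (e(z := n))" using val_upd[OF zw(1,2), of g e n] True by (simp add: fun_upd_idem)
            ultimately have "der L N \<Gamma> (GE g)" using dec_ge g(2) by simp
            then have "der L (Suc N) \<Delta> (GE g)"
              by (rule ge_weaken[OF _ D(1) cD(1)]) (use bg Qpow in \<open>auto elim: form_bound_mono\<close>)
            then show ?thesis
            proof (rule der_lines_mono)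
              have "1 * (N + K) \<le> \<kappa> * (N + K)" by (rule mult_le_mono1) (use kappa_ge in linarith)
              then show "Suc N \<le> \<kappa> ^ 8 * (N + K)" using kk(2) NK(1) by linarith
            qed
          next
            case False
            define gh where "gh = g(0 := 0)"
            have ogh: "over (insert z V) A 0 gh" using g(1) by (auto simp: over_def gh_def)
            have g0: "\<bar>g 0\<bar> \<le> int B" using g(1) by (simp add: over_def)
            have "g = (\<lambda>i. gh i + (if i = 0 then g 0 else 0))" by (auto simp: gh_def)
            then have vg: "val g (e(z := n)) = val gh (e(z := n)) + g 0" using val_add_const[of gh "g 0"] by simp
            have gz: "gh z = g z" using zw by (simp add: gh_def)
            \<comment> \<open>As g \<ge> 0 at n, the homogeneous part of g is not below - B there.
              So it is not on the negative side, and the context knows it to exceed C, which absorbs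
              the constant g 0.\<close>
            have "der L K \<Delta> (GE (above gh))"
            proof (cases "0 < g z")
              case True
              then have ph: "gh \<in> pos_forms" using ogh gz by (simp add: pos_forms_def)
              have "gh \<notin> Up" using up[of gh] vg g(2) g0 by linarith
              then show ?thesis using gap[OF ph] ph by (auto simp: Up_def)
            next
              case F: False
              then have ph: "neg gh \<in> pos_forms" using ogh gz False by (simp add: pos_forms_def)
              have "neg gh \<notin> Lo"
              proof
                assume "neg gh \<in> Lo"
                then have "int B < val (neg gh) (e(z := n))" using n unfolding P_def by blast
                then show False using vg g(2) g0 by simp
              qed
              then show ?thesis using gap[OF ph] ph by (auto simp: Lo_def)
            qed
            then have "der L (\<kappa> * (K + K)) \<Delta> (GE g)"
              by (intro ge_lincomb[OF cD(1) bdC[OF ogh] bdC[OF ogh] bg _ _ H1, of 0])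
                (use QH Qpow Q1 g0 bounds in \<open>auto simp: above_def gh_def\<close>)
            then show ?thesis
            proof (rule der_lines_mono)
              have "\<kappa> * (K + K) \<le> \<kappa> * (2 * (N + K))" using NK by (intro mult_le_mono2)
              also have "\<dots> \<le> 16 * (\<kappa> * (N + K))" by simp
              finally show "\<kappa> * (K + K) \<le> \<kappa> ^ 8 * (N + K)" using kk by linarith
            qed
          qed
        qed
        then show False using nd by blast
      qed
      then obtain f g where fg: "f \<in> Lo" "g \<in> Up"
        and lt: "g z * val (f(z := 0)) e - f z * val (g(z := 0)) e < (f z + g z) * (int C + 1)" by blast
      have f: "over (insert z V) A 0 f" "0 < f z" "der L K \<Delta> (GE (above f))" using fg by (auto simp: Lo_def pos_forms_def)
      have g: "over (insert z V) A 0 g" "0 < g z" "der L K \<Delta> (GE (above (neg g)))" using fg by (auto simp: Up_def pos_forms_def)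
      have fgA: "f z \<le> int A" "g z \<le> int A"
        using f(1) g(1) zw by (auto simp: over_def dest!: spec[of _ z])
      define h where "h = (\<lambda>i. g z * f i + (- f z) * g i)"
      have z0: "z \<noteq> 0" using zw by simp
      have oh: "over V (2 * A * A) 0 h"
        using over_comb[OF f(1) g(1) _ _ z0] f(2) g(2) zw by (simp add: h_def)
      have vh: "val h e = g z * val (f(z := 0)) e - f z * val (g(z := 0)) e"
      proof -
        have "val h e = val h (e(z := e z))" by simp
        also have "\<dots> = g z * val f (e(z := e z)) + (- f z) * val g (e(z := e z))" unfolding h_def val_lincomb ..
        finally show ?thesis
          using val_upd[OF zw(1,2), of f e "e z"] val_upd[OF zw(1,2), of g e "e z"] by (simp only:) (simp add: algebra_simps)
      qed
      \<comment> \<open>The bounds f \<ge> C + 1 and - g \<ge> C + 1 give h \<ge> c0 + 1, while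
        \<Gamma> proves h \<le> c0, since this holds at e by \<open>lt\<close>.\<close>
      define c0 where "c0 = (f z + g z) * (int C + 1) - 1"
      have c0: "\<bar>c0\<bar> \<le> int B'"
      proof -
        have "(f z + g z) * (int C + 1) \<le> (int A + int A) * (int C + 1)" using fgA by (intro mult_right_mono) auto
        also have "\<dots> = int (2 * A * (C + 1))" by (simp add: algebra_simps)
        also have "\<dots> \<le> int B'" using B' by (simp only: of_nat_le_iff)
        finally have "c0 \<le> int B'" by (simp add: c0_def)
        moreover have "0 < (f z + g z) * (int C + 1)" using f(2) g(2) by (intro mult_pos_pos) auto
        ultimately show ?thesis by (simp add: c0_def)
      qed
      define t where "t = (\<lambda>i. neg h i + (if i = 0 then c0 else 0))"
      have ot: "over V A' B' t"
        unfolding over_def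
      proof (intro conjI allI impI)
        fix i assume "i \<noteq> 0" "i \<notin> V" then show "t i = 0" using oh by (auto simp: t_def over_def)
      next
        fix i :: nat assume "i \<noteq> 0"
        then have "\<bar>t i\<bar> \<le> int (2 * A * A)" using oh by (auto simp: t_def over_def simp del: of_nat_mult)
        then show "\<bar>t i\<bar> \<le> int A'" using A' by linarith
      next
        show "\<bar>t 0\<bar> \<le> int B'" using oh c0 by (auto simp: t_def over_def)
      qed
      have "der L N \<Gamma> (GE t)"
        by (rule dec_ge[OF ot]) (use lt vh in \<open>simp add: t_def val_add_const c0_def del: neg_apply\<close>)
      moreover have bt: "form_bound Q t" by (rule over_bd[OF ot VR(1)]) (use Qb in auto)
      ultimately have 1: "der L (Suc N) \<Delta> (GE t)" by (intro ge_weaken[OF _ D(1) cD(1)]) (use Qpow in \<open>auto elim: form_bound_mono\<close>)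
      define s where "s = (\<lambda>i. h i + (if i = 0 then - (c0 + 1) else 0))"
      have og: "over (insert z V) A 0 (neg g)" using g(1) by simp
      have bs: "form_bound (2 * Q) s"
      proof -
        have "form_bound (Q + 1) (\<lambda>i. neg t i + (if i = 0 then - 1 else 0))"
          by (rule form_bound_add[of Q _ 1]) (use bt in \<open>simp, auto simp: form_bound_def\<close>)
        moreover have "(\<lambda>i. neg t i + (if i = 0 then - 1 else 0)) = s" by (auto simp: t_def s_def)
        ultimately have "form_bound (Q + 1) s" by simp
        then show ?thesis by (rule form_bound_mono) (use Q1 in simp)
      qed
      have fgn: "int (nat (f z)) = f z" "int (nat (g z)) = g z" "nat (f z) \<le> Q" "nat (g z) \<le> Q"
        using f(2) g(2) fgA bounds by auto
      have 2: "der L (\<kappa> * (K + K)) \<Delta> (GE s)"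
      proof (rule ge_lincomb[OF cD(1) bdC[OF f(1)] bdC[OF og] bs _ _ _ _ _ f(3) g(3), of "nat (g z)" "nat (f z)"])
        show "nat (g z) * Q + nat (f z) * Q + 2 * Q \<le> H"
          using Qmult1[OF fgn(3), of Q] Qmult1[OF fgn(4), of Q] QH Qpow by linarith
        fix i show "int (nat (g z)) * above f i + int (nat (f z)) * above (neg g) i \<le> s i"
        proof (cases "i = 0")
          case True
          have "h 0 = 0" using oh by (simp add: over_def)
          then show ?thesis using True fgn by (simp add: s_def above_def c0_def algebra_simps)
        next
          case False
          then show ?thesis using fgn by (simp add: s_def above_def h_def)
        qed
      qed (use fgn Qpow in auto)
      have "der L (2 * \<kappa> * (\<kappa> * (K + K) + Suc N)) \<Delta> \<chi>"
      proof (rule ge_falsum[OF cD(1) bs bt _ _ H1 H1 _ 2 1 _ _ c])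
        fix i :: nat assume "i \<noteq> 0" then show "int 1 * s i + int 1 * t i \<le> 0" by (simp add: s_def t_def)
      qed (use QH Qpow Q1 in \<open>auto simp: s_def t_def\<close>)
      moreover have "2 * \<kappa> * (\<kappa> * (K + K) + Suc N) \<le> \<kappa> ^ 8 * (N + K)"
      proof -
        have "\<kappa> * (K + K) + Suc N \<le> \<kappa> * (2 * (N + K)) + \<kappa> * (2 * (N + K))"
        proof (rule add_mono)
          show "\<kappa> * (K + K) \<le> \<kappa> * (2 * (N + K))" using NK by (intro mult_le_mono2)
          have "1 * (2 * (N + K)) \<le> \<kappa> * (2 * (N + K))" by (rule mult_le_mono1) (use kappa_ge in linarith)
          then show "Suc N \<le> \<kappa> * (2 * (N + K))" using NK by linarith
        qed
        also have "\<dots> = 4 * (\<kappa> * (N + K))" by (simp add: algebra_simps)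
        finally have "2 * \<kappa> * (\<kappa> * (K + K) + Suc N) \<le> 2 * \<kappa> * (4 * (\<kappa> * (N + K)))" by (rule mult_le_mono2)
        also have "2 * \<kappa> * (4 * (\<kappa> * (N + K))) = 8 * (\<kappa> * (\<kappa> * (N + K)))" by simp
        finally show ?thesis using kk(1) by (rule le_trans)
      qed
      ultimately show ?thesis by (rule der_lines_mono)
    qed
  qed
qed

end

lemma exact_div_bound:
  assumes "(n::int) dvd x" "1 \<le> n" shows "\<bar>x div n\<bar> \<le> \<bar>x\<bar>"
proof -
  obtain k where k: "x = n * k" using assms(1) by blast
  have "1 * \<bar>k\<bar> \<le> n * \<bar>k\<bar>" using assms(2) by (rule mult_right_mono) simp
  then show ?thesis using k assms(2) by (simp add: abs_mult)
qed

section \<open>Case splits on the values of homogeneous forms\<close>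

context calc begin

lemma decides_mono:
  assumes "decides \<Gamma> N m V e A B M W" "N \<le> N'" shows "decides \<Gamma> N' m V e A B M W"
  unfolding decides_def
proof (intro conjI allI impI)
  fix f assume "over V A B f" "0 \<le> val f e"
  then have "der L N \<Gamma> (GE f)" using assms(1) unfolding decides_def by blast
  then show "der L N' \<Gamma> (GE f)" using assms(2) by (rule der_lines_mono)
next
  fix f assume "over V A 0 f"
  then obtain U where "form_bound W U" "\<forall>i\<ge>m. U i = 0" "EQ N \<Gamma> (\<lambda>i. f i - U i)"
       "\<forall>i. i \<noteq> 0 \<longrightarrow> int M dvd U i" "int M dvd U 0 - val f e" using assms(1) unfolding decides_def by blast
  then show "\<exists>U. form_bound W U \<and> (\<forall>i\<ge>m. U i = 0) \<and> EQ N' \<Gamma> (\<lambda>i. f i - U i) \<and>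
       (\<forall>i. i \<noteq> 0 \<longrightarrow> int M dvd U i) \<and> int M dvd U 0 - val f e" using EQ_mono assms(2) by blast
qed

lemma fv_GE: "fv (GE f) \<subseteq> {i. f i \<noteq> 0}"
  using vars_pos_part[of f] vars_pos_part[of "neg f"] by (auto simp: GE_def le_fm_def)

text \<open>With the constant fixed at 0, the count depends on the coefficient bound and the number
  of variables only, and not on the much larger bound for constants.\<close>

lemma finite_over:
  assumes "finite U"
  shows "finite {f. over U A 0 f}" "card {f. over U A 0 f} \<le> (2 * A + 1) ^ card U"
proof -
  let ?P = "PiE U (\<lambda>_. {- int A..int A})"
  have fP: "finite ?P" using assms by (intro finite_PiE) auto
  have inj: "inj_on (\<lambda>f. restrict f U) {f. over U A 0 f}"
  proof (rule inj_onI, rule ext)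
    fix f g i assume "f \<in> {f. over U A 0 f}" "g \<in> {f. over U A 0 f}" "restrict f U = restrict g U"
    then show "f i = g i" by (cases "i \<in> U"; cases "i = 0") (auto simp: over_def dest: fun_cong[of _ _ i])
  qed
  have sub: "(\<lambda>f. restrict f U) ` {f. over U A 0 f} \<subseteq> ?P"
  proof (clarsimp simp: PiE_iff)
    fix f i assume f: "over U A 0 f" "i \<in> U"
    then have "\<bar>f i\<bar> \<le> int A" by (cases "i = 0") (auto simp: over_def)
    then show "- int A \<le> f i \<and> f i \<le> int A" by linarith
  qed
  show "finite {f. over U A 0 f}" using finite_imageD[OF finite_subset[OF sub fP] inj] .
  have "card {f. over U A 0 f} = card ((\<lambda>f. restrict f U) ` {f. over U A 0 f})" by (rule card_image[OF inj, symmetric])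
  also have "\<dots> \<le> card ?P" by (rule card_mono[OF fP sub])
  also have "card {- int A..int A} = 2 * A + 1" by (simp add: nat_eq_iff)
  then have "card ?P = (2 * A + 1) ^ card U" using assms by (simp add: card_PiE)
  finally show "card {f. over U A 0 f} \<le> (2 * A + 1) ^ card U" .
qed

text \<open>The form is compared with the consecutive integers from C + 1 down to - C. Each
  comparison is one use of \<open>ge_split\<close>, whence 2 * C + 2 of them.\<close>

lemma ge_trichotomy:
  assumes c: "csz \<Delta> + 30 * \<tau> \<le> G" "fsz \<chi> \<le> 100 * \<tau>"
    and f: "\<And>c. \<bar>c\<bar> \<le> int C + 1 \<Longrightarrow> form_bound H (f(0 := c))"
    and hi: "der L K1 (GE (f(0 := - int C - 1)) # \<Delta>) \<chi>"
    and lo: "der L K2 (GE ((neg f)(0 := - int C - 1)) # \<Delta>) \<chi>"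
    and near: "\<And>c. \<bar>c\<bar> \<le> int C \<Longrightarrow> der L K3 (GE ((neg f)(0 := c)) # GE (f(0 := - c)) # \<Delta>) \<chi>"
  shows "der L (K1 + K2 + (2 * C + 2) * (K3 + 3 * k1 + 1)) \<Delta> \<chi>"
proof -
  have nf: "form_bound H ((neg f)(0 := c))" if "\<bar>c\<bar> \<le> int C + 1" for c
  proof -
    have "(neg f)(0 := c) = neg (f(0 := - c))" by (auto simp: neg_def)
    then show ?thesis using f[of "- c"] that by simp
  qed
  \<comment> \<open>By induction on j the goal follows from f \<ge> C + 1 - j. Lowering the
    threshold by 1 adds only the case that f equals the new threshold.\<close>
  have H: "j \<le> 2 * C + 1 \<Longrightarrow> der L (K1 + j * (K3 + 3 * k1 + 1)) (GE (f(0 := - (int C + 1 - int j))) # \<Delta>) \<chi>" for j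
  proof (induction j)
    case 0
    have "- (int C + 1 - int 0) = - int C - 1" by simp
    then show ?case using hi by (simp only: mult_0 add_0_right)
  next
    case (Suc j)
    define c where "c = int C - int j"
    have cC: "\<bar>c\<bar> \<le> int C" using Suc.prems by (simp add: c_def)
    have e: "int C + 1 - int j = c + 1" "int C + 1 - int (Suc j) = c" by (simp_all add: c_def)
    let ?c = "GE (f(0 := - c))" and ?n = "GE (f(0 := - (c + 1)))"
    have s: "fsz ?c \<le> 3 * \<tau>" "fsz ?n \<le> 3 * \<tau>" by (rule fsz_GE, rule f, use cC in linarith)+
    have "j \<le> 2 * C + 1" using Suc.prems by simp
    from Suc.IH[OF this] have "der L (K1 + j * (K3 + 3 * k1 + 1)) (?n # \<Delta>) \<chi>" unfolding e(1) .
    then have 1: "der L (Suc (K1 + j * (K3 + 3 * k1 + 1))) (?n # ?c # \<Delta>) \<chi>"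
      by (rule der_weaken) (use s c L_slack tau_ge in auto)
    have 2: "der L (Suc (K1 + j * (K3 + 3 * k1 + 1)) + K3 + 3 * k1) (?c # \<Delta>) \<chi>"
    proof (rule ge_split[OF _ _ _ _ _ 1 near[OF cC]])
      show "csz (?c # \<Delta>) + 10 * \<tau> \<le> G" using s c tau_ge by auto
      show "form_bound H (f(0 := - (c + 1)))" by (rule f) (use cC in linarith)
      show "form_bound H ((neg f)(0 := c))" by (rule nf) (use cC in linarith)
    qed (use c in auto)
    then show ?case unfolding e by (rule der_lines_mono) simp
  qed
  have e: "- (int C + 1 - int (2 * C + 1)) = int C" by simp
  have 1: "der L (K1 + (2 * C + 1) * (K3 + 3 * k1 + 1)) (GE (f(0 := int C)) # \<Delta>) \<chi>"
    using H[of "2 * C + 1"] unfolding e by simp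
  have "der L (K1 + (2 * C + 1) * (K3 + 3 * k1 + 1) + K2 + 3 * k1) \<Delta> \<chi>"
    by (rule ge_split[OF _ _ _ _ c(2) 1 lo]) (use c f nf in auto)
  then show ?thesis by (rule der_lines_mono) (simp add: algebra_simps)
qed

end

context step begin

lemma finite_pos_forms: "finite pos_forms" "card pos_forms \<le> (2 * A + 1) ^ Suc (card V)"
proof -
  have fV: "finite V" using V finite_subset by blast
  have sub: "pos_forms \<subseteq> {f. over (insert z V) A 0 f}" by (auto simp: pos_forms_def)
  note fo = finite_over[of "insert z V" A]
  show "finite pos_forms" using finite_subset[OF sub] fo(1) fV by blast
  have "card pos_forms \<le> card {f. over (insert z V) A 0 f}" by (rule card_mono) (use fo fV sub in auto)
  also have "\<dots> \<le> (2 * A + 1) ^ Suc (card V)" using fo(2) fV zw by simp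
  finally show "card pos_forms \<le> (2 * A + 1) ^ Suc (card V)" .
qed

lemma fv_pos_form:
  assumes "f \<in> pos_forms"
  shows "fv (GE (f(0 := c))) \<subseteq> {..<m + 2}" "fv (GE ((neg f)(0 := c))) \<subseteq> {..<m + 2}"
proof -
  have "i < m + 2" if "f i \<noteq> 0" for i
  proof -
    have "i = 0 \<or> i = z \<or> i \<in> V" using assms that unfolding pos_forms_def over_def by blast
    then show ?thesis using V by auto
  qed
  then have s: "{i. f i \<noteq> 0} \<subseteq> {..<m + 2}" by auto
  show "fv (GE (f(0 := c))) \<subseteq> {..<m + 2}" "fv (GE ((neg f)(0 := c))) \<subseteq> {..<m + 2}"
    using fv_GE[of "f(0 := c)"] fv_GE[of "(neg f)(0 := c)"] s by (auto split: if_splits)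
qed

lemma form_bound_pos_form:
  assumes "f \<in> pos_forms" "\<bar>c\<bar> \<le> int C + 1"
  shows "form_bound H (f(0 := c))" "form_bound H ((neg f)(0 := c))"
proof -
  have "over (insert z V) A (C + 1) (f(0 := c))" "over (insert z V) A (C + 1) ((neg f)(0 := c))"
    using assms by (auto simp: pos_forms_def over_def)
  then show "form_bound H (f(0 := c))" "form_bound H ((neg f)(0 := c))"
    using bounds Qpow by (auto intro!: over_bd[OF _ VR(2)])
qed

text \<open>The forms are treated one after another. A branch in which a form takes a value between
  - C and C ends at once through \<open>near\<close>, because this value determines z; only the two
  far branches go on to the remaining forms.\<close>

lemma split_pos_forms:
  assumes c: "fsz \<chi> \<le> 100 * \<tau>" "X + 100 * \<tau> \<le> G" "\<kappa> \<le> K"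
    and near: "\<And>\<Delta> f c. f \<in> pos_forms \<Longrightarrow> \<bar>c\<bar> \<le> int C \<Longrightarrow> set \<Gamma>' \<subseteq> set \<Delta> \<Longrightarrow> csz \<Delta> \<le> X \<Longrightarrow> fvs \<Delta> \<subseteq> {..<m + 2} \<Longrightarrow>
      GE (f(0 := - c)) \<in> set \<Delta> \<Longrightarrow> GE ((neg f)(0 := c)) \<in> set \<Delta> \<Longrightarrow> der L K \<Delta> \<chi>"
    and gap: "\<And>\<Delta>. set \<Gamma>' \<subseteq> set \<Delta> \<Longrightarrow> csz \<Delta> \<le> X \<Longrightarrow> fvs \<Delta> \<subseteq> {..<m + 2} \<Longrightarrow>
      (\<And>f. f \<in> pos_forms \<Longrightarrow> GE (above f) \<in> set \<Delta> \<or> GE (above (neg f)) \<in> set \<Delta>) \<Longrightarrow> der L K \<Delta> \<chi>"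
  shows "set fs \<subseteq> pos_forms \<Longrightarrow> set \<Gamma>' \<subseteq> set \<Delta> \<Longrightarrow> csz \<Delta> + length fs * (4 * \<tau>) + 10 * \<tau> \<le> X \<Longrightarrow> fvs \<Delta> \<subseteq> {..<m + 2} \<Longrightarrow>
    (\<And>f. f \<in> pos_forms - set fs \<Longrightarrow> GE (above f) \<in> set \<Delta> \<or> GE (above (neg f)) \<in> set \<Delta>) \<Longrightarrow>
    der L ((20 * (C + 1)) ^ length fs * K) \<Delta> \<chi>"
proof (induction fs arbitrary: \<Delta>)
  case Nil
  have "der L K \<Delta> \<chi>"
  proof (rule gap)
    show "csz \<Delta> \<le> X" using Nil.prems(3) by simp
    show "GE (above f) \<in> set \<Delta> \<or> GE (above (neg f)) \<in> set \<Delta>" if "f \<in> pos_forms" for f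
      using Nil.prems(5)[of f] that by (simp only: list.set Diff_empty)
  qed (use Nil.prems(2,4) in blast)+
  then show ?case by simp
next
  case (Cons f fs)
  let ?K = "(20 * (C + 1)) ^ length fs * K"
  have f: "f \<in> pos_forms" using Cons.prems by auto
  have s: "fsz (GE (f(0 := c))) \<le> 3 * \<tau>" "fsz (GE ((neg f)(0 := c))) \<le> 3 * \<tau>" if "\<bar>c\<bar> \<le> int C + 1" for c
    by (rule fsz_GE, rule form_bound_pos_form[OF f that])+
  have "der L (?K + ?K + (2 * C + 2) * (K + 3 * k1 + 1)) \<Delta> \<chi>"
  proof (rule ge_trichotomy[OF _ c(1)])
    show "csz \<Delta> + 30 * \<tau> \<le> G" using Cons.prems c by simp
    show "form_bound H (f(0 := c))" if "\<bar>c\<bar> \<le> int C + 1" for c by (rule form_bound_pos_form[OF f that])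
    show "der L ?K (GE (f(0 := - int C - 1)) # \<Delta>) \<chi>"
    proof (rule Cons.IH)
      show "csz (GE (f(0 := - int C - 1)) # \<Delta>) + length fs * (4 * \<tau>) + 10 * \<tau> \<le> X"
        using Cons.prems(3) s(1)[of "- int C - 1"] tau_ge by simp
      show "fvs (GE (f(0 := - int C - 1)) # \<Delta>) \<subseteq> {..<m + 2}"
        using Cons.prems(4) fv_pos_form[OF f] by auto
      fix g assume g: "g \<in> pos_forms - set fs"
      show "GE (above g) \<in> set (GE (f(0 := - int C - 1)) # \<Delta>) \<or> GE (above (neg g)) \<in> set (GE (f(0 := - int C - 1)) # \<Delta>)"
      proof (cases "g = f")
        case True then show ?thesis unfolding above_def by (meson list.set_intros(1))
      next
        case False
        then have "g \<in> pos_forms - set (f # fs)" using g by simp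
        from Cons.prems(5)[OF this] show ?thesis by (meson list.set_intros(2))
      qed
    qed (use Cons.prems in auto)
    show "der L ?K (GE ((neg f)(0 := - int C - 1)) # \<Delta>) \<chi>"
    proof (rule Cons.IH)
      show "csz (GE ((neg f)(0 := - int C - 1)) # \<Delta>) + length fs * (4 * \<tau>) + 10 * \<tau> \<le> X"
        using Cons.prems(3) s(2)[of "- int C - 1"] tau_ge by simp
      show "fvs (GE ((neg f)(0 := - int C - 1)) # \<Delta>) \<subseteq> {..<m + 2}"
        using Cons.prems(4) fv_pos_form[OF f] by auto
      fix g assume g: "g \<in> pos_forms - set fs"
      show "GE (above g) \<in> set (GE ((neg f)(0 := - int C - 1)) # \<Delta>) \<or> GE (above (neg g)) \<in> set (GE ((neg f)(0 := - int C - 1)) # \<Delta>)"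
      proof (cases "g = f")
        case True then show ?thesis unfolding above_def by (meson list.set_intros(1))
      next
        case False
        then have "g \<in> pos_forms - set (f # fs)" using g by simp
        from Cons.prems(5)[OF this] show ?thesis by (meson list.set_intros(2))
      qed
    qed (use Cons.prems in auto)
    fix c assume cC: "\<bar>c\<bar> \<le> int C"
    show "der L K (GE ((neg f)(0 := c)) # GE (f(0 := - c)) # \<Delta>) \<chi>"
    proof (rule near[OF f cC])
      show "csz (GE ((neg f)(0 := c)) # GE (f(0 := - c)) # \<Delta>) \<le> X"
        using Cons.prems(3) s(1)[of "- c"] s(2)[of c] cC tau_ge by simp
      show "fvs (GE ((neg f)(0 := c)) # GE (f(0 := - c)) # \<Delta>) \<subseteq> {..<m + 2}"
        using Cons.prems(4) fv_pos_form[OF f] by auto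
    qed (use Cons.prems in auto)
  qed
  then show ?case
  proof (rule der_lines_mono)
    have "1 * K \<le> ?K" by (intro mult_le_mono1 one_le_power) simp
    then have K: "K \<le> ?K" by simp
    have "K + 3 * k1 + 1 \<le> 5 * ?K" using K c(3) kappa_ge by linarith
    then have "(2 * C + 2) * (K + 3 * k1 + 1) \<le> (2 * C + 2) * (5 * ?K)" by (rule mult_le_mono2)
    then have "?K + ?K + (2 * C + 2) * (K + 3 * k1 + 1) \<le> ?K + ?K + (2 * C + 2) * (5 * ?K)" by (rule add_left_mono)
    also have "\<dots> = (10 * C + 12) * ?K" by (simp add: add_mult_distrib)
    also have "\<dots> \<le> (20 * (C + 1)) * ?K" by (rule mult_le_mono1) simp
    finally show "?K + ?K + (2 * C + 2) * (K + 3 * k1 + 1) \<le> (20 * (C + 1)) ^ length (f # fs) * K"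
      by (simp only: length_Cons power_Suc mult.assoc)
  qed
qed

text \<open>Each branch of the split on the residue of z and on the forms is contradictory or
  describes some number n, and in the latter case \<open>hyp\<close> finishes it. Different branches
  describe different numbers, so \<open>hyp\<close> has to cover every n.\<close>

lemma forall_step:
  assumes c: "fsz \<chi> \<le> 100 * \<tau>" "w \<notin> fv \<chi>" and X: "csz \<Gamma> + card pos_forms * (4 * \<tau>) + 30 * \<tau> \<le> X" "X + 100 * \<tau> \<le> G"
    and K: "\<kappa> ^ 13 * N \<le> K"
    and hyp: "\<And>\<Delta> n. set \<Gamma> \<subseteq> set \<Delta> \<Longrightarrow> csz \<Delta> \<le> X \<Longrightarrow> fvs \<Delta> \<subseteq> {..<m + 2} \<Longrightarrow>
      decides \<Delta> (\<kappa> ^ 13 * N) (m + 2) (insert z V) (e(z := n)) A B M (W + A * M) \<Longrightarrow> der L K \<Delta> \<chi>"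
  shows "der L (\<kappa> ^ 7 * M ^ 4 + M * ((20 * (C + 1)) ^ card pos_forms * K + 30)) \<Gamma> \<chi>"
proof (rule res_cases[OF _ M1 _ _ zw(1,2,3,4)])
  show "csz \<Gamma> \<le> G" using cG by simp
  show MH: "M \<le> H" using bounds Qpow by simp
  show "der L (\<kappa> ^ 7 * M ^ 4) [] (Res M)"
  proof (rule der_Res[OF M1])
    have "M * M \<le> Q ^ 2" using bounds by (intro Qmult1)
    then show "20 * M * M + 100 \<le> H" using QH Qpow by (simp add: mult.assoc)
  qed (use cG in simp)
  show "w \<notin> fvs \<Gamma>" using fG by auto
  show "fsz \<chi> \<le> 100 * (\<tau> * \<tau>)" using c tau_sq by linarith
  fix r assume r: "r < M"
  let ?E = "Equ (Var z) (residue_trm M r w)"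
  have sE: "fsz ?E \<le> 3 * \<tau>" using tsz_residue_trm_le[of M r w] vsz_tau[of z] r zw MH tau_ge by auto
  obtain fs where fs: "set fs = pos_forms" "distinct fs" using finite_distinct_list[OF finite_pos_forms(1)] by blast
  have lfs: "length fs = card pos_forms" using fs distinct_card by fastforce
  have kap: "\<kappa> ^ 8 * (N + 3 * k1) \<le> \<kappa> ^ 13 * N" "\<kappa> ^ 4 * (N + 3 * k1) \<le> \<kappa> ^ 13 * N" "\<kappa> \<le> \<kappa> ^ 13 * N"
  proof -
    have "1 * 1 \<le> \<kappa> * N" using N1 kappa_ge by (intro mult_le_mono) auto
    have "3 * k1 * 1 \<le> 3 * k1 * N" using N1 by (rule mult_le_mono2)
    then have "N + 3 * k1 \<le> (1 + 3 * k1) * N" by (simp add: algebra_simps)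
    also have "\<dots> \<le> \<kappa> * N" by (rule mult_le_mono1) (use kappa_ge in linarith)
    finally have n: "N + 3 * k1 \<le> \<kappa> * N" .
    have "\<kappa> ^ 8 * (N + 3 * k1) \<le> \<kappa> ^ 8 * (\<kappa> * N)" using n by (rule mult_le_mono2)
    also have "\<dots> = \<kappa> ^ 9 * N" by (simp add: eval_nat_numeral)
    also have "\<dots> \<le> \<kappa> ^ 13 * N" by (intro mult_le_mono1 power_increasing) (use kappa_ge in auto)
    finally show k8: "\<kappa> ^ 8 * (N + 3 * k1) \<le> \<kappa> ^ 13 * N" .
    have "\<kappa> ^ 4 * (N + 3 * k1) \<le> \<kappa> ^ 8 * (N + 3 * k1)" by (intro mult_le_mono1 power_increasing) (use kappa_ge in auto)
    then show "\<kappa> ^ 4 * (N + 3 * k1) \<le> \<kappa> ^ 13 * N" using k8 by linarith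
    have "\<kappa> ^ 1 * 1 \<le> \<kappa> ^ 13 * N" using N1 kappa_ge by (intro mult_le_mono power_increasing) auto
    then show "\<kappa> \<le> \<kappa> ^ 13 * N" by simp
  qed
  have eqr: "EQ (3 * k1) \<Delta> (residue_form z M w r)" if "set (?E # \<Gamma>) \<subseteq> set \<Delta>" "csz \<Delta> \<le> X" for \<Delta>
    by (rule EQ_of_residue) (use that zw r MH X in auto)
  have "der L ((20 * (C + 1)) ^ length fs * K) (?E # \<Gamma>) \<chi>"
  proof (rule split_pos_forms[OF c(1) X(2) _ _ _ _ order_refl])
    show "\<kappa> \<le> K" using kap(3) K by linarith
  next
    fix \<Delta> f c assume f: "f \<in> pos_forms" and cC: "\<bar>c\<bar> \<le> int C" and D: "set (?E # \<Gamma>) \<subseteq> set \<Delta>" "csz \<Delta> \<le> X" "fvs \<Delta> \<subseteq> {..<m + 2}"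
      and mem: "GE (f(0 := - c)) \<in> set \<Delta>" "GE ((neg f)(0 := c)) \<in> set \<Delta>"
    have G: "set \<Gamma> \<subseteq> set \<Delta>" "csz \<Delta> + 100 * \<tau> \<le> G" using D X by auto
    let ?f = "f(0 := - c)"
    have nf: "(neg f)(0 := c) = neg ?f" by (auto simp: neg_def)
    have of: "over (insert z V) A C ?f" "0 < ?f z" using f cC zw by (auto simp: pos_forms_def over_def)
    have "fsz (GE ?f) \<le> 3 * \<tau>" "fsz (GE (neg ?f)) \<le> 3 * \<tau>"
      unfolding nf[symmetric] by (rule fsz_GE, rule form_bound_pos_form[OF f], use cC in simp)+
    then have "EQ 1 \<Delta> ?f" unfolding EQ_def
      by (intro conjI der_assume) (use mem[unfolded nf] G L_slack in linarith | use mem[unfolded nf] in simp)+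
    then have ef: "EQ (3 * k1) \<Delta> ?f" by (rule EQ_mono) (use k1_ge in simp)
    from near_cases[OF G eqr[OF D(1,2)] r of ef] show "der L K \<Delta> \<chi>"
    proof (elim disjE exE conjE)
      assume "\<forall>\<chi>. fsz \<chi> \<le> 100 * \<tau> \<longrightarrow> der L (\<kappa> ^ 8 * (N + 3 * k1)) \<Delta> \<chi>"
      then have "der L (\<kappa> ^ 8 * (N + 3 * k1)) \<Delta> \<chi>" using c by blast
      then show ?thesis by (rule der_lines_mono) (use kap K in linarith)
    next
      fix n assume "val ?f (e(z := n)) = 0" "n mod M = r"
      then have "decides \<Delta> (\<kappa> ^ 4 * (N + 3 * k1)) (m + 2) (insert z V) (e(z := n)) A B M (W + A * M)"
        by (intro near_dec[OF G eqr[OF D(1,2)] r _ of ef])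
      then show ?thesis using hyp[OF G(1) D(2,3)] decides_mono kap(2) by blast
    qed
  next
    fix \<Delta> assume D: "set (?E # \<Gamma>) \<subseteq> set \<Delta>" "csz \<Delta> \<le> X" "fvs \<Delta> \<subseteq> {..<m + 2}"
      and mem: "\<And>f. f \<in> pos_forms \<Longrightarrow> GE (above f) \<in> set \<Delta> \<or> GE (above (neg f)) \<in> set \<Delta>"
    have G: "set \<Gamma> \<subseteq> set \<Delta>" "csz \<Delta> + 100 * \<tau> \<le> G" using D X by auto
    have gp: "der L (3 * k1) \<Delta> (GE (above f)) \<or> der L (3 * k1) \<Delta> (GE (above (neg f)))" if f: "f \<in> pos_forms" for f
    proof -
      have s: "fsz (GE (above f)) \<le> 3 * \<tau>" "fsz (GE (above (neg f))) \<le> 3 * \<tau>"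
        unfolding above_def by (rule fsz_GE, rule form_bound_pos_form[OF f], simp)+
      have w: "csz \<Delta> + fsz (GE (above f)) + 2 \<le> L" "csz \<Delta> + fsz (GE (above (neg f))) + 2 \<le> L"
        using s G L_slack by linarith+
      have "der L 1 \<Delta> (GE (above f)) \<or> der L 1 \<Delta> (GE (above (neg f)))"
        using mem[OF f] der_assume[OF _ w(1)] der_assume[OF _ w(2)] by blast
      then show ?thesis using k1_ge der_lines_mono[of L 1 \<Delta> _ "3 * k1"] by auto
    qed
    have "(\<forall>\<chi>. fsz \<chi> \<le> 100 * \<tau> \<longrightarrow> der L (\<kappa> ^ 8 * (N + 3 * k1)) \<Delta> \<chi>) \<or>
        (\<exists>n. decides \<Delta> (\<kappa> ^ 8 * (N + 3 * k1)) (m + 2) (insert z V) (e(z := n)) A B M (W + A * M))"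
      by (rule gap_cases[OF G eqr[OF D(1,2)] r gp])
    then show "der L K \<Delta> \<chi>"
    proof (elim disjE exE)
      assume "\<forall>\<chi>. fsz \<chi> \<le> 100 * \<tau> \<longrightarrow> der L (\<kappa> ^ 8 * (N + 3 * k1)) \<Delta> \<chi>"
      then have "der L (\<kappa> ^ 8 * (N + 3 * k1)) \<Delta> \<chi>" using c by blast
      then show ?thesis by (rule der_lines_mono) (use kap K in linarith)
    next
      fix n assume "decides \<Delta> (\<kappa> ^ 8 * (N + 3 * k1)) (m + 2) (insert z V) (e(z := n)) A B M (W + A * M)"
      then show ?thesis using hyp[OF G(1) D(2,3)] decides_mono kap(1) by blast
    qed
  next
    show "csz (?E # \<Gamma>) + length fs * (4 * \<tau>) + 10 * \<tau> \<le> X" using X sE lfs tau_ge by simp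
    show "fvs (?E # \<Gamma>) \<subseteq> {..<m + 2}" using fG vars_residue_trm[of M r w] by fastforce
  qed (use fs in auto)
  then show "der L ((20 * (C + 1)) ^ card pos_forms * K) (?E # \<Gamma>) \<chi>" by (simp add: lfs)
qed (use c in auto)

text \<open>The least number of the same type as \<open>n0\<close> is close to a root of some form, so it can be defined
  by an equation; this equation then has a solution provably.\<close>

lemma near_witness:
  obtains n f where "over (insert z V) A C f" "0 < f z" "val f (e(z := n)) = 0" "n mod M = n0 mod M"
    "\<And>g. over (insert z V) A B g \<Longrightarrow> sgn (val g (e(z := n))) = sgn (val g (e(z := n0)))"
proof -
  define P where "P = (\<lambda>n. n mod M = n0 mod M \<and>
     (\<forall>g. over (insert z V) A B g \<longrightarrow> sgn (val g (e(z := n))) = sgn (val g (e(z := n0)))))"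
  have "P n0" by (simp add: P_def)
  then obtain n where n: "P n" and least: "\<And>k. k < n \<Longrightarrow> \<not> P k" using exists_least_iff[of P] by blast
  have "\<exists>f. over (insert z V) A C f \<and> 0 < f z \<and> val f (e(z := n)) = 0"
  proof (cases "M \<le> n")
    case False
    \<comment> \<open>A number below M is a root of z - n, whose constant is within C.\<close>
    define f where "f = (\<lambda>i. if i = 0 then - int n else if i = z then 1 else 0)"
    have "over (insert z V) A C f" using A1 False bounds zw by (auto simp: f_def over_def)
    moreover have "f(z := 0) = (\<lambda>i. if i = 0 then - int n else 0)" using zw by (auto simp: f_def)
    then have "val f (e(z := n)) = 0" using val_upd[OF zw(1,2), of f e n] zw by (simp add: val_const f_def)
    ultimately show ?thesis using zw by (intro exI[of _ f]) (simp add: f_def)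
  next
    case True
    then have "\<not> P (n - M)" using M1 by (intro least) auto
    moreover have "(n - M) mod M = n0 mod M" using n True by (simp add: P_def le_mod_geq)
    ultimately obtain g where g: "over (insert z V) A B g" "sgn (val g (e(z := n - M))) \<noteq> sgn (val g (e(z := n0)))"
      by (auto simp: P_def)
    have sg: "sgn (val g (e(z := n))) = sgn (val g (e(z := n0)))" using n g(1) by (auto simp: P_def)
    have "\<exists>g. over (insert z V) A B g \<and> 0 < g z \<and> sgn (val g (e(z := n - M))) \<noteq> sgn (val g (e(z := n)))"
    proof (cases "0 < g z")
      case True
      then show ?thesis using g sg by metis
    next
      case F: False
      have "g z \<noteq> 0"
      proof
        assume "g z = 0"
        then have "val g (e(z := n - M)) = val g (e(z := n))"
          using val_upd[OF zw(1,2), of g e "n - M"] val_upd[OF zw(1,2), of g e n] by simp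
        then show False using g sg by simp
      qed
      then have "0 < neg g z" using F by simp
      moreover have "sgn (val (neg g) (e(z := n - M))) \<noteq> sgn (val (neg g) (e(z := n)))"
        unfolding val_neg sgn_minus using g(2) sg by simp
      ultimately show ?thesis using g(1) over_neg by blast
    qed
    then obtain g where g: "over (insert z V) A B g" "0 < g z" "sgn (val g (e(z := n - M))) \<noteq> sgn (val g (e(z := n)))"
      by blast
    define v where "v = val g (e(z := n))"
    have vM: "val g (e(z := n - M)) = v - g z * int M"
      using val_upd[OF zw(1,2), of g e "n - M"] val_upd[OF zw(1,2), of g e n] True
      by (simp add: v_def of_nat_diff algebra_simps)
    have gM: "0 < g z * int M" using g(2) M1 by (intro mult_pos_pos) auto
    have "\<bar>g z\<bar> \<le> int A" using g(1) zw unfolding over_def by auto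
    then have "g z * int M \<le> int A * int M" using g(2) by (intro mult_right_mono) auto
    then have gA: "g z * int M \<le> int (A * M)" by simp
    \<comment> \<open>The sign of g changes between n - M and n, so the value at n is at most one
      step g z * M away from 0. Subtracting it from g makes n a root and keeps the constant below A
      * M + B.\<close>
    have v: "0 \<le> v" "v \<le> g z * int M"
      using g(3) gM unfolding vM v_def[symmetric] by (auto simp: sgn_if split: if_splits)
    define f where "f = (\<lambda>i. g i + (if i = 0 then - v else 0))"
    have "val f (e(z := n)) = 0" unfolding f_def val_add_const by (simp add: v_def)
    moreover have "\<bar>f 0\<bar> \<le> int C"
    proof -
      have "\<bar>g 0\<bar> \<le> int B" using g(1) by (simp add: over_def)
      moreover have "int (A * M) + int B \<le> int C" using CB by linarith
      ultimately show ?thesis using v gA by (simp add: f_def)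
    qed
    then have "over (insert z V) A C f" using g(1) by (auto simp: over_def f_def)
    ultimately show ?thesis using g(2) zw by (intro exI[of _ f]) (simp add: f_def)
  qed
  then show ?thesis using that n unfolding P_def by blast
qed

text \<open>The number n from \<open>near_witness\<close> stands in for n0. It is a root of f, so a
  * z = s - f 0, and \<Gamma> knows s as U. With z = M * w + r this reads w = h for a form h in the
  old variables, integral because a * M divides \<open>M'\<close>. Since \<Gamma> proves h \<ge> 0,
  names for w and then for z can be introduced; f = 0 is derived for them, and
  \<open>near_dec\<close> applies.\<close>

lemma exists_step:
  "\<exists>\<Delta>. set \<Gamma> \<subseteq> set \<Delta> \<and> csz \<Delta> \<le> csz \<Gamma> + 20 * \<tau> \<and> fvs \<Delta> \<subseteq> {..<m + 2} \<and>
     decides \<Delta> (\<kappa> ^ 13 * N) (m + 2) (insert z V) (e(z := n0)) A B M (W + A * M) \<and>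
     (\<forall>\<chi> K. z \<notin> fv \<chi> \<longrightarrow> w \<notin> fv \<chi> \<longrightarrow> der L K \<Delta> \<chi> \<longrightarrow> der L (K + \<kappa> ^ 13 * N) \<Gamma> \<chi>)"
proof -
  obtain n f where f: "over (insert z V) A C f" "0 < f z" "val f (e(z := n)) = 0" and nM: "n mod M = n0 mod M"
    and sg: "\<And>g. over (insert z V) A B g \<Longrightarrow> sgn (val g (e(z := n))) = sgn (val g (e(z := n0)))"
    using near_witness[of n0] by metis
  have cG': "csz \<Gamma> \<le> G" "csz \<Gamma> + 20 * \<tau> \<le> G" using cG by auto
  define r where "r = n mod M"
  have r: "r < M" using M1 by (simp add: r_def)
  define a where "a = nat (f z)"
  have "\<bar>f z\<bar> \<le> int A" using f(1) zw unfolding over_def by auto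
  then have a: "1 \<le> a" "int a = f z" "a \<le> A" using f(2) unfolding a_def by auto
  define s where "s = (\<lambda>i. if i = 0 \<or> i = z then 0 else - f i)"
  have os: "over V A 0 s" using f(1) zw unfolding over_def s_def by auto
  have f0: "\<bar>f 0\<bar> \<le> int C" using f(1) by (simp add: over_def)
  obtain U where U: "form_bound W U" "\<And>i. m \<le> i \<Longrightarrow> U i = 0" "EQ N \<Gamma> (\<lambda>i. s i - U i)"
    "\<And>i. i \<noteq> 0 \<Longrightarrow> int M' dvd U i" "int M' dvd U 0 - val s e" "form_bound (2 * Q) (\<lambda>i. s i - U i)"
    using dec_res[OF os] by blast
  have aMM: "int (a * M) dvd int M'" using M'[OF a(1,3)] by (simp only: int_dvd_int_iff)
  have aM: "a * M \<le> Q ^ 2" "1 \<le> a * M" "a * Q \<le> Q ^ 2"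
    using a bounds M1 by (auto intro!: Qmult1)
  have az: "val s e - f 0 = int a * int n"
  proof -
    have "f(z := 0) = (\<lambda>i. neg s i + (if i = 0 then f 0 else 0))" using zw by (auto simp: s_def)
    then have "val (f(z := 0)) e = - val s e + f 0" using val_add_const[of "neg s" "f 0" e] by simp
    then show ?thesis using val_upd[OF zw(1,2), of f e n] a f(3) by simp
  qed
  have dv0: "int (a * M) dvd U 0 - f 0 - int a * int r"
  proof -
    have "int M dvd int n - int r" unfolding r_def by (metis mod_eq_dvd_iff mod_mod_trivial zmod_int)
    then have "int a * int M dvd int a * (int n - int r)" by (rule mult_dvd_mono[OF dvd_refl])
    moreover have "int (a * M) dvd U 0 - val s e" by (rule dvd_trans[OF aMM U(5)])
    ultimately have "int (a * M) dvd (U 0 - val s e) + int a * (int n - int r)" by (intro dvd_add) auto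
    also have "(U 0 - val s e) + int a * (int n - int r) = U 0 - f 0 - int a * int r"
      using az by (simp add: algebra_simps)
    finally show ?thesis .
  qed
  \<comment> \<open>From a * z = U - f 0 and z = M * w + r, the form u has to equal a * M *
    w.\<close>
  define u where "u = (\<lambda>i. if i = 0 then U 0 - f 0 - int a * int r else U i)"
  define h where "h = (\<lambda>i. u i div int (a * M))"
  have dvu: "int (a * M) dvd u i" for i
    using dv0 dvd_trans[OF aMM U(4)[of i]] by (auto simp: u_def)
  have uh: "u i = int (a * M) * h i" for i using dvu[of i] by (simp add: h_def)
  have bu: "\<bar>u i\<bar> \<le> int (4 * Q ^ 2)" for i
  proof -
    have u: "\<bar>U i\<bar> \<le> int W" "\<bar>U 0\<bar> \<le> int W" using U(1) by (auto simp: form_bound_def)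
    have "a * r \<le> Q ^ 2" using a bounds r by (intro Qmult1) auto
    then have ar: "int a * int r \<le> int (Q ^ 2)" by (metis of_nat_le_iff of_nat_mult)
    have wc: "int W \<le> int (Q ^ 2)" "int C \<le> int (Q ^ 2)" using bounds Qpow by linarith+
    have p: "0 \<le> int a * int r" "int (4 * Q ^ 2) = 4 * int (Q ^ 2)" by simp_all
    show ?thesis
    proof (cases "i = 0")
      case True
      then have "u i = U 0 - f 0 - int a * int r" by (simp add: u_def)
      then show ?thesis using u ar wc p f0 by linarith
    next
      case False
      then have "u i = U i" by (simp add: u_def)
      then show ?thesis using u wc p by linarith
    qed
  qed
  have bh: "form_bound (4 * Q ^ 2) h"
    unfolding form_bound_def
  proof (intro conjI allI impI)
    fix i
    have "\<bar>h i\<bar> \<le> \<bar>u i\<bar>" unfolding h_def by (rule exact_div_bound[OF dvu]) (use aM in linarith)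
    then show "\<bar>h i\<bar> \<le> int (4 * Q ^ 2)" using bu[of i] by linarith
  next
    fix i assume "h i \<noteq> 0"
    then have "i = 0 \<or> U i \<noteq> 0" by (auto simp: h_def u_def)
    then show "i = 0 \<or> 10 \<le> i \<and> i < R" using U(1) by (auto simp: form_bound_def)
  qed
  have hm: "h i = 0" if "m \<le> i" for i using U(2)[OF that] that m by (simp add: h_def u_def)
  \<comment> \<open>s' = s - f 0 has value a * n at e, hence is provably nonnegative; g is the same
    form with U in place of s.\<close>
  define s' where "s' = (\<lambda>i. s i + (if i = 0 then - f 0 else 0))"
  define g where "g = (\<lambda>i. U i + (if i = 0 then - f 0 else 0))"
  have "over V A' B' s'"
    using over_mono[OF os order_refl bounds(1), of B'] f0 bounds(2) os unfolding over_def s'_def by auto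
  moreover have "0 \<le> val s' e" unfolding s'_def val_add_const using az by simp
  ultimately have 1: "der L N \<Gamma> (GE s')" by (rule dec_ge)
  have bs': "form_bound (2 * Q) s'" unfolding s'_def
  proof (rule form_bound_add)
    show "form_bound Q s" by (rule over_bd[OF os VR(1)]) (use bounds in auto)
    show "form_bound Q (\<lambda>i. if i = 0 then - f 0 else 0)" using f0 bounds by (auto simp: form_bound_def)
  qed simp
  have bg: "form_bound (2 * Q) g" unfolding g_def
  proof (rule form_bound_add)
    show "form_bound Q U" using U(1) bounds by (auto elim: form_bound_mono)
    show "form_bound Q (\<lambda>i. if i = 0 then - f 0 else 0)" using f0 bounds by (auto simp: form_bound_def)
  qed simp
  have 2: "der L (\<kappa> * (N + N)) \<Gamma> (GE g)"
    by (rule ge_eq_lincomb[OF cG'(1) bs' U(6) bg _ _ _ _ _ 1 U(3), of 1 "- 1"])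
      (use QH Qpow H1 Q1 in \<open>auto simp: g_def s'_def\<close>)
  \<comment> \<open>g = a * M * h + a * r with a * r < a * M, so rounding g \<ge> 0 gives h \<ge>
    0.\<close>
  have 3: "der L (\<kappa> ^ 2 * (\<kappa> * (N + N))) \<Gamma> (GE h)"
  proof (rule ge_round[OF cG'(2) bg bh _ aM(2) _ 2])
    show "a * M \<le> H" using aM QH Qpow by linarith
    have "a * M * (4 * Q ^ 2 + 1) \<le> Q ^ 2 * (4 * Q ^ 2 + 1)" using aM(1) by (rule mult_le_mono1)
    also have "\<dots> = 4 * Q ^ 4 + Q ^ 2" by (simp add: eval_nat_numeral algebra_simps)
    finally show "a * M * (4 * Q ^ 2 + 1) + 2 * Q + 1 \<le> H" using QH Qpow Q1 by linarith
    show "g i \<le> int (a * M) * h i" if "i \<noteq> 0" for i using uh[of i] that by (simp add: g_def u_def)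
    have "int a * int r \<le> int a * (int M - 1)" using r by (intro mult_left_mono) auto
    then have "int a * int r \<le> int (a * M) - 1" using a(1) by (simp add: algebra_simps)
    then show "g 0 \<le> int (a * M) * h 0 + int (a * M) - 1" using uh[of 0] by (simp add: g_def u_def)
  qed
  define zf where "zf = (\<lambda>i. if i = 0 then int r else if i = w then int M else 0)"
  have bzf: "form_bound Q zf" using zw r bounds by (auto simp: form_bound_def zf_def)
  have QH': "4 * Q ^ 2 + 1 \<le> H" "Q + 1 \<le> H" using QH Qpow Q1 by linarith+
  have bhH: "form_bound H h" "form_bound H (h(w := - 1))" "form_bound H zf" "form_bound H (zf(z := - 1))"
    using form_bound_mono[OF bh, of H] form_bound_mono[OF form_bound_witness[OF bh zw(3,4) hm], of H]
      form_bound_mono[OF bzf, of H] form_bound_mono[OF form_bound_witness[OF bzf zw(1,2)], of H] QH' zw by (auto simp: zf_def)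
  let ?c1 = "Equ (Add (pos_part (neg h)) (Var w)) (pos_part h)"
  let ?c2 = "Equ (Add (pos_part (neg zf)) (Var z)) (pos_part zf)"
  let ?G1 = "?c1 # \<Gamma>" and ?G2 = "?c2 # ?c1 # \<Gamma>"
  have sc: "fsz ?c1 \<le> 5 * \<tau>" "fsz ?c2 \<le> 5 * \<tau>"
    using tsz_pos_part[OF bhH(1)] tsz_pos_part[of "neg h"] tsz_pos_part[OF bhH(3)] tsz_pos_part[of "neg zf"] bhH vsz_tau[of z] vsz_tau[of w] zw tau_ge
    by auto
  have c12: "csz ?G1 \<le> G" "csz ?G2 \<le> G" "csz ?G2 + 100 * \<tau> \<le> G" "csz ?G2 \<le> csz \<Gamma> + 20 * \<tau>"
    using sc cG tau_ge by auto
  have fvc1: "fv ?c1 \<subseteq> insert w {..<m}"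
  proof -
    have "i < m" if "h i \<noteq> 0" for i using hm[of i] that by (meson not_le)
    then show ?thesis using vars_pos_part[of h] vars_pos_part[of "neg h"] by fastforce
  qed
  have fvc2: "fv ?c2 \<subseteq> {z, w}"
    using vars_pos_part[of zf] vars_pos_part[of "neg zf"] by (auto simp: zf_def split: if_splits)
  have fG2: "fvs ?G2 \<subseteq> {..<m + 2}" using fvc1 fvc2 fG by fastforce
  have eh: "EQ (3 * k1) ?G2 (h(w := - 1))"
    by (rule EQ_witness[OF c12(2) bhH(1,2) zw(3,4) hm]) auto
  have ez: "EQ (3 * k1) ?G2 (zf(z := - 1))"
    by (rule EQ_witness[OF c12(2) bhH(3,4) zw(1,2)]) (use zw in \<open>auto simp: zf_def\<close>)
  have "neg (zf(z := - 1)) = residue_form z M w r" using zw by (auto simp: zf_def residue_form_def)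
  then have er: "EQ (3 * k1) ?G2 (residue_form z M w r)" using EQ_neg[OF ez] by simp
  \<comment> \<open>Here w cancels and a * z - a * r - a * M * h remains; subtracting s - U leaves
    f.\<close>
  define t1 where "t1 = (\<lambda>i. int a * residue_form z M w r i + (- int (a * M)) * (h(w := - 1)) i)"
  have br: "form_bound Q (residue_form z M w r)" by (rule form_bound_residue_form) (use zw r bounds Q1 in auto)
  have bh1: "form_bound (5 * Q ^ 2) (h(w := - 1))"
    using form_bound_mono[OF form_bound_witness[OF bh zw(3,4) hm], of "5 * Q ^ 2"] Qpow by simp
  have q4: "a * M * (5 * Q ^ 2) \<le> 5 * Q ^ 4"
    using mult_le_mono1[OF aM(1), of "5 * Q ^ 2"] by (simp add: eval_nat_numeral algebra_simps)
  have bt1: "form_bound (6 * Q ^ 4) t1"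
  proof -
    have 1: "form_bound (Q ^ 2) (\<lambda>i. int a * residue_form z M w r i)" by (rule form_bound_scale[OF br aM(3)])
    have 2: "form_bound (5 * Q ^ 4) (\<lambda>i. int (a * M) * neg (h(w := - 1)) i)"
      by (rule form_bound_scale[OF _ q4]) (simp only: form_bound_neg bh1)
    have "form_bound (6 * Q ^ 4) (\<lambda>i. int a * residue_form z M w r i + int (a * M) * neg (h(w := - 1)) i)"
      by (rule form_bound_add[OF 1 2]) (use Qpow in linarith)
    moreover have "(\<lambda>i. int a * residue_form z M w r i + int (a * M) * neg (h(w := - 1)) i) = t1"
      by (auto simp: t1_def)
    ultimately show ?thesis by simp
  qed
  have e1: "EQ (\<kappa> * (3 * k1 + 3 * k1)) ?G2 t1"
  proof (rule EQ_lincomb[OF c12(2) br bh1 bt1 _ _ _ _ _ er eh])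
    show "nat \<bar>int a\<bar> * Q + nat \<bar>- int (a * M)\<bar> * (5 * Q ^ 2) + 6 * Q ^ 4 \<le> H"
    proof -
      have "nat \<bar>int a\<bar> = a" "nat \<bar>- int (a * M)\<bar> = a * M" by (simp_all only: abs_minus abs_of_nat nat_int)
      then show ?thesis using q4 aM(3) QH Qpow by (simp only:)
    qed
    show "nat \<bar>int a\<bar> \<le> H" "nat \<bar>- int (a * M)\<bar> \<le> H"
      using a bounds aM QH Qpow by (simp_all only: abs_minus abs_of_nat nat_int)
  qed (use QH Qpow in \<open>auto simp: t1_def\<close>)
  have bsU: "form_bound H (\<lambda>i. s i - U i)" by (rule form_bound_mono[OF U(6)]) (use QH Qpow in linarith)
  have e2: "EQ (Suc N) ?G2 (\<lambda>i. s i - U i)" by (rule EQ_weaken[OF U(3) _ c12(2) bsU]) auto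
  have bf: "form_bound Q f" by (rule over_bd[OF f(1) VR(2)]) (use bounds in auto)
  have ft: "f i = 1 * t1 i + (- 1) * (s i - U i)" for i
  proof -
    consider "i = 0" | "i = z" | "i = w" | "i \<noteq> 0" "i \<noteq> z" "i \<noteq> w" by blast
    then show ?thesis
    proof cases
      case 1 then show ?thesis using uh[of 0] zw by (simp add: t1_def residue_form_def s_def u_def)
    next
      case 2 then show ?thesis using hm[of z] U(2)[of z] a zw by (simp add: t1_def residue_form_def s_def)
    next
      case 3
      then have "f w = 0" using f(1) zw by (auto simp: over_def)
      then show ?thesis using 3 U(2)[of w] zw by (simp add: t1_def residue_form_def s_def)
    next
      case 4 then show ?thesis using uh[of i] by (simp add: t1_def residue_form_def s_def u_def)
    qed
  qed
  have e3: "EQ (\<kappa> * (\<kappa> * (3 * k1 + 3 * k1) + Suc N)) ?G2 f"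
    by (rule EQ_lincomb[OF c12(2) bt1 U(6) bf _ _ _ _ _ e1 e2 ft]) (use QH Qpow H1 in auto)
  let ?K = "\<kappa> * (\<kappa> * (3 * k1 + 3 * k1) + Suc N)"
  have kN: "\<kappa> ^ i * N \<le> \<kappa> ^ j * N" if "i \<le> j" for i j
    using that by (intro mult_le_mono1 power_increasing) (use kappa_ge in auto)
  have k2: "2 * (\<kappa> ^ i * N) \<le> \<kappa> ^ Suc i * N" for i
  proof -
    have "2 * (\<kappa> ^ i * N) \<le> \<kappa> * (\<kappa> ^ i * N)" by (rule mult_le_mono1) (use kappa_ge in linarith)
    then show ?thesis by simp
  qed
  have K: "3 * k1 \<le> ?K" "?K \<le> \<kappa> ^ 4 * N"
  proof -
    have "1 * (3 * k1) \<le> \<kappa> * (3 * k1 + 3 * k1)" using kappa_ge by (intro mult_le_mono) auto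
    then have x: "3 * k1 \<le> \<kappa> * (3 * k1 + 3 * k1) + Suc N" by linarith
    have "1 * (3 * k1) \<le> \<kappa> * (\<kappa> * (3 * k1 + 3 * k1) + Suc N)"
      by (rule mult_le_mono[OF _ x]) (use kappa_ge in linarith)
    then show "3 * k1 \<le> ?K" by simp
    have "\<kappa> * (3 * k1 + 3 * k1) \<le> \<kappa> * (\<kappa> * N)"
    proof (rule mult_le_mono2)
      have "\<kappa> * 1 \<le> \<kappa> * N" using N1 by (rule mult_le_mono2)
      then show "3 * k1 + 3 * k1 \<le> \<kappa> * N" using kappa_ge by linarith
    qed
    moreover have "\<kappa> * (\<kappa> * N) = \<kappa> ^ 2 * N" by (simp add: power2_eq_square)
    moreover have "Suc N \<le> 2 * (\<kappa> ^ 0 * N)" using N1 by simp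
    then have "Suc N \<le> \<kappa> ^ 2 * N" using k2[of 0] kN[of "Suc 0" 2] by linarith
    ultimately have "\<kappa> * (3 * k1 + 3 * k1) + Suc N \<le> \<kappa> ^ 2 * N + \<kappa> ^ 2 * N" by linarith
    also have "\<dots> \<le> \<kappa> ^ 3 * N" using k2[of 2] by (simp add: eval_nat_numeral)
    finally have "\<kappa> * (3 * k1 + 3 * k1) + Suc N \<le> \<kappa> ^ 3 * N" .
    then have "?K \<le> \<kappa> * (\<kappa> ^ 3 * N)" by (rule mult_le_mono2)
    then show "?K \<le> \<kappa> ^ 4 * N" by (simp add: eval_nat_numeral)
  qed
  have dec1: "decides ?G2 (\<kappa> ^ 4 * (N + ?K)) (m + 2) (insert z V) (e(z := n)) A B M (W + A * M)"
    by (rule near_dec[OF _ c12(3) EQ_mono[OF er K(1)] r _ f(1,2) e3 f(3)]) (auto simp: r_def)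
  have "\<kappa> ^ 4 * (N + ?K) \<le> \<kappa> ^ 13 * N"
  proof -
    have "N = \<kappa> ^ 0 * N" by simp
    also have "\<dots> \<le> \<kappa> ^ 4 * N" by (rule kN) simp
    finally have "N + ?K \<le> \<kappa> ^ 4 * N + \<kappa> ^ 4 * N" using K(2) by (rule add_mono)
    also have "\<dots> = 2 * (\<kappa> ^ 4 * N)" by simp
    also have "\<dots> \<le> \<kappa> ^ Suc 4 * N" by (rule k2)
    also have "\<dots> = \<kappa> ^ 5 * N" by (simp add: eval_nat_numeral)
    finally have "N + ?K \<le> \<kappa> ^ 5 * N" .
    then have "\<kappa> ^ 4 * (N + ?K) \<le> \<kappa> ^ 4 * (\<kappa> ^ 5 * N)" by (rule mult_le_mono2)
    also have "\<dots> = \<kappa> ^ 9 * N" by (simp add: eval_nat_numeral)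
    also have "\<dots> \<le> \<kappa> ^ 13 * N" by (rule kN) simp
    finally show ?thesis .
  qed
  then have dec2: "decides ?G2 (\<kappa> ^ 13 * N) (m + 2) (insert z V) (e(z := n)) A B M (W + A * M)"
    by (rule decides_mono[OF dec1])
  \<comment> \<open>A description at n is one at n0: the signs agree by \<open>sg\<close>, and the
    values of a form at the two numbers differ by a multiple of M.\<close>
  have dec3: "decides ?G2 (\<kappa> ^ 13 * N) (m + 2) (insert z V) (e(z := n0)) A B M (W + A * M)"
    unfolding decides_def
  proof (intro conjI allI impI)
    fix g assume g: "over (insert z V) A B g" "0 \<le> val g (e(z := n0))"
    then have "0 \<le> val g (e(z := n))" using sg[OF g(1)] by (auto simp: sgn_if split: if_splits)
    then show "der L (\<kappa> ^ 13 * N) ?G2 (GE g)" using dec2 g(1) unfolding decides_def by blast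
  next
    fix g assume "over (insert z V) A 0 g"
    then obtain U where U: "form_bound (W + A * M) U" "\<forall>i\<ge>m + 2. U i = 0" "EQ (\<kappa> ^ 13 * N) ?G2 (\<lambda>i. g i - U i)"
            "\<forall>i. i \<noteq> 0 \<longrightarrow> int M dvd U i" "int M dvd U 0 - val g (e(z := n))"
      using dec2 unfolding decides_def by blast
    have "int M dvd int n - int n0" using nM by (metis mod_eq_dvd_iff zmod_int)
    then have "int M dvd (U 0 - val g (e(z := n))) + g z * (int n - int n0)" using U(5) by (intro dvd_add dvd_mult)
    also have "(U 0 - val g (e(z := n))) + g z * (int n - int n0) = U 0 - val g (e(z := n0))"
      using val_upd[OF zw(1,2), of g e n] val_upd[OF zw(1,2), of g e n0] by (simp add: algebra_simps)
    finally show "\<exists>U. form_bound (W + A * M) U \<and> (\<forall>i\<ge>m + 2. U i = 0) \<and> EQ (\<kappa> ^ 13 * N) ?G2 (\<lambda>i. g i - U i) \<and>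
            (\<forall>i. i \<noteq> 0 \<longrightarrow> int M dvd U i) \<and> int M dvd U 0 - val g (e(z := n0))"
      using U by blast
  qed
  have elim: "der L (K + \<kappa> ^ 13 * N) \<Gamma> \<chi>" if \<chi>: "z \<notin> fv \<chi>" "w \<notin> fv \<chi>" and d: "der L K ?G2 \<chi>" for \<chi> K
  proof -
    \<comment> \<open>z is discharged before w, because its defining equation mentions w.\<close>
    have "der L k1 ?G1 (GE zf)" by (rule ge_nonneg[OF c12(1) bhH(3)]) (simp add: zf_def)
    then have "der L (Suc (k1 + K)) ?G1 \<chi>"
    proof (rule ge_witness[OF c12(1) bhH(3) _ zw(1,2) _ _ \<chi>(1) d])
      show "zf z = 0" using zw by (simp add: zf_def)
      show "z \<notin> fvs ?G1" using fvc1 fG by fastforce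
    qed
    then have "der L (Suc (\<kappa> ^ 2 * (\<kappa> * (N + N)) + Suc (k1 + K))) \<Gamma> \<chi>"
      by (rule ge_witness[OF cG'(1) bhH(1) 3 zw(3,4) hm _ \<chi>(2), rotated 2]) (use fG in auto)
    then show ?thesis
    proof (rule der_lines_mono)
      have "\<kappa> ^ 2 * (\<kappa> * (N + N)) = 2 * (\<kappa> ^ 3 * N)" by (simp add: eval_nat_numeral algebra_simps)
      then have "\<kappa> ^ 2 * (\<kappa> * (N + N)) \<le> \<kappa> ^ 4 * N" using k2[of 3] by (simp add: eval_nat_numeral)
      moreover have "\<kappa> * 1 \<le> \<kappa> * N" using N1 by (rule mult_le_mono2)
      moreover have "\<kappa> ^ 1 * N \<le> \<kappa> ^ 4 * N" by (rule kN) simp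
      then have "\<kappa> * N \<le> \<kappa> ^ 4 * N" by (simp only: power_one_right)
      ultimately have "\<kappa> ^ 2 * (\<kappa> * (N + N)) + (k1 + 2) \<le> 2 * (\<kappa> ^ 4 * N)"
        using kappa_ge(1,2) k1_ge(2) by linarith
      also have "\<dots> \<le> \<kappa> ^ Suc 4 * N" by (rule k2)
      also have "\<dots> \<le> \<kappa> ^ 13 * N" by (rule kN) simp
      finally show "Suc (\<kappa> ^ 2 * (\<kappa> * (N + N)) + Suc (k1 + K)) \<le> K + \<kappa> ^ 13 * N" by simp
    qed
  qed
  show ?thesis
  proof (intro exI[of _ ?G2] conjI allI impI)
    show "set \<Gamma> \<subseteq> set ?G2" by auto
  qed (use c12(4) fG2 dec3 elim in blast)+
qed

end

section \<open>Induction over formulas\<close>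

text \<open>Nodes are counted instead of characters because renaming a variable to a fresh one may
  lengthen its name; the number of nodes is unchanged and can serve as the induction
  measure.\<close>

fun trm_nodes :: "trm \<Rightarrow> nat" where
  "trm_nodes (Add s t) = trm_nodes s + trm_nodes t + 1"
| "trm_nodes t = 1"

fun fm_nodes :: "fm \<Rightarrow> nat" where
  "fm_nodes (Equ s t) = trm_nodes s + trm_nodes t + 1"
| "fm_nodes (Neg \<phi>) = fm_nodes \<phi> + 1"
| "fm_nodes (Conj \<phi> \<psi>) = fm_nodes \<phi> + fm_nodes \<psi> + 1"
| "fm_nodes (Disj \<phi> \<psi>) = fm_nodes \<phi> + fm_nodes \<psi> + 1"
| "fm_nodes (Imp \<phi> \<psi>) = fm_nodes \<phi> + fm_nodes \<psi> + 1"
| "fm_nodes (Forall x \<phi>) = fm_nodes \<phi> + 1"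
| "fm_nodes (Exists x \<phi>) = fm_nodes \<phi> + 1"

fun quant_depth :: "fm \<Rightarrow> nat" where
  "quant_depth (Equ s t) = 0"
| "quant_depth (Neg \<phi>) = quant_depth \<phi>"
| "quant_depth (Conj \<phi> \<psi>) = max (quant_depth \<phi>) (quant_depth \<psi>)"
| "quant_depth (Disj \<phi> \<psi>) = max (quant_depth \<phi>) (quant_depth \<psi>)"
| "quant_depth (Imp \<phi> \<psi>) = max (quant_depth \<phi>) (quant_depth \<psi>)"
| "quant_depth (Forall x \<phi>) = quant_depth \<phi> + 1"
| "quant_depth (Exists x \<phi>) = quant_depth \<phi> + 1"

lemma trm_nodes_tsubst [simp]: "trm_nodes (tsubst x (Var y) t) = trm_nodes t" by (induction t) auto
lemma fm_nodes_subst [simp]: "fm_nodes (subst x (Var y) \<phi>) = fm_nodes \<phi>" by (induction \<phi>) auto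
lemma quant_depth_subst [simp]: "quant_depth (subst x u \<phi>) = quant_depth \<phi>" by (induction \<phi>) auto
lemma trm_nodes_le_tsz: "trm_nodes t \<le> tsz t" by (induction t) auto
lemma fm_nodes_le_fsz: "fm_nodes \<phi> \<le> fsz \<phi>"
proof (induction \<phi>)
  case (Equ s t) show ?case using trm_nodes_le_tsz[of s] trm_nodes_le_tsz[of t] by simp
qed auto
lemma quant_depth_le_fm_nodes: "quant_depth \<phi> \<le> fm_nodes \<phi>" by (induction \<phi>) auto

lemma tsz_le_trm_nodes: "vars t \<subseteq> {..<R} \<Longrightarrow> tsz t \<le> (R + 5) * trm_nodes t"
proof (induction t)
  case (Var i) then show ?case using vsz_le[of i] by simp
qed (auto simp: algebra_simps)

lemma fsz_le_fm_nodes: "fv \<phi> \<union> bound_vars \<phi> \<subseteq> {..<R} \<Longrightarrow> fsz \<phi> \<le> (R + 5) * fm_nodes \<phi>"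
proof (induction \<phi>)
  case (Equ s t)
  then show ?case using tsz_le_trm_nodes[of s R] tsz_le_trm_nodes[of t R] by (simp add: algebra_simps)
next
  case (Forall x \<phi>)
  then have "fsz \<phi> \<le> (R + 5) * fm_nodes \<phi>" by (intro Forall.IH) auto
  then show ?case using vsz_le[of x] Forall.prems by simp
next
  case (Exists x \<phi>)
  then have "fsz \<phi> \<le> (R + 5) * fm_nodes \<phi>" by (intro Exists.IH) auto
  then show ?case using vsz_le[of x] Exists.prems by simp
qed (auto simp: algebra_simps)

lemma eval_cong: "(\<And>i. i \<in> vars t \<Longrightarrow> e i = e' i) \<Longrightarrow> eval e t = eval e' t" by (induction t) auto

lemma sat_cong: "(\<And>i. i \<in> fv \<phi> \<Longrightarrow> e i = e' i) \<Longrightarrow> sat e \<phi> \<longleftrightarrow> sat e' \<phi>"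
proof (induction \<phi> arbitrary: e e')
  case (Equ s t) then show ?case using eval_cong[of s e e'] eval_cong[of t e e'] by auto
next
  case (Forall x \<phi>)
  have "sat (e(x := n)) \<phi> \<longleftrightarrow> sat (e'(x := n)) \<phi>" for n by (rule Forall.IH) (use Forall.prems in auto)
  then show ?case by simp
next
  case (Exists x \<phi>)
  have "sat (e(x := n)) \<phi> \<longleftrightarrow> sat (e'(x := n)) \<phi>" for n by (rule Exists.IH) (use Exists.prems in auto)
  then show ?case by simp
next
  case (Neg \<phi>)
  have "sat e \<phi> \<longleftrightarrow> sat e' \<phi>" by (rule Neg.IH) (use Neg.prems in auto)
  then show ?case by simp
next
  case (Conj \<phi> \<psi>)
  have "sat e \<phi> \<longleftrightarrow> sat e' \<phi>" by (rule Conj.IH(1)) (use Conj.prems in auto)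
  moreover have "sat e \<psi> \<longleftrightarrow> sat e' \<psi>" by (rule Conj.IH(2)) (use Conj.prems in auto)
  ultimately show ?case by simp
next
  case (Disj \<phi> \<psi>)
  have "sat e \<phi> \<longleftrightarrow> sat e' \<phi>" by (rule Disj.IH(1)) (use Disj.prems in auto)
  moreover have "sat e \<psi> \<longleftrightarrow> sat e' \<psi>" by (rule Disj.IH(2)) (use Disj.prems in auto)
  ultimately show ?case by simp
next
  case (Imp \<phi> \<psi>)
  have "sat e \<phi> \<longleftrightarrow> sat e' \<phi>" by (rule Imp.IH(1)) (use Imp.prems in auto)
  moreover have "sat e \<psi> \<longleftrightarrow> sat e' \<psi>" by (rule Imp.IH(2)) (use Imp.prems in auto)
  ultimately show ?case by simp
qed

lemma eval_tsubst_var: "eval e (tsubst x (Var y) t) = eval (e(x := e y)) t" by (induction t) auto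

lemma sat_subst_var: "y \<notin> bound_vars \<phi> \<Longrightarrow> sat e (subst x (Var y) \<phi>) \<longleftrightarrow> sat (e(x := e y)) \<phi>"
proof (induction \<phi> arbitrary: e)
  case (Forall z \<phi>)
  show ?case
  proof (cases "z = x")
    case True
    then show ?thesis by (simp only: subst.simps refl if_True sat.simps fun_upd_upd)
  next
    case False
    have "sat (e(z := n)) (subst x (Var y) \<phi>) \<longleftrightarrow> sat ((e(x := e y))(z := n)) \<phi>" for n
    proof -
      have "(e(z := n)) y = e y" "(e(z := n))(x := e y) = (e(x := e y))(z := n)"
        using Forall.prems False by (auto simp: fun_upd_twist)
      then show ?thesis using Forall.IH[of "e(z := n)"] Forall.prems by (simp only: bound_vars.simps insert_iff de_Morgan_disj simp_thms)
    qed
    then show ?thesis using False by (simp only: subst.simps if_False sat.simps)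
  qed
next
  case (Exists z \<phi>)
  show ?case
  proof (cases "z = x")
    case True
    then show ?thesis by (simp only: subst.simps refl if_True sat.simps fun_upd_upd)
  next
    case False
    have "sat (e(z := n)) (subst x (Var y) \<phi>) \<longleftrightarrow> sat ((e(x := e y))(z := n)) \<phi>" for n
    proof -
      have "(e(z := n)) y = e y" "(e(z := n))(x := e y) = (e(x := e y))(z := n)"
        using Exists.prems False by (auto simp: fun_upd_twist)
      then show ?thesis using Exists.IH[of "e(z := n)"] Exists.prems by (simp only: bound_vars.simps insert_iff de_Morgan_disj simp_thms)
    qed
    then show ?thesis using False by (simp only: subst.simps if_False sat.simps)
  qed
qed (auto simp: eval_tsubst_var)

lemma vars_tsubst: "vars (tsubst x (Var y) t) \<subseteq> vars t - {x} \<union> {y}" by (induction t) auto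
lemma fv_subst_var: "fv (subst x (Var y) \<phi>) \<subseteq> fv \<phi> - {x} \<union> {y}"
proof (induction \<phi>)
  case (Equ s t) then show ?case using vars_tsubst[of x y s] vars_tsubst[of x y t] by auto
qed auto

section \<open>Atomic formulas as forms\<close>

context calc begin

lemma decides_mono_width:
  assumes "decides \<Gamma> N m V e A B M W" "W \<le> W'" shows "decides \<Gamma> N m V e A B M W'"
  using assms(1) form_bound_mono[OF _ assms(2)] unfolding decides_def by blast

definition diff_form :: "trm \<Rightarrow> trm \<Rightarrow> nat \<Rightarrow> int" where
  "diff_form s t = (\<lambda>i. int (count (mset (flat t)) (atom i)) - int (count (mset (flat s)) (atom i)))"

lemma val_count:
  assumes "vars t \<subseteq> {10..<R}"
  shows "(\<Sum>i<R. int (count (mset (flat t)) (atom i)) * int (ev0 e i)) = int (eval e t)"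
  using assms
proof (induction t)
  case (Var j)
  then have j: "10 \<le> j" "j < R" by auto
  have "(\<Sum>i<R. int (count (mset (flat (Var j))) (atom i)) * int (ev0 e i)) = (\<Sum>i<R. if i = j then int (e i) else 0)"
    by (rule sum.cong) (use j in \<open>auto simp: atom_def ev0_def\<close>)
  then show ?case using j by simp
next
  case One
  have "(\<Sum>i<R. int (count (mset (flat One)) (atom i)) * int (ev0 e i)) = (\<Sum>i<R. if i = 0 then 1 else 0)"
    by (rule sum.cong) (auto simp: atom_def ev0_def)
  then show ?case using R20 by simp
next
  case (Add s t)
  then show ?case by (simp add: distrib_right sum.distrib)
qed auto

lemma val_diff_form:
  assumes "vars s \<subseteq> {10..<R}" "vars t \<subseteq> {10..<R}"
  shows "val (diff_form s t) e = int (eval e t) - int (eval e s)"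
  unfolding val_def diff_form_def left_diff_distrib sum_subtractf using val_count[OF assms(1)] val_count[OF assms(2)] by simp

lemma count_flat: "count (mset (flat t)) x \<le> trm_nodes t" by (induction t) auto

lemma over_diff_form:
  assumes "vars s \<subseteq> V" "vars t \<subseteq> V" "0 \<notin> V" "trm_nodes s + trm_nodes t \<le> A" "trm_nodes s + trm_nodes t \<le> B"
  shows "over V A B (diff_form s t)"
proof -
  have "\<bar>diff_form s t i\<bar> \<le> int (trm_nodes s + trm_nodes t)" for i
    using count_flat[of s "atom i"] count_flat[of t "atom i"] by (simp add: diff_form_def)
  then have b: "\<bar>diff_form s t i\<bar> \<le> int A" "\<bar>diff_form s t i\<bar> \<le> int B" for i using assms by (meson of_nat_mono order_trans)+
  have *: "Var i \<notin> set (flat t)" if "i \<notin> vars t" for i t using that by (induction t) auto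
  have z: "diff_form s t i = 0" if "i \<noteq> 0" "i \<notin> V" for i
  proof -
    have "i \<notin> vars s" "i \<notin> vars t" using that assms(1,2) by auto
    then have "Var i \<notin> set (flat s)" "Var i \<notin> set (flat t)" using * by blast+
    then have c: "count (mset (flat s)) (Var i) = 0" "count (mset (flat t)) (Var i) = 0"
      by (simp_all add: count_eq_zero_iff)
    show ?thesis by (simp only: diff_form_def atom_def if_not_P[OF that(1)] c of_nat_0 diff_self)
  qed
  show ?thesis unfolding over_def using b z by blast
qed

text \<open>The language has no falsum, and the conclusion of an existential elimination may not
  contain the eigenvariable. The contradiction about z is therefore exported as the negation of 0 =
  0.\<close>

lemma der_not_exists:
  assumes "csz \<Gamma> + 50 * \<tau> \<le> G" "fsz (Exists x \<phi>) \<le> 20 * \<tau>" "fsz (subst x (Var z) \<phi>) \<le> 20 * \<tau>"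
    "z \<notin> bound_vars \<phi>" "z \<notin> fv \<phi>" "z \<notin> fvs \<Gamma>"
    "der L N \<Gamma> (Neg (subst x (Var z) \<phi>))"
  shows "der L (N + 20) \<Gamma> (Neg (Exists x \<phi>))"
proof -
  let ?E = "Exists x \<phi>" and ?p = "subst x (Var z) \<phi>" and ?o = "Equ Zero Zero"
  have 1: "der L 1 (?E # \<Gamma>) ?o" by (rule der_refl) (use assms L_slack tau_ge in auto)
  have 2: "der L 1 (?p # ?E # \<Gamma>) ?p" by (rule der_assume) (use assms L_slack tau_ge in auto)
  have 3: "der L (Suc N) (?p # ?E # \<Gamma>) (Neg ?p)" by (rule der_weaken[OF assms(7)]) (use assms L_slack tau_ge in auto)
  have 4: "der L (1 + Suc N + 3) (?p # ?E # \<Gamma>) (Neg ?o)"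
    by (rule der_explode[OF 2 3]) (use assms L_slack tau_ge in auto)
  have 5: "der L 1 (?E # \<Gamma>) ?E" by (rule der_assume) (use assms L_slack tau_ge in auto)
  have "der L (Suc (1 + (1 + Suc N + 3))) (?E # \<Gamma>) (Neg ?o)"
    by (rule der_existsE[OF 5 4]) (use assms in \<open>auto intro!: free_for_bvs\<close>)
  from der_negI[OF 1 this] show ?thesis by (rule der_lines_mono) simp
qed

end

text \<open>The sequences are indexed by the remaining quantifier depth. A quantifier uses up two fresh variables,
  which start at \<open>m0\<close>.\<close>

locale levels = lev +
  fixes As Bs Ms Ws :: "nat \<Rightarrow> nat" and D m0 P S0 :: nat
  assumes lA: "\<And>j. 1 \<le> As j" and lM: "\<And>j. 1 \<le> Ms j"
    and lA': "\<And>j. j < D \<Longrightarrow> 2 * As j * As j \<le> As (Suc j)"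
    and lB': "\<And>j. j < D \<Longrightarrow> 2 * As j * (As j * Ms j + Bs j + 1) \<le> Bs (Suc j)"
    and lM': "\<And>j a. j < D \<Longrightarrow> 1 \<le> a \<Longrightarrow> a \<le> As j \<Longrightarrow> a * Ms j dvd Ms (Suc j)"
    and lQ: "\<And>j. j < D \<Longrightarrow> As (Suc j) \<le> Q" "\<And>j. j < D \<Longrightarrow> Bs (Suc j) \<le> Q"
      "\<And>j. j < D \<Longrightarrow> Ms (Suc j) \<le> Q" "\<And>j. j < D \<Longrightarrow> Ws j \<le> Q"
    and lW: "\<And>j. j < D \<Longrightarrow> Ws (Suc j) + As j * Ms j \<le> Ws j"
    and m0: "10 \<le> m0" "m0 + 2 * D + 2 \<le> R"
    and lP: "\<And>j. j < D \<Longrightarrow> (2 * As j + 1) ^ Suc D \<le> P"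
    and lS: "\<And>j. j \<le> D \<Longrightarrow> S0 + 1 \<le> As j" "\<And>j. j \<le> D \<Longrightarrow> S0 + 1 \<le> Bs j" "\<And>j. j \<le> D \<Longrightarrow> Bs j \<le> Q" "\<And>j. j \<le> D \<Longrightarrow> As j \<le> Q"
    and lG: "D * ((4 * P + 30) * \<tau>) + 1000 * \<tau> \<le> G"
begin

text \<open>The size that a context may have after D - j quantifiers. A quantifier adds at most one
  inequality for each of the at most \<open>P\<close> forms, and a few further formulas.\<close>

definition Y :: "nat \<Rightarrow> nat" where "Y j = (D - j) * ((4 * P + 30) * \<tau>)"
text \<open>The factor paid for a quantifier: \<open>\<kappa> ^ 13\<close> for a description with
  one more variable, \<open>(20 * Q) ^ P\<close> for the splits on forms, and \<open>Q ^ 4\<close>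
  for the residue classes and for deriving \<open>Res\<close>.\<close>

definition Z0 :: nat where "Z0 = \<kappa> ^ 13 * (Q ^ 4 * (20 * Q) ^ P)"
definition Z :: nat where "Z = 100 * Z0"

lemma Y_G: "Y j + 1000 * \<tau> \<le> G"
proof -
  have "Y j \<le> D * ((4 * P + 30) * \<tau>)" unfolding Y_def by (rule mult_le_mono1) simp
  then show ?thesis using lG by linarith
qed

lemma Y_Suc: "j < D \<Longrightarrow> Y j = Y (Suc j) + (4 * P + 30) * \<tau>"
proof -
  assume "j < D"
  then have "D - j = Suc (D - Suc j)" by simp
  then show ?thesis by (simp add: Y_def)
qed

lemma S0H: "S0 \<le> H" using lS(1)[of 0] lS(4)[of 0] Qpow by simp

lemma fsz_small: "fm_nodes \<phi> \<le> S0 \<Longrightarrow> fv \<phi> \<union> bound_vars \<phi> \<subseteq> {..<R} \<Longrightarrow> fsz \<phi> \<le> \<tau>"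
proof -
  assume a: "fm_nodes \<phi> \<le> S0" "fv \<phi> \<union> bound_vars \<phi> \<subseteq> {..<R}"
  have "fsz \<phi> \<le> (R + 5) * fm_nodes \<phi>" by (rule fsz_le_fm_nodes[OF a(2)])
  also have "\<dots> \<le> (R + 10) * (H + 1)" using a S0H by (intro mult_le_mono) auto
  also have "\<dots> \<le> \<tau>" using RH_tau by linarith
  finally show ?thesis .
qed

lemma tsz_small: "trm_nodes t \<le> S0 \<Longrightarrow> vars t \<subseteq> {..<R} \<Longrightarrow> tsz t \<le> \<tau>"
proof -
  assume a: "trm_nodes t \<le> S0" "vars t \<subseteq> {..<R}"
  have "tsz t \<le> (R + 5) * trm_nodes t" by (rule tsz_le_trm_nodes[OF a(2)])
  also have "\<dots> \<le> (R + 10) * (H + 1)" using a S0H by (intro mult_le_mono) auto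
  also have "\<dots> \<le> \<tau>" using RH_tau by linarith
  finally show ?thesis .
qed

definition state :: "nat \<Rightarrow> fm list \<Rightarrow> nat \<Rightarrow> nat \<Rightarrow> nat set \<Rightarrow> (nat \<Rightarrow> nat) \<Rightarrow> bool" where
  "state j \<Gamma> N m V e \<longleftrightarrow> j \<le> D \<and> m = m0 + 2 * (D - j) \<and> V \<subseteq> {m0..<m} \<and> card V \<le> D - j \<and>
     fvs \<Gamma> \<subseteq> {..<m} \<and> csz \<Gamma> \<le> Y j \<and> 1 \<le> N \<and> decides \<Gamma> N m V e (As j) (Bs j) (Ms j) (Ws j)"

lemma state_step:
  assumes "state (Suc j) \<Gamma> N m V e" "Suc j \<le> D"
  shows "step R H G L Q (As j) (Bs j) (As j * Ms j + Bs j) (Ms j) (Ws (Suc j)) (As (Suc j)) (Bs (Suc j)) (Ms (Suc j)) m V e \<Gamma> N"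
proof unfold_locales
  have j: "j < D" using assms(2) by simp
  show "1 \<le> As j" "1 \<le> Ms j" "As j * Ms j + Bs j \<le> As j * Ms j + Bs j" "2 * As j * As j \<le> As (Suc j)"
    "2 * As j * (As j * Ms j + Bs j + 1) \<le> Bs (Suc j)" "1 \<le> Ms (Suc j)" "As (Suc j) \<le> Q" "Bs (Suc j) \<le> Q" "Ms (Suc j) \<le> Q"
    using lA lM lA' lB' lQ j by auto
  show "a * Ms j dvd Ms (Suc j)" if "1 \<le> a" "a \<le> As j" for a using lM' j that by blast
  show "Ws (Suc j) + As j * Ms j \<le> Q" using lW[OF j] lQ(4)[OF j] by linarith
  show "10 \<le> m" "m + 1 < R" using assms m0 unfolding state_def by auto
  show "V \<subseteq> {10..<m}" using assms(1) m0 unfolding state_def by fastforce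
  show "fvs \<Gamma> \<subseteq> {..<m}" "1 \<le> N" "decides \<Gamma> N m V e (As (Suc j)) (Bs (Suc j)) (Ms (Suc j)) (Ws (Suc j))"
    using assms(1) unfolding state_def by auto
  have "csz \<Gamma> \<le> Y (Suc j)" using assms(1) unfolding state_def by blast
  then show "csz \<Gamma> + 200 * \<tau> \<le> G" using Y_G[of "Suc j"] by linarith
qed

lemma state_next:
  assumes "state (Suc j) \<Gamma> N m V e" "Suc j \<le> D" and "csz \<Delta> \<le> Y j" "fvs \<Delta> \<subseteq> {..<m + 2}" "1 \<le> K"
    "decides \<Delta> K (m + 2) (insert m V) (e(m := n)) (As j) (Bs j) (Ms j) (Ws (Suc j) + As j * Ms j)"
  shows "state j \<Delta> K (m + 2) (insert m V) (e(m := n))"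
proof -
  have j: "j < D" using assms(2) by simp
  have m: "m = m0 + 2 * (D - Suc j)" "V \<subseteq> {m0..<m}" "card V \<le> D - Suc j" using assms(1) by (auto simp: state_def)
  have "D - j = Suc (D - Suc j)" using j by simp
  moreover have "finite V" using m(2) finite_subset by blast
  then have "card (insert m V) \<le> Suc (card V)" by (simp add: card_insert_if)
  moreover have "decides \<Delta> K (m + 2) (insert m V) (e(m := n)) (As j) (Bs j) (Ms j) (Ws j)"
    by (rule decides_mono_width[OF assms(6) lW[OF j]])
  ultimately show ?thesis using m assms(3-5) j unfolding state_def by auto
qed


lemma Z0_ge: "1 \<le> Z0" "\<kappa> ^ 13 \<le> Z0"
proof -
  have "1 * 1 \<le> Q ^ 4 * (20 * Q) ^ P" using Q1 by (intro mult_le_mono one_le_power) auto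
  then have "\<kappa> ^ 13 * 1 \<le> Z0" unfolding Z0_def by (intro mult_le_mono2) simp
  then show "\<kappa> ^ 13 \<le> Z0" by simp
  moreover have "1 \<le> \<kappa> ^ 13" using kappa_ge by (intro one_le_power) linarith
  ultimately show "1 \<le> Z0" by linarith
qed

text \<open>One factor \<open>Z\<close> per node of the formula, for connectives and quantifiers
  alike, so that a single measure governs the recursion.\<close>

definition cost :: "nat \<Rightarrow> nat \<Rightarrow> nat" where "cost N k = N * Z ^ k"

lemma cost_ge: "1 \<le> N \<Longrightarrow> 1 \<le> cost N k" "1 \<le> N \<Longrightarrow> N \<le> cost N k" "k \<le> l \<Longrightarrow> cost N k \<le> cost N l"
  "1 \<le> k \<Longrightarrow> 100 * cost N (k - 1) \<le> cost N k" "100 * cost N k \<le> cost N (Suc k)"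
proof -
  have Z1: "1 \<le> Z" using Z0_ge by (simp add: Z_def)
  then have *: "N * 1 \<le> cost N k" for k unfolding cost_def by (intro mult_le_mono2 one_le_power)
  then show "1 \<le> N \<Longrightarrow> N \<le> cost N k" by simp
  show "1 \<le> N \<Longrightarrow> 1 \<le> cost N k" using *[of k] by linarith
  show "k \<le> l \<Longrightarrow> cost N k \<le> cost N l" unfolding cost_def using Z1 by (intro mult_le_mono2 power_increasing) auto
  have **: "100 * cost N k \<le> cost N (Suc k)" for k
  proof -
    have "100 \<le> Z" using Z0_ge by (simp add: Z_def)
    then have "100 * (N * Z ^ k) \<le> Z * (N * Z ^ k)" by (rule mult_le_mono1)
    then show ?thesis by (simp add: cost_def)
  qed
  then show "100 * cost N k \<le> cost N (Suc k)" .
  show "1 \<le> k \<Longrightarrow> 100 * cost N (k - 1) \<le> cost N k" using **[of "k - 1"] by simp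
qed

text \<open>The final 30 leaves room for the rules that introduce or refute the quantifier.\<close>

lemma cost_quantifier:
  assumes N: "1 \<le> N" and j: "j < D" and c: "card X \<le> P" and C: "C + 1 \<le> Q"
  shows "\<kappa> ^ 7 * Ms j ^ 4 + Ms j * ((20 * (C + 1)) ^ card X * cost (\<kappa> ^ 13 * N) k + 30) + 30 \<le> cost N (Suc k)"
proof -
  have M: "Ms j \<le> Q"
  proof -
    have "1 * Ms j dvd Ms (Suc j)" using lA[of j] by (intro lM'[OF j]) auto
    then have "Ms j \<le> Ms (Suc j)" using lM[of "Suc j"] by (auto dest: dvd_imp_le)
    then show ?thesis using lQ(3)[OF j] by linarith
  qed
  let ?y = "N * Z ^ k"
  have y: "1 \<le> ?y" using cost_ge(1)[OF N] by (simp add: cost_def)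
  have Qs: "1 \<le> Q ^ 4" "1 \<le> (20 * Q) ^ P" "1 \<le> \<kappa> ^ 13" using Q1 kappa_ge by (auto intro!: one_le_power)
  have 1: "\<kappa> ^ 7 * Ms j ^ 4 \<le> Z0 * ?y"
  proof -
    have a: "\<kappa> ^ 7 \<le> \<kappa> ^ 13" using kappa_ge by (intro power_increasing) auto
    have b: "Ms j ^ 4 * 1 \<le> Q ^ 4 * (20 * Q) ^ P" using M Qs by (intro mult_le_mono power_mono) auto
    have "\<kappa> ^ 7 * (Ms j ^ 4 * 1) * 1 \<le> Z0 * ?y"
      unfolding Z0_def by (rule mult_le_mono[OF mult_le_mono[OF a b] y])
    then show ?thesis by simp
  qed
  have 2: "Ms j * ((20 * (C + 1)) ^ card X * cost (\<kappa> ^ 13 * N) k) \<le> Z0 * ?y"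
  proof -
    have Q4: "Ms j \<le> Q ^ 4" using M Qpow by linarith
    have "(20 * (C + 1)) ^ card X \<le> (20 * Q) ^ card X" using C by (intro power_mono) auto
    also have "\<dots> \<le> (20 * Q) ^ P" using c Q1 by (intro power_increasing) auto
    finally have p: "(20 * (C + 1)) ^ card X \<le> (20 * Q) ^ P" .
    have "Ms j * (20 * (C + 1)) ^ card X * (\<kappa> ^ 13 * ?y) \<le> Q ^ 4 * (20 * Q) ^ P * (\<kappa> ^ 13 * ?y)"
      by (rule mult_le_mono1[OF mult_le_mono[OF Q4 p]])
    then show ?thesis by (simp add: cost_def Z0_def mult_ac)
  qed
  have 3: "Ms j \<le> Z0 * ?y"
  proof -
    have "1 * (Ms j * 1) * 1 \<le> \<kappa> ^ 13 * (Q ^ 4 * (20 * Q) ^ P) * ?y"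
      using M Qpow Qs by (intro mult_le_mono y) linarith+
    then show ?thesis by (simp add: Z0_def)
  qed
  have "1 * 1 \<le> Z0 * ?y" by (rule mult_le_mono[OF Z0_ge(1) y])
  moreover have "Ms j * ((20 * (C + 1)) ^ card X * cost (\<kappa> ^ 13 * N) k + 30)
      = Ms j * ((20 * (C + 1)) ^ card X * cost (\<kappa> ^ 13 * N) k) + 30 * Ms j" by (simp add: algebra_simps)
  ultimately have "\<kappa> ^ 7 * Ms j ^ 4 + Ms j * ((20 * (C + 1)) ^ card X * cost (\<kappa> ^ 13 * N) k + 30) + 30 \<le> 100 * (Z0 * ?y)"
    using 1 2 3 by linarith
  also have "\<dots> = cost N (Suc k)" by (simp add: cost_def Z_def)
  finally show ?thesis .
qed

end

section \<open>Proving and refuting compound formulas from their parts\<close>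

context calc begin

lemma prop_rules:
  assumes "csz \<Gamma> + 50 * \<tau> \<le> G" "fsz \<phi> \<le> 5 * \<tau>" "fsz \<psi> \<le> 5 * \<tau>"
  shows neg_neg_rule: "der L N \<Gamma> \<phi> \<Longrightarrow> der L (N + 5) \<Gamma> (Neg (Neg \<phi>))"
    and neg_conj_rule1: "der L N \<Gamma> (Neg \<phi>) \<Longrightarrow> der L (N + 5) \<Gamma> (Neg (Conj \<phi> \<psi>))"
    and neg_conj_rule2: "der L N \<Gamma> (Neg \<psi>) \<Longrightarrow> der L (N + 5) \<Gamma> (Neg (Conj \<phi> \<psi>))"
    and neg_disj_rule: "der L N \<Gamma> (Neg \<phi>) \<Longrightarrow> der L M \<Gamma> (Neg \<psi>) \<Longrightarrow> der L (N + M + 15) \<Gamma> (Neg (Disj \<phi> \<psi>))"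
    and imp_rule1: "der L N \<Gamma> (Neg \<phi>) \<Longrightarrow> der L (N + 9) \<Gamma> (Imp \<phi> \<psi>)"
    and imp_rule2: "der L N \<Gamma> \<psi> \<Longrightarrow> der L (N + 5) \<Gamma> (Imp \<phi> \<psi>)"
    and neg_imp_rule: "der L N \<Gamma> \<phi> \<Longrightarrow> der L M \<Gamma> (Neg \<psi>) \<Longrightarrow> der L (N + M + 9) \<Gamma> (Neg (Imp \<phi> \<psi>))"
proof -
  note w = assms L_slack tau_ge
  show "der L N \<Gamma> \<phi> \<Longrightarrow> der L (N + 5) \<Gamma> (Neg (Neg \<phi>))"
  proof -
    assume a: "der L N \<Gamma> \<phi>"
    have 1: "der L (Suc N) (Neg \<phi> # \<Gamma>) \<phi>" by (rule der_weaken[OF a]) (use w in auto)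
    have 2: "der L 1 (Neg \<phi> # \<Gamma>) (Neg \<phi>)" by (rule der_assume) (use w in auto)
    from der_negI[OF 1 2] show ?thesis by (rule der_lines_mono) simp
  qed
  have C: "der L 1 (Conj \<phi> \<psi> # \<Gamma>) (Conj \<phi> \<psi>)" by (rule der_assume) (use w in auto)
  show "der L N \<Gamma> (Neg \<phi>) \<Longrightarrow> der L (N + 5) \<Gamma> (Neg (Conj \<phi> \<psi>))"
  proof -
    assume a: "der L N \<Gamma> (Neg \<phi>)"
    have "der L (Suc N) (Conj \<phi> \<psi> # \<Gamma>) (Neg \<phi>)" by (rule der_weaken[OF a]) (use w in auto)
    from der_negI[OF der_conjE1[OF C] this] show ?thesis by (rule der_lines_mono) simp
  qed
  show "der L N \<Gamma> (Neg \<psi>) \<Longrightarrow> der L (N + 5) \<Gamma> (Neg (Conj \<phi> \<psi>))"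
  proof -
    assume a: "der L N \<Gamma> (Neg \<psi>)"
    have "der L (Suc N) (Conj \<phi> \<psi> # \<Gamma>) (Neg \<psi>)" by (rule der_weaken[OF a]) (use w in auto)
    from der_negI[OF der_conjE2[OF C] this] show ?thesis by (rule der_lines_mono) simp
  qed
  show "der L N \<Gamma> (Neg \<phi>) \<Longrightarrow> der L M \<Gamma> (Neg \<psi>) \<Longrightarrow> der L (N + M + 15) \<Gamma> (Neg (Disj \<phi> \<psi>))"
  proof -
    assume a: "der L N \<Gamma> (Neg \<phi>)" and b: "der L M \<Gamma> (Neg \<psi>)"
    let ?D = "Disj \<phi> \<psi>"
    have d: "der L 1 (?D # \<Gamma>) ?D" by (rule der_assume) (use w in auto)
    have 1: "der L 1 (\<phi> # ?D # \<Gamma>) \<phi>" by (rule der_assume) (use w in auto)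
    have 2: "der L 1 (\<psi> # ?D # \<Gamma>) \<psi>" by (rule der_assume) (use w in auto)
    have 3: "der L (Suc M) (\<psi> # ?D # \<Gamma>) (Neg \<psi>)" by (rule der_weaken[OF b]) (use w in auto)
    have 4: "der L (1 + Suc M + 3) (\<psi> # ?D # \<Gamma>) \<phi>" by (rule der_explode[OF 2 3]) (use w in auto)
    have 5: "der L (Suc N) (?D # \<Gamma>) (Neg \<phi>)" by (rule der_weaken[OF a]) (use w in auto)
    from der_negI[OF der_disjE[OF d 1 4] 5] show ?thesis by (rule der_lines_mono) simp
  qed
  show "der L N \<Gamma> (Neg \<phi>) \<Longrightarrow> der L (N + 9) \<Gamma> (Imp \<phi> \<psi>)"
  proof -
    assume a: "der L N \<Gamma> (Neg \<phi>)"
    have 1: "der L 1 (\<phi> # \<Gamma>) \<phi>" by (rule der_assume) (use w in auto)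
    have 2: "der L (Suc N) (\<phi> # \<Gamma>) (Neg \<phi>)" by (rule der_weaken[OF a]) (use w in auto)
    have 3: "der L (1 + Suc N + 3) (\<phi> # \<Gamma>) \<psi>" by (rule der_explode[OF 1 2]) (use w in auto)
    have "der L (Suc (1 + Suc N + 3)) \<Gamma> (Imp \<phi> \<psi>)" by (rule der_impI[OF 3]) (use w in auto)
    then show ?thesis by (rule der_lines_mono) simp
  qed
  show "der L N \<Gamma> \<psi> \<Longrightarrow> der L (N + 5) \<Gamma> (Imp \<phi> \<psi>)"
  proof -
    assume a: "der L N \<Gamma> \<psi>"
    have 1: "der L (Suc N) (\<phi> # \<Gamma>) \<psi>" by (rule der_weaken[OF a]) (use w in auto)
    have "der L (Suc (Suc N)) \<Gamma> (Imp \<phi> \<psi>)" by (rule der_impI[OF 1]) (use w in auto)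
    then show ?thesis by (rule der_lines_mono) simp
  qed
  show "der L N \<Gamma> \<phi> \<Longrightarrow> der L M \<Gamma> (Neg \<psi>) \<Longrightarrow> der L (N + M + 9) \<Gamma> (Neg (Imp \<phi> \<psi>))"
  proof -
    assume a: "der L N \<Gamma> \<phi>" and b: "der L M \<Gamma> (Neg \<psi>)"
    let ?D = "Imp \<phi> \<psi>"
    have d: "der L 1 (?D # \<Gamma>) ?D" by (rule der_assume) (use w in auto)
    have 1: "der L (Suc N) (?D # \<Gamma>) \<phi>" by (rule der_weaken[OF a]) (use w in auto)
    have 2: "der L (Suc M) (?D # \<Gamma>) (Neg \<psi>)" by (rule der_weaken[OF b]) (use w in auto)
    from der_negI[OF der_impE[OF d 1] 2] show ?thesis by (rule der_lines_mono) simp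
  qed
qed

lemma neg_forall_rule:
  assumes "csz \<Gamma> + 50 * \<tau> \<le> G" "fsz (Forall x \<phi>) \<le> 5 * \<tau>" "fsz (subst x (Var z) \<phi>) \<le> 5 * \<tau>" "z \<notin> bound_vars \<phi>"
    "der L N \<Gamma> (Neg (subst x (Var z) \<phi>))"
  shows "der L (N + 5) \<Gamma> (Neg (Forall x \<phi>))"
proof -
  let ?F = "Forall x \<phi>"
  have 1: "der L 1 (?F # \<Gamma>) ?F" by (rule der_assume) (use assms L_slack tau_ge in auto)
  have 2: "der L (Suc 1) (?F # \<Gamma>) (subst x (Var z) \<phi>)"
    by (rule der_forallE[OF 1]) (use assms L_slack tau_ge in \<open>auto intro!: free_for_bvs\<close>)
  have 3: "der L (Suc N) (?F # \<Gamma>) (Neg (subst x (Var z) \<phi>))"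
    by (rule der_weaken[OF assms(5)]) (use assms L_slack tau_ge in auto)
  from der_negI[OF 2 3] show ?thesis by (rule der_lines_mono) simp
qed

end

section \<open>Deciding all formulas in a context that describes a tuple\<close>

context levels begin

lemma state_facts:
  assumes "state j \<Gamma> N m V e"
  shows "csz \<Gamma> + 500 * \<tau> \<le> G" "V \<subseteq> {10..<R}" "V \<subseteq> {..<m}" "0 \<notin> V" "1 \<le> N" "m0 \<le> m" "j \<le> D" "m \<le> R"
proof -
  have j: "j \<le> D" "m = m0 + 2 * (D - j)" "V \<subseteq> {m0..<m}" "csz \<Gamma> \<le> Y j" "1 \<le> N" using assms by (auto simp: state_def)
  then show "csz \<Gamma> + 500 * \<tau> \<le> G" using Y_G[of j] by linarith
  show "m \<le> R" using j m0 by simp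
  then show "V \<subseteq> {10..<R}" "V \<subseteq> {..<m}" "0 \<notin> V" using j m0 by fastforce+
  show "1 \<le> N" "m0 \<le> m" "j \<le> D" using j by auto
qed

lemma decide_Equ:
  assumes st: "state j \<Gamma> N m V e" and V: "vars s \<subseteq> V" "vars t \<subseteq> V" and n: "fm_nodes (Equ s t) \<le> S0"
  shows "der L (cost N (fm_nodes (Equ s t))) \<Gamma> (if sat e (Equ s t) then Equ s t else Neg (Equ s t))"
proof -
  note sf = state_facts[OF st]
  have cG: "csz \<Gamma> \<le> G" using sf(1) by simp
  let ?f = "diff_form s t"
  have trm_nodes: "trm_nodes s + trm_nodes t \<le> S0" "trm_nodes s \<le> S0" "trm_nodes t \<le> S0" using n by auto
  have AB: "S0 + 1 \<le> As j" "S0 + 1 \<le> Bs j" "Bs j \<le> Q" "As j \<le> Q" using lS sf(7) by auto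
  \<comment> \<open>The constant stays 1 below its bound, so that the shifted form g - 1 used
    against a false equation is still covered by the description.\<close>
  have of: "over V (As j) (Bs j - 1) ?f" by (rule over_diff_form[OF V sf(4)]) (use trm_nodes AB in auto)
  have bf: "form_bound Q ?f" by (rule over_bd[OF of sf(2)]) (use AB in auto)
  have bH: "form_bound H ?f" using form_bound_mono[OF bf] Qpow by simp
  have vR: "vars s \<subseteq> {10..<R}" "vars t \<subseteq> {10..<R}" using V sf(2) by auto
  have b: "big s" "big t" using vR by (auto simp: big_def)
  have vR': "vars s \<subseteq> {..<R}" "vars t \<subseteq> {..<R}" using vR by auto
  have t: "tsz s \<le> \<tau>" "tsz t \<le> \<tau>" using tsz_small[OF trm_nodes(2) vR'(1)] tsz_small[OF trm_nodes(3) vR'(2)] by auto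
  have dec: "over V (As j) (Bs j) g \<Longrightarrow> 0 \<le> val g e \<Longrightarrow> der L N \<Gamma> (GE g)" for g
    using st unfolding state_def decides_def by blast
  have oB: "over V (As j) (Bs j) ?f" using over_mono[OF of] by simp
  have v: "val ?f e' = int (eval e' t) - int (eval e' s)" for e' by (rule val_diff_form[OF vR])
  have c1: "1 \<le> cost N 0" "N \<le> cost N 0" using cost_ge sf(5) by auto
  have "\<kappa> * N \<le> Z * N"
  proof (rule mult_le_mono1)
    have "\<kappa> \<le> \<kappa> ^ 13" using self_le_power[of \<kappa> 13] kappa_ge by auto
    then show "\<kappa> \<le> Z" using Z0_ge unfolding Z_def by linarith
  qed
  then have kZ: "\<kappa> * N \<le> cost N 1" by (simp add: cost_def mult.commute)
  have kN: "\<kappa> \<le> \<kappa> * N" "20 * k1 \<le> \<kappa> * N" "100 * N \<le> \<kappa> * N"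
  proof -
    have "\<kappa> * 1 \<le> \<kappa> * N" using sf(5) by (rule mult_le_mono2)
    then show "\<kappa> \<le> \<kappa> * N" "20 * k1 \<le> \<kappa> * N" using kappa_ge by linarith+
    show "100 * N \<le> \<kappa> * N" using kappa_ge(1) by (rule mult_le_mono1)
  qed
  have tn1: "1 \<le> trm_nodes x" for x by (cases x) auto
  have c3: "100 * cost N 1 \<le> cost N (fm_nodes (Equ s t))"
    using cost_ge(5)[of N 1] cost_ge(3)[of 2 "fm_nodes (Equ s t)" N] tn1[of s] tn1[of t] by (simp add: numeral_2_eq_2)
  show ?thesis
  proof (cases "eval e s = eval e t")
    case True
    have "EQ N \<Gamma> ?f" unfolding EQ_def using dec[OF oB] dec[of "neg ?f"] oB v[of e] True by simp
    then have "der L (2 * N + 3 * k1) \<Gamma> (Equ s t)"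
      by (rule Equ_of_EQ[OF cG]) (use b t bH v in auto)
    then have "der L (cost N (fm_nodes (Equ s t))) \<Gamma> (Equ s t)"
      by (rule der_lines_mono) (use kN kZ c3 in linarith)
    then show ?thesis using True by simp
  next
    case False
    let ?E = "Equ s t" and ?o = "Equ Zero Zero"
    have cE: "csz (?E # \<Gamma>) \<le> G" using sf(1) t tau_ge by simp
    \<comment> \<open>The difference of the sides with the sign that makes it positive at e. The
      context then knows g - 1 \<ge> 0, which contradicts the assumed equation.\<close>
    define g where "g = (if 0 < val ?f e then ?f else neg ?f)"
    define g1 where "g1 = (\<lambda>i. g i + (if i = 0 then - 1 else 0))"
    have og: "over V (As j) (Bs j - 1) g" using of by (simp add: g_def)
    have vg: "0 < val g e" using v[of e] False by (simp add: g_def)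
    have og1: "over V (As j) (Bs j) g1"
      unfolding over_def
    proof (intro conjI allI impI)
      have "\<bar>g 0\<bar> \<le> int (Bs j - 1)" using og by (simp add: over_def)
      then show "\<bar>g1 0\<bar> \<le> int (Bs j)" using AB by (simp add: g1_def of_nat_diff)
    qed (use og in \<open>auto simp: g1_def over_def\<close>)
    have "0 \<le> val g1 e" unfolding g1_def val_add_const using vg by simp
    then have 1: "der L N \<Gamma> (GE g1)" by (rule dec[OF og1])
    have bg1: "form_bound Q g1" by (rule over_bd[OF og1 sf(2)]) (use AB in auto)
    have bg: "form_bound Q (neg g)" using bf by (simp add: g_def)
    have 2: "der L (Suc N) (?E # \<Gamma>) (GE g1)"
      by (rule ge_weaken[OF 1 _ cE]) (use form_bound_mono[OF bg1, of H] Qpow in auto)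
    have "der L 1 (?E # \<Gamma>) ?E" by (rule der_assume) (use sf(1) t L_slack tau_ge in auto)
    then have "EQ (1 + 2 * k1) (?E # \<Gamma>) ?f" by (rule EQ_of_Equ[OF cE]) (use b t bH v in auto)
    then have 3: "der L (1 + 2 * k1) (?E # \<Gamma>) (GE (neg g))" by (simp add: EQ_def g_def)
    have 4: "der L (2 * \<kappa> * (Suc N + (1 + 2 * k1))) (?E # \<Gamma>) \<chi>" if "fsz \<chi> \<le> 100 * \<tau>" for \<chi>
    proof (rule ge_falsum[OF cE bg1 bg _ _ H1 H1 _ 2 3 _ _ that])
      show "1 * Q + 1 * Q + 1 \<le> H" using QH Qpow Q1 by linarith
    qed (use Qpow in \<open>auto simp: g1_def\<close>)
    have "der L (Suc (2 * \<kappa> * (Suc N + (1 + 2 * k1)) + 2 * \<kappa> * (Suc N + (1 + 2 * k1)))) \<Gamma> (Neg ?E)"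
      by (rule der_negI[OF 4[of ?o] 4[of "Neg ?o"]]) (use tau_ge in auto)
    moreover have "Suc (2 * \<kappa> * (Suc N + (1 + 2 * k1)) + 2 * \<kappa> * (Suc N + (1 + 2 * k1))) \<le> cost N (fm_nodes ?E)"
    proof -
      have "\<kappa> * (Suc N + (1 + 2 * k1)) \<le> \<kappa> * (\<kappa> * N)" using kN kappa_ge sf(5) by (intro mult_le_mono2) linarith
      also have "\<dots> \<le> \<kappa> * cost N 1" using kZ by (rule mult_le_mono2)
      also have "\<dots> \<le> Z * cost N 1"
      proof (rule mult_le_mono1)
        have "\<kappa> \<le> \<kappa> ^ 13" using self_le_power[of \<kappa> 13] kappa_ge by auto
        then show "\<kappa> \<le> Z" using Z0_ge unfolding Z_def by linarith
      qed
      also have "\<dots> = cost N 2" by (simp add: cost_def power2_eq_square)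
      finally have "\<kappa> * (Suc N + (1 + 2 * k1)) \<le> cost N 2" .
      moreover have "1 \<le> cost N 2" using cost_ge(1) sf(5) by blast
      moreover have "100 * cost N 2 \<le> cost N 3" using cost_ge(5)[of N 2] by (simp add: numeral_3_eq_3 numeral_2_eq_2)
      moreover have "cost N 3 \<le> cost N (fm_nodes ?E)" by (rule cost_ge(3)) (use tn1[of s] tn1[of t] in simp)
      ultimately show ?thesis by linarith
    qed
    ultimately show ?thesis using False der_lines_mono by (auto simp del: fm_nodes.simps)
  qed
qed

text \<open>For true existential and false universal formulas. The goal does not contain the new
  variable, so a description of one suitable number n is enough.\<close>

lemma state_exists:
  assumes st: "state (Suc j) \<Gamma> N m V e" and \<chi>: "fv \<chi> \<subseteq> V" 
    and step: "\<And>\<Delta>. state j \<Delta> (\<kappa> ^ 13 * N) (m + 2) (insert m V) (e(m := n)) \<Longrightarrow> der L K \<Delta> \<chi>"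
  shows "der L (K + \<kappa> ^ 13 * N) \<Gamma> \<chi>"
proof -
  have j: "Suc j \<le> D" using st by (simp add: state_def)
  interpret step R H G L Q "As j" "Bs j" "As j * Ms j + Bs j" "Ms j" "Ws (Suc j)" "As (Suc j)" "Bs (Suc j)" "Ms (Suc j)" m V e \<Gamma> N
    by (rule state_step[OF st j])
  obtain \<Delta> where D: "csz \<Delta> \<le> csz \<Gamma> + 20 * \<tau>" "fvs \<Delta> \<subseteq> {..<m + 2}"
     "decides \<Delta> (\<kappa> ^ 13 * N) (m + 2) (insert m V) (e(m := n)) (As j) (Bs j) (Ms j) (Ws (Suc j) + As j * Ms j)"
     and el: "\<And>\<chi> K. m \<notin> fv \<chi> \<Longrightarrow> Suc m \<notin> fv \<chi> \<Longrightarrow> der L K \<Delta> \<chi> \<Longrightarrow> der L (K + \<kappa> ^ 13 * N) \<Gamma> \<chi>"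
    using exists_step[of n] by blast
  have "csz \<Gamma> \<le> Y (Suc j)" using st by (simp add: state_def)
  then have "csz \<Delta> \<le> Y j" using D(1) Y_Suc[of j] j by (simp add: add_mult_distrib)
  moreover have "1 * 1 \<le> \<kappa> ^ 13 * N" using N1 kappa_ge by (intro mult_le_mono one_le_power) auto
  ultimately have "state j \<Delta> (\<kappa> ^ 13 * N) (m + 2) (insert m V) (e(m := n))"
    by (intro state_next[OF st j _ D(2) _ D(3)]) auto
  from el[OF _ _ step[OF this]] show ?thesis using \<chi> zw by auto
qed

text \<open>For true universal and false existential formulas. The goal contains the new variable
  and has to be derived under every description of it.\<close>

lemma state_forall:
  assumes st: "state (Suc j) \<Gamma> N m V e" and \<chi>: "fv \<chi> \<subseteq> insert m V" "fsz \<chi> \<le> 100 * \<tau>"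
    and step: "\<And>\<Delta> n. state j \<Delta> (\<kappa> ^ 13 * N) (m + 2) (insert m V) (e(m := n)) \<Longrightarrow> der L (cost (\<kappa> ^ 13 * N) k) \<Delta> \<chi>"
  obtains K where "der L K \<Gamma> \<chi>" "K + 30 \<le> cost N (Suc k)"
proof -
  have j: "Suc j \<le> D" "j < D" using st by (simp_all add: state_def)
  interpret step R H G L Q "As j" "Bs j" "As j * Ms j + Bs j" "Ms j" "Ws (Suc j)" "As (Suc j)" "Bs (Suc j)" "Ms (Suc j)" m V e \<Gamma> N
    by (rule state_step[OF st j(1)])
  have cP: "card pos_forms \<le> P"
  proof -
    have "card V \<le> D - Suc j" using st unfolding state_def by blast
    then have "card V \<le> D" by simp
    then have "(2 * As j + 1) ^ Suc (card V) \<le> (2 * As j + 1) ^ Suc D" by (intro power_increasing) auto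
    then show ?thesis using finite_pos_forms(2) lP[OF j(2)] by linarith
  qed
  have cY: "csz \<Gamma> \<le> Y (Suc j)" using st by (simp add: state_def)
  have N13: "1 * 1 \<le> \<kappa> ^ 13 * N" using N1 kappa_ge by (intro mult_le_mono one_le_power) auto
  have "der L (\<kappa> ^ 7 * Ms j ^ 4 + Ms j * ((20 * (As j * Ms j + Bs j + 1)) ^ card pos_forms * cost (\<kappa> ^ 13 * N) k + 30)) \<Gamma> \<chi>"
  proof (rule forall_step[of \<chi> "Y j"])
    show "Suc m \<notin> fv \<chi>" using \<chi>(1) zw by auto
    have "card pos_forms * (4 * \<tau>) \<le> P * (4 * \<tau>)" using cP by (rule mult_le_mono1)
    moreover have "(4 * P + 30) * \<tau> = P * (4 * \<tau>) + 30 * \<tau>" by (simp add: algebra_simps)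
    ultimately show "csz \<Gamma> + card pos_forms * (4 * \<tau>) + 30 * \<tau> \<le> Y j" using cY Y_Suc[OF j(2)] by linarith
    show "Y j + 100 * \<tau> \<le> G" using Y_G[of j] by linarith
    show "\<kappa> ^ 13 * N \<le> cost (\<kappa> ^ 13 * N) k" using N13 by (intro cost_ge(2)) simp
    fix \<Delta> n assume "csz \<Delta> \<le> Y j" "fvs \<Delta> \<subseteq> {..<m + 2}"
      "decides \<Delta> (\<kappa> ^ 13 * N) (m + 2) (insert m V) (e(m := n)) (As j) (Bs j) (Ms j) (Ws (Suc j) + As j * Ms j)"
    then have "state j \<Delta> (\<kappa> ^ 13 * N) (m + 2) (insert m V) (e(m := n))"
      using N13 by (intro state_next[OF st j(1)]) auto
    then show "der L (cost (\<kappa> ^ 13 * N) k) \<Delta> \<chi>" by (rule step)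
  qed (rule \<chi>(2))
  moreover have "\<kappa> ^ 7 * Ms j ^ 4 + Ms j * ((20 * (As j * Ms j + Bs j + 1)) ^ card pos_forms * cost (\<kappa> ^ 13 * N) k + 30) + 30
      \<le> cost N (Suc k)"
    by (rule cost_quantifier[OF N1 j(2) cP]) (use bounds(6) in simp)
  ultimately show ?thesis using that by blast
qed

lemma cost_exists: "1 \<le> N \<Longrightarrow> cost (\<kappa> ^ 13 * N) k + \<kappa> ^ 13 * N + 30 \<le> cost N (Suc k)"
proof -
  assume N: "1 \<le> N"
  have "\<kappa> ^ 13 * (N * Z ^ k) \<le> Z0 * (N * Z ^ k)" using Z0_ge(2) by (rule mult_le_mono1)
  then have 1: "cost (\<kappa> ^ 13 * N) k \<le> Z0 * (N * Z ^ k)" by (simp add: cost_def mult.assoc)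
  have "1 * 1 \<le> \<kappa> ^ 13 * N" using N kappa_ge by (intro mult_le_mono one_le_power) auto
  then have 2: "\<kappa> ^ 13 * N \<le> cost (\<kappa> ^ 13 * N) k" by (intro cost_ge(2)) simp
  have "1 * 1 \<le> Z0 * (N * Z ^ k)" using Z0_ge(1) cost_ge(1)[OF N, of k] by (intro mult_le_mono) (auto simp: cost_def)
  then have "cost (\<kappa> ^ 13 * N) k + \<kappa> ^ 13 * N + 30 \<le> 100 * (Z0 * (N * Z ^ k))" using 1 2 by linarith
  also have "\<dots> = cost N (Suc k)" by (simp add: cost_def Z_def)
  finally show ?thesis .
qed

text \<open>Proofs and refutations are constructed together, since negation and implication exchange
  them. A bound variable is renamed to the fresh m; the bound variables lie below \<open>m0\<close>,
  so nothing is captured. The induction is on nodes, as the body after renaming is not a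
  subformula.\<close>

lemma decide:
  assumes "state j \<Gamma> N m V e" "quant_depth \<phi> \<le> j" "fv \<phi> \<subseteq> V" "bound_vars \<phi> \<subseteq> {..<m0}" "fm_nodes \<phi> \<le> S0"
  shows "der L (cost N (fm_nodes \<phi>)) \<Gamma> (if sat e \<phi> then \<phi> else Neg \<phi>)"
  using assms
proof (induction "fm_nodes \<phi>" arbitrary: \<phi> j \<Gamma> N m V e rule: less_induct)
  case less
  note st = less.prems(1)
  note sf = state_facts[OF st]
  have cG: "csz \<Gamma> + 50 * \<tau> \<le> G" using sf(1) by simp
  have small: "fsz \<psi> \<le> \<tau>" if "fm_nodes \<psi> \<le> fm_nodes \<phi>" "fv \<psi> \<union> bound_vars \<psi> \<subseteq> {..<R}" for \<psi>
    by (rule fsz_small) (use that less.prems in auto)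
  have VR: "V \<subseteq> {..<R}" "{..<m0} \<subseteq> {..<R}" using sf(2) m0 by auto
  have sub: "der L (cost N k) \<Gamma> (if sat e \<psi> then \<psi> else Neg \<psi>)" "fsz \<psi> \<le> 5 * \<tau>"
    if "fm_nodes \<psi> < fm_nodes \<phi>" "fm_nodes \<psi> \<le> k" "quant_depth \<psi> \<le> quant_depth \<phi>" "fv \<psi> \<subseteq> V" "bound_vars \<psi> \<subseteq> bound_vars \<phi>" for \<psi> k
  proof -
    have "der L (cost N (fm_nodes \<psi>)) \<Gamma> (if sat e \<psi> then \<psi> else Neg \<psi>)"
      by (rule less.hyps[OF that(1) st]) (use that less.prems in auto)
    then show "der L (cost N k) \<Gamma> (if sat e \<psi> then \<psi> else Neg \<psi>)"
      by (rule der_lines_mono) (rule cost_ge(3)[OF that(2)])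
    have "fsz \<psi> \<le> \<tau>" by (rule small) (use that less.prems VR in auto)
    then show "fsz \<psi> \<le> 5 * \<tau>" by simp
  qed
  have fin: "der L K \<Gamma> \<psi> \<Longrightarrow> K \<le> 2 * cost N k + 15 \<Longrightarrow> der L (cost N (Suc k)) \<Gamma> \<psi>" for K k \<psi>
    using cost_ge(5)[of N k] cost_ge(1)[OF sf(5), of k] by (erule_tac der_lines_mono) linarith
  show ?case
  proof (cases \<phi>)
    case (Equ s t)
    then show ?thesis using decide_Equ[OF st, of s t] less.prems by auto
  next
    case (Neg \<psi>)
    note s = sub[of \<psi> "fm_nodes \<psi>"]
    have 1: "der L (cost N (fm_nodes \<psi>)) \<Gamma> (if sat e \<psi> then \<psi> else Neg \<psi>)" "fsz \<psi> \<le> 5 * \<tau>"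
      using s Neg less.prems by auto
    show ?thesis
    proof (cases "sat e \<psi>")
      case True
      then have "der L (cost N (fm_nodes \<psi>) + 5) \<Gamma> (Neg (Neg \<psi>))" using 1 by (intro neg_neg_rule[OF cG]) auto
      from fin[OF this] show ?thesis using True Neg by simp
    next
      case False
      then have "der L (cost N (fm_nodes \<psi>)) \<Gamma> (Neg \<psi>)" using 1 by simp
      from fin[OF this] show ?thesis using False Neg by simp
    qed
  next
    case (Conj \<psi> \<theta>)
    let ?k = "fm_nodes \<psi> + fm_nodes \<theta>"
    have s: "der L (cost N ?k) \<Gamma> (if sat e \<psi> then \<psi> else Neg \<psi>)" "fsz \<psi> \<le> 5 * \<tau>"
      "der L (cost N ?k) \<Gamma> (if sat e \<theta> then \<theta> else Neg \<theta>)" "fsz \<theta> \<le> 5 * \<tau>"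
      using sub[of \<psi> ?k] sub[of \<theta> ?k] Conj less.prems by auto
    have f: "fm_nodes \<phi> = Suc ?k" using Conj by simp
    have "der L (cost N (Suc ?k)) \<Gamma> (if sat e \<phi> then \<phi> else Neg \<phi>)"
    proof (cases "sat e \<psi>")
      case False
      have "der L (cost N ?k + 5) \<Gamma> (Neg \<phi>)" unfolding Conj by (rule neg_conj_rule1[OF cG s(2,4)]) (use False s in auto)
      from fin[OF this] show ?thesis using False Conj by simp
    next
      case T: True
      show ?thesis
      proof (cases "sat e \<theta>")
        case True
        have "der L (Suc (cost N ?k + cost N ?k)) \<Gamma> \<phi>" unfolding Conj
          by (rule der_conjI) (use T True s cG L_slack tau_ge in auto)
        from fin[OF this] show ?thesis using T True Conj by simp
      next
        case False
        have "der L (cost N ?k + 5) \<Gamma> (Neg \<phi>)" unfolding Conj by (rule neg_conj_rule2[OF cG s(2,4)]) (use False s in auto)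
        from fin[OF this] show ?thesis using False Conj by simp
      qed
    qed
    then show ?thesis by (simp only: f)
  next
    case (Disj \<psi> \<theta>)
    let ?k = "fm_nodes \<psi> + fm_nodes \<theta>"
    have s: "der L (cost N ?k) \<Gamma> (if sat e \<psi> then \<psi> else Neg \<psi>)" "fsz \<psi> \<le> 5 * \<tau>"
      "der L (cost N ?k) \<Gamma> (if sat e \<theta> then \<theta> else Neg \<theta>)" "fsz \<theta> \<le> 5 * \<tau>"
      using sub[of \<psi> ?k] sub[of \<theta> ?k] Disj less.prems by auto
    have f: "fm_nodes \<phi> = Suc ?k" using Disj by simp
    have "der L (cost N (Suc ?k)) \<Gamma> (if sat e \<phi> then \<phi> else Neg \<phi>)"
    proof (cases "sat e \<psi>")
      case True
      have "der L (Suc (cost N ?k)) \<Gamma> \<phi>" unfolding Disj by (rule der_disjI1) (use True s cG L_slack tau_ge in auto)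
      from fin[OF this] show ?thesis using True Disj by simp
    next
      case F: False
      show ?thesis
      proof (cases "sat e \<theta>")
        case True
        have "der L (Suc (cost N ?k)) \<Gamma> \<phi>" unfolding Disj by (rule der_disjI2) (use True s cG L_slack tau_ge in auto)
        from fin[OF this] show ?thesis using True Disj by simp
      next
        case False
        have "der L (cost N ?k + cost N ?k + 15) \<Gamma> (Neg \<phi>)" unfolding Disj
          by (rule neg_disj_rule[OF cG s(2,4)]) (use F False s in auto)
        from fin[OF this] show ?thesis using F False Disj by simp
      qed
    qed
    then show ?thesis by (simp only: f)
  next
    case (Imp \<psi> \<theta>)
    let ?k = "fm_nodes \<psi> + fm_nodes \<theta>"
    have s: "der L (cost N ?k) \<Gamma> (if sat e \<psi> then \<psi> else Neg \<psi>)" "fsz \<psi> \<le> 5 * \<tau>"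
      "der L (cost N ?k) \<Gamma> (if sat e \<theta> then \<theta> else Neg \<theta>)" "fsz \<theta> \<le> 5 * \<tau>"
      using sub[of \<psi> ?k] sub[of \<theta> ?k] Imp less.prems by auto
    have f: "fm_nodes \<phi> = Suc ?k" using Imp by simp
    have "der L (cost N (Suc ?k)) \<Gamma> (if sat e \<phi> then \<phi> else Neg \<phi>)"
    proof (cases "sat e \<psi>")
      case False
      have "der L (cost N ?k + 9) \<Gamma> \<phi>" unfolding Imp by (rule imp_rule1[OF cG s(2,4)]) (use False s in auto)
      from fin[OF this] show ?thesis using False Imp by simp
    next
      case T: True
      show ?thesis
      proof (cases "sat e \<theta>")
        case True
        have "der L (cost N ?k + 5) \<Gamma> \<phi>" unfolding Imp by (rule imp_rule2[OF cG s(2,4)]) (use True s in auto)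
        from fin[OF this] show ?thesis using True Imp by simp
      next
        case False
        have "der L (cost N ?k + cost N ?k + 9) \<Gamma> (Neg \<phi>)" unfolding Imp
          by (rule neg_imp_rule[OF cG s(2,4)]) (use T False s in auto)
        from fin[OF this] show ?thesis using T False Imp by simp
      qed
    qed
    then show ?thesis by (simp only: f)
  next
    case (Forall x \<psi>)
    obtain j' where j': "j = Suc j'" "quant_depth \<psi> \<le> j'" using less.prems(2) Forall by (cases j) auto
    let ?p = "subst x (Var m) \<psi>"
    have st': "state (Suc j') \<Gamma> N m V e" using st j' by simp
    have mR: "m < R" using st' m0 by (auto simp: state_def)
    have mb: "m \<notin> bound_vars \<psi>" "m \<notin> fv \<psi> - {x}" using less.prems(3,4) Forall sf(3,6) by fastforce+
    have mx: "m \<noteq> x" using less.prems(4) Forall sf(6) by auto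
    have mf: "m \<notin> fv \<psi>" using mb(2) mx by auto
    have fp: "fv ?p \<subseteq> insert m V" using fv_subst_var[of x m \<psi>] less.prems(3) Forall by auto
    have szs: "fsz (Forall x \<psi>) \<le> 5 * \<tau>" "fsz ?p \<le> 5 * \<tau>"
    proof -
      have r: "fv ?p \<subseteq> {..<R}" "bound_vars \<psi> \<subseteq> {..<R}" "fv \<phi> \<union> bound_vars \<phi> \<subseteq> {..<R}"
        using fp mR VR less.prems(3,4) Forall by fastforce+
      have "fsz \<phi> \<le> \<tau>" by (rule small[OF order_refl r(3)])
      then show "fsz (Forall x \<psi>) \<le> 5 * \<tau>" using Forall by simp
      have "fsz ?p \<le> \<tau>" by (rule small) (use r Forall in auto)
      then show "fsz ?p \<le> 5 * \<tau>" by simp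
    qed
    have satp: "sat (e(m := n)) ?p \<longleftrightarrow> sat (e(x := n)) \<psi>" for n
    proof -
      have "sat (e(m := n)) ?p \<longleftrightarrow> sat ((e(m := n))(x := n)) \<psi>" using sat_subst_var[OF mb(1), of "e(m := n)" x] by simp
      also have "\<dots> \<longleftrightarrow> sat (e(x := n)) \<psi>" by (rule sat_cong) (use mf in auto)
      finally show ?thesis .
    qed
    have IH: "der L (cost (\<kappa> ^ 13 * N) (fm_nodes \<psi>)) \<Delta> (if sat (e(m := n)) ?p then ?p else Neg ?p)"
      if "state j' \<Delta> (\<kappa> ^ 13 * N) (m + 2) (insert m V) (e(m := n))" for \<Delta> n
      using less.hyps[of ?p, OF _ that] Forall j' fp less.prems(4,5) by simp
    have f: "fm_nodes \<phi> = Suc (fm_nodes \<psi>)" using Forall by simp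
    show ?thesis unfolding f
    proof (cases "sat e \<phi>")
      case True
      then have all: "sat (e(m := n)) ?p" for n using Forall satp by simp
      obtain K where K: "der L K \<Gamma> ?p" "K + 30 \<le> cost N (Suc (fm_nodes \<psi>))"
        using state_forall[OF st' fp, of "fm_nodes \<psi>"] IH all szs by auto
      have "der L (Suc K) \<Gamma> (Forall x \<psi>)"
      proof (rule der_forallI[OF K(1)])
        show "free_for (Var m) x \<psi>" by (rule free_for_bvs) (use mb in auto)
        have "m \<notin> fvs \<Gamma>" using st' by (auto simp: state_def)
        then show "m \<notin> fvs \<Gamma> \<union> fv (Forall x \<psi>)" using mb by auto
      qed (use szs cG L_slack in auto)
      then have "der L (cost N (Suc (fm_nodes \<psi>))) \<Gamma> (Forall x \<psi>)" by (rule der_lines_mono) (use K in linarith)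
      then show "der L (cost N (Suc (fm_nodes \<psi>))) \<Gamma> (if sat e \<phi> then \<phi> else Neg \<phi>)"
        unfolding if_P[OF True] unfolding Forall .
    next
      case False
      then obtain n where n: "\<not> sat (e(m := n)) ?p" using Forall satp by auto
      have "der L ((cost (\<kappa> ^ 13 * N) (fm_nodes \<psi>) + 5) + \<kappa> ^ 13 * N) \<Gamma> (Neg (Forall x \<psi>))"
      proof (rule state_exists[OF st'])
        show "fv (Neg (Forall x \<psi>)) \<subseteq> V" using less.prems(3) Forall by simp
        fix \<Delta> assume s: "state j' \<Delta> (\<kappa> ^ 13 * N) (m + 2) (insert m V) (e(m := n))"
        have "csz \<Delta> + 50 * \<tau> \<le> G" using state_facts(1)[OF s] by simp
        then show "der L (cost (\<kappa> ^ 13 * N) (fm_nodes \<psi>) + 5) \<Delta> (Neg (Forall x \<psi>))"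
          by (rule neg_forall_rule[OF _ szs mb(1)]) (use IH[OF s] n in simp)
      qed
      then have "der L (cost N (Suc (fm_nodes \<psi>))) \<Gamma> (Neg (Forall x \<psi>))"
        by (rule der_lines_mono) (use cost_exists[OF sf(5), of "fm_nodes \<psi>"] in linarith)
      then show "der L (cost N (Suc (fm_nodes \<psi>))) \<Gamma> (if sat e \<phi> then \<phi> else Neg \<phi>)"
        unfolding if_not_P[OF False] unfolding Forall .
    qed
  next
    case (Exists x \<psi>)
    obtain j' where j': "j = Suc j'" "quant_depth \<psi> \<le> j'" using less.prems(2) Exists by (cases j) auto
    let ?p = "subst x (Var m) \<psi>"
    have st': "state (Suc j') \<Gamma> N m V e" using st j' by simp
    have mR: "m < R" using st' m0 by (auto simp: state_def)
    have mb: "m \<notin> bound_vars \<psi>" "m \<notin> fv \<psi> - {x}" using less.prems(3,4) Exists sf(3,6) by fastforce+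
    have mx: "m \<noteq> x" using less.prems(4) Exists sf(6) by auto
    have mf: "m \<notin> fv \<psi>" using mb(2) mx by auto
    have fp: "fv ?p \<subseteq> insert m V" using fv_subst_var[of x m \<psi>] less.prems(3) Exists by auto
    have szs: "fsz (Exists x \<psi>) \<le> 5 * \<tau>" "fsz ?p \<le> 5 * \<tau>"
    proof -
      have r: "fv ?p \<subseteq> {..<R}" "bound_vars \<psi> \<subseteq> {..<R}" "fv \<phi> \<union> bound_vars \<phi> \<subseteq> {..<R}"
        using fp mR VR less.prems(3,4) Exists by fastforce+
      have "fsz \<phi> \<le> \<tau>" by (rule small[OF order_refl r(3)])
      then show "fsz (Exists x \<psi>) \<le> 5 * \<tau>" using Exists by simp
      have "fsz ?p \<le> \<tau>" by (rule small) (use r Exists in auto)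
      then show "fsz ?p \<le> 5 * \<tau>" by simp
    qed
    have satp: "sat (e(m := n)) ?p \<longleftrightarrow> sat (e(x := n)) \<psi>" for n
    proof -
      have "sat (e(m := n)) ?p \<longleftrightarrow> sat ((e(m := n))(x := n)) \<psi>" using sat_subst_var[OF mb(1), of "e(m := n)" x] by simp
      also have "\<dots> \<longleftrightarrow> sat (e(x := n)) \<psi>" by (rule sat_cong) (use mf in auto)
      finally show ?thesis .
    qed
    have IH: "der L (cost (\<kappa> ^ 13 * N) (fm_nodes \<psi>)) \<Delta> (if sat (e(m := n)) ?p then ?p else Neg ?p)"
      if "state j' \<Delta> (\<kappa> ^ 13 * N) (m + 2) (insert m V) (e(m := n))" for \<Delta> n
      using less.hyps[of ?p, OF _ that] Exists j' fp less.prems(4,5) by simp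
    have f: "fm_nodes \<phi> = Suc (fm_nodes \<psi>)" using Exists by simp
    show ?thesis unfolding f
    proof (cases "sat e \<phi>")
      case True
      then obtain n where n: "sat (e(m := n)) ?p" using Exists satp by auto
      have "der L (Suc (cost (\<kappa> ^ 13 * N) (fm_nodes \<psi>)) + \<kappa> ^ 13 * N) \<Gamma> (Exists x \<psi>)"
      proof (rule state_exists[OF st'])
        show "fv (Exists x \<psi>) \<subseteq> V" using less.prems(3) Exists by simp
        fix \<Delta> assume s: "state j' \<Delta> (\<kappa> ^ 13 * N) (m + 2) (insert m V) (e(m := n))"
        have c: "csz \<Delta> + 50 * \<tau> \<le> G" using state_facts(1)[OF s] by simp
        have "der L (cost (\<kappa> ^ 13 * N) (fm_nodes \<psi>)) \<Delta> ?p" using IH[OF s] n by simp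
        then show "der L (Suc (cost (\<kappa> ^ 13 * N) (fm_nodes \<psi>))) \<Delta> (Exists x \<psi>)"
        proof (rule der_existsI)
          show "free_for (Var m) x \<psi>" by (rule free_for_bvs) (use mb in auto)
        qed (use szs c L_slack in auto)
      qed
      then have "der L (cost N (Suc (fm_nodes \<psi>))) \<Gamma> (Exists x \<psi>)"
        by (rule der_lines_mono) (use cost_exists[OF sf(5), of "fm_nodes \<psi>"] in linarith)
      then show "der L (cost N (Suc (fm_nodes \<psi>))) \<Gamma> (if sat e \<phi> then \<phi> else Neg \<phi>)"
        unfolding if_P[OF True] unfolding Exists .
    next
      case False
      then have all: "\<not> sat (e(m := n)) ?p" for n using Exists satp by simp
      have fp': "fv (Neg ?p) \<subseteq> insert m V" using fp by simp
      have IH': "der L (cost (\<kappa> ^ 13 * N) (fm_nodes \<psi>)) \<Delta> (Neg ?p)"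
        if "state j' \<Delta> (\<kappa> ^ 13 * N) (m + 2) (insert m V) (e(m := n))" for \<Delta> n
        using IH[OF that] all by simp
      have s100: "fsz (Neg ?p) \<le> 100 * \<tau>" using szs tau_ge by simp
      obtain K where K: "der L K \<Gamma> (Neg ?p)" "K + 30 \<le> cost N (Suc (fm_nodes \<psi>))"
        by (rule state_forall[OF st' fp' s100 IH']) blast+
      have "m \<notin> fvs \<Gamma>" using st' by (auto simp: state_def)
      then have "der L (K + 20) \<Gamma> (Neg (Exists x \<psi>))"
        by (intro der_not_exists[OF cG _ _ mb(1) mf _ K(1)]) (use szs tau_ge in auto)
      then have "der L (cost N (Suc (fm_nodes \<psi>))) \<Gamma> (Neg (Exists x \<psi>))" by (rule der_lines_mono) (use K in linarith)
      then show "der L (cost N (Suc (fm_nodes \<psi>))) \<Gamma> (if sat e \<phi> then \<phi> else Neg \<phi>)"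
        unfolding if_not_P[OF False] unfolding Exists .
    qed
  qed
qed

text \<open>The recursion starts with the empty tuple, which the empty context describes: a form
  without variables is a constant, whose sign \<open>ge_nonneg\<close> proves, and a homogeneous one
  is 0.\<close>

lemma der_true_sentence:
  assumes "sentence F" "true_in_N F" "quant_depth F \<le> D" "bound_vars F \<subseteq> {..<m0}" "fm_nodes F \<le> S0"
  shows "der L (cost k1 (fm_nodes F)) [] F"
proof -
  have "state D [] k1 m0 {} (\<lambda>i. 0)"
    unfolding state_def
  proof (intro conjI)
    show "1 \<le> k1" using k1_ge by simp
    show "decides [] k1 m0 {} (\<lambda>i. 0) (As D) (Bs D) (Ms D) (Ws D)"
      unfolding decides_def
    proof (intro conjI allI impI)
      fix f assume f: "over {} (As D) (Bs D) f" "0 \<le> val f (\<lambda>i. 0)"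
      have e: "f = (\<lambda>i. if i = 0 then f 0 else 0)" using f(1) by (auto simp: over_def)
      have "val f (\<lambda>i. 0) = f 0" by (subst e) (rule val_const)
      then have "0 \<le> f i" for i using e f(2) by (metis order_refl)
      moreover have "form_bound Q f" by (rule over_bd[OF f(1)]) (use lS[of D] in auto)
      then have "form_bound H f" using form_bound_mono Qpow(5) by blast
      ultimately show "der L k1 [] (GE f)" by (intro ge_nonneg) auto
    next
      fix f assume f: "over {} (As D) 0 f"
      have e: "f = (\<lambda>i. 0)"
      proof
        fix i show "f i = 0" using f by (cases "i = 0") (auto simp: over_def)
      qed
      have "der L k1 [] (GE (\<lambda>i. 0))" "der L k1 [] (GE (neg (\<lambda>i. 0)))" by (intro ge_nonneg; simp add: form_bound_def)+
      then have "EQ k1 [] (\<lambda>i. f i - 0)" by (simp add: EQ_def e)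
      moreover have "val f (\<lambda>i. 0) = 0" by (simp add: e val_def)
      ultimately show "\<exists>U. form_bound (Ws D) U \<and> (\<forall>i\<ge>m0. U i = 0) \<and> EQ k1 [] (\<lambda>i. f i - U i) \<and>
          (\<forall>i. i \<noteq> 0 \<longrightarrow> int (Ms D) dvd U i) \<and> int (Ms D) dvd U 0 - val f (\<lambda>i. 0)"
        by (intro exI[of _ "\<lambda>i. 0"]) (simp add: form_bound_def)
    qed
  qed auto
  from decide[OF this assms(3) _ assms(4,5)] show ?thesis
    using assms(1,2) by (simp add: sentence_def true_in_N_def)
qed

end

section \<open>Triply exponential bounds\<close>

definition tower :: "nat \<Rightarrow> nat" where "tower k = 2 ^ (2 ^ (2 ^ k))"

lemma tower_mono: "x \<le> tower a \<Longrightarrow> a \<le> b \<Longrightarrow> x \<le> tower b"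
proof -
  assume "x \<le> tower a" "a \<le> b"
  moreover have "tower a \<le> tower b" unfolding tower_def using \<open>a \<le> b\<close> by (intro power_increasing) auto
  ultimately show ?thesis by simp
qed

text \<open>Squaring \<open>tower d\<close> adds 1 to the exponent \<open>2 ^ d\<close>, and the
  next index absorbs this.\<close>

lemma tower_mult:
  assumes "x \<le> tower a" "y \<le> tower b" "a < c" "b < c"
  shows "x * y \<le> tower c"
proof -
  define d where "d = c - 1"
  have d: "x \<le> tower d" "y \<le> tower d" "c = Suc d" using assms tower_mono[of x a d] tower_mono[of y b d] by (auto simp: d_def)
  have "x * y \<le> tower d * tower d" using d by (intro mult_le_mono)
  also have "\<dots> = 2 ^ (2 ^ (2 ^ d + 1))" by (simp add: tower_def power_add[symmetric] mult_2)
  also have "\<dots> \<le> tower c"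
  proof -
    have "(1::nat) \<le> 2 ^ d" by simp
    then have "(2::nat) ^ d + 1 \<le> 2 ^ c" using d(3) by simp
    then show ?thesis unfolding tower_def by (intro power_increasing) auto
  qed
  finally show ?thesis .
qed

lemma tower_ge2: "2 \<le> tower k"
proof -
  have "(2::nat) ^ 1 \<le> 2 ^ (2 ^ (2 ^ k))" by (intro power_increasing) auto
  then show ?thesis by (simp add: tower_def)
qed

lemma tower_add:
  assumes "x \<le> tower a" "y \<le> tower b" "a < c" "b < c"
  shows "x + y \<le> tower c"
proof -
  define d where "d = c - 1"
  have d: "x \<le> tower d" "y \<le> tower d" "d < c" using assms tower_mono[of x a d] tower_mono[of y b d] by (auto simp: d_def)
  have "x + y \<le> 2 * tower d" using d by simp
  also have "\<dots> \<le> tower c" by (rule tower_mult[OF tower_ge2 order_refl d(3,3)])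
  finally show ?thesis .
qed

text \<open>Raising \<open>tower a\<close> to the power \<open>2 ^ (2 ^ b)\<close> only adds the
  inner exponents to \<open>2 ^ a + 2 ^ b\<close>. A doubly exponential exponent is thus harmless,
  which is what the count of branches relies on.\<close>

lemma tower_power:
  assumes "x \<le> tower a" "m \<le> 2 ^ (2 ^ b)" "a < c" "b < c"
  shows "x ^ m \<le> tower c"
proof -
  have "x ^ m \<le> tower a ^ m" using assms by (intro power_mono) auto
  also have "\<dots> \<le> tower a ^ (2 ^ (2 ^ b))" using assms tower_ge2[of a] by (intro power_increasing) auto
  also have "\<dots> = 2 ^ (2 ^ (2 ^ a + 2 ^ b))" by (simp add: tower_def power_mult[symmetric] power_add)
  also have "\<dots> \<le> tower c"
  proof -
    have "(2::nat) ^ a \<le> 2 ^ (c - 1)" "(2::nat) ^ b \<le> 2 ^ (c - 1)" using assms by (auto intro!: power_increasing)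
    moreover have "(2::nat) ^ c = 2 * 2 ^ (c - 1)" using assms by (cases c) auto
    ultimately have "(2::nat) ^ a + 2 ^ b \<le> 2 ^ c" by linarith
    then show ?thesis unfolding tower_def by (intro power_increasing) auto
  qed
  finally show ?thesis .
qed

lemma le_two_power: "(x::nat) \<le> 2 ^ x" by (metis less_exp less_imp_le)

lemma double_le_tower: "x \<le> 2 ^ (2 ^ a) \<Longrightarrow> x \<le> tower a"
proof -
  assume "x \<le> 2 ^ (2 ^ a)"
  also have "(2::nat) ^ (2 ^ a) \<le> tower a" unfolding tower_def by (intro power_increasing le_two_power) auto
  finally show ?thesis .
qed

lemma power_le_double: "x \<le> 2 ^ a \<Longrightarrow> x \<le> 2 ^ (2 ^ (a::nat))" for x :: nat
proof -
  assume "x \<le> 2 ^ a"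
  also have "(2::nat) ^ a \<le> 2 ^ (2 ^ a)" by (intro power_increasing le_two_power) auto
  finally show ?thesis .
qed

lemma id_le_double: "x \<le> a \<Longrightarrow> x \<le> 2 ^ (2 ^ (a::nat))"
  by (rule power_le_double) (meson le_two_power le_trans)

lemma id_le_tower: "x \<le> a \<Longrightarrow> x \<le> tower a"
  by (rule double_le_tower[OF id_le_double])

lemma const_le_tower: "c \<le> 1000 \<Longrightarrow> 2 \<le> a \<Longrightarrow> c \<le> tower a"
proof -
  assume "c \<le> 1000" "2 \<le> a"
  moreover have "1000 \<le> tower 2" by (simp add: tower_def)
  ultimately show ?thesis by (meson le_trans tower_mono)
qed

lemma less_two_power_mono: "x < 2 ^ a \<Longrightarrow> a \<le> b \<Longrightarrow> x < 2 ^ b" for x :: nat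
  by (erule less_le_trans) (rule power_increasing, auto)

text \<open>Indices are written in binary, so a sentence can name variables exponentially large in
  its length; this is the reason for \<open>m0\<close> and \<open>R\<close> being
  exponential.\<close>

lemma bvs_less: "x \<in> bound_vars \<phi> \<Longrightarrow> x < 2 ^ fsz \<phi>"
proof (induction \<phi>)
  case (Forall y \<phi>)
  have "y < 2 ^ fsz (Forall y \<phi>)"
    by (rule less_two_power_mono[OF less_power_length_bin_string]) (simp add: vsz_def var_string_def)
  then show ?case using Forall less_two_power_mono[of x "fsz \<phi>" "fsz (Forall y \<phi>)"] by auto
next
  case (Exists y \<phi>)
  have "y < 2 ^ fsz (Exists y \<phi>)"
    by (rule less_two_power_mono[OF less_power_length_bin_string]) (simp add: vsz_def var_string_def)
  then show ?case using Exists less_two_power_mono[of x "fsz \<phi>" "fsz (Exists y \<phi>)"] by auto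
qed (auto elim!: less_two_power_mono simp del: power_Suc)

lemma der_bound:
  assumes F: "sentence F" "true_in_N F" and n: "n = fsz F"
  shows "\<exists>N L. der L N [] F \<and> N * L \<le> tower (4 * n + scheme_bound + 70)"
proof -
  have n1: "1 \<le> n" using n fsz_ge1[of F] by simp
  \<comment> \<open>Cubing covers the required growth, as 2 * A * A \<le> A ^ 3 for A \<ge> 2. The
    start n + 2 ensures this and exceeds the number of nodes of F.\<close>
  define At where "At = (\<lambda>j. (n + 2) ^ (3 ^ j))"
  \<comment> \<open>Divisible by every coefficient a that occurs at any level, so that with the
    moduli \<open>Dn ^ j\<close> each a * \<open>Dn ^ j\<close> divides the next one.\<close>
  define Dn where "Dn = (fact (At n) :: nat)"
  \<comment> \<open>With the constants bounded by \<open>E ^ Suc j\<close>, the base must dominate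
    both At n * Dn, for the product of coefficient and modulus, and the factor 6 * At n between
    levels.\<close>
  define E where "E = 16 * At n * Dn"
  define P where "P = (2 * At n + 1) ^ Suc n"
  define Q where "Q = (n + 1) * E ^ Suc n"
  define m0 :: nat where "m0 = 10 + 2 ^ n"
  define R where "R = m0 + (2 * n + 20)"
  define H where "H = 1000 * Q ^ 5"
  define T where "T = (R + 10) ^ 2 * (H + 1)"
  define G where "G = n * ((4 * P + 30) * T) + 1000 * T"
  define L where "L = G + scheme_bound * (400 * T) ^ 4 + 2"
  have At1: "2 \<le> At j" "n + 1 \<le> At j" for j
  proof -
    have "n + 2 \<le> At j" unfolding At_def by (rule self_le_power) auto
    then show "2 \<le> At j" "n + 1 \<le> At j" by auto
  qed
  have Atn: "At j \<le> At n" if "j \<le> n" for j unfolding At_def using that by (intro power_increasing) auto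
  have Dn1: "1 \<le> Dn" unfolding Dn_def by (rule fact_ge_1)
  have E: "At n \<le> E" "Dn \<le> E" "16 * At n \<le> E" "1 \<le> E"
  proof -
    have "16 * At n * 1 \<le> E" unfolding E_def using Dn1 by (rule mult_le_mono2)
    then show "16 * At n \<le> E" "At n \<le> E" by auto
    have "1 * Dn \<le> E" unfolding E_def using At1[of n] by (intro mult_le_mono1) auto
    then show "Dn \<le> E" "1 \<le> E" using Dn1 by auto
  qed
  have EQ: "E ^ j \<le> E ^ Suc n" "E ^ j \<le> Q" "n * E ^ Suc n \<le> Q" if "j \<le> Suc n" for j
  proof -
    show 1: "E ^ j \<le> E ^ Suc n" using E that by (intro power_increasing) auto
    have "1 * E ^ Suc n \<le> Q" unfolding Q_def by (rule mult_le_mono1) simp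
    then show "E ^ j \<le> Q" using 1 by linarith
    show "n * E ^ Suc n \<le> Q" unfolding Q_def by (rule mult_le_mono1) simp
  qed
  have ED: "At n * Dn ^ j \<le> E ^ Suc j" for j
    using mult_le_mono[OF E(1) power_mono[OF E(2), of j]] by simp
  have Q1: "1 \<le> Q" using EQ(2)[of 0] by simp
  interpret calc R H G L
  proof
    show "20 \<le> R" by (simp add: R_def)
    show "1 \<le> H" using one_le_power[OF Q1, of 5] by (simp add: H_def)
    show "G + scheme_bound * (400 * ((R + 10)\<^sup>2 * (H + 1))) ^ 4 + 2 \<le> L" by (simp add: L_def T_def)
  qed
  have T: "T = \<tau>" by (simp add: T_def \<tau>_def)
  \<comment> \<open>The bounds for U decrease in j because each quantifier passed adds at most At n
    * \<open>Dn ^ n\<close> to the coefficients of U. The factor n + 1 in \<open>Q\<close> makes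
    room for n such additions.\<close>
  interpret levels R H G L Q At "\<lambda>j. E ^ Suc j" "\<lambda>j. Dn ^ j" "\<lambda>j. (n - j) * (At n * Dn ^ n)" n m0 P n
  proof unfold_locales
    show "1 \<le> Q" by (rule Q1)
    show "1000 * Q ^ 5 \<le> H" by (simp add: H_def)
    show "1 \<le> At j" for j using At1[of j] by simp
    show "1 \<le> Dn ^ j" for j using Dn1 by simp
    show "10 \<le> m0" "m0 + 2 * n + 2 \<le> R" by (simp_all add: m0_def R_def)
    fix j assume j: "j < n"
    show "2 * At j * At j \<le> At (Suc j)"
    proof -
      have "2 * (At j * At j) \<le> At j * (At j * At j)" using At1[of j] by (intro mult_le_mono1)
      also have "\<dots> = At (Suc j)" by (simp add: At_def power_mult power3_eq_cube power_add[symmetric] flip: power_Suc)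
          (simp add: power_mult[symmetric] power_add[symmetric])
      finally show ?thesis by simp
    qed
    show "2 * At j * (At j * Dn ^ j + E ^ Suc j + 1) \<le> E ^ Suc (Suc j)"
    proof -
      have "At j * Dn ^ j \<le> At n * Dn ^ j" using Atn[of j] j by (intro mult_le_mono1) auto
      then have a: "At j * Dn ^ j \<le> E ^ Suc j" using ED[of j] by linarith
      have "1 \<le> E ^ Suc j" using E by (intro one_le_power)
      then have "At j * Dn ^ j + E ^ Suc j + 1 \<le> 3 * E ^ Suc j" using a by linarith
      then have "2 * At j * (At j * Dn ^ j + E ^ Suc j + 1) \<le> 2 * At n * (3 * E ^ Suc j)"
        using Atn[of j] j by (intro mult_le_mono) auto
      also have "\<dots> = (6 * At n) * E ^ Suc j" by simp
      also have "\<dots> \<le> E * E ^ Suc j" by (rule mult_le_mono1) (use E(3) in linarith)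
      finally show ?thesis by simp
    qed
    show "a * Dn ^ j dvd Dn ^ Suc j" if "1 \<le> a" "a \<le> At j" for a
    proof -
      have "a dvd Dn" unfolding Dn_def by (rule dvd_fact) (use that Atn[of j] j in auto)
      then show ?thesis by (simp add: mult_dvd_mono)
    qed
    show "At (Suc j) \<le> Q" using Atn[of "Suc j"] j E(1) EQ(2)[of 1] by simp
    show "E ^ Suc (Suc j) \<le> Q" by (rule EQ(2)) (use j in simp)
    show "Dn ^ Suc j \<le> Q" using power_mono[OF E(2), of "Suc j"] EQ(2)[of "Suc j"] j by simp
    show "(n - j) * (At n * Dn ^ n) \<le> Q"
    proof -
      have "(n - j) * (At n * Dn ^ n) \<le> n * E ^ Suc n" by (rule mult_le_mono[OF _ ED]) simp
      then show ?thesis using EQ(3)[of 0] by simp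
    qed
    show "(n - Suc j) * (At n * Dn ^ n) + At j * Dn ^ j \<le> (n - j) * (At n * Dn ^ n)"
    proof -
      have "At j * Dn ^ j \<le> At n * Dn ^ n"
        using Atn[of j] j Dn1 by (intro mult_le_mono power_increasing) auto
      moreover have "n - j = Suc (n - Suc j)" using j by simp
      ultimately show ?thesis by simp
    qed
    show "(2 * At j + 1) ^ Suc n \<le> P" unfolding P_def using Atn[of j] j by (intro power_mono) auto
  next
    show "n * ((4 * P + 30) * \<tau>) + 1000 * \<tau> \<le> G" by (simp add: G_def T)
  next
    fix j assume j: "j \<le> n"
    show "n + 1 \<le> At j" by (rule At1)
    have "E ^ 1 \<le> E ^ Suc j" by (rule power_increasing) (use E in auto)
    then have "E \<le> E ^ Suc j" by (simp only: power_one_right)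
    then show "n + 1 \<le> E ^ Suc j" using At1(2)[of n] E(1) by linarith
    show "E ^ Suc j \<le> Q" by (rule EQ(2)) (use j in simp)
    show "At j \<le> Q" using Atn[OF j] E(1) EQ(2)[of 1] by simp
  qed
  have der: "der L (cost k1 (fm_nodes F)) [] F"
  proof (rule der_true_sentence[OF F])
    show "quant_depth F \<le> n" "fm_nodes F \<le> n" using quant_depth_le_fm_nodes[of F] fm_nodes_le_fsz[of F] n by auto
    show "bound_vars F \<subseteq> {..<m0}" using bvs_less[of _ F] n by (fastforce simp: m0_def)
  qed
  define v where "v = 4 * n + scheme_bound + 10"
  have v: "4 * n + 10 \<le> v" "scheme_bound \<le> v" "10 \<le> v" "n \<le> v" by (simp_all add: v_def)
  have c: "c \<le> tower v" if "c \<le> 1000" for c by (rule const_le_tower) (use that v in auto)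
  have ltn: "n + 2 \<le> 2 ^ (n + 2)" by (rule le_two_power)
  \<comment> \<open>Doubly exponential is needed here: \<open>At n\<close> becomes the exponent in
    the estimate of its factorial, which thereby is triply exponential.\<close>
  have A2: "At n \<le> 2 ^ (2 ^ (3 * n + 2))"
  proof -
    have "At n \<le> (2 ^ (n + 2)) ^ (3 ^ n)" unfolding At_def using ltn by (rule power_mono) simp
    also have "\<dots> = 2 ^ ((n + 2) * 3 ^ n)" by (simp only: power_mult)
    also have "\<dots> \<le> 2 ^ (2 ^ (3 * n + 2))"
    proof (rule power_increasing)
      have "(n + 2) * 3 ^ n \<le> 2 ^ (n + 2) * 4 ^ n" using ltn by (intro mult_le_mono power_mono) auto
      also have "(4::nat) ^ n = 2 ^ (2 * n)" by (simp add: power_mult)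
      also have "(2::nat) ^ (n + 2) * 2 ^ (2 * n) = 2 ^ (3 * n + 2)" by (simp add: power_add[symmetric])
      finally show "(n + 2) * 3 ^ n \<le> 2 ^ (3 * n + 2)" .
    qed simp
    finally show ?thesis .
  qed
  \<comment> \<open>\<open>P\<close> is an exponent in \<open>(20 * Q) ^ P\<close> and so must be
    doubly exponential as well. The slope 4 of the final polynomial comes from this
    estimate.\<close>
  have P2: "P \<le> 2 ^ (2 ^ v)"
  proof -
    let ?a = "2 ^ (3 * n + 2) :: nat"
    have "(1::nat) \<le> 2 ^ ?a" by simp
    then have "2 * At n + 1 \<le> 3 * 2 ^ ?a" using A2 by linarith
    also have "\<dots> \<le> 2 ^ (?a + 2)" by simp
    finally have "P \<le> (2 ^ (?a + 2)) ^ Suc n" unfolding P_def by (rule power_mono) simp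
    also have "\<dots> = 2 ^ ((?a + 2) * Suc n)" by (simp only: power_mult)
    also have "\<dots> \<le> 2 ^ (2 ^ v)"
    proof (rule power_increasing)
      have "(2::nat) \<le> ?a" using power_increasing[of 1 "3 * n + 2" "2::nat"] by simp
      then have "(?a + 2) * Suc n \<le> (2 * ?a) * 2 ^ (n + 2)" using ltn by (intro mult_le_mono) auto
      also have "\<dots> = 2 ^ (4 * n + 5)" by (simp add: power_add power_mult_distrib[symmetric] power_mult)
      also have "\<dots> \<le> 2 ^ v" using v by (intro power_increasing) auto
      finally show "(?a + 2) * Suc n \<le> 2 ^ v" .
    qed simp
    finally show ?thesis .
  qed
  have Av: "At n \<le> 2 ^ (2 ^ v)"
    by (rule le_trans[OF A2]) (use v in \<open>intro power_increasing; simp\<close>)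
  have num: "m \<le> 2 ^ (2 ^ v)" if "m \<le> v" for m by (rule id_le_double[OF that])
  have nv: "n \<le> tower v" by (rule id_le_tower) (rule v)
  have 1: "Dn \<le> tower (v + 1)"
  proof -
    have "Dn \<le> At n ^ At n" unfolding Dn_def using fact_le_power[of "At n", where ?'a = nat] by simp
    also have "\<dots> \<le> tower (v + 1)" by (rule tower_power[OF double_le_tower[OF Av] Av]) auto
    finally show ?thesis .
  qed
  have "16 * At n \<le> tower (v + 1)" by (rule tower_mult[OF c double_le_tower[OF Av]]) auto
  then have 2: "E \<le> tower (v + 2)" unfolding E_def by (rule tower_mult[OF _ 1]) auto
  have 3: "E ^ Suc n \<le> tower (v + 3)" by (rule tower_power[OF 2 num]) (use v in auto)
  have "n + 1 \<le> tower (v + 1)" by (rule tower_add[OF nv c]) auto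
  then have 4: "Q \<le> tower (v + 4)" unfolding Q_def by (rule tower_mult[OF _ 3]) auto
  have q5: "Q ^ 5 \<le> tower (v + 5)" by (rule tower_power[OF 4 num]) (use v in auto)
  have 5: "H \<le> tower (v + 6)" unfolding H_def by (rule tower_mult[OF c q5]) auto
  have 6: "H + 1 \<le> tower (v + 7)" by (rule tower_add[OF 5 c]) auto
  have pn: "2 ^ n \<le> tower v" by (rule double_le_tower, rule power_le_double) (use v in \<open>intro power_increasing; simp\<close>)
  have "10 + 2 ^ n \<le> tower (v + 1)" by (rule tower_add[OF c pn]) auto
  moreover have "2 * n \<le> tower (v + 1)" by (rule tower_mult[OF c nv]) auto
  then have "2 * n + 20 \<le> tower (v + 2)" by (rule tower_add[OF _ c]) auto
  ultimately have "R \<le> tower (v + 3)" unfolding R_def m0_def by (rule tower_add) auto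
  then have "R + 10 \<le> tower (v + 4)" by (rule tower_add[OF _ c]) auto
  then have "(R + 10) ^ 2 \<le> tower (v + 5)" by (rule tower_power[OF _ num]) (use v in auto)
  then have 7: "T \<le> tower (v + 8)" unfolding T_def by (rule tower_mult[OF _ 6]) auto
  have "4 * P \<le> tower (v + 1)" by (rule tower_mult[OF c double_le_tower[OF P2]]) auto
  then have "4 * P + 30 \<le> tower (v + 2)" by (rule tower_add[OF _ c]) auto
  then have "(4 * P + 30) * T \<le> tower (v + 9)" by (rule tower_mult[OF _ 7]) auto
  then have "n * ((4 * P + 30) * T) \<le> tower (v + 10)" by (rule tower_mult[OF nv]) auto
  moreover have "1000 * T \<le> tower (v + 9)" by (rule tower_mult[OF c 7]) auto
  ultimately have 8: "G \<le> tower (v + 11)" unfolding G_def by (rule tower_add) auto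
  have kv: "scheme_bound \<le> tower v" by (rule id_le_tower) (rule v)
  have "400 * T \<le> tower (v + 9)" by (rule tower_mult[OF c 7]) auto
  then have "(400 * T) ^ 4 \<le> tower (v + 10)" by (rule tower_power[OF _ num]) (use v in auto)
  then have "scheme_bound * (400 * T) ^ 4 \<le> tower (v + 11)" by (rule tower_mult[OF kv]) auto
  then have "G + scheme_bound * (400 * T) ^ 4 \<le> tower (v + 12)" by (rule tower_add[OF 8]) auto
  then have 9: "L \<le> tower (v + 13)" unfolding L_def by (rule tower_add[OF _ c]) auto
  have k0: "k0 \<le> tower (v + 1)" unfolding k0_def by (rule tower_add[OF kv c]) auto
  have "20 * \<tau> \<le> tower (v + 9)" unfolding T[symmetric] by (rule tower_mult[OF c 7]) auto
  then have a: "(20 * \<tau>) ^ 2 \<le> tower (v + 10)" by (rule tower_power[OF _ num]) (use v in auto)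
  have "30 * k0 \<le> tower (v + 2)" by (rule tower_mult[OF c k0]) auto
  then have b: "30 * k0 * (20 * \<tau>) ^ 2 \<le> tower (v + 11)" by (rule tower_mult[OF _ a]) auto
  have "2 * k0 \<le> tower (v + 2)" by (rule tower_mult[OF c k0]) auto
  with b have 10: "k1 \<le> tower (v + 12)" unfolding k1_def by (rule tower_add) auto
  have "20 * (H + 1) \<le> tower (v + 8)" by (rule tower_mult[OF c 6]) auto
  moreover have "k1 + 1 \<le> tower (v + 13)" by (rule tower_add[OF 10 c]) auto
  ultimately have "\<kappa> \<le> tower (v + 14)" unfolding \<kappa>_def by (rule tower_mult) auto
  then have d: "\<kappa> ^ 13 \<le> tower (v + 15)" by (rule tower_power[OF _ id_le_double[of 13 "v + 3"]]) (use v in auto)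
  have e: "Q ^ 4 \<le> tower (v + 5)" by (rule tower_power[OF 4 num]) (use v in auto)
  have "20 * Q \<le> tower (v + 5)" by (rule tower_mult[OF c 4]) auto
  then have "(20 * Q) ^ P \<le> tower (v + 6)" by (rule tower_power[OF _ P2]) auto
  with e have "Q ^ 4 * (20 * Q) ^ P \<le> tower (v + 7)" by (rule tower_mult) auto
  with d have z0: "Z0 \<le> tower (v + 16)" unfolding Z0_def by (rule tower_mult) auto
  have "Z \<le> tower (v + 17)" unfolding Z_def by (rule tower_mult[OF c z0]) auto
  then have "Z ^ fm_nodes F \<le> tower (v + 18)"
    by (rule tower_power[OF _ num]) (use v fm_nodes_le_fsz[of F] n in auto)
  then have "cost k1 (fm_nodes F) \<le> tower (v + 19)" unfolding cost_def by (rule tower_mult[OF 10]) auto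
  then have "cost k1 (fm_nodes F) * L \<le> tower (v + 20)" by (rule tower_mult[OF _ 9]) auto
  then have "cost k1 (fm_nodes F) * L \<le> tower (4 * n + scheme_bound + 70)" by (rule tower_mono) (simp add: v_def)
  then show ?thesis using der by blast
qed

theorem theorem6:
  "\<exists>P :: nat poly. \<forall>F. sentence F \<longrightarrow> true_in_N F \<longrightarrow>
     (\<exists>\<pi>. is_proof PrA_alt \<pi> F \<and>
        length (proof_string \<pi>) \<le> 2 ^ (2 ^ (2 ^ poly P (length (fm_string F)))))"
proof (intro exI[of _ "[:scheme_bound + 70, 4:]"] allI impI)
  fix F assume "sentence F" "true_in_N F"
  then obtain N L where d: "der L N [] F" "N * L \<le> tower (4 * fsz F + scheme_bound + 70)"
    using der_bound[OF _ _ refl] by blast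
  obtain \<pi> where \<pi>: "is_proof PrA_alt \<pi> F" "length (proof_string \<pi>) \<le> N * L"
    using der_imp_proof[OF d(1)] by blast
  have "poly [:scheme_bound + 70, 4:] (length (fm_string F)) = 4 * fsz F + scheme_bound + 70" by (simp add: fsz_def)
  then have "length (proof_string \<pi>) \<le> 2 ^ (2 ^ (2 ^ poly [:scheme_bound + 70, 4:] (length (fm_string F))))"
    using \<pi>(2) d(2) by (simp only: tower_def[symmetric])
  then show "\<exists>\<pi>. is_proof PrA_alt \<pi> F \<and>
        length (proof_string \<pi>) \<le> 2 ^ (2 ^ (2 ^ poly [:scheme_bound + 70, 4:] (length (fm_string F))))"
    using \<pi>(1) by blast
qed

end
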